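(* Let $\gamma>0$ and let $k\ge 3$ be an integer. If $p=p(n)\ge n^{-1+\gamma}$, then the binomial random $k$-uniform hypergraph $\Gamma=G^{(k)}(n,p)$ asymptotically almost surely satisfies the following. Let $G$ be any $n$-vertex subgraph of $\Gamma$ such that $\delta_{k-1}(G)\ge\big(\tfrac12+2\gamma\big)pn$. Then $G$ contains a tight Hamilton cycle.
   Context: $G^{(k)}(n,p)$ is the random $k$-uniform hypergraph on $n$ vertices in which each $k$-set of vertices is an edge independently with probability $p$. "Asymptotically almost surely" means with probability tending to $1$ as $n\to\infty$. For a $k$-uniform hypergraph $G$, $\delta_{k-1}(G)$ is the minimum, over all sets $X$ of $k-1$ vertices, of the number of edges of $G$ containing $X$. A tight Hamilton cycle in an $n$-vertex $k$-uniform hypergraph is a cyclic ordering of all $n$ vertices such that every $k$ consecutive vertices form an edge. *)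

theory Defs
  imports "HOL-Probability.Probability" "HOL-Library.Ramsey"
begin

(* A hypergraph is a pair (V, E); "nsets V k" is the set of all k-element subsets of V. *)
type_synonym 'a hypergraph = "'a set \<times> 'a set set"

abbreviation verts :: "'a hypergraph \<Rightarrow> 'a set" where
  "verts H \<equiv> fst H"

abbreviation edges :: "'a hypergraph \<Rightarrow> 'a set set" where
  "edges H \<equiv> snd H"

definition uniform_hypergraph :: "nat \<Rightarrow> 'a hypergraph \<Rightarrow> bool" where
  "uniform_hypergraph k H \<longleftrightarrow> finite (verts H) \<and> edges H \<subseteq> nsets (verts H) k"

definition subhypergraph :: "nat \<Rightarrow> 'a hypergraph \<Rightarrow> 'a hypergraph \<Rightarrow> bool" where
  "subhypergraph k G H \<longleftrightarrow>
     uniform_hypergraph k G \<and> verts G \<subseteq> verts H \<and> edges G \<subseteq> edges H"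

definition codegree :: "'a hypergraph \<Rightarrow> 'a set \<Rightarrow> nat" where
  "codegree H X = card {e \<in> edges H. X \<subseteq> e}"

(* The minimum (k-1)-degree, meaningful when H has at least k - 1 vertices;
   otherwise the Min is over the empty set and hence unspecified. *)
definition min_codegree :: "nat \<Rightarrow> 'a hypergraph \<Rightarrow> nat" where
  "min_codegree k H = Min (codegree H ` nsets (verts H) (k - 1))"

(* The cyclic ordering is given by a list; its k-element cyclic intervals are the
   length-k prefixes of its rotations. *)
definition tight_Hamilton_cycle :: "nat \<Rightarrow> 'a hypergraph \<Rightarrow> 'a list \<Rightarrow> bool" where
  "tight_Hamilton_cycle k H vs \<longleftrightarrow>
     distinct vs \<and> set vs = verts H \<and>
     (\<forall>i < length vs. set (take k (rotate i vs)) \<in> edges H)"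

definition random_hypergraph :: "nat \<Rightarrow> nat \<Rightarrow> real \<Rightarrow> nat hypergraph pmf" where
  "random_hypergraph k n p =
     map_pmf (\<lambda>b. ({..<n}, {e \<in> nsets {..<n} k. b e}))
       (Pi_pmf (nsets {..<n} k) False (\<lambda>_. bernoulli_pmf p))"

end

theory Submission
  imports Defs
begin

text \<open>
Write deg E a X for the number of vertices of X that extend the set a to an edge of E. The random hypergraph almost
surely has two properties, which the locale pseudorandom collects: no large family of (k-1)-sets has abnormally many
neighbours in one small set (spread), and in the link of a (k-2)-set the number of edges between two disjoint sets is
not much above its expectation (mixing). Both are Chernoff bounds with a union bound (random_typical). Everything else is
deterministic: a subgraph E of such a hypergraph with minimum codegree (1/2+2g)pn has a tight Hamilton cycle. The argument
is of absorption type and avoids the regularity method.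

The heart is the following connection property. Take two (k-1)-tuples, and disjoint vertex sets into which all codegrees are
typical. Starting from one tuple, walk along edges through k of these sets and record all tuples that can be reached in
m steps. Since the number of tuples is polynomial, for some m of logarithmic size one more step hardly enlarges the
reachable family F (slow_step): F is almost closed under steps. Cleaning the edges that violate closure, and using spread,
gives that F has positive density (almost_closed.dense). If F and its complement were both dense, then by isoperimetry in the grid of
tuples some (k-2)-set z would have many completions inside F and many outside; because the codegree exceeds one half,
both families of completions see a common vertex along edges, and mixing turns this into too many violating edges
(inconsistent_link). So F contains almost all tuples (few_missing), and the families reached from both ends
can be joined (join). A small set of forbidden vertices is tolerated: by spread it spoils only few
(k-1)-sets, directly or through other spoiled sets (infection). A logarithmic number of rounds on fresh sets
therefore solves many connection problems disjointly (rounds, many_tight).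

The same walk with a zigzag order of the k sets connects two tuples by a chain of spikes, and a spike chain with
connections between opposite spikes is an absorber for a given vertex r: its vertex set
can be traversed with or without r between the same two ends (absorber_from_chain).

A random colouring splits V into many parts with typical codegrees (fair_partition). Some of them form a reservoir R, every
vertex of R receives an absorber, and the absorbers are linked. The rest of V is covered by long tight paths up to few
vertices: if many vertices U were left over, one could find in U together with a small union of path and leftover blocks
more disjoint paths than were destroyed, because a path that meets the blocks in every kth vertex only is k times as long as its
part in the blocks (almost_cover). Each remaining vertex becomes a (k-1)-tuple with the help of
reservoir vertices, all pieces are linked cyclically through R, and the unused vertices of R are absorbed (hamilton_cycle).
\<close>

section \<open>Tight paths as lists\<close>

text \<open>All windows of k consecutive entries are edges. Distinctness is kept separate, and a list shorter than k qualifies; so a tuple of k-1 vertices is a path.\<close>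
definition win :: "nat => 'a set set => 'a list => bool" where
  "win k E xs \<longleftrightarrow> (\<forall>i. i + k <= length xs --> set (take k (drop i xs)) : E)"

lemma win_short: "length xs < k ==> win k E xs"
 by (auto simp: win_def)

lemma win_mono: "win k E xs ==> E \<subseteq> E' ==> win k E' xs"
 by (auto simp: win_def)

lemma win_append:
  assumes "win k E (P @ f)" "win k E (f @ X)" "Suc (length f) >= k"
  shows "win k E (P @ f @ X)"
 unfolding win_def
proof (intro allI impI)
 fix i assume i: "i + k <= length (P @ f @ X)"
 show "set (take k (drop i (P @ f @ X))) : E"
 proof (cases "i + k <= length (P @ f)")
  case True
  hence "take k (drop i (P @ f @ X)) = take k (drop i (P @ f))" by (simp add: append_assoc[symmetric] del: append_assoc)
  with True assms(1) show ?thesis by (simp add: win_def)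
 next
  case False
  hence "i >= length P" using assms(3) by simp
  hence "drop i (P @ f @ X) = drop (i - length P) (f @ X)" by simp
  moreover have "(i - length P) + k <= length (f @ X)" using i \<open>i >= length P\<close> by simp
  ultimately show ?thesis using assms(2) by (metis win_def)
 qed
qed

lemma win_infix: assumes "win k E (A @ B @ C)" shows "win k E B"
 unfolding win_def
proof (intro allI impI)
 fix i assume i: "i + k <= length B"
 hence "take k (drop (length A + i) (A @ B @ C)) = take k (drop i B)" by simp
 moreover have "length A + i + k <= length (A @ B @ C)" using i by simp
 ultimately show "set (take k (drop i B)) : E" using assms by (metis win_def)
qed

lemma win_appendD1: "win k E (A @ B) ==> win k E A"
 using win_infix[of k E "[]" A B] by simp

lemma win_appendD2: "win k E (A @ B) ==> win k E B"
 using win_infix[of k E A B "[]"] by simp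

lemma win_rev: assumes "win k E xs" shows "win k E (rev xs)"
 unfolding win_def
proof (intro allI impI)
 fix i assume i: "i + k <= length (rev xs)"
 have "take k (drop i (rev xs)) = rev (take k (drop (length xs - i - k) xs))" using i by (simp add: take_rev drop_rev drop_take add.commute)
 moreover have "(length xs - i - k) + k <= length xs" using i by simp
 ultimately show "set (take k (drop i (rev xs))) : E" using assms by (metis set_rev win_def)
qed

lemma win_rev_iff: "win k E (rev xs) \<longleftrightarrow> win k E xs"
 using win_rev[of k E xs] win_rev[of k E "rev xs"] by auto

lemma win_snoc:
  assumes "win k E (P @ f)" "insert y (set f) : E" "Suc (length f) = k"
  shows "win k E (P @ f @ [y])"
proof (rule win_append)
 show "win k E (f @ [y])" using assms(2,3) by (auto simp: win_def)
qed (use assms in auto)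

text \<open>Closing up: repeating the first k-1 entries at the end makes every cyclic window an ordinary one.\<close>
lemma cyclic_win:
  assumes "win k E (vs @ take (k - 1) vs)" "k <= length vs" "i < length vs"
  shows "set (take k (rotate i vs)) : E"
proof -
 have le: "k - (length vs - i) <= i" "k - (length vs - i) <= k - 1" using assms(2,3) by auto
 have "take k (rotate i vs) = take k (drop i (vs @ take (k - 1) vs))" using assms(3) le by (simp add: rotate_drop_take min_absorb1)
 moreover have "i + k <= length (vs @ take (k-1) vs)" using assms(2,3) by simp
 ultimately show ?thesis using assms(1) by (metis win_def)
qed

definition first_of :: "nat => 'a list => 'a list" where "first_of k P = take (k - 1) P"
definition last_of :: "nat => 'a list => 'a list" where "last_of k P = drop (length P - (k - 1)) P"

text \<open>A pair (P, Q) is a path P followed by the interior Q of its connection to the next path, and S is the tuple that the last connection must reach. Only the two ends of P enter the conditions on Q, which is what lets an absorber be switched inside a finished cycle.\<close>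
fun linked :: "nat => 'a set set => ('a list \<times> 'a list) list => 'a list => bool" where
  "linked k E [] S = True"
| "linked k E ((P, Q) # r) S = (k - 1 <= length P & win k E P &
     win k E (last_of k P @ Q @ (if r = [] then S else first_of k (fst (hd r)))) & linked k E r S)"

lemma linked_win:
  assumes "k >= 1" "linked k E r S" "length S = k - 1"
  shows "win k E (concat (map (%(P, Q). P @ Q) r) @ S)"
 using assms(2)
proof (induction r)
 case Nil thus ?case using assms by (auto intro: win_short)
next
 case (Cons PQ r)
 obtain P Q where PQ: "PQ = (P, Q)" by force
 define s where "s = (if r = [] then S else first_of k (fst (hd r)))"
 have l: "k - 1 <= length P" "win k E P" "win k E (last_of k P @ Q @ s)" "linked k E r S" using Cons.prems by (auto simp: PQ s_def)
 have lf: "length (last_of k P) = k - 1" using l(1) by (simp add: last_of_def)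
 define P0 where "P0 = take (length P - (k - 1)) P"
 have P: "P = P0 @ last_of k P" by (simp add: P0_def last_of_def)
 have s: "length s = k - 1"
 proof (cases r)
  case Nil thus ?thesis using assms by (simp add: s_def)
 next
  case (Cons a list) thus ?thesis using l(4) by (cases a) (simp add: s_def first_of_def)
 qed
 obtain tl where tl: "concat (map (%(P, Q). P @ Q) r) @ S = s @ tl"
 proof (cases r)
  case Nil thus ?thesis using that[of "[]"] by (simp add: s_def)
 next
  case (Cons a list)
  obtain A B where a: "a = (A,B)" by force
  have "take (k-1) A @ drop (k-1) A = A" by simp
  thus ?thesis using that[of "drop (k-1) A @ B @ concat (map (%(P, Q). P @ Q) list) @ S"] Cons a by (simp add: s_def first_of_def append_assoc[symmetric] del: append_assoc)
 qed
 have 1: "win k E (P0 @ last_of k P @ (Q @ s))" by (rule win_append) (use l P lf in auto)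
 have "win k E ((P0 @ last_of k P @ Q) @ s @ tl)" by (rule win_append) (use 1 Cons.IH[OF l(4)] tl s in auto)
 thus ?case using PQ tl P by (metis append.assoc case_prod_conv concat.simps(2) list.map(2))
qed

section \<open>Families of functions: cleaning, fibres, isoperimetry\<close>

text \<open>Repeatedly delete a fibre with fewer than th elements. Each deletion removes one element from some shadow, so fewer than the weighted number of shadow elements are lost, and something survives.\<close>
lemma min_degree_subfamily:
  fixes E :: "('i => 'a) set" and th :: real
  assumes "finite E" "finite I" "th >= 0"
    and "(\<Sum>s\<in>I. th * card ((%e. e(s := undefined)) ` E)) < card E"
  shows "\<exists>E'\<subseteq>E. E' ~= {} & (\<forall>e\<in>E'. \<forall>s\<in>I. th <= card {y. e(s := y) : E'})"
 using assms(1,4)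
proof (induction "card E" arbitrary: E rule: less_induct)
 case less
 let ?d = "%s E. (%e. e(s := undefined)) ` E"
 have ne: "E ~= {}" using less.prems(2) assms(3) by (auto)
 show ?case
 proof (cases "ALL e:E. ALL s:I. th <= card {y. e(s := y) : E}")
  case True thus ?thesis using ne by blast
 next
  case False
  then obtain e s where es: "e : E" "s : I" "card {y. e(s := y) : E} < th" by force
  let ?R = "(%y. e(s := y)) ` {y. e(s := y) : E}"
  have inj: "inj_on (%y. e(s := y)) {y. e(s := y) : E}" by (auto simp: inj_on_def dest: fun_upd_eqD)
  have cR: "card ?R = card {y. e(s := y) : E}" by (rule card_image[OF inj])
  have RE: "?R <= E" by auto
  define E1 where "E1 = E - ?R"
  have "e : ?R" using es(1) by (auto intro!: image_eqI[of _ _ "e s"])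
  hence lt: "card E1 < card E" using less.prems(1) es(1) by (auto simp: E1_def intro: psubset_card_mono)
  have cE1: "real (card E1) = card E - card ?R" using RE less.prems(1) by (simp add: E1_def card_Diff_subset card_mono finite_subset of_nat_diff)
  have notin: "e(s := undefined) ~: ?d s E1"
  proof
   assume "e(s := undefined) : ?d s E1"
   then obtain e' where e': "e' : E1" "e(s := undefined) = e'(s := undefined)" by auto
   hence "e' = e(s := e' s)" by (metis fun_upd_triv fun_upd_upd)
   hence "e' : ?R" using e'(1) by (auto simp: E1_def intro!: image_eqI[of _ _ "e' s"])
   thus False using e'(1) by (simp add: E1_def)
  qed
  have sub: "?d t E1 <= ?d t E" for t by (auto simp: E1_def)
  have "insert (e(s := undefined)) (?d s E1) <= ?d s E" using es(1) sub[of s] by auto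
  hence "card (insert (e(s := undefined)) (?d s E1)) <= card (?d s E)" using less.prems(1) by (intro card_mono) auto
  hence c1: "real (card (?d s E1)) + 1 <= card (?d s E)" using notin less.prems(1) by (simp add: E1_def)
  have ct: "card (?d t E1) <= card (?d t E)" for t using less.prems(1) by (intro card_mono sub) auto
  have "(\<Sum>t\<in>I. th * card (?d t E1)) = th * card (?d s E1) + (\<Sum>t\<in>I-{s}. th * card (?d t E1))" using es(2) assms(2) by (simp add: sum.remove)
  also have "... <= th * (real (card (?d s E)) - 1) + (\<Sum>t\<in>I-{s}. th * card (?d t E))" using c1 ct assms(3) by (intro add_mono sum_mono mult_left_mono) auto
  also have "... = (\<Sum>t\<in>I. th * card (?d t E)) - th" using es(2) assms(2) by (simp add: sum.remove right_diff_distrib)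
  also have "... < card E1" using less.prems(2) es(3) cE1 cR by simp
  finally have lt2: "(\<Sum>t\<in>I. th * card (?d t E1)) < card E1" .
  have fin1: "finite E1" using less.prems(1) by (simp add: E1_def)
  have "E1 <= E" by (auto simp: E1_def)
  with less.hyps[OF lt fin1 lt2] show ?thesis by (meson order_trans)
 qed
qed

lemma one_le_card: "finite A ==> x : A ==> 1 <= real (card A)"
 by (cases "card A") auto

text \<open>Choosing the coordinates in J one after another, there are at least c choices each time. The coordinate s is forgotten at the end and so may be adjusted freely at every step.\<close>
lemma product_fibres:
  fixes E' :: "('i => 'a) set" and c :: real
  assumes "finite E'" "finite J" "s \<notin> J" "c >= 0" "e : E'"
    and fib: "!!e i. e : E' ==> i : J ==> c <= card {x. \<exists>y. e(i := x, s := y) : E'}"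
  shows "c ^ card J <= card {f : (%e. e(s := undefined)) ` E'. \<forall>i. i \<notin> J --> i ~= s --> f i = e i}"
proof -
 define D where "D = (%e. e(s := undefined)) ` E'"
 define T where "T J e = {f : D. ALL i. i ~: J --> i ~= s --> f i = e i}" for J e
 have finD: "finite D" using assms(1) by (simp add: D_def)
 have finT: "finite (T J e)" for J e using finD by (simp add: T_def)
 have DI: "e(s := undefined) : D" if "e : E'" for e using that unfolding D_def by (rule imageI)
 have "c ^ card J <= card (T J e)" using assms(2,3,5,6)
 proof (induction J arbitrary: e rule: finite_induct)
  case empty
  have "e(s := undefined) : T {} e" using DI[OF empty(2)] by (simp add: T_def)
  from one_le_card[OF finT this] show ?case by simp
 next
  case (insert i J)
  let ?X = "{x. EX y. e(i := x, s := y) : E'}"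
  have isn: "i ~= s" using insert.prems by auto
  have "ALL x. EX y. x : ?X --> e(i := x, s := y) : E'" by blast
  then obtain y where y: "!!x. x : ?X ==> e(i := x, s := y x) : E'" by metis
  define e' where "e' x = e(i := x, s := y x)" for x
  have e': "e' x : E'" if "x : ?X" for x using y[OF that] by (simp add: e'_def)
  have e'i: "e' x i = x" and e'j: "j ~= i ==> j ~= s ==> e' x j = e j" for x j using isn by (auto simp: e'_def)
  have finX: "finite ?X"
  proof (rule finite_subset)
   show "?X <= (%e. e i) ` E'"
   proof
    fix x assume "x : ?X"
    from imageI[OF e'[OF this], of "%e. e i"] show "x : (%e. e i) ` E'" by (simp only: e'i)
   qed
  qed (use assms(1) in auto)
  have IH: "c ^ card J <= card (T J (e' x))" if "x : ?X" for x by (rule insert.IH) (use insert.prems e'[OF that] in blast)+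
  have sub: "(\<Union>x\<in>?X. T J (e' x)) <= T (insert i J) e" using e'j by (auto simp: T_def)
  have fi: "f i = x" if "f : T J (e' x)" for f x using that insert.hyps(2) isn e'i by (simp add: T_def)
  have "c ^ card (insert i J) = c * c ^ card J" using insert.hyps by simp
  also have "... <= card ?X * c ^ card J" by (rule mult_right_mono[OF insert.prems(3)[OF insert.prems(2) insertI1]]) (use assms(4) in simp)
  also have "... = (\<Sum>x\<in>?X. c ^ card J)" by simp
  also have "... <= (\<Sum>x\<in>?X. real (card (T J (e' x))))" by (intro sum_mono IH)
  also have "... = real (\<Sum>x\<in>?X. card (T J (e' x)))" by simp
  also have "(\<Sum>x\<in>?X. card (T J (e' x))) = card (\<Union>x\<in>?X. T J (e' x))" by (rule card_UN_disjoint[symmetric]) (use finX finT fi in blast)+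
  also have "real ... <= card (T (insert i J) e)" using sub finT by (intro of_nat_mono card_mono)
  finally show ?case .
 qed
 thus ?thesis by (simp only: T_def D_def)
qed

text \<open>The pairs of a point of S and a point outside S that differ in coordinate i only: the edge boundary of S in direction i of the grid.\<close>
definition bd :: "'i set => ('i => 'a set) => ('i => 'a) set => 'i => (('i => 'a) \<times> 'a) set" where
  "bd I V S i = {(f, y). f : S & y : V i & f(i := y) \<notin> S}"

text \<open>Join every point of S to every point outside by changing the coordinates one at a time; some step crosses the boundary, and a boundary pair is used by as many pairs as there are choices for the remaining coordinates.\<close>
lemma isoperimetry:
  fixes V :: "'i => 'a set"
  assumes "finite I" "!!i. i : I ==> finite (V i)" "S \<subseteq> PiE I V"
  shows "card S * card (PiE I V - S) <= (\<Sum>i\<in>I. card (bd I V S i) * (\<Prod>j\<in>I-{i}. card (V j)))"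
 using assms
proof (induction I arbitrary: S rule: finite_induct)
 case empty
 hence "S = {} | S = PiE {} V" by auto
 thus ?case by auto
next
 case (insert i I)
 let ?O = "PiE I V" and ?O' = "PiE (insert i I) V"
 define sl where "sl y = {f : ?O. f(i := y) : S}" for y
 have finV: "finite (V i)" and finO: "finite ?O" and finO': "finite ?O'" using insert by (auto intro!: finite_PiE)
 have finsl: "finite (sl y)" for y using finO by (simp add: sl_def)
 have slO: "sl y <= ?O" for y by (auto simp: sl_def)
 have inj: "inj_on (%(y, f). f(i := y)) (V i \<times> ?O)"
 proof (rule inj_onI, clarify)
  fix y f y' f' assume a: "f : ?O" "f' : ?O" "f(i := y) = f'(i := y')"
  have "f i = undefined" "f' i = undefined" using a insert.hyps by (auto simp: PiE_def extensional_def)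
  with a(3) show "y = y' & f = f'" by (metis fun_upd_eqD fun_upd_triv fun_upd_upd)
 qed
 have mem: "f(i := y) : ?O'" if "f : ?O" "y : V i" for f y using that by (auto simp: PiE_def extensional_def)
 have Oeq: "?O' = (%(y, f). f(i := y)) ` (V i \<times> ?O)" by (simp add: PiE_insert_eq)
 have S_eq: "S = (%(y, f). f(i := y)) ` (SIGMA y:V i. sl y)"
 proof -
  have "S <= (%(y, f). f(i := y)) ` (SIGMA y:V i. sl y)"
  proof
   fix g assume g: "g : S"
   hence "g : ?O'" using insert.prems by auto
   then obtain y f where "y : V i" "f : ?O" "g = f(i := y)" unfolding Oeq by auto
   thus "g : (%(y, f). f(i := y)) ` (SIGMA y:V i. sl y)" using g by (auto simp: sl_def intro!: image_eqI[of _ _ "(y,f)"])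
  qed
  thus ?thesis by (auto simp: sl_def)
 qed
 have Sc_eq: "?O' - S = (%(y, f). f(i := y)) ` (SIGMA y:V i. ?O - sl y)"
 proof -
  have "?O' - S <= (%(y, f). f(i := y)) ` (SIGMA y:V i. ?O - sl y)"
   unfolding Oeq by (auto simp: sl_def)
  moreover have "(%(y, f). f(i := y)) ` (SIGMA y:V i. ?O - sl y) <= ?O' - S" using mem unfolding sl_def by (clarsimp simp del: PiE_iff fun_upd_apply)
  ultimately show ?thesis by blast
 qed
 have cS: "card S = (\<Sum>y\<in>V i. card (sl y))"
  unfolding S_eq using finV finsl by (subst card_image, intro inj_on_subset[OF inj]) (use slO in \<open>blast, simp\<close>)
 have cSc: "card (?O' - S) = (\<Sum>y\<in>V i. card (?O - sl y))"
  unfolding Sc_eq using finV finO by (subst card_image, intro inj_on_subset[OF inj]) (blast, simp)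
 have bdi: "card (bd (insert i I) V S i) = (\<Sum>y\<in>V i. \<Sum>y'\<in>V i. card (sl y - sl y'))"
 proof -
  have "bd (insert i I) V S i = (%((y, y'), f). (f(i := y), y')) ` (SIGMA yy:V i \<times> V i. sl (fst yy) - sl (snd yy))" (is "_ = ?R")
  proof -
   have "bd (insert i I) V S i <= ?R"
   proof
    fix x assume "x : bd (insert i I) V S i"
    then obtain g y' where x: "x = (g, y')" "g : S" "y' : V i" "g(i := y') ~: S" by (auto simp: bd_def)
    then obtain y f where yf: "y : V i" "f : sl y" "g = f(i := y)" using S_eq by auto
    hence "f ~: sl y'" using x by (simp add: sl_def)
    thus "x : ?R" using x yf by (intro image_eqI[of _ _ "((y,y'),f)"]) auto
   qed
   thus ?thesis by (auto simp: bd_def sl_def)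
  qed
  moreover have "inj_on (%((y, y'), f). (f(i := y), y')) (SIGMA yy:V i \<times> V i. sl (fst yy) - sl (snd yy))"
  proof (rule inj_onI, goal_cases)
   case uv: (1 u v)
   obtain y y' f z z' g where [simp]: "u = ((y, y'), f)" "v = ((z, z'), g)" by (metis surj_pair)
   have "(y, f) = (z, g)" by (rule inj_onD[OF inj]) (use uv slO in auto)
   thus ?case using uv by simp
  qed
  ultimately have "card (bd (insert i I) V S i) = card (SIGMA yy:V i \<times> V i. sl (fst yy) - sl (snd yy))" by (simp add: card_image)
  also have "... = (\<Sum>yy\<in>V i \<times> V i. card (sl (fst yy) - sl (snd yy)))" using finV finsl by (simp add: card_SigmaI)
  also have "... = (\<Sum>y\<in>V i. \<Sum>y'\<in>V i. card (sl y - sl y'))" by (subst sum.cartesian_product) (simp add: case_prod_unfold)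
  finally show ?thesis .
 qed
 have bdj: "card (bd (insert i I) V S j) = (\<Sum>y\<in>V i. card (bd I V (sl y) j))" if "j : I" for j
 proof -
  have ji: "j ~= i" using that insert.hyps by auto
  have "bd (insert i I) V S j = (%(y, (f, x)). (f(i := y), x)) ` (SIGMA y:V i. bd I V (sl y) j)" (is "_ = ?R")
  proof -
   have "bd (insert i I) V S j <= ?R"
   proof
    fix x assume "x : bd (insert i I) V S j"
    then obtain g y' where x: "x = (g, y')" "g : S" "y' : V j" "g(j := y') ~: S" by (auto simp: bd_def)
    then obtain y f where yf: "y : V i" "f : sl y" "g = f(i := y)" using S_eq by auto
    hence "f(j := y') ~: sl y" using x ji by (simp add: sl_def fun_upd_twist)
    thus "x : ?R" using x yf by (intro image_eqI[of _ _ "(y,(f,y'))"]) (auto simp: bd_def)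
   qed
   moreover have "?R <= bd (insert i I) V S j"
   proof
    fix x assume "x : ?R"
    then obtain y f y' where x: "x = (f(i := y), y')" "y : V i" "f : sl y" "y' : V j" "f(j := y') ~: sl y" by (auto simp: bd_def)
    have "f(j := y') : ?O" using x that by (auto simp: sl_def PiE_def extensional_def)
    hence "f(j := y', i := y) ~: S" using x by (simp add: sl_def)
    thus "x : bd (insert i I) V S j" using x ji by (simp add: bd_def sl_def fun_upd_twist)
   qed
   ultimately show ?thesis by blast
  qed
  moreover have "inj_on (%(y, (f, x)). (f(i := y), x)) (SIGMA y:V i. bd I V (sl y) j)"
  proof (rule inj_onI)
   fix u v assume uv: "u : (SIGMA y:V i. bd I V (sl y) j)" "v : (SIGMA y:V i. bd I V (sl y) j)"
    "(case u of (y, f, x) => (f(i := y), x)) = (case v of (y, f, x) => (f(i := y), x))"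
   obtain y f x z g x' where [simp]: "u = (y, f, x)" "v = (z, g, x')" by (metis surj_pair)
   have "f : sl y" "g : sl z" using uv by (auto simp: bd_def)
   hence "(y, f) = (z, g)" by (intro inj_onD[OF inj]) (use uv slO in auto)
   thus "u = v" using uv by simp
  qed
  ultimately have "card (bd (insert i I) V S j) = card (SIGMA y:V i. bd I V (sl y) j)" by (simp add: card_image)
  moreover have "finite (bd I V (sl y) j)" for y by (rule finite_subset[of _ "sl y \<times> V j"]) (use finsl insert.prems(1) that in \<open>auto simp: bd_def\<close>)
  ultimately show ?thesis using finV by (simp add: card_SigmaI)
 qed
 have IH: "card (sl y) * card (?O - sl y) <= (\<Sum>j\<in>I. card (bd I V (sl y) j) * (\<Prod>l\<in>I-{j}. card (V l)))" for y using insert.IH[OF _ slO] insert.prems(1) by auto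
 have pair: "card (sl y) * card (?O - sl y') <= card (sl y - sl y') * card ?O + card (sl y') * card (?O - sl y')" for y y'
 proof -
  have "card (sl y) = card (sl y - sl y') + card (sl y Int sl y')" using finsl by (metis Int_commute add.commute card_Int_Diff)
  moreover have "card (sl y Int sl y') <= card (sl y')" using finsl by (intro card_mono) auto
  moreover have "card (?O - sl y') <= card ?O" using finO by (intro card_mono) auto
  ultimately show ?thesis by (simp add: add_mult_distrib add_mono mult_le_mono)
 qed
 have "card S * card (?O' - S) = (\<Sum>y\<in>V i. \<Sum>y'\<in>V i. card (sl y) * card (?O - sl y'))"
  unfolding cS cSc by (simp add: sum_product)
 also have "... <= (\<Sum>y\<in>V i. \<Sum>y'\<in>V i. card (sl y - sl y') * card ?O + card (sl y') * card (?O - sl y'))" by (intro sum_mono pair)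
 also have "... = card (bd (insert i I) V S i) * card ?O + card (V i) * (\<Sum>y\<in>V i. card (sl y) * card (?O - sl y))" by (simp add: sum.distrib bdi sum_distrib_right)
 also have "... <= card (bd (insert i I) V S i) * card ?O + card (V i) * (\<Sum>y\<in>V i. \<Sum>j\<in>I. card (bd I V (sl y) j) * (\<Prod>l\<in>I-{j}. card (V l)))"
  by (intro add_left_mono mult_left_mono sum_mono IH) auto
 also have "(\<Sum>y\<in>V i. \<Sum>j\<in>I. card (bd I V (sl y) j) * (\<Prod>l\<in>I-{j}. card (V l))) =
    (\<Sum>j\<in>I. card (bd (insert i I) V S j) * (\<Prod>l\<in>I-{j}. card (V l)))" by (subst sum.swap) (simp add: bdj sum_distrib_right)
 also have "card (V i) * (\<Sum>j\<in>I. card (bd (insert i I) V S j) * (\<Prod>l\<in>I-{j}. card (V l))) =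
    (\<Sum>j\<in>I. card (bd (insert i I) V S j) * (\<Prod>l\<in>insert i I-{j}. card (V l)))"
 proof -
  have "insert i I - {j} = insert i (I - {j})" if "j : I" for j using that insert.hyps by auto
  thus ?thesis using insert.hyps by (simp add: sum_distrib_left mult.left_commute)
 qed
 also have "card ?O = (\<Prod>l\<in>insert i I - {i}. card (V l))" using insert.hyps by (simp add: card_PiE)
 finally show ?case using insert.hyps by simp
qed

section \<open>Pseudorandom hypergraphs and infected sets\<close>

definition deg :: "'a set set => 'a set => 'a set => nat" where
  "deg E a X = card {y : X. insert y a : E}"

lemma deg_mono: "finite X ==> Y \<subseteq> X ==> E \<subseteq> E' ==> deg E a Y <= deg E' a X"
 unfolding deg_def by (intro card_mono) auto

lemma nsets_insertD: "insert y z : nsets V (Suc m) ==> finite z ==> card z <= m ==> y \<notin> z & card z = m"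
 by (auto simp: nsets_def card_insert_if split: if_splits)

text \<open>p is the edge density, L a logarithmic error term and g the excess of the codegree over one half. In spread the bound d must exceed the expected degree into F by a constant factor; then the sets with degree at least d are rare. The maximum with |V| L in mixing covers pairs C, X too small for concentration around the mean.\<close>
locale pseudorandom =
  fixes V :: "'a set" and k :: nat and p L g :: real and G :: "'a set set"
  assumes finV: "finite V" and k3: "k >= 3" and GV: "G \<subseteq> nsets V k"
    and p0: "p > 0" and L1: "L >= 1" and g0: "0 < g" and g1: "g <= 1/10"
    and spread: "!!A F (d::real). [|A \<subseteq> nsets V (k - 1); F \<subseteq> V; !!a. a : A ==> d <= deg G a F;
        4 * k * p * card F <= d; 8 * real k ^ 2 * L <= d|] ==> card A * d <= 8 * k * L * card F"
    and mixing: "!!z C X. [|z : nsets V (k - 2); C \<subseteq> V; X \<subseteq> V; C \<inter> X = {}|] ==>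
        card {(c, x) : C \<times> X. insert c (insert x z) : G} <= (1 + g/8) * max (p * card C * card X) (card V * L)"
begin

lemma fin_nsets: "finite (nsets V m)"
 using finV by (rule finite_imp_finite_nsets)

lemma nsets_finite: "a : nsets V m ==> finite a"
 by (auto simp: nsets_def)

lemma finite_sub: "X \<subseteq> V ==> finite X"
 using finV by (rule rev_finite_subset)

text \<open>Close the family of sets with large degree into W under the rule that a set is added when many of its one-element exchanges lie in the family already. By spread, applied to the link of each (k-2)-set, one closing step adds at most half of the current size, so the closure stays within twice the first bound.\<close>
lemma infection:
  fixes d :: real
  assumes W: "W \<subseteq> V" and d: "16 * real k ^ 2 * L <= d" "4 * k * p * card W <= d"
    "64 * k ^ 2 * L * p * card W <= d ^ 2"
  shows "\<exists>D\<subseteq>nsets V (k - 1). card D * d <= 16 * k * L * card W &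
     (\<forall>a\<in>nsets V (k - 1) - D. deg G a W < d & (\<forall>x\<in>a. deg G a {y : V. insert y (a - {x}) : D} < d))"
proof -
 let ?N = "nsets V (k - 1)"
 have k1: "k - 1 = Suc (k - 2)" using k3 by simp
 have "0 < real k ^ 2" using k3 by simp
 hence kL: "0 < real k ^ 2 * L" using L1 by simp
 hence dpos: "d > 0" using d(1) by linarith
 define D0 where "D0 = {a : ?N. d <= deg G a W}"
 define new where "new D = {a : ?N. EX x:a. d <= deg G a {y : V. insert y (a - {x}) : D}}" for D
 define P where "P D \<longleftrightarrow> D <= ?N & card D * d <= 16 * k * L * card W & D <= D0 Un new D" for D
 have D0: "card D0 * d <= 8 * k * L * card W" by (rule spread) (use W d kL in \<open>auto simp: D0_def\<close>)
 have newmono: "new D <= new D'" if "D <= D'" for D D'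
 proof -
  have "deg G a {y : V. insert y (a - {x}) : D} <= deg G a {y : V. insert y (a - {x}) : D'}" for a x using that finV by (intro deg_mono) auto
  hence le: "d <= deg G a {y : V. insert y (a - {x}) : D'}"
   if "d <= deg G a {y : V. insert y (a - {x}) : D}" for a x using that by (meson of_nat_mono order_trans)
  show ?thesis unfolding new_def using le by blast
 qed
 have new: "2 * card (new D) <= card D" if D: "D <= ?N" "card D * d <= 16 * k * L * card W" for D
 proof -
  let ?Z = "nsets V (k - 2)"
  have finD: "finite D" using D fin_nsets by (auto intro: finite_subset)
  define Dz where "Dz z = {y : V. insert y z : D}" for z
  define Az where "Az z = {a : ?N. d <= deg G a (Dz z)}" for z
  have finDz: "finite (Dz z)" for z using finV by (simp add: Dz_def)
  have y_notin: "y ~: z" if "z : ?Z" "y : Dz z" for y z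
  proof -
   have "insert y z : nsets V (Suc (k - 2))" using that(2) D(1) unfolding k1[symmetric] Dz_def by blast
   moreover have "finite z" "card z <= k - 2" using that(1) by (simp_all add: nsets_def)
   ultimately show ?thesis using nsets_insertD[of y z V "k - 2"] by simp
  qed
  have cDz: "card (Dz z) <= card D" if z: "z : ?Z" for z
  proof (rule card_inj_on_le)
   show "inj_on (%y. insert y z) (Dz z)"
   proof (rule inj_onI)
    fix x y assume xy: "x : Dz z" "y : Dz z" "insert x z = insert y z"
    have "x : insert y z" using xy(3) by blast
    thus "x = y" using y_notin[OF z xy(1)] by simp
   qed
  qed (use finD in \<open>auto simp: Dz_def\<close>)
  have Az: "card (Az z) * d <= 8 * k * L * card (Dz z)" if z: "z : ?Z" for z
  proof (rule spread)
   have "4 * k * p * card (Dz z) * d <= 4 * k * p * (card D * d)" using cDz[OF z] p0 dpos by (simp add: mult_left_mono mult_right_mono)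
   also have "... <= 4 * k * p * (16 * k * L * card W)" using D(2) p0 by (intro mult_left_mono) auto
   also have "... <= d * d" using d(3) by (simp add: power2_eq_square algebra_simps)
   finally show "4 * k * p * card (Dz z) <= d" using dpos by simp
  qed (use kL d in \<open>auto simp: Az_def Dz_def\<close>)
  have "new D <= (\<Union>z\<in>?Z. Az z)"
  proof
   fix a assume "a : new D"
   then obtain x where a: "a : ?N" "x : a" "d <= deg G a {y : V. insert y (a - {x}) : D}" by (auto simp: new_def)
   hence "a - {x} : ?Z" by (auto simp: nsets_def)
   thus "a : (\<Union>z\<in>?Z. Az z)" using a by (auto simp: Az_def Dz_def)
  qed
  hence "card (new D) <= card (\<Union>z\<in>?Z. Az z)" by (intro card_mono) (auto simp: Az_def fin_nsets)
  also have "... <= (\<Sum>z\<in>?Z. card (Az z))" by (rule card_UN_le[OF fin_nsets])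
  finally have "card (new D) * d <= (\<Sum>z\<in>?Z. card (Az z)) * d" using dpos by (simp del: of_nat_sum)
  also have "... = (\<Sum>z\<in>?Z. card (Az z) * d)" by (simp add: sum_distrib_right)
  also have "... <= (\<Sum>z\<in>?Z. 8 * k * L * card (Dz z))" by (intro sum_mono Az)
  also have "... = 8 * k * L * card (SIGMA z:?Z. Dz z)" using finDz fin_nsets by (simp add: sum_distrib_left)
  also have "card (SIGMA z:?Z. Dz z) <= card (SIGMA b:D. b)"
  proof (rule card_inj_on_le)
   show "inj_on (%(z, y). (insert y z, y)) (SIGMA z:?Z. Dz z)"
   proof (rule inj_onI, goal_cases)
    case (1 u v)
    obtain z y z' y' where uv: "u = (z, y)" "v = (z', y')" by (metis surj_pair)
    have eq: "y' = y" "insert y z = insert y z'" using 1(3) by (auto simp: uv)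
    have "y ~: z" "y ~: z'" using 1(1,2) y_notin eq(1) by (auto simp: uv)
    thus ?case using eq by (simp add: uv insert_ident)
   qed
   show "finite (SIGMA b:D. b)" using finD D(1) nsets_finite by auto
  qed (auto simp: Dz_def)
  also have "card (SIGMA b:D. b) = (\<Sum>b\<in>D. card b)" using finD D(1) nsets_finite by (intro card_SigmaI) auto
  also have "... = (\<Sum>b\<in>D. k - 1)" using D(1) by (intro sum.cong) (auto simp: nsets_def)
  also have "... <= card D * k" by (simp)
  finally have "card (new D) * d <= 8 * k * L * (card D * k)" using L1 k3 by (simp add: mult_left_mono)
  also have "... = (8 * real k ^ 2 * L) * card D" by (simp add: power2_eq_square)
  also have "... <= (d / 2) * card D" using d(1) by (intro mult_right_mono) auto
  finally have "(2 * real (card (new D))) * d <= real (card D) * d" by (simp add: algebra_simps)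
  hence "2 * real (card (new D)) <= real (card D)" using dpos by (rule mult_right_le_imp_le)
  thus ?thesis by linarith
 qed
 have "P {}" using L1 by (simp add: P_def)
 moreover have "card D <= card ?N" if "P D" for D using that card_mono[OF fin_nsets] unfolding P_def by blast
 ultimately obtain D where D: "P D" and max: "!!D'. P D' ==> card D' <= card D" using ex_has_greatest_nat[of P "{}" card "Suc (card ?N)"] by (metis le_imp_less_Suc)
 have DN: "D <= ?N" and Dd: "card D * d <= 16 * k * L * card W" and Dsub: "D <= D0 Un new D" using D by (auto simp: P_def)
 have "P (D0 Un new D)"
 proof -
  have "card (D0 Un new D) <= card D0 + card (new D)" by (rule card_Un_le)
  hence "card (D0 Un new D) * d <= (card D0 + card (new D)) * d" using dpos by simp
  also have "... = card D0 * d + (2 * card (new D)) * d / 2" by (simp add: algebra_simps)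
  also have "... <= 8 * k * L * card W + card D * d / 2" using D0 new[OF DN Dd] dpos by (intro add_mono divide_right_mono mult_right_mono of_nat_mono) auto
  also have "... <= 16 * k * L * card W" using Dd by (simp add: mult_ac)
  finally have "card (D0 Un new D) * d <= 16 * k * L * card W" .
  thus ?thesis using newmono[OF Dsub] by (auto simp: P_def D0_def new_def)
 qed
 hence le: "card (D0 Un new D) <= card D" by (rule max)
 have fin: "finite (D0 Un new D)" using fin_nsets by (simp add: D0_def new_def)
 have "D0 Un new D <= D" by (rule equalityD2[OF card_seteq[OF fin Dsub le]])
 hence D0D: "D0 <= D" and newD: "new D <= D" by simp_all
 show ?thesis
 proof (intro exI[of _ D] conjI ballI DN Dd)
  fix a assume a: "a : ?N - D"
  hence "a ~: D0" "a ~: new D" using D0D newD by auto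
  thus "deg G a W < d" using a by (simp add: D0_def)
  fix x assume "x : a"
  thus "deg G a {y : V. insert y (a - {x}) : D} < d" using a \<open>a ~: new D\<close> unfolding new_def by (simp add: not_le)
 qed
qed

end

section \<open>Walks through a system of disjoint sets\<close>

text \<open>The setting after all spoiled sets are removed: every facet of an edge of H is good, and every good set still has more than half of the expected maximum degree into each of the disjoint sets in Ps.\<close>
locale world = pseudorandom V k p L g G
  for V :: "'a set" and k :: nat and p L g :: real and G :: "'a set set" +
  fixes H good :: "'a set set" and N tau :: real and Ps :: "'a set set"
  assumes HG: "H \<subseteq> G" and goodV: "good \<subseteq> nsets V (k - 1)"
    and H_good: "!!e x. e : H ==> x : e ==> e - {x} : good"
    and PsV: "!!X. X : Ps ==> X \<subseteq> V"
    and Ps_disj: "!!X Y. X : Ps ==> Y : Ps ==> X ~= Y ==> X \<inter> Y = {}"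
    and Ps_card: "!!X. X : Ps ==> card X <= (1 + g/8) * N"
    and H_deg: "!!a X. a : good ==> X : Ps ==> (1/2 + g) * p * N <= deg H a X"
    and G_deg: "!!a X. a : nsets V (k - 1) ==> X : Ps ==> deg G a X <= 3 * p * N"
    and few_bad: "card (nsets V (k - 1) - good) <= tau * N"
    and N0: "N > 0" and tau0: "tau > 0"
    and L_N: "L <= tau * p * N" and L_N2: "L * card V <= tau * p * N ^ 2"
begin

lemma HV: "H \<subseteq> nsets V k" using HG GV by blast

lemma Ps_card2: "X : Ps ==> card X <= 2 * N"
proof -
 assume "X : Ps"
 have "(1 + g/8) * N <= 2 * N" using g1 N0 by (intro mult_right_mono) auto
 thus ?thesis using Ps_card[OF \<open>X : Ps\<close>] by linarith
qed

lemma edge_card: assumes "e : H" shows "finite e" "card e = k" "e \<subseteq> V"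
 using assms HV by (auto simp: nsets_def)

text \<open>Double count the H-edges between C and Y in the link of z: each vertex of C sends at least (1/2+g)pN of them, and mixing limits what fewer than (1/2+g/2)N vertices of Y can receive. The excess over one half is used later to make two such neighbourhoods intersect.\<close>
lemma link_expansion:
  assumes z: "z : nsets V (k - 2)" and X: "X : Ps" "Y : Ps" "X ~= Y" and C: "C \<subseteq> X"
    and Cgood: "!!c. c : C ==> insert c z : good" and Cbig: "2 * tau * N <= card C"
  shows "(1/2 + g/2) * N <= card {w : Y. (g/8) * p * card C <= card {c : C. insert w (insert c z) : H}}"
proof (rule ccontr)
 define B where "B = {w : Y. (g/8) * p * card C <= card {c : C. insert w (insert c z) : H}}"
 assume "~ ?thesis"
 hence Bs: "card B < (1/2 + g/2) * N" by (simp add: B_def)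
 have finC: "finite C" and finY: "finite Y" using finite_sub PsV X C by (meson finite_subset)+
 have BY: "B <= Y" by (auto simp: B_def)
 have finB: "finite B" using finY BY by (rule rev_finite_subset)
 have c0: "card C > 0" using Cbig tau0 N0 by (metis mult_pos_pos of_nat_0_less_iff order_less_le_trans zero_less_numeral)
 have "card C * ((1/2 + g) * p * N) = (\<Sum>c\<in>C. (1/2 + g) * p * N)" by simp
 also have "... <= (\<Sum>c\<in>C. real (deg H (insert c z) Y))" using H_deg Cgood X by (intro sum_mono) auto
 also have "... = (\<Sum>c\<in>C. \<Sum>w\<in>Y. of_bool (insert w (insert c z) : H))" using finY by (simp add: deg_def of_bool_def sum.If_cases Collect_conj_eq[symmetric] Int_def)
 also have "... = (\<Sum>w\<in>Y. \<Sum>c\<in>C. of_bool (insert w (insert c z) : H))" by (rule sum.swap)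
 also have "... = (\<Sum>w\<in>Y. real (card {c : C. insert w (insert c z) : H}))" using finC by (simp add: of_bool_def sum.If_cases Int_def)
 also have "... = (\<Sum>w\<in>B. real (card {c : C. insert w (insert c z) : H})) + (\<Sum>w\<in>Y-B. real (card {c : C. insert w (insert c z) : H}))"
  using finY BY by (metis (no_types, lifting) add.commute sum.subset_diff)
 also have "(\<Sum>w\<in>Y-B. real (card {c : C. insert w (insert c z) : H})) <= (\<Sum>w\<in>Y-B. (g/8) * p * card C)" by (intro sum_mono) (auto simp: B_def)
 also have "... <= card Y * ((g/8) * p * card C)" using finY g0 p0 by (simp add: mult_right_mono card_mono)
 also have "... <= ((1 + g/8) * N) * ((g/8) * p * card C)" using Ps_card[OF X(2)] g0 p0 by (intro mult_right_mono) auto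
 also have "(\<Sum>w\<in>B. real (card {c : C. insert w (insert c z) : H})) <= (1 + g/8) * (p * card C * ((1/2 + g/2) * N))"
 proof -
  have "(\<Sum>w\<in>B. card {c : C. insert w (insert c z) : H}) = card (SIGMA w:B. {c : C. insert w (insert c z) : H})" using finB finC by simp
  also have "... <= card {(c, x) : C \<times> B. insert c (insert x z) : G}"
  proof (rule card_inj_on_le[where f = "%(x, y). (y, x)"])
   show "inj_on (%(x, y). (y, x)) (SIGMA w:B. {c : C. insert w (insert c z) : H})" by (auto simp: inj_on_def)
   show "finite {(c, x) : C \<times> B. insert c (insert x z) : G}" by (rule finite_subset[of _ "C \<times> B"]) (use finB finC in auto)
   show "(%(x, y). (y, x)) ` (SIGMA w:B. {c : C. insert w (insert c z) : H}) <= {(c, x) : C \<times> B. insert c (insert x z) : G}"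
   proof (rule image_subsetI)
    fix u assume "u : (SIGMA w:B. {c : C. insert w (insert c z) : H})"
    then obtain w c where u: "u = (w, c)" "w : B" "c : C" "insert w (insert c z) : H" by blast
    have "insert c (insert w z) : G" using u(4) HG by (subst insert_commute) (rule subsetD)
    thus "(case u of (x, y) => (y, x)) : {(c, x) : C \<times> B. insert c (insert x z) : G}" using u by simp
   qed
  qed
  finally have "(\<Sum>w\<in>B. real (card {c : C. insert w (insert c z) : H})) <= card {(c, x) : C \<times> B. insert c (insert x z) : G}"
   unfolding of_nat_sum[symmetric] of_nat_le_iff .
  also have "... <= (1 + g/8) * max (p * card C * card B) (card V * L)"
  proof (rule mixing[OF z])
   show "C <= V" "B <= V" using C BY PsV X by auto
   show "C Int B = {}" using Ps_disj[OF X] C BY by auto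
  qed
  also have "max (p * card C * card B) (card V * L) <= p * card C * ((1/2 + g/2) * N)"
  proof (rule max.boundedI)
   show "p * card C * card B <= p * card C * ((1/2 + g/2) * N)" using Bs p0 by (intro mult_left_mono) auto
   have "card V * L <= p * (tau * N) * N" using L_N2 by (simp add: power2_eq_square mult_ac)
   also have "... <= p * (card C / 2) * N" using Cbig p0 N0 by (intro mult_right_mono mult_left_mono) auto
   also have "... <= p * card C * ((1/2 + g/2) * N)" using p0 N0 g0 by (simp add: algebra_simps)
   finally show "card V * L <= p * card C * ((1/2 + g/2) * N)" .
  qed
  finally show ?thesis using g0 by (simp add: mult_left_mono)
 qed
 finally have "(p * card C * N) * (1/2 + g) <= (p * card C * N) * ((1 + g/8) * (1/2 + g/2 + g/8))" by (simp add: algebra_simps add_divide_distrib)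
 moreover have "p * card C * N > 0" using p0 c0 N0 by simp
 ultimately have "1/2 + g <= (1 + g/8) * (1/2 + g/2 + g/8)" by (metis mult_le_cancel_left_pos)
 hence "1/2 + g <= 1/2 + 11/16 * g + 5/64 * (g * g)" by (simp add: algebra_simps add_divide_distrib)
 moreover have "g * g <= g * 1" using g0 g1 by (intro mult_left_mono) auto
 ultimately show False using g0 unfolding mult_1_right by linarith
qed

subsection \<open>States\<close>

definition slots :: "(nat => 'a set) => bool" where
  "slots U \<longleftrightarrow> (\<forall>i<k. U i : Ps) & (\<forall>i<k. \<forall>j<k. i ~= j --> U i ~= U j)"

text \<open>Edges with one vertex in each of the sets U 0, ..., U (k-1), as choice functions. A state of a walk is such a function with one coordinate s missing, which is encoded by the value undefined at s.\<close>
definition EH :: "(nat => 'a set) => (nat => 'a) set" where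
  "EH U = {e : PiE {..<k} U. e ` {..<k} : H}"

lemma slots_Ps: "slots U ==> i < k ==> U i : Ps" by (simp add: slots_def)

lemma slots_finite: "slots U ==> i < k ==> finite (U i)"
 using slots_Ps PsV finite_sub by simp

lemma slots_disj: "slots U ==> i < k ==> j < k ==> x : U i ==> x : U j ==> i = j"
 using Ps_disj[of "U i" "U j"] by (auto simp: slots_def)

lemma state_inj: "slots U ==> J \<subseteq> {..<k} ==> a : PiE J U ==> inj_on a J"
proof (rule inj_onI)
 fix x y assume "slots U" "J <= {..<k}" "a : PiE J U" "x : J" "y : J" "a x = a y"
 thus "x = y" using slots_disj[of U x y "a x"] by (metis PiE_mem lessThan_iff subsetD)
qed

lemma state_nsets: assumes "slots U" "J \<subseteq> {..<k}" "a : PiE J U" shows "a ` J : nsets V (card J)"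
proof -
 have "a ` J <= V" using assms PsV slots_Ps PiE_mem[OF assms(3)] by blast
 moreover have "finite J" using assms(2) finite_subset by blast
 ultimately show ?thesis using card_image[OF state_inj[OF assms]] by (simp add: nsets_def)
qed

lemma finite_states: "slots U ==> J \<subseteq> {..<k} ==> finite (PiE J U)"
 using slots_finite finite_subset by (intro finite_PiE) blast+

lemma card_states: assumes "slots U" "J \<subseteq> {..<k}" shows "card (PiE J U) <= (2 * N) ^ card J"
proof -
 have "finite J" using assms(2) finite_subset by blast
 hence "real (card (PiE J U)) = (\<Prod>i\<in>J. real (card (U i)))" by (simp add: card_PiE)
 also have "... <= (\<Prod>i\<in>J. 2 * N)" using assms slots_Ps Ps_card2 by (intro prod_mono) auto
 finally show ?thesis by simp
qed

lemma finite_EH: "slots U ==> finite (EH U)"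
 using finite_states[of U "{..<k}"] by (simp add: EH_def)

lemma upd_image: "s < k ==> (a(s := y)) ` {..<k} = insert y (a ` ({..<k} - {s}))"
 by (auto simp: image_iff)

lemma upd_EH: "a : PiE ({..<k} - {s}) U ==> s < k ==> a(s := y) : EH U \<longleftrightarrow> y : U s & insert y (a ` ({..<k} - {s})) : H"
 unfolding EH_def using upd_image[of s a y] by (auto simp: PiE_def extensional_def Pi_def split: if_splits)

lemma drop_state:
  assumes "slots U" "e : EH U" "s < k"
  shows "e(s := undefined) : PiE ({..<k} - {s}) U" "(e(s := undefined)) ` ({..<k} - {s}) : good"
proof -
 have e: "e : PiE {..<k} U" "e ` {..<k} : H" using assms(2) by (auto simp: EH_def)
 show "e(s := undefined) : PiE ({..<k} - {s}) U" using e(1) by (auto simp: PiE_def extensional_def)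
 have inj: "inj_on e {..<k}" using state_inj[OF assms(1) _ e(1)] by simp
 have "(e(s := undefined)) ` ({..<k} - {s}) = e ` ({..<k} - {s})" by (intro image_cong) auto
 also have "... = e ` {..<k} - {e s}" using inj assms(3) by (auto simp: inj_on_def)
 finally show "(e(s := undefined)) ` ({..<k} - {s}) : good" using H_good[OF e(2)] assms(3) by auto
qed

lemma drop_upd: "a : PiE ({..<k} - {s}) U ==> (a(s := y))(s := undefined) = a"
 by (auto simp: PiE_def extensional_def fun_eq_iff)

lemma state_deg:
  assumes "slots U" "s < k" "a : PiE ({..<k} - {s}) U"
  shows "card {y : U s. a(s := y) : EH U} = deg H (a ` ({..<k} - {s})) (U s)"
 using upd_EH[OF assms(3,2)] by (simp add: deg_def conj_commute cong: conj_cong)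

lemma card_fibres:
  assumes sl: "slots U" and s: "s < k" and F: "F \<subseteq> PiE ({..<k} - {s}) U"
  shows "card {e : EH U. e(s := undefined) : F} = (\<Sum>a\<in>F. deg H (a ` ({..<k} - {s})) (U s))"
proof -
 have "{e : EH U. e(s := undefined) : F} = (%(a, y). a(s := y)) ` (SIGMA a:F. {y : U s. a(s := y) : EH U})" (is "_ = ?R")
 proof (intro equalityI subsetI)
  fix e assume e: "e : {e : EH U. e(s := undefined) : F}"
  hence "e s : U s" using s by (auto simp: EH_def)
  thus "e : ?R" using e by (intro image_eqI[of _ _ "(e(s := undefined), e s)"]) auto
 next
  fix e assume "e : ?R"
  then obtain a y where e: "e = a(s := y)" "a : F" "e : EH U" by auto
  have "e(s := undefined) = a" unfolding e(1) by (rule drop_upd[OF subsetD[OF F e(2)]])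
  thus "e : {e : EH U. e(s := undefined) : F}" using e by simp
 qed
 moreover have "inj_on (%(a, y). a(s := y)) (SIGMA a:F. {y : U s. a(s := y) : EH U})"
 proof (rule inj_onI, goal_cases)
  case (1 u v)
  obtain a y b x where uv: "u = (a, y)" "v = (b, x)" by (metis surj_pair)
  have ab: "a : F" "b : F" "a(s := y) = b(s := x)" using 1 by (auto simp: uv)
  hence "a = b" using drop_upd F by (metis subsetD)
  thus ?case using ab by (metis fun_upd_eqD uv)
 qed
 ultimately have "card {e : EH U. e(s := undefined) : F} = card (SIGMA a:F. {y : U s. a(s := y) : EH U})" by (simp add: card_image)
 also have "... = (\<Sum>a\<in>F. card {y : U s. a(s := y) : EH U})" using finite_subset[OF F finite_states[OF sl]] slots_finite[OF sl s] by (intro card_SigmaI) auto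
 also have "... = (\<Sum>a\<in>F. deg H (a ` ({..<k} - {s})) (U s))" using F by (intro sum.cong refl state_deg[OF sl s]) auto
 finally show ?thesis .
qed

end

context world begin

text \<open>If only few x occurred in coordinate i, then the many sets obtained from e by varying coordinate s would all have large degree into the small set of these x, against spread.\<close>
lemma fibre_large:
  fixes th :: real
  assumes sl: "slots U" and E': "E' \<subseteq> EH U" and e: "e : E'" and is': "i < k" "s < k" "i ~= s"
    and mindeg: "!!e s. e : E' ==> s < k ==> th <= card {y. e(s := y) : E'}"
    and th: "8 * real k ^ 2 * L <= th"
  shows "th / (4 * k * p) < card {x. \<exists>y. e(i := x, s := y) : E'}"
proof -
 define fib where "fib i s = {x. EX y. e(i := x, s := y) : E'}" for i s
 have kL: "0 < k * L" "8 * (k * L) < th"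
 proof -
  show "0 < k * L" using k3 L1 by simp
  hence "8 * (k * L) * 1 < 8 * (k * L) * k" using k3 by (intro mult_strict_left_mono) auto
  also have "... <= th" using th by (simp add: power2_eq_square mult_ac)
  finally show "8 * (k * L) < th" by simp
 qed
 have fin: "finite (fib i s) & fib i s <= V & fib i s ~= {} &
   (card (fib s i) <= th / (4 * k * p) --> card (fib i s) * th <= 8 * k * L * card (fib s i))"
  if is': "i < k" "s < k" "i ~= s" and fV: "fib s i <= V" for i s
 proof -
  define z where "z = e ` ({..<k} - {i, s})"
  have im: "(e(i := x, s := y)) ` {..<k} = insert y (insert x z)" for x y
  proof -
   have "{..<k} = insert s (insert i ({..<k} - {i, s}))" using is' by auto
   hence "(e(i := x, s := y)) ` {..<k} = insert y (insert x ((e(i := x, s := y)) ` ({..<k} - {i, s})))" using is' by (metis (no_types, lifting) fun_upd_other fun_upd_same image_insert)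
   also have "(e(i := x, s := y)) ` ({..<k} - {i, s}) = z" unfolding z_def by (intro image_cong) auto
   finally show ?thesis .
  qed
  have eU: "e : PiE {..<k} U" using e E' by (auto simp: EH_def)
  have zle: "finite z" "card z <= k - 2"
  proof -
   show "finite z" by (simp add: z_def)
   have "card z <= card ({..<k} - {i, s})" unfolding z_def by (rule card_image_le) simp
   also have "... = k - 2" using is' by (simp add: card_Diff_subset)
   finally show "card z <= k - 2" .
  qed
  have edge: "insert y (insert x z) : H" if "e(i := x, s := y) : E'" for x y using that E' im[of x y] by (auto simp: EH_def)
  have xz: "x ~: z & insert x z : nsets V (k - 1) & x : V" if xf: "x : fib i s" for x
  proof -
   obtain y where "e(i := x, s := y) : E'" using xf by (auto simp: fib_def)
   note ed = edge_card[OF edge[OF this]]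
   have "k <= Suc (card (insert x z))" using ed(2) zle(1) by (metis card_insert_le_m1 card_insert_if finite_insert le_SucI order_refl)
   moreover have "card (insert x z) <= Suc (card z)" using zle(1) by (simp add: card_insert_if)
   ultimately have "card (insert x z) = k - 1" "card z < card (insert x z)" using zle(2) k3 by linarith+
   thus ?thesis using ed(3) zle(1) by (auto simp: nsets_def insert_absorb)
  qed
  have ne: "fib i s ~= {}"
  proof -
   have "e(i := e i, s := e s) : E'" using e by simp
   thus ?thesis unfolding fib_def by blast
  qed
  have fi: "finite (fib i s)" "fib i s <= V" using xz finV by (auto intro: finite_subset)
  have "card (fib i s) * th <= 8 * k * L * card (fib s i)" if le: "card (fib s i) <= th / (4 * k * p)"
  proof -
   define A where "A = (%x. insert x z) ` fib i s"
   have "card A = card (fib i s)" unfolding A_def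
   proof (rule card_image, rule inj_onI)
    fix x y assume "x : fib i s" "y : fib i s" "insert x z = insert y z"
    thus "x = y" using xz by blast
   qed
   moreover have "card A * th <= 8 * k * L * card (fib s i)"
   proof (rule spread)
    show "A <= nsets V (k - 1)" using xz by (auto simp: A_def)
    show "fib s i <= V" by (rule fV)
    show "real (4 * k) * p * card (fib s i) <= th" using le p0 k3 by (simp add: field_simps)
    show "8 * real k ^ 2 * L <= th" by (rule th)
    fix a assume "a : A"
    then obtain x where x: "x : fib i s" "a = insert x z" by (auto simp: A_def)
    then obtain y where y: "e(i := x, s := y) : E'" by (auto simp: fib_def)
    have sub: "{y'. (e(i := x, s := y))(s := y') : E'} <= {y' : fib s i. insert y' a : G}"
    proof
     fix y' assume "y' : {y'. (e(i := x, s := y))(s := y') : E'}"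
     hence y': "e(i := x, s := y') : E'" by simp
     hence "e(s := y', i := x) : E'" using is'(3) by (simp add: fun_upd_twist)
     thus "y' : {y' : fib s i. insert y' a : G}" using edge[OF y'] HG x(2) by (auto simp: fib_def)
    qed
    have "th <= card {y'. (e(i := x, s := y))(s := y') : E'}" by (rule mindeg[OF y is'(2)])
    also have "... <= deg G a (fib s i)" unfolding deg_def using finite_sub[OF fV] by (intro of_nat_mono card_mono sub) auto
    finally show "th <= deg G a (fib s i)" .
   qed
   ultimately show ?thesis by simp
  qed
  thus ?thesis using fi ne by blast
 qed
 have V0: "fib i s <= V" if is': "i < k" "s < k" "i ~= s" for i s
 proof
  fix x assume "x : fib i s"
  then obtain y where "e(i := x, s := y) : E'" by (auto simp: fib_def)
  hence "(e(i := x, s := y)) ` {..<k} : H" using E' by (auto simp: EH_def)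
  hence "(e(i := x, s := y)) ` {..<k} <= V" by (rule edge_card(3))
  moreover have "x : (e(i := x, s := y)) ` {..<k}" using is' by (intro image_eqI[of _ _ i]) auto
  ultimately show "x : V" by blast
 qed
 note f1 = fin[OF is' V0[OF is'(2,1) is'(3)[symmetric]]] and f2 = fin[OF is'(2,1) is'(3)[symmetric] V0[OF is']]
 have strict: "card B < card A" if "card A > 0" "card B * th <= 8 * k * L * card A" for A B :: "'a set"
 proof -
  have "card B * th <= (8 * (k * L)) * card A" using that(2) by (simp add: mult_ac)
  also have "... < th * card A" using kL that(1) by (intro mult_strict_right_mono) auto
  finally have "card B * th < card A * th" by (simp add: mult.commute)
  thus ?thesis using kL by (simp add: mult_less_cancel_right)
 qed
 have pos: "card (fib i s) > 0" "card (fib s i) > 0" using f1 f2 by (auto simp: card_gt_0_iff)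
 show ?thesis
 proof (rule ccontr)
  assume "~ ?thesis"
  hence le1: "card (fib i s) <= th / (4 * k * p)" by (simp add: fib_def)
  hence lt: "card (fib s i) < card (fib i s)" using f2 strict pos by blast
  hence "card (fib s i) <= th / (4 * k * p)" using le1 by linarith
  hence "card (fib i s) < card (fib s i)" using f1 strict pos by blast
  thus False using lt by simp
 qed
qed

end

section \<open>Almost closed families of tuples\<close>

text \<open>F t collects the states of time t modulo q, where coordinate sg t is missing; a step fills it and drops the next coordinate. Err contains the edges that lead from F to outside F. The schedule sg visits all coordinates.\<close>
locale almost_closed = world V k p L g G H good N tau Ps
  for V :: "'a set" and k :: nat and p L g :: real and G H good :: "'a set set" and N tau :: real
    and Ps :: "'a set set" +
  fixes U :: "nat => 'a set" and sg :: "nat => nat" and q :: nat and F :: "nat => (nat => 'a) set"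
    and Err :: "(nat => 'a) set" and xi :: real
  assumes sl: "slots U" and q0: "q > 0" and sg: "!!t. t < q ==> sg t < k"
    and sg_onto: "!!i. i < k ==> \<exists>t<q. sg t = i"
    and F_sub: "!!t. t < q ==> F t \<subseteq> PiE ({..<k} - {sg t}) U"
    and F_good: "!!t a. t < q ==> a : F t ==> a ` ({..<k} - {sg t}) : good"
    and Err_sub: "Err \<subseteq> EH U"
    and closed: "!!e t. [|e : EH U - Err; t < q; e(sg t := undefined) : F t|] ==>
        e(sg (Suc t mod q) := undefined) : F (Suc t mod q)"
    and Err_card: "card Err <= xi * p * N * (\<Sum>t<q. card (F t))"
    and xi0: "xi > 0" and xi1: "xi <= 1 / (4 * q)"
    and F_pos: "(\<Sum>t<q. card (F t)) > 0"
    and tau_small: "tau <= 1 / (64 * q * k ^ 3)"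
begin

lemma finF: "t < q ==> finite (F t)"
 using F_sub finite_states[OF sl] by (meson Diff_subset finite_subset)

text \<open>Time is cyclic, so following the steps around from t reaches t'.\<close>
lemma all_or_none:
  assumes e: "e : EH U - Err" and t: "t < q" "t' < q" and m: "e(sg t := undefined) : F t"
  shows "e(sg t' := undefined) : F t'"
proof -
 have "e(sg ((t + j) mod q) := undefined) : F ((t + j) mod q)" for j
 proof (induction j)
  case 0 show ?case using m t(1) by (simp only: add_0_right mod_less)
 next
  case (Suc j)
  have "(t + j) mod q < q" using q0 by simp
  from closed[OF e this Suc] show ?case by (simp only: mod_Suc_eq add_Suc_right)
 qed
 from this[of "t' + q - t"] show ?thesis using t by simp
qed

text \<open>The edges met by F, without those in Err, have all their facets in F. Few are lost compared to the codegree, so cleaning leaves a subfamily of large minimum degree, and its fibres are large in every direction.\<close>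
lemma dense:
  assumes t: "t < q"
  shows "(N / (32 * q * k ^ 2)) ^ (k - 1) <= card (F t)"
proof -
 define Ph where "Ph = (\<Sum>t<q. card (F t))"
 define E where "E = {e : EH U - Err. ALL t<q. e(sg t := undefined) : F t}"
 define th where "th = p * N / (8 * q * k)"
 define Et where "Et t = {e : EH U. e(sg t := undefined) : F t}" for t
 have k0: "real k > 0" "real q > 0" using k3 q0 by auto
 have pN: "p * N > 0" using p0 N0 by simp
 have finE: "finite E" "finite Err" "finite (Et t)" for t using finite_EH[OF sl] Err_sub by (auto simp: E_def Et_def intro: finite_subset)
 have sub: "Et t <= E Un Err" if "t < q" for t using all_or_none[OF _ that] by (auto simp: Et_def E_def)
 have "Ph * (p * N / 2) = (\<Sum>t<q. \<Sum>a\<in>F t. p * N / 2)" by (simp add: Ph_def sum_distrib_right)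
 also have "... <= (\<Sum>t<q. \<Sum>a\<in>F t. real (deg H (a ` ({..<k} - {sg t})) (U (sg t))))"
 proof (intro sum_mono)
  fix t a assume "t : {..<q}" "a : F t"
  hence "(1/2 + g) * p * N <= deg H (a ` ({..<k} - {sg t})) (U (sg t))" using F_good slots_Ps[OF sl sg] by (intro H_deg) auto
  moreover have "g * (p * N) >= 0" using g0 pN by simp
  ultimately show "p * N / 2 <= deg H (a ` ({..<k} - {sg t})) (U (sg t))" by (simp add: algebra_simps)
 qed
 also have "... = (\<Sum>t<q. real (card (Et t)))"
 proof (intro sum.cong refl)
  fix t assume "t : {..<q}"
  hence t: "t < q" by simp
  show "(\<Sum>a\<in>F t. real (deg H (a ` ({..<k} - {sg t})) (U (sg t)))) = real (card (Et t))"
   unfolding Et_def card_fibres[OF sl sg[OF t] F_sub[OF t]] by simp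
 qed
 also have "... <= (\<Sum>t<q. real (card E + card Err))"
 proof (intro sum_mono of_nat_mono)
  fix t assume "t : {..<q}"
  hence "card (Et t) <= card (E Un Err)" using sub finE by (intro card_mono) auto
  thus "card (Et t) <= card E + card Err" using card_Un_le[of E Err] by linarith
 qed
 also have "... = real (q * card E) + real (q * card Err)" by (simp add: algebra_simps)
 also have "real (q * card Err) <= q * (xi * p * N * Ph)" using mult_left_mono[OF Err_card, of q] by (simp add: Ph_def)
 also have "... <= q * ((1 / (4 * q)) * p * N * Ph)" using xi1 p0 N0 by (intro mult_left_mono mult_right_mono) auto
 also have "... = Ph * (p * N / 4)" using k0 by simp
 finally have "Ph * (p * N) / (4 * q) <= card E" using k0 by (simp add: field_simps)
 moreover have "(\<Sum>s<k. th * card ((%e. e(s := undefined)) ` E)) <= (\<Sum>s<k. th * Ph)"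
 proof (intro sum_mono mult_left_mono of_nat_mono)
  fix s assume "s : {..<k}"
  then obtain t where t: "t < q" "sg t = s" using sg_onto by auto
  have "card ((%e. e(s := undefined)) ` E) <= card (F t)" using t finF by (intro card_mono) (auto simp: E_def)
  also have "... <= Ph" unfolding Ph_def using t by (intro member_le_sum) auto
  finally show "card ((%e. e(s := undefined)) ` E) <= Ph" .
 qed (use pN in \<open>simp add: th_def\<close>)
 moreover have "(\<Sum>s<k. th * Ph) = Ph * (p * N) / (8 * q)" using k0 by (simp add: th_def)
 moreover have "Ph * (p * N) / (8 * q) < Ph * (p * N) / (4 * q)"
 proof -
  have "Ph > 0" using F_pos by (simp only: Ph_def)
  hence "Ph * (p * N) > 0" using pN by simp
  thus ?thesis using k0 by (intro divide_strict_left_mono) auto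
 qed
 ultimately have lt: "(\<Sum>s<k. th * card ((%e. e(s := undefined)) ` E)) < card E" by linarith
 have th0: "th >= 0" using pN by (simp add: th_def)
 obtain E' where E': "E' <= E" "E' ~= {}" "!!e s. e : E' ==> s < k ==> th <= card {y. e(s := y) : E'}" using min_degree_subfamily[OF finE(1) finite_lessThan th0 lt] by auto
 have E'EH: "E' <= EH U" using E' by (auto simp: E_def)
 obtain e where e: "e : E'" using E' by blast
 have thL: "8 * real k ^ 2 * L <= th"
 proof -
  have "8 * real k ^ 2 * L <= 8 * real k ^ 2 * (tau * p * N)" using L_N by (intro mult_left_mono) auto
  also have "... <= 8 * real k ^ 2 * ((1 / (64 * q * k ^ 3)) * p * N)" using tau_small p0 N0 by (intro mult_left_mono mult_right_mono) auto
  also have "... = th" using k0 by (simp add: th_def field_simps power2_eq_square power3_eq_cube)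
  finally show ?thesis .
 qed
 have eq: "th / (4 * k * p) = N / (32 * q * k ^ 2)" using k0 p0 by (simp add: th_def field_simps power2_eq_square)
 let ?s = "sg t"
 have "(N / (32 * q * k ^ 2)) ^ card ({..<k} - {?s}) <= card {f : (%e. e(?s := undefined)) ` E'. ALL i. i ~: {..<k} - {?s} --> i ~= ?s --> f i = e i}"
 proof (rule product_fibres)
  show "finite E'" using E' finE by (auto intro: finite_subset)
  show "N / (32 * q * k ^ 2) >= 0" using N0 k0 by simp
  fix e' i assume a: "e' : E'" "i : {..<k} - {?s}"
  hence "th / (4 * k * p) < card {x. EX y. e'(i := x, ?s := y) : E'}" using sg[OF t] by (intro fibre_large[OF sl E'EH _ _ _ _ E'(3) thL]) auto
  thus "N / (32 * q * k ^ 2) <= card {x. EX y. e'(i := x, ?s := y) : E'}" using eq by simp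
 qed (use e in auto)
 also have "... <= card (F t)" using finF[OF t] E' t by (intro of_nat_mono card_mono) (auto simp: E_def)
 finally show ?thesis using sg[OF t] by simp
qed

text \<open>The completions of z inside F and those outside both see more than half of the set of the missing coordinate. A vertex seen by both gives edges one facet of which lies in F while another does not, and such edges are in Err.\<close>
lemma inconsistent_link:
  fixes eps :: real
  assumes eps: "0 < eps" "4 * tau <= eps" and t0: "t0 < q" and i: "i < k" "i ~= sg t0"
    and z: "z : PiE ({..<k} - {sg t0, i}) U"
    and C: "eps * N <= card {c : U i. z(i := c) : F t0}"
    and C': "eps * N <= card {c : U i. z(i := c) \<notin> F t0}"
  shows "7 / 128 * g^2 * eps * p * N^2 <= card {e : Err. e(i := undefined, sg t0 := undefined) = z}"
proof -
 let ?s = "sg t0"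
 have s: "?s < k" by (rule sg[OF t0])
 obtain ti where ti: "ti < q" "sg ti = i" using sg_onto[OF i(1)] by blast
 define zs where "zs = z ` ({..<k} - {?s, i})"
 define Cz where "Cz = {c : U i. z(i := c) : F t0}"
 define Cn where "Cn = {c : U i. z(i := c) ~: F t0 & insert c zs : good}"
 have fU: "finite (U i)" "finite (U ?s)" using slots_finite[OF sl] i s by auto
 have neU: "U i : Ps" "U ?s : Ps" "U i ~= U ?s" using sl i s by (auto simp: slots_def)
 have zs: "zs : nsets V (k - 2)"
 proof -
  have "card ({..<k} - {?s, i}) = k - 2" using i s by (simp add: card_Diff_subset)
  thus ?thesis using state_nsets[OF sl _ z] by (auto simp: zs_def)
 qed
 have zi: "z(i := c) : PiE ({..<k} - {?s}) U" if "c : U i" for c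
 proof -
  have "{..<k} - {?s} = insert i ({..<k} - {?s, i})" using i by auto
  thus ?thesis using PiE_fun_upd[OF that z] by simp
 qed
 have zsi: "(z(i := c)) ` ({..<k} - {?s}) = insert c zs" for c
 proof -
  have "{..<k} - {?s} = insert i ({..<k} - {?s, i})" using i by auto
  hence "(z(i := c)) ` ({..<k} - {?s}) = insert c ((z(i := c)) ` ({..<k} - {?s, i}))" by (simp only: image_insert fun_upd_same)
  also have "(z(i := c)) ` ({..<k} - {?s, i}) = zs" unfolding zs_def by (intro image_cong) auto
  finally show ?thesis .
 qed
 have czn: "c ~: zs" "insert c zs : nsets V (k - 1)" if "c : U i" for c
 proof -
  have "(z(i := c)) ` ({..<k} - {?s}) : nsets V (card ({..<k} - {?s}))" by (rule state_nsets[OF sl _ zi[OF that]]) auto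
  thus *: "insert c zs : nsets V (k - 1)" using s unfolding zsi by simp
  have "card zs = k - 2" using zs by (simp add: nsets_def)
  thus "c ~: zs" using * k3 by (auto simp: nsets_def insert_absorb)
 qed
 have edge: "z(i := c, ?s := w) : EH U" "(z(i := c, ?s := w))(?s := undefined) = z(i := c)"
   "(z(i := c, ?s := w))(i := undefined) = z(?s := w)" "z(i := c, ?s := w, i := undefined, ?s := undefined) = z"
  if "c : U i" "w : U ?s" "insert w (insert c zs) : H" for c w
 proof -
  show "z(i := c, ?s := w) : EH U" using upd_EH[OF zi[OF that(1)] s, of w] that(2,3) unfolding zsi by blast
  show "(z(i := c, ?s := w))(?s := undefined) = z(i := c)" by (rule drop_upd[OF zi[OF that(1)]])
  have "z i = undefined" "z ?s = undefined" using z by (auto simp: PiE_def extensional_def)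
  thus "(z(i := c, ?s := w))(i := undefined) = z(?s := w)" "z(i := c, ?s := w, i := undefined, ?s := undefined) = z" using i by (auto simp: fun_eq_iff)
 qed
 have goodC: "insert c zs : good" if "c : Cz" for c using F_good[OF t0, of "z(i := c)"] that zsi by (auto simp: Cz_def)
 have Cn: "eps / 2 * N <= card Cn"
 proof -
  have "card {c : U i. insert c zs ~: good} <= card (nsets V (k - 1) - good)"
  proof (rule card_inj_on_le)
   show "inj_on (%c. insert c zs) {c : U i. insert c zs ~: good}"
   proof (rule inj_onI)
    fix x y assume "x : {c : U i. insert c zs ~: good}" "y : {c : U i. insert c zs ~: good}" "insert x zs = insert y zs"
    thus "x = y" using czn(1)[of x] czn(1)[of y] by blast
   qed
   show "(%c. insert c zs) ` {c : U i. insert c zs ~: good} <= nsets V (k - 1) - good" using czn(2) by auto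
   show "finite (nsets V (k - 1) - good)" using fin_nsets by simp
  qed
  hence b: "card {c : U i. insert c zs ~: good} <= tau * N" using few_bad by linarith
  have "card {c : U i. z(i := c) ~: F t0} <= card (Cn Un {c : U i. insert c zs ~: good})" using fU by (intro card_mono) (auto simp: Cn_def)
  also have "... <= card Cn + card {c : U i. insert c zs ~: good}" by (rule card_Un_le)
  finally have "eps * N <= card Cn + tau * N" using C' b by linarith
  moreover have "tau * N <= eps / 4 * N" using eps N0 by (intro mult_right_mono) auto
  moreover have "eps * N > 0" using eps N0 by simp
  ultimately show ?thesis by linarith
 qed
 define B where "B X = {w : U ?s. (g/8) * p * card X <= card {c : X. insert w (insert c zs) : H}}" for X
 have Bs: "(1/2 + g/2) * N <= card (B X)" if X: "X <= U i" "!!c. c : X ==> insert c zs : good" "eps / 2 * N <= card X" for X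
  unfolding B_def
 proof (rule link_expansion[OF zs neU X(1,2)])
  have "2 * tau * N <= eps / 2 * N" using eps N0 by (intro mult_right_mono) auto
  thus "2 * tau * N <= card X" using X(3) by linarith
 qed
 have "eps * N > 0" using eps N0 by simp
 hence C2: "eps / 2 * N <= card Cz" using C by (simp add: Cz_def)
 have BB: "7/8 * g * N <= card (B Cz Int B Cn)"
 proof -
  have fin: "finite (B X)" for X using fU by (simp add: B_def)
  have "card (B Cz Un B Cn) <= card (U ?s)" using fU by (intro card_mono) (auto simp: B_def)
  hence "card (B Cz Un B Cn) <= (1 + g/8) * N" using Ps_card[OF neU(2)] by linarith
  moreover have "card (B Cz) + card (B Cn) = card (B Cz Un B Cn) + card (B Cz Int B Cn)" by (rule card_Un_Int[OF fin fin])
  hence "real (card (B Cz)) + card (B Cn) = card (B Cz Un B Cn) + real (card (B Cz Int B Cn))" by linarith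
  moreover have "(1/2 + g/2) * N <= card (B Cz)" by (rule Bs) (use goodC C2 in \<open>auto simp: Cz_def\<close>)
  moreover have "(1/2 + g/2) * N <= card (B Cn)" by (rule Bs) (use Cn in \<open>auto simp: Cn_def\<close>)
  ultimately have "(1/2 + g/2) * N + (1/2 + g/2) * N <= (1 + g/8) * N + card (B Cz Int B Cn)" by linarith
  thus ?thesis by (simp add: algebra_simps)
 qed
 define R where "R w = {c : U i. z(i := c, ?s := w) : Err & insert w (insert c zs) : H}" for w
 have R: "g / 16 * eps * p * N <= card (R w)" if w: "w : B Cz Int B Cn" for w
 proof -
  have step: "g / 16 * eps * p * N <= card (R w)"
   if X: "eps / 2 * N <= card X" "w : B X" "{c : X. insert w (insert c zs) : H} <= R w" for X
  proof -
   have "g / 16 * eps * p * N = (g/8) * p * (eps / 2 * N)" by simp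
   also have "... <= (g/8) * p * card X" using X(1) g0 p0 by (intro mult_left_mono) auto
   also have "... <= card {c : X. insert w (insert c zs) : H}" using X(2) by (simp add: B_def)
   also have "... <= card (R w)" using fU X(3) by (intro of_nat_mono card_mono) (auto simp: R_def)
   finally show ?thesis .
  qed
  have wU: "w : U ?s" using w by (simp add: B_def)
  show ?thesis
  proof (cases "z(?s := w) : F ti")
   case True
   show ?thesis
   proof (rule step[OF Cn])
    show "w : B Cn" using w by simp
    show "{c : Cn. insert w (insert c zs) : H} <= R w"
    proof
     fix c assume c: "c : {c : Cn. insert w (insert c zs) : H}"
     hence cU: "c : U i" by (simp add: Cn_def)
     have cH: "insert w (insert c zs) : H" using c by simp
     note e = edge[OF cU wU cH]
     have "z(i := c, ?s := w) : Err"
     proof (rule ccontr)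
      assume "z(i := c, ?s := w) ~: Err"
      hence "z(i := c, ?s := w) : EH U - Err" using e(1) by simp
      moreover have "(z(i := c, ?s := w))(sg ti := undefined) : F ti"
       unfolding ti e(3) by (rule True)
      ultimately have "(z(i := c, ?s := w))(sg t0 := undefined) : F t0" by (rule all_or_none[OF _ ti(1) t0])
      hence "z(i := c) : F t0" unfolding e(2) .
      thus False using c by (simp add: Cn_def)
     qed
     thus "c : R w" using cU cH by (simp add: R_def)
    qed
   qed
  next
   case False
   show ?thesis
   proof (rule step[OF C2])
    show "w : B Cz" using w by simp
    show "{c : Cz. insert w (insert c zs) : H} <= R w"
    proof
     fix c assume c: "c : {c : Cz. insert w (insert c zs) : H}"
     hence cU: "c : U i" and cF: "z(i := c) : F t0" by (simp_all add: Cz_def)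
     have cH: "insert w (insert c zs) : H" using c by simp
     note e = edge[OF cU wU cH]
     have "z(i := c, ?s := w) : Err"
     proof (rule ccontr)
      assume "z(i := c, ?s := w) ~: Err"
      hence "z(i := c, ?s := w) : EH U - Err" using e(1) by simp
      moreover have "(z(i := c, ?s := w))(sg t0 := undefined) : F t0"
       unfolding e(2) by (rule cF)
      ultimately have "(z(i := c, ?s := w))(sg ti := undefined) : F ti" by (rule all_or_none[OF _ t0 ti(1)])
      hence "z(?s := w) : F ti" unfolding ti e(3) .
      thus False using False by simp
     qed
     thus "c : R w" using cU cH by (simp add: R_def)
    qed
   qed
  qed
 qed
 have fE: "finite Err" using Err_sub finite_EH[OF sl] by (rule finite_subset)
 have fB: "finite (B Cz Int B Cn)" and fR: "finite (R w)" for w using fU by (simp_all add: B_def R_def)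
 have "7 / 128 * g^2 * eps * p * N^2 = (7/8 * g * N) * (g / 16 * eps * p * N)" by (simp add: power2_eq_square)
 also have "... <= card (B Cz Int B Cn) * (g / 16 * eps * p * N)" using BB g0 eps p0 N0 by (intro mult_right_mono) auto
 also have "... = (\<Sum>w\<in>B Cz Int B Cn. g / 16 * eps * p * N)" by simp
 also have "... <= (\<Sum>w\<in>B Cz Int B Cn. real (card (R w)))" by (intro sum_mono R)
 also have "... = real (card (SIGMA w:B Cz Int B Cn. R w))" using fB fR by simp
 also have "card (SIGMA w:B Cz Int B Cn. R w) <= card {e : Err. e(i := undefined, ?s := undefined) = z}"
 proof (rule card_inj_on_le[where f = "%(w, c). z(i := c, ?s := w)"])
  show "inj_on (%(w, c). z(i := c, ?s := w)) (SIGMA w:B Cz Int B Cn. R w)"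
  proof (rule inj_onI, goal_cases)
   case (1 u v)
   obtain w c w' c' where uv: "u = (w, c)" "v = (w', c')" by (metis surj_pair)
   have eq: "z(i := c, ?s := w) = z(i := c', ?s := w')" using 1(3) by (simp add: uv)
   have "w = w'" using fun_cong[OF eq, of ?s] by simp
   moreover have "c = c'" using fun_cong[OF eq, of i] i by simp
   ultimately show ?case by (simp add: uv)
  qed
  show "finite {e : Err. e(i := undefined, ?s := undefined) = z}" using fE by simp
  show "(%(w, c). z(i := c, ?s := w)) ` (SIGMA w:B Cz Int B Cn. R w) <= {e : Err. e(i := undefined, ?s := undefined) = z}"
  proof (rule image_subsetI)
   fix u assume u: "u : (SIGMA w:B Cz Int B Cn. R w)"
   then obtain w c where wc: "u = (w, c)" "w : U ?s" "c : U i" "z(i := c, ?s := w) : Err" "insert w (insert c zs) : H" by (auto simp: B_def R_def)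
   show "(case u of (w, c) => z(i := c, ?s := w)) : {e : Err. e(i := undefined, ?s := undefined) = z}" using wc(4) edge(4)[OF wc(3,2,5)] by (simp only: wc(1) case_prod_conv mem_Collect_eq)
  qed
 qed
 finally show ?thesis by simp
qed

text \<open>By inconsistent_link, a (k-2)-set with many completions on both sides uses up many edges of Err, so such sets are few; all others contribute little to the boundary. Isoperimetry then bounds the product of the sizes of F and its complement.\<close>
lemma few_missing:
  fixes eps :: real
  assumes eps: "0 < eps" "4 * tau <= eps" "xi <= eps^2 * g^2 / (100 * q)" and t0: "t0 < q"
  shows "card (F t0) * card (PiE ({..<k} - {sg t0}) U - F t0) <= k * 4 ^ k * eps * N ^ (2 * k - 2)"
proof -
 let ?s = "sg t0"
 let ?I = "{..<k} - {?s}"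
 have s: "?s < k" by (rule sg[OF t0])
 have fE: "finite Err" using Err_sub finite_EH[OF sl] by (rule finite_subset)
 have k2: "2 * N > 0" using N0 by simp
 have err: "100 / (g^2 * eps * p) * card Err <= eps * N * (2 * N) ^ (k - 1)"
 proof -
  have "(\<Sum>t<q. real (card (F t))) <= (\<Sum>t<q. (2 * N) ^ (k - 1))"
  proof (rule sum_mono)
   fix t assume "t : {..<q}"
   hence t: "t < q" by simp
   have "card (F t) <= card (PiE ({..<k} - {sg t}) U)" by (intro card_mono F_sub[OF t] finite_states[OF sl]) auto
   also have "real ... <= (2 * N) ^ (k - 1)" using card_states[OF sl, of "{..<k} - {sg t}"] sg[OF t] by simp
   finally show "card (F t) <= (2 * N) ^ (k - 1)" by simp
  qed
  hence "(\<Sum>t<q. real (card (F t))) <= q * (2 * N) ^ (k - 1)" by simp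
  hence "xi * p * N * (\<Sum>t<q. real (card (F t))) <= xi * p * N * (q * (2 * N) ^ (k - 1))" using xi0 p0 N0 by (intro mult_left_mono) auto
  also have "... <= (eps^2 * g^2 / (100 * q)) * p * N * (q * (2 * N) ^ (k - 1))" using eps p0 N0 by (intro mult_right_mono) auto
  finally have "card Err <= (eps^2 * g^2 / (100 * q)) * p * N * (q * (2 * N) ^ (k - 1))" using Err_card by simp
  hence "100 / (g^2 * eps * p) * card Err <= 100 / (g^2 * eps * p) * ((eps^2 * g^2 / (100 * q)) * p * N * (q * (2 * N) ^ (k - 1)))" using eps g0 p0 by (intro mult_left_mono) auto
  also have "... = eps * N * (2 * N) ^ (k - 1)" using eps g0 p0 q0 by (simp add: power2_eq_square)
  finally show ?thesis .
 qed
 have bdi: "card (bd ?I U (F t0) i) <= eps * 2 ^ k * N ^ k" if i: "i : ?I" for i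
 proof -
  define Z where "Z = PiE ({..<k} - {?s, i}) U"
  define C where "C z = {c : U i. z(i := c) : F t0}" for z
  define C' where "C' z = {c : U i. z(i := c) ~: F t0}" for z
  define Ez where "Ez z = {e : Err. e(i := undefined, ?s := undefined) = z}" for z
  have fU: "finite (U i)" using slots_finite[OF sl] i by auto
  have fZ: "finite Z" unfolding Z_def by (rule finite_states[OF sl]) auto
  have cU: "card (U i) <= 2 * N" using Ps_card2 slots_Ps[OF sl] i by auto
  have cC: "card (C z) <= card (U i)" "card (C' z) <= card (U i)" for z using fU by (auto simp: C_def C'_def intro: card_mono)
  have cC2: "card (C z) <= 2 * N" "card (C' z) <= 2 * N" for z using cC[of z] cU by linarith+
  have "card (bd ?I U (F t0) i) <= card (SIGMA z:Z. C z \<times> C' z)"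
  proof (rule card_inj_on_le[where f = "%(f, y). (f(i := undefined), (f i, y))"])
   show "inj_on (%(f, y). (f(i := undefined), (f i, y))) (bd ?I U (F t0) i)"
   proof (rule inj_onI, goal_cases)
    case (1 u v)
    obtain f y f' y' where uv: "u = (f, y)" "v = (f', y')" by (metis surj_pair)
    have "f(i := undefined) = f'(i := undefined)" "f i = f' i" "y = y'" using 1(3) unfolding uv case_prod_conv prod.inject by auto
    thus ?case by (metis fun_upd_triv fun_upd_upd uv)
   qed
   show "finite (SIGMA z:Z. C z \<times> C' z)" using fZ fU by (auto simp: C_def C'_def)
   show "(%(f, y). (f(i := undefined), (f i, y))) ` bd ?I U (F t0) i <= (SIGMA z:Z. C z \<times> C' z)"
   proof (rule image_subsetI)
    fix u assume "u : bd ?I U (F t0) i"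
    then obtain f y where u: "u = (f, y)" "f : F t0" "y : U i" "f(i := y) ~: F t0" by (auto simp: bd_def)
    have "f : PiE ?I U" using F_sub[OF t0] u(2) by blast
    hence "f(i := undefined) : Z" "f i : U i" using i by (auto simp: Z_def PiE_def extensional_def)
    thus "(case u of (f, y) => (f(i := undefined), (f i, y))) : (SIGMA z:Z. C z \<times> C' z)" using u by (simp add: C_def C'_def del: fun_upd_apply)
   qed
  qed
  also have "... = (\<Sum>z\<in>Z. card (C z) * card (C' z))" using fZ fU by (simp add: C_def C'_def card_cartesian_product)
  finally have "real (card (bd ?I U (F t0) i)) <= (\<Sum>z\<in>Z. real (card (C z)) * card (C' z))" by (metis (mono_tags, lifting) of_nat_le_iff of_nat_mult of_nat_sum sum.cong)
  also have "... <= (\<Sum>z\<in>Z. 2 * eps * N^2 + 100 / (g^2 * eps * p) * card (Ez z))"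
  proof (rule sum_mono)
   fix z assume z: "z : Z"
   have nn: "0 <= 100 / (g^2 * eps * p) * card (Ez z)" using eps p0 by simp
   show "real (card (C z)) * card (C' z) <= 2 * eps * N^2 + 100 / (g^2 * eps * p) * card (Ez z)"
   proof (cases "eps * N <= card (C z) & eps * N <= card (C' z)")
    case True
    have "7 / 128 * g^2 * eps * p * N^2 <= card (Ez z)" unfolding Ez_def by (rule inconsistent_link[OF eps(1,2) t0]) (use True i z in \<open>auto simp: C_def C'_def Z_def\<close>)
    hence "100 / (g^2 * eps * p) * (7 / 128 * g^2 * eps * p * N^2) <= 100 / (g^2 * eps * p) * card (Ez z)" using eps p0 by (intro mult_left_mono) auto
    moreover have "100 / (g^2 * eps * p) * (7 / 128 * g^2 * eps * p * N^2) = 700 / 128 * N^2" using eps p0 g0 by simp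
    moreover have "real (card (C z)) * card (C' z) <= (2 * N) * (2 * N)" using cC2 N0 by (intro mult_mono) auto
    moreover have "(2 * N) * (2 * N) <= 700 / 128 * N^2" by (simp add: power2_eq_square)
    moreover have "0 <= 2 * eps * N^2" using eps by simp
    ultimately show ?thesis by linarith
   next
    case False
    hence "real (card (C z)) * card (C' z) <= (eps * N) * (2 * N)"
    proof (cases "eps * N <= card (C z)")
     case True
     hence "card (C' z) <= eps * N" using False by linarith
     hence "card (C' z) * real (card (C z)) <= (eps * N) * (2 * N)" using cC2 eps N0 by (intro mult_mono) auto
     thus ?thesis by (simp add: mult.commute)
    next
     case False
     thus ?thesis using cC2 eps N0 by (intro mult_mono) auto
    qed
    thus ?thesis using nn by (simp add: power2_eq_square mult_ac)
   qed
  qed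
  also have "... = card Z * (2 * eps * N^2) + 100 / (g^2 * eps * p) * (\<Sum>z\<in>Z. card (Ez z))" by (simp add: sum.distrib sum_distrib_left)
  also have "(\<Sum>z\<in>Z. card (Ez z)) <= card Err"
  proof -
   have "(\<Sum>z\<in>Z. card (Ez z)) = card (\<Union>z\<in>Z. Ez z)" by (rule card_UN_disjoint[symmetric]) (use fZ fE in \<open>auto simp: Ez_def\<close>)
   also have "... <= card Err" using fE by (intro card_mono) (auto simp: Ez_def)
   finally show ?thesis .
  qed
  hence "100 / (g^2 * eps * p) * (\<Sum>z\<in>Z. card (Ez z)) <= 100 / (g^2 * eps * p) * card Err" using eps p0 by (intro mult_left_mono of_nat_mono) auto
  also note err
  also have "card Z * (2 * eps * N^2) <= (2 * N) ^ (k - 2) * (2 * eps * N^2)"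
  proof (intro mult_right_mono)
   have "card ({..<k} - {?s, i}) = k - 2" using i s by (auto simp add: card_Diff_subset)
   thus "card Z <= (2 * N) ^ (k - 2)" using card_states[OF sl, of "{..<k} - {?s, i}"] by (auto simp: Z_def)
  qed (use eps in simp)
  finally have "real (card (bd ?I U (F t0) i)) <= (2 * N) ^ (k - 2) * (2 * eps * N^2) + eps * N * (2 * N) ^ (k - 1)" by linarith
  also have "... = eps * 2 ^ k * N ^ k"
  proof -
   obtain j where "k = Suc (Suc j)" using k3 that[of "k - 2"] by simp
   thus ?thesis by (simp add: power_mult_distrib power2_eq_square)
  qed
  finally show ?thesis .
 qed
 have "card (F t0) * card (PiE ?I U - F t0) <= (\<Sum>i\<in>?I. card (bd ?I U (F t0) i) * (\<Prod>j\<in>?I-{i}. card (U j)))" by (rule isoperimetry) (use slots_finite[OF sl] F_sub[OF t0] in auto)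
 hence "real (card (F t0) * card (PiE ?I U - F t0)) <= real (\<Sum>i\<in>?I. card (bd ?I U (F t0) i) * (\<Prod>j\<in>?I-{i}. card (U j)))" by (rule of_nat_mono)
 also have "... = (\<Sum>i\<in>?I. real (card (bd ?I U (F t0) i)) * (\<Prod>j\<in>?I-{i}. real (card (U j))))" by simp
 also have "... <= (\<Sum>i\<in>?I. (eps * 2 ^ k * N ^ k) * (2 * N) ^ (k - 2))"
 proof (intro sum_mono mult_mono bdi)
  fix i assume i: "i : ?I"
  have "(\<Prod>j\<in>?I-{i}. real (card (U j))) <= (\<Prod>j\<in>?I-{i}. 2 * N)" using Ps_card2 slots_Ps[OF sl] by (intro prod_mono) auto
  also have "... = (2 * N) ^ (k - 2)" using i s by (simp add: card_Diff_subset numeral_2_eq_2)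
  finally show "(\<Prod>j\<in>?I-{i}. real (card (U j))) <= (2 * N) ^ (k - 2)" .
 qed (use eps N0 in \<open>auto intro: prod_nonneg\<close>)
 also have "... = (k - 1) * ((eps * 2 ^ k * N ^ k) * (2 * N) ^ (k - 2))" using s by simp
 also have "... <= k * ((eps * 2 ^ k * N ^ k) * (2 * N) ^ (k - 2))" using eps N0 by (intro mult_right_mono) auto
 also have "... <= k * 4 ^ k * eps * N ^ (2 * k - 2)"
 proof -
  obtain j where j: "k = Suc (Suc j)" using k3 that[of "k - 2"] by simp
  have "N ^ k * N ^ (k - 2) = N ^ (2 * k - 2)" using j by (simp add: power_add[symmetric] mult_2)
  moreover have "(2::real) ^ k * 2 ^ (k - 2) <= 2 ^ k * 2 ^ k" by (intro mult_left_mono power_increasing) auto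
  moreover have "(2::real) ^ k * 2 ^ k = 4 ^ k" by (simp add: power_mult_distrib[symmetric])
  ultimately have "(2 ^ k * 2 ^ (k - 2)) * (k * eps * (N ^ k * N ^ (k - 2))) <= 4 ^ k * (k * eps * N ^ (2 * k - 2))" using eps N0 by (intro mult_mono) auto
  thus ?thesis by (simp add: power_mult_distrib mult_ac)
 qed
 finally show ?thesis by simp
qed

end

text \<open>Growth by the factor 1 + et in all M steps would exceed the bound B.\<close>
lemma slow_step:
  fixes Ph :: "nat => real" and B et :: real
  assumes "Ph 0 >= 1" "!!m. Ph m <= B" "0 <= et" "B < (1 + et) ^ M"
  shows "\<exists>m<M. Ph (Suc m) <= (1 + et) * Ph m"
proof (rule ccontr)
 assume *: "~ ?thesis"
 have "m <= M ==> (1 + et) ^ m <= Ph m" for m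
 proof (induction m)
  case (Suc m)
  have "(1 + et) ^ Suc m <= (1 + et) * Ph m" using Suc assms(3) by simp
  also have "... <= Ph (Suc m)" using * Suc.prems by (meson Suc_le_eq linear)
  finally show ?case .
 qed (use assms in simp)
 from this[of M] show False using assms(2)[of M] assms(4) by simp
qed

context world begin

text \<open>R t a S says that some walk arrives at state a at time t having used the vertices S. It stays abstract here because tight paths and spike chains use the same argument.\<close>
definition reach :: "(nat => 'a set) => (nat => nat) => (nat => (nat => 'a) => 'a set => bool) => nat => nat => (nat => 'a) set" where
  "reach U sg R m t = {a : PiE ({..<k} - {sg t}) U. a ` ({..<k} - {sg t}) : good & (\<exists>S. R t a S & finite S & card S <= k + m)}"

text \<open>At a slow step m the family of states reached within m steps is almost closed: an edge violates closure only if its step repeats a used vertex or if it ends in one of the few new states. Now dense and few_missing apply.\<close>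
lemma closure_large:
  fixes R :: "nat => (nat => 'a) => 'a set => bool" and eps et :: real
  assumes sl: "slots U" and q0: "q > 0" and sg: "!!t. t < q ==> sg t < k"
    and sg_onto: "!!i. i < k ==> \<exists>t<q. sg t = i"
    and R0: "R 0 a0 S0" "finite S0" "card S0 <= k" "a0 : PiE ({..<k} - {sg 0}) U" "a0 ` ({..<k} - {sg 0}) : good"
    and Rstep: "!!t a S y. [|t < q; a : PiE ({..<k} - {sg t}) U; R t a S; y : U (sg t); y \<notin> S; a(sg t := y) : EH U|]
        ==> R (Suc t mod q) ((a(sg t := y))(sg (Suc t mod q) := undefined)) (insert y S)"
    and eps: "0 < eps" "4 * tau <= eps" "eps <= 1" and tau: "tau <= 1 / (64 * q * k ^ 3)"
    and et: "et = eps^2 * g^2 / (400 * q^2)" and growth: "q * (2 * N) ^ (k - 1) < (1 + et) ^ M" and M: "k + M <= et * q * p * N"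
  shows "\<exists>m\<le>M. \<forall>t<q. (N / (32 * q * k ^ 2)) ^ (k - 1) <= card (reach U sg R m t) &
     card (reach U sg R m t) * card (PiE ({..<k} - {sg t}) U - reach U sg R m t) <= k * 4 ^ k * eps * N ^ (2 * k - 2)"
proof -
 let ?F = "reach U sg R"
 define Ph where "Ph m = (\<Sum>t<q. real (card (?F m t)))" for m
 have et0: "et > 0" using eps g0 q0 by (simp add: et)
 have subF: "?F m t <= PiE ({..<k} - {sg t}) U" for m t by (auto simp: reach_def)
 have finF: "finite (?F m t)" for m t by (rule finite_subset[OF subF finite_states[OF sl]]) auto
 have monoF: "?F m t <= ?F (Suc m) t" for m t by (auto simp: reach_def)
 have Ph0: "1 <= Ph 0"
 proof -
  have "R 0 a0 S0 & finite S0 & card S0 <= k + 0" using R0 by simp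
  hence "a0 : ?F 0 0" unfolding reach_def using R0(4,5) by blast
  hence "1 <= real (card (?F 0 0))" by (rule one_le_card[OF finF])
  also have "... <= Ph 0" unfolding Ph_def using q0 by (intro member_le_sum) auto
  finally show ?thesis .
 qed
 have PhB: "Ph m <= q * (2 * N) ^ (k - 1)" for m
 proof -
  have "Ph m <= (\<Sum>t<q. (2 * N) ^ (k - 1))" unfolding Ph_def
  proof (rule sum_mono)
   fix t assume "t : {..<q}"
   hence t: "t < q" by simp
   have "card (?F m t) <= card (PiE ({..<k} - {sg t}) U)" by (intro card_mono subF finite_states[OF sl]) auto
   also have "real ... <= (2 * N) ^ (k - 1)" using card_states[OF sl, of "{..<k} - {sg t}"] sg[OF t] by simp
   finally show "card (?F m t) <= (2 * N) ^ (k - 1)" by simp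
  qed
  thus ?thesis by simp
 qed
 obtain m where m: "m < M" "Ph (Suc m) <= (1 + et) * Ph m" using slow_step[of Ph, OF Ph0 PhB less_imp_le[OF et0] growth] by blast
 have Phmono: "Ph m' >= 1" for m'
 proof (induction m')
  case (Suc m')
  have "Ph m' <= Ph (Suc m')" unfolding Ph_def by (intro sum_mono of_nat_mono card_mono finF monoF)
  with Suc show ?case by linarith
 qed (rule Ph0)
 define nx where "nx t = Suc t mod q" for t
 have nx: "nx t < q" for t using q0 by (simp add: nx_def)
 define Err where "Err = {e : EH U. EX t<q. e(sg t := undefined) : ?F m t & e(sg (nx t) := undefined) ~: ?F m (nx t)}"
 define W where "W t a = (SOME S. R t a S & finite S & card S <= k + m)" for t a
 have W: "R t a (W t a) & finite (W t a) & card (W t a) <= k + m" if "a : ?F m t" for t a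
  unfolding W_def by (rule someI_ex) (use that in \<open>simp add: reach_def\<close>)
 define \<Delta> where "\<Delta> t = ?F (Suc m) t - ?F m t" for t
 define Ea where "Ea t = (%(a, y). a(sg t := y)) ` (SIGMA a:?F m t. W t a)" for t
 define Eb where "Eb t = {e : EH U. e(sg (nx t) := undefined) : \<Delta> (nx t)}" for t
 have Errsub: "Err <= (\<Union>t<q. Ea t Un Eb t)"
 proof
  fix e assume "e : Err"
  then obtain t where t: "t < q" and e: "e : EH U" "e(sg t := undefined) : ?F m t" "e(sg (nx t) := undefined) ~: ?F m (nx t)" by (auto simp: Err_def)
  define a where "a = e(sg t := undefined)"
  have ea: "e = a(sg t := e (sg t))" by (simp add: a_def)
  show "e : (\<Union>t<q. Ea t Un Eb t)"
  proof (cases "e (sg t) : W t a")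
   case True
   hence "(a, e (sg t)) : (SIGMA a:?F m t. W t a)" using e(2) by (simp add: a_def)
   hence "e : Ea t" unfolding Ea_def by (rule image_eqI[rotated]) (use ea in simp)
   thus ?thesis using t by blast
  next
   case False
   have aF: "a : ?F m t" using e(2) by (simp add: a_def)
   have eU: "e (sg t) : U (sg t)" using e(1) sg[OF t] by (auto simp: EH_def)
   have "R (nx t) ((a(sg t := e (sg t)))(sg (nx t) := undefined)) (insert (e (sg t)) (W t a))"
    unfolding nx_def by (rule Rstep[OF t _ _ eU False]) (use W[OF aF] subF aF e(1) ea in auto)
   hence "R (nx t) (e(sg (nx t) := undefined)) (insert (e (sg t)) (W t a))" using ea by simp
   moreover have "card (insert (e (sg t)) (W t a)) <= k + Suc m" using W[OF aF] by (simp add: card_insert_if)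
   moreover have "finite (insert (e (sg t)) (W t a))" using W[OF aF] by simp
   moreover note drop_state[OF sl e(1) sg[OF nx]]
   ultimately have "e(sg (nx t) := undefined) : ?F (Suc m) (nx t)" unfolding reach_def by blast
   hence "e : Eb t" using e by (simp add: Eb_def \<Delta>_def)
   thus ?thesis using t by blast
  qed
 qed
 have Ea: "card (Ea t) <= (k + m) * card (?F m t)" "finite (Ea t)" if "t < q" for t
 proof -
  have fS: "finite (SIGMA a:?F m t. W t a)" using finF W by (intro finite_SigmaI) auto
  thus "finite (Ea t)" by (simp add: Ea_def)
  have "card (Ea t) <= card (SIGMA a:?F m t. W t a)" unfolding Ea_def by (rule card_image_le[OF fS])
  also have "... = (\<Sum>a\<in>?F m t. card (W t a))" using finF W by (intro card_SigmaI) auto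
  also have "... <= (\<Sum>a\<in>?F m t. k + m)" using W by (intro sum_mono) auto
  finally show "card (Ea t) <= (k + m) * card (?F m t)" by (simp add: mult.commute)
 qed
 have \<Delta>: "card (\<Delta> t) <= et * Ph m" if "t < q" for t
 proof -
  have c: "real (card (\<Delta> t)) = real (card (?F (Suc m) t)) - real (card (?F m t))" for t
   unfolding \<Delta>_def using card_Diff_subset[OF finF monoF] card_mono[OF finF monoF] by (simp add: of_nat_diff)
  have "card (\<Delta> t) <= (\<Sum>t<q. real (card (\<Delta> t)))" using that by (intro member_le_sum) auto
  also have "... = Ph (Suc m) - Ph m" by (simp add: c Ph_def sum_subtractf)
  also have "... <= et * Ph m" using m(2) by (simp add: algebra_simps)
  finally show ?thesis .
 qed
 have Eb: "card (Eb t) <= 3 * p * N * (et * Ph m)" "finite (Eb t)" for t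
 proof -
  show "finite (Eb t)" using finite_EH[OF sl] by (simp add: Eb_def)
  have D: "\<Delta> (nx t) <= PiE ({..<k} - {sg (nx t)}) U" using subF by (auto simp: \<Delta>_def)
  have "card (Eb t) = (\<Sum>a\<in>\<Delta> (nx t). deg H (a ` ({..<k} - {sg (nx t)})) (U (sg (nx t))))"
   unfolding Eb_def by (rule card_fibres[OF sl sg[OF nx] D])
  also have "real ... <= (\<Sum>a\<in>\<Delta> (nx t). 3 * p * N)" unfolding of_nat_sum
  proof (rule sum_mono)
   fix a assume a: "a : \<Delta> (nx t)"
   have "a ` ({..<k} - {sg (nx t)}) : nsets V (k - 1)" using a goodV by (auto simp: \<Delta>_def reach_def)
   hence "deg G (a ` ({..<k} - {sg (nx t)})) (U (sg (nx t))) <= 3 * p * N" using G_deg slots_Ps[OF sl sg[OF nx]] by blast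
   moreover have "deg H (a ` ({..<k} - {sg (nx t)})) (U (sg (nx t))) <= deg G (a ` ({..<k} - {sg (nx t)})) (U (sg (nx t)))" using HG slots_finite[OF sl sg[OF nx]] by (intro deg_mono) auto
   ultimately show "deg H (a ` ({..<k} - {sg (nx t)})) (U (sg (nx t))) <= 3 * p * N" by linarith
  qed
  also have "... = 3 * p * N * card (\<Delta> (nx t))" by simp
  also have "... <= 3 * p * N * (et * Ph m)" using \<Delta>[OF nx] p0 N0 by (intro mult_left_mono) auto
  finally show "card (Eb t) <= 3 * p * N * (et * Ph m)" by simp
 qed
 define xi where "xi = 4 * q * et"
 have Errcard: "card Err <= xi * p * N * Ph m"
 proof -
  have "card Err <= card (\<Union>t<q. Ea t Un Eb t)" using Errsub Ea(2) Eb(2) by (intro card_mono) auto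
  also have "... <= (\<Sum>t<q. card (Ea t Un Eb t))" by (rule card_UN_le) simp
  also have "... <= (\<Sum>t<q. card (Ea t) + card (Eb t))" by (intro sum_mono card_Un_le)
  finally have "card Err <= (\<Sum>t<q. real (card (Ea t)) + card (Eb t))" by (metis (mono_tags, lifting) of_nat_add of_nat_mono of_nat_sum sum.cong)
  also have "... <= (\<Sum>t<q. real (k + m) * card (?F m t) + 3 * p * N * (et * Ph m))"
  proof (intro sum_mono add_mono Eb)
   fix t assume "t : {..<q}"
   hence "card (Ea t) <= (k + m) * card (?F m t)" using Ea(1) by simp
   thus "real (card (Ea t)) <= real (k + m) * card (?F m t)" unfolding of_nat_mult[symmetric] of_nat_le_iff .
  qed
  also have "... = (k + m) * Ph m + q * (3 * p * N * (et * Ph m))" by (simp add: sum.distrib Ph_def sum_distrib_left)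
  also have "(k + m) * Ph m <= (et * q * p * N) * Ph m" using m(1) M Phmono[of m] by (intro mult_right_mono) linarith+
  finally show ?thesis by (simp add: xi_def algebra_simps)
 qed
 have xieq: "xi = eps^2 * g^2 / (100 * q)" using q0 by (simp add: xi_def et power2_eq_square)
 interpret almost_closed V k p L g G H good N tau Ps U sg q "?F m" Err xi
 proof
  show "xi <= 1 / real (4 * q)"
  proof -
   have "eps^2 * g^2 <= 1 * 1" using eps g0 g1 by (intro mult_mono power_le_one) auto
   thus ?thesis using q0 by (simp add: xieq field_simps)
  qed
  show "real (card Err) <= xi * p * N * real (\<Sum>t<q. card (?F m t))" using Errcard by (simp add: Ph_def)
  show "0 < (\<Sum>t<q. card (?F m t))" using Phmono[of m] unfolding Ph_def of_nat_sum[symmetric] by linarith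
  show "xi > 0" using et0 q0 by (simp add: xi_def)
  fix e t assume "e : EH U - Err" "t < q" "e(sg t := undefined) : ?F m t"
  thus "e(sg (Suc t mod q) := undefined) : ?F m (Suc t mod q)"
   unfolding Err_def nx_def by blast
 next
  show "Err <= EH U" unfolding Err_def by blast
  show "!!t a. t < q ==> a : ?F m t ==> a ` ({..<k} - {sg t}) : good" unfolding reach_def by blast
 qed (rule sl q0 tau subF | erule sg sg_onto)+
 have "xi <= eps^2 * g^2 / (100 * q)" by (simp add: xieq)
 from dense few_missing[OF eps(1,2) this] m(1) show ?thesis by (meson less_imp_le)
qed

end

section \<open>Joining the families reached from both ends\<close>

text \<open>c0 is the density guaranteed by almost_closed.dense for schedules of period at most 2k; eps0 makes few_missing give a smaller complement than the density that join needs, and eta0 is the growth rate that this requires.\<close>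
definition c0 :: "nat => real" where "c0 k = (1 / (64 * real k ^ 3)) ^ (k - 1)"
definition eps0 :: "nat => real" where "eps0 k = (c0 k)^2 / (k * 32 ^ k)"
definition eta0 :: "real => nat => real" where "eta0 g k = (eps0 k)^2 * g^2 / (1600 * real k ^ 2)"

context world begin

text \<open>Exchanging coordinate j of the states in S for another coordinate keeps positive density: many (k-2)-sets have many extensions in S, and by link_expansion these extensions together see more than half of W j.\<close>
lemma step_dense:
  fixes c :: real
  assumes sl: "slots W" and j: "j < k" "j' < k" "j ~= j'" and S: "S \<subseteq> PiE ({..<k} - {j}) W"
    and good: "!!a. a : S ==> a ` ({..<k} - {j}) : good" and c: "c > 0" "2 * tau <= c / 2 ^ k"
    and Sc: "c * N ^ (k - 1) <= card S"
  shows "c / 8 * N ^ (k - 1) <= card {b. \<exists>e\<in>EH W. e(j := undefined) : S & b = e(j' := undefined)}"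
proof -
 define T where "T = {b. EX e:EH W. e(j := undefined) : S & b = e(j' := undefined)}"
 define Z where "Z = PiE ({..<k} - {j, j'}) W"
 define C where "C z = {x : W j'. z(j' := x) : S}" for z
 define thr where "thr = c / 2 ^ k * N"
 define Zb where "Zb = {z : Z. thr <= card (C z)}"
 have fW: "finite (W j)" "finite (W j')" using slots_finite[OF sl] j by auto
 have neW: "W j' : Ps" "W j : Ps" "W j' ~= W j" using sl j by (auto simp: slots_def)
 have fZ: "finite Z" unfolding Z_def by (rule finite_states[OF sl]) auto
 have fZb: "finite Zb" using fZ by (simp add: Zb_def)
 have fC: "finite (C z)" for z using fW by (simp add: C_def)
 have cJ: "card ({..<k} - {j, j'}) = k - 2" using j by (auto simp add: card_Diff_subset)
 have cZ: "card Z <= (2 * N) ^ (k - 2)" using card_states[OF sl, of "{..<k} - {j, j'}"] cJ by (auto simp: Z_def)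
 obtain l where kl: "k = Suc (Suc l)" using k3 that[of "k - 2"] by simp
 have thr0: "thr > 0" using c N0 by (simp add: thr_def)
 have cC: "card (C z) <= 2 * N" for z
 proof -
  have "card (C z) <= card (W j')" using fW by (intro card_mono) (auto simp: C_def)
  thus ?thesis using Ps_card2[OF neW(1)] by linarith
 qed
 have "card S <= card (SIGMA z:Z. C z)"
 proof (rule card_inj_on_le[where f = "%f. (f(j' := undefined), f j')"])
  show "inj_on (%f. (f(j' := undefined), f j')) S" by (rule inj_onI) (metis fun_upd_triv fun_upd_upd prod.inject)
  show "(%f. (f(j' := undefined), f j')) ` S <= (SIGMA z:Z. C z)"
  proof (rule image_subsetI)
   fix f assume f: "f : S"
   hence fP: "f : PiE (insert j' ({..<k} - {j, j'})) W" using S j by (metis (no_types, lifting) Diff_insert2 Diff_iff insert_Diff lessThan_iff singletonD subsetD insert_commute)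
   have "f(j' := undefined) : Z" unfolding Z_def by (rule fun_upd_in_PiE[OF _ fP]) simp
   moreover have "f j' : W j'" using fP by (auto simp: PiE_def)
   ultimately show "(f(j' := undefined), f j') : (SIGMA z:Z. C z)" using f by (simp add: C_def del: fun_upd_apply)
  qed
 qed (use fZ fC in auto)
 also have "... = (\<Sum>z\<in>Z. card (C z))" using fZ fC by (intro card_SigmaI) auto
 finally have "real (card S) <= (\<Sum>z\<in>Z. real (card (C z)))" unfolding of_nat_sum[symmetric] of_nat_le_iff .
 also have "... <= (\<Sum>z\<in>Z. thr + (if z : Zb then 2 * N else 0))"
 proof (rule sum_mono)
  fix z assume z: "z : Z"
  show "real (card (C z)) <= thr + (if z : Zb then 2 * N else 0)"
  proof (cases "z : Zb")
   case True thus ?thesis using cC[of z] thr0 by simp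
  next
   case False
   hence "card (C z) < thr" using z by (simp add: Zb_def)
   thus ?thesis using False by simp
  qed
 qed
 also have "... = card Z * thr + card Zb * (2 * N)"
 proof -
  have "Z Int Zb = Zb" by (auto simp: Zb_def)
  thus ?thesis using fZ by (simp add: sum.distrib sum.If_cases)
 qed
 also have "card Z * thr <= (2 * N) ^ (k - 2) * thr" using cZ thr0 by (intro mult_right_mono) auto
 also have "(2 * N) ^ (k - 2) * thr = c / 4 * N ^ (k - 1)" using kl by (simp add: thr_def power_mult_distrib)
 finally have up: "real (card S) <= c / 4 * N ^ (k - 1) + card Zb * (2 * N)" by simp
 have "0 <= c / 4 * N ^ (k - 1)" using c N0 by simp
 hence "c / 2 * N ^ (k - 1) <= card Zb * (2 * N)" using up Sc by linarith
 hence Zb: "c / 4 * N ^ (k - 2) <= card Zb" using N0 kl by (simp add: field_simps)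
 define B where "B z = {y : W j. EX x:C z. insert y (insert x (z ` ({..<k} - {j, j'}))) : H}" for z
 have zj': "z(j' := x) : PiE ({..<k} - {j}) W" if "z : Z" "x : W j'" for z x
 proof -
  have "insert j' ({..<k} - {j, j'}) = {..<k} - {j}" using j by auto
  thus ?thesis using PiE_fun_upd[of x W j' z, OF that(2) that(1)[unfolded Z_def]] by simp
 qed
 have imj': "(z(j' := x)) ` ({..<k} - {j}) = insert x (z ` ({..<k} - {j, j'}))" for z x
 proof -
  have "{..<k} - {j} = insert j' ({..<k} - {j, j'})" using j by auto
  hence "(z(j' := x)) ` ({..<k} - {j}) = insert x ((z(j' := x)) ` ({..<k} - {j, j'}))" by (simp only: image_insert fun_upd_same)
  also have "(z(j' := x)) ` ({..<k} - {j, j'}) = z ` ({..<k} - {j, j'})" by (intro image_cong) auto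
  finally show ?thesis .
 qed
 have Bz: "N / 2 <= card (B z)" if z: "z : Zb" for z
 proof -
  have zZ: "z : Z" and thrz: "thr <= card (C z)" using z by (auto simp: Zb_def)
  let ?zs = "z ` ({..<k} - {j, j'})"
  have zs: "?zs : nsets V (k - 2)" using state_nsets[OF sl _ zZ[unfolded Z_def]] cJ by auto
  have "2 * tau * N <= thr" unfolding thr_def using c N0 by (intro mult_right_mono) auto
  hence tC: "2 * tau * N <= card (C z)" using thrz by linarith
  have "(1/2 + g/2) * N <= card {w : W j. (g/8) * p * card (C z) <= card {c : C z. insert w (insert c ?zs) : H}}"
  proof (rule link_expansion[OF zs neW _ _ tC])
   fix x assume "x : C z"
   hence "z(j' := x) : S" by (simp add: C_def)
   thus "insert x ?zs : good" using good[of "z(j' := x)"] unfolding imj' by blast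
  qed (auto simp: C_def)
  also have "... <= card (B z)"
  proof (intro of_nat_mono card_mono)
   show "finite (B z)" using fW by (simp add: B_def)
   have "card (C z) > 0" using thrz thr0 by linarith
   hence "(g/8) * p * card (C z) > 0" using g0 p0 by simp
   hence "!!w. (g/8) * p * card (C z) <= card {c : C z. insert w (insert c ?zs) : H} ==> {c : C z. insert w (insert c ?zs) : H} ~= {}" by (metis card.empty of_nat_0 not_le)
   thus "{w : W j. (g/8) * p * card (C z) <= card {c : C z. insert w (insert c ?zs) : H}} <= B z"
    unfolding B_def by blast
  qed
  finally have "(1/2 + g/2) * N <= card (B z)" .
  moreover have "g/2 * N >= 0" using g0 N0 by simp
  ultimately show ?thesis by (simp add: algebra_simps)
 qed
 have fB: "finite (B z)" for z using fW by (simp add: B_def)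
 have fT: "finite T"
 proof -
  have "T <= (%e. e(j' := undefined)) ` EH W" by (auto simp: T_def)
  thus ?thesis using finite_EH[OF sl] by (meson finite_imageI finite_subset)
 qed
 have "c / 8 * N ^ (k - 1) = (c / 4 * N ^ (k - 2)) * (N / 2)" using kl by simp
 also have "... <= card Zb * (N / 2)" using Zb N0 by (intro mult_right_mono) auto
 also have "... = (\<Sum>z\<in>Zb. N / 2)" by simp
 also have "... <= (\<Sum>z\<in>Zb. real (card (B z)))" by (intro sum_mono Bz)
 also have "... = real (card (SIGMA z:Zb. B z))" using fZb fB by simp
 also have "card (SIGMA z:Zb. B z) <= card T"
 proof (rule card_inj_on_le[where f = "%(z, y). z(j := y)"])
  show "inj_on (%(z, y). z(j := y)) (SIGMA z:Zb. B z)"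
  proof (rule inj_onI, goal_cases)
   case (1 u v)
   obtain z y z' y' where uv: "u = (z, y)" "v = (z', y')" by (metis surj_pair)
   have eq: "z(j := y) = z'(j := y')" using 1(3) by (simp add: uv)
   have "z j = undefined" "z' j = undefined" using 1(1,2) by (auto simp: uv Zb_def Z_def PiE_def extensional_def)
   hence "z = z'" using eq by (metis fun_upd_triv fun_upd_upd)
   moreover have "y = y'" using fun_cong[OF eq, of j] by simp
   ultimately show ?case by (simp add: uv)
  qed
  show "(%(z, y). z(j := y)) ` (SIGMA z:Zb. B z) <= T"
  proof (rule image_subsetI)
   fix u assume "u : (SIGMA z:Zb. B z)"
   then obtain z y x where u: "u = (z, y)" "z : Z" "y : W j" "x : W j'" "z(j' := x) : S" "insert y (insert x (z ` ({..<k} - {j, j'}))) : H" by (auto simp: Zb_def B_def C_def)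
   have zP: "z(j' := x) : PiE ({..<k} - {j}) W" by (rule zj'[OF u(2,4)])
   define e where "e = z(j' := x, j := y)"
   have "e : EH W" unfolding e_def using upd_EH[OF zP j(1), of y] u(3,6) unfolding imj' by blast
   moreover have "e(j := undefined) : S" unfolding e_def drop_upd[OF zP] by (rule u(5))
   moreover have "e(j' := undefined) = z(j := y)" using u(2) j by (auto simp: e_def Z_def PiE_def extensional_def fun_eq_iff)
   ultimately have "z(j := y) : T" unfolding T_def by force
   thus "(case u of (z, y) => z(j := y)) : T" using u(1) by simp
  qed
 qed (rule fT)
 finally show ?thesis by (simp add: T_def)
qed

text \<open>Replace the coordinates of a state in U by vertices of Y one at a time. By step_dense the set of tuples that arise stays dense for k-1 steps, so it meets Hs, which misses only few tuples.\<close>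
lemma join:
  fixes c :: real
  assumes slU: "slots U" and slY: "slots Y" and UY: "!!i j. i < k ==> j < k ==> U i ~= Y j"
    and F: "F \<subseteq> PiE ({..<k} - {0}) U" "!!a. a : F ==> a ` ({..<k} - {0}) : good"
    and c: "c > 0" "2 * tau <= c / 16 ^ k" and Fc: "c * N ^ (k - 1) <= card F"
    and Hs: "card (PiE ({..<k} - {k - 1}) Y - Hs) < c / 8 ^ (k - 1) * N ^ (k - 1)"
  shows "\<exists>a\<in>F. \<exists>h\<in>Hs. \<forall>l<k-1. h ` {..l} \<union> a ` {Suc l..<k} : H"
proof -
 define W where "W j i = (if i < j then Y i else U i)" for j i
 have slW: "slots (W j)" for j using slU slY UY unfolding slots_def W_def by (metis (full_types))
 define P where "P j b a \<longleftrightarrow> a : F & (ALL i. j < i --> i < k --> b i = a i) & (ALL l<j. b ` {..l} Un a ` {Suc l..<k} : H)" for j b a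
 define Gj where "Gj j = {b : PiE ({..<k} - {j}) (W j). b ` ({..<k} - {j}) : good & (EX a. P j b a)}" for j
 have "c / 8 ^ j * N ^ (k - 1) <= card (Gj j)" if "j <= k - 1" for j using that
 proof (induction j)
  case 0
  have "F <= Gj 0"
  proof
   fix a assume "a : F"
   moreover have "P 0 a a" using \<open>a : F\<close> by (simp add: P_def)
   moreover have "W 0 = U" by (simp add: W_def fun_eq_iff)
   ultimately show "a : Gj 0" using F by (auto simp: Gj_def)
  qed
  moreover have "finite (Gj 0)" by (rule finite_subset[OF _ finite_states[OF slW[of 0], of "{..<k} - {0}"]]) (auto simp: Gj_def)
  ultimately have "card F <= card (Gj 0)" by (intro card_mono)
  thus ?case using Fc by simp
 next
  case (Suc j)
  hence j: "j < k" "Suc j < k" by auto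
  have Peq: "PiE ({..<k} - {j}) (W (Suc j)) = PiE ({..<k} - {j}) (W j)" by (intro PiE_cong) (auto simp: W_def less_Suc_eq)
  let ?T = "{b. EX e:EH (W (Suc j)). e(j := undefined) : Gj j & b = e(Suc j := undefined)}"
  have "c / 8 ^ j / 8 * N ^ (k - 1) <= card ?T"
  proof (rule step_dense[OF slW j])
   have "(8::real) ^ j * 2 ^ k <= 8 ^ k * 2 ^ k" using j by (intro mult_right_mono power_increasing) auto
   also have "... = 16 ^ k" by (simp add: power_mult_distrib[symmetric])
   finally have "c / 16 ^ k <= c / (8 ^ j * 2 ^ k)" using c by (intro divide_left_mono) auto
   thus "2 * tau <= c / 8 ^ j / 2 ^ k" using c by simp
  qed (use c Suc in \<open>auto simp: Gj_def Peq\<close>)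
  also have "?T <= Gj (Suc j)"
  proof
   fix b assume "b : ?T"
   then obtain e where e: "e : EH (W (Suc j))" "e(j := undefined) : Gj j" "b = e(Suc j := undefined)" by blast
   then obtain a where a: "P j (e(j := undefined)) a" by (auto simp: Gj_def)
   have ea: "e i = a i" if "j < i" "i < k" for i using a that by (auto simp: P_def dest: spec[of _ i])
   have im: "b ` {..l} = e ` {..l}" if "l <= j" for l using that e(3) by (intro image_cong) auto
   have "P (Suc j) b a" unfolding P_def
   proof (intro conjI allI impI)
    show "a : F" using a by (simp add: P_def)
    show "b i = a i" if "Suc j < i" "i < k" for i using ea[of i] that e(3) by simp
    fix l assume l: "l < Suc j"
    show "b ` {..l} Un a ` {Suc l..<k} : H"
    proof (cases "l = j")
     case True
     have "a ` {Suc l..<k} = e ` {Suc l..<k}" using ea True by (intro image_cong) auto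
     moreover have "{..l} Un {Suc l..<k} = {..<k}" using j True by auto
     ultimately have "b ` {..l} Un a ` {Suc l..<k} = e ` {..<k}" using im True by (metis image_Un order_refl)
     thus ?thesis using e(1) by (simp add: EH_def)
    next
     case False
     hence "l < j" using l by simp
     have "(e(j := undefined)) ` {..l} = e ` {..l}" using \<open>l < j\<close> by (intro image_cong) auto
     moreover have "(e(j := undefined)) ` {..l} Un a ` {Suc l..<k} : H" using a \<open>l < j\<close> unfolding P_def by blast
     ultimately show ?thesis using im[of l] \<open>l < j\<close> by simp
    qed
   qed
   thus "b : Gj (Suc j)" using drop_state[OF slW e(1) j(2)] e(3) by (auto simp: Gj_def)
  qed
  moreover have "finite (Gj (Suc j))" by (rule finite_subset[OF _ finite_states[OF slW[of "Suc j"], of "{..<k} - {Suc j}"]]) (auto simp: Gj_def)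
  ultimately show ?case using card_mono[of "Gj (Suc j)" ?T] by (simp add: mult.commute)
 qed
 from this[of "k - 1"] have big: "c / 8 ^ (k - 1) * N ^ (k - 1) <= card (Gj (k - 1))" by simp
 have WY: "PiE ({..<k} - {k - 1}) (W (k - 1)) = PiE ({..<k} - {k - 1}) Y" by (intro PiE_cong) (auto simp: W_def)
 have "~ Gj (k - 1) <= PiE ({..<k} - {k - 1}) Y - Hs"
 proof
  assume "Gj (k - 1) <= PiE ({..<k} - {k - 1}) Y - Hs"
  hence "card (Gj (k - 1)) <= card (PiE ({..<k} - {k - 1}) Y - Hs)" using finite_states[OF slY, of "{..<k} - {k - 1}"] by (intro card_mono) auto
  thus False using big Hs by linarith
 qed
 then obtain h where "h : Gj (k - 1)" "h : Hs" using WY by (auto simp: Gj_def)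
 thus ?thesis by (auto simp: Gj_def P_def)
qed

end

section \<open>Tuples as lists; tight connections\<close>

text \<open>The list l enumerates a in the cyclic order of the coordinates that starts after the missing one; rh translates positions in this order into coordinates.\<close>
definition rep :: "nat => (nat => nat) => nat => (nat => 'a) => 'a list => bool" where
  "rep k rh r a l \<longleftrightarrow> length l = k - 1 & (\<forall>j<k-1. a (rh ((r + 1 + j) mod k)) = l ! j)"

lemma shift_ne: "j < k - 1 ==> (r + 1 + j) mod k ~= r mod k" for k :: nat
proof
 assume j: "j < k - 1" and eq: "(r + 1 + j) mod k = r mod k"
 hence "k dvd (r + 1 + j) - r" by (metis add.assoc le_add1 mod_eq_dvd_iff_nat)
 hence "k dvd 1 + j" by simp
 with j show False by (auto dest: dvd_imp_le)
qed

lemma shift_onto: fixes k :: nat assumes "i < k" "i ~= r mod k" shows "\<exists>j<k-1. (r + 1 + j) mod k = i"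
proof -
 define j where "j = (i + (k - 1) * (r + 1)) mod k"
 have "r + 1 + (i + (k - 1) * (r + 1)) = i + k * (r + 1)" using assms(1) by (cases k) (auto simp: algebra_simps)
 hence 1: "(r + 1 + j) mod k = i" unfolding j_def using assms(1) by (metis mod_add_right_eq mod_less mod_mult_self2)
 have "j ~= k - 1" using 1 assms by auto
 moreover have "j < k" using assms(1) by (simp add: j_def)
 ultimately have "j < k - 1" by simp
 thus ?thesis using 1 by blast
qed

lemma rep_image:
  assumes "rep k rh r a l" "bij_betw rh {..<k} {..<k}" "k >= 1"
  shows "a ` ({..<k} - {rh (r mod k)}) = set l"
proof -
 have rk: "r mod k < k" using assms(3) by simp
 have "{..<k} - {rh (r mod k)} = rh ` ({..<k} - {r mod k})" using assms(2) rk by (auto simp: bij_betw_def inj_on_def image_iff set_eq_iff)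
 also have "{..<k} - {r mod k} = (%j. (r + 1 + j) mod k) ` {..<k - 1}"
 proof (intro equalityI subsetI)
  fix i assume "i : {..<k} - {r mod k}"
  thus "i : (%j. (r + 1 + j) mod k) ` {..<k - 1}" using shift_onto[of i k r] by auto
 next
  fix i assume "i : (%j. (r + 1 + j) mod k) ` {..<k - 1}"
  thus "i : {..<k} - {r mod k}" using shift_ne[of _ k r] assms(3) by auto
 qed
 finally have "a ` ({..<k} - {rh (r mod k)}) = (%j. a (rh ((r + 1 + j) mod k))) ` {..<k - 1}" by (simp add: image_image)
 also have "... = (%j. l ! j) ` {..<k - 1}" using assms(1) by (intro image_cong) (auto simp: rep_def)
 also have "... = set l" using assms(1) by (auto simp: rep_def set_conv_nth)
 finally show ?thesis .
qed

lemma rep_step: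
  assumes rep: "rep k rh r a l" and bij: "bij_betw rh {..<k} {..<k}" and k: "k >= 2"
  shows "rep k rh (Suc r) ((a(rh (r mod k) := y))(rh (Suc r mod k) := undefined)) (tl l @ [y])"
 unfolding rep_def
proof (intro conjI allI impI)
 have inj: "rh i = rh j \<longleftrightarrow> i = j" if "i < k" "j < k" for i j using bij that by (auto simp: bij_betw_def inj_on_def)
 have len: "length l = k - 1" using rep by (simp add: rep_def)
 thus "length (tl l @ [y]) = k - 1" using k by simp
 fix j assume j: "j < k - 1"
 let ?s = "(Suc r + 1 + j) mod k"
 have s: "?s < k" using k by simp
 have "?s ~= Suc r mod k" using shift_ne[OF j, of "Suc r"] by simp
 hence 1: "((a(rh (r mod k) := y))(rh (Suc r mod k) := undefined)) (rh ?s) = (a(rh (r mod k) := y)) (rh ?s)" using inj[OF s] k by simp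
 show "((a(rh (r mod k) := y))(rh (Suc r mod k) := undefined)) (rh ?s) = (tl l @ [y]) ! j"
 proof (cases "j < k - 2")
  case True
  hence "(r + 1 + Suc j) mod k ~= r mod k" by (intro shift_ne) auto
  hence "?s ~= r mod k" by simp
  hence "(a(rh (r mod k) := y)) (rh ?s) = a (rh ((r + 1 + Suc j) mod k))" using inj[OF s] k by simp
  also have "... = l ! Suc j"
  proof -
   have "Suc j < k - 1" using True by simp
   thus ?thesis using rep unfolding rep_def by blast
  qed
  also have "l ! Suc j = (tl l @ [y]) ! j" using True len by (simp add: nth_append nth_tl numeral_2_eq_2)
  finally show ?thesis using 1 by simp
 next
  case False
  hence j: "j = k - 2" using j by simp
  have "Suc r + 1 + j = r + k" using j k by simp
  hence "?s = r mod k" by (simp only: mod_add_self2)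
  moreover have "(tl l @ [y]) ! j = y" using j len k by (simp add: nth_append numeral_2_eq_2)
  ultimately show ?thesis using 1 by simp
 qed
qed

lemma rep_mod: "rep k rh r a l ==> r mod k = r' mod k ==> rep k rh r' a l"
 unfolding rep_def by (metis add.assoc mod_add_left_eq)

lemma last_of_snoc: "k >= 2 ==> k - 1 <= length xs ==> last_of k (xs @ [y]) = tl (last_of k xs) @ [y]"
 by (simp add: last_of_def tl_drop drop_Suc[symmetric] Suc_diff_le flip: drop_Suc)

lemma last_of_append: "k - 1 <= length ys ==> last_of k (xs @ ys) = last_of k ys"
 by (simp add: last_of_def)

lemma last_of_self: "length ys = k - 1 ==> last_of k ys = ys"
 by (simp add: last_of_def)

lemma length_last_of: "k - 1 <= length xs ==> length (last_of k xs) = k - 1"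
 by (simp add: last_of_def)

lemma split_last_of: "xs = take (length xs - (k - 1)) xs @ last_of k xs"
 by (simp add: last_of_def)

lemma win_snoc':
  assumes "win k E xs" "insert y (set (last_of k xs)) : E" "k >= 1" "k - 1 <= length xs"
  shows "win k E (xs @ [y])"
proof -
 have "win k E (take (length xs - (k - 1)) xs @ last_of k xs @ [y])" by (rule win_snoc) (use assms split_last_of[of xs k, symmetric] length_last_of[of k xs] in auto)
 thus ?thesis using split_last_of[of xs k] by (metis append_assoc)
qed

text \<open>A spike is read in one direction on the way up and in the other on the way down, so the order of coordinates is reversed in every second spike.\<close>
definition reflect :: "nat => nat => nat => nat" where
  "reflect k h s = (if h = 0 then s else k - 1 - s)"

lemma bij_reflect: "bij_betw (reflect k h) {..<k} {..<k}"
 by (rule bij_betw_byWitness[of _ "reflect k h"]) (auto simp: reflect_def)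

context world begin

lemma extend:
  assumes "length x = k - 1" "set x : good" "!!i. i < m ==> T i : Ps"
  shows "\<exists>y. length y = m & (\<forall>i<m. y ! i : T i) & win k H (x @ y) & set (last_of k (x @ y)) : good"
 using assms(3)
proof (induction m)
 case 0
 have "win k H x" using assms(1) k3 by (intro win_short) simp
 thus ?case using assms by (simp add: last_of_self)
next
 case (Suc m)
 then obtain y where y: "length y = m" "!!i. i < m ==> y ! i : T i" "win k H (x @ y)" "set (last_of k (x @ y)) : good" by auto
 let ?l = "last_of k (x @ y)"
 have "(1/2 + g) * p * N > 0" using g0 p0 N0 by simp
 hence "deg H (set ?l) (T m) > 0" using H_deg[OF y(4) Suc.prems[of m]] by (simp del: of_nat_0_less_iff add: of_nat_0_less_iff[symmetric, where 'a=real])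
 then obtain w where w: "w : T m" "insert w (set ?l) : H"
  unfolding deg_def by (metis (no_types, lifting) card_gt_0_iff ex_in_conv mem_Collect_eq)
 have len: "length ?l = k - 1" using assms(1) by (intro length_last_of) simp
 have dl: "distinct ?l" using y(4) goodV len by (auto simp: nsets_def card_distinct)
 obtain a l' where al: "?l = a # l'" using len k3 by (cases ?l) auto
 have wl: "w ~: set ?l"
 proof
  assume "w : set ?l"
  hence "set ?l : H" using w(2) by (simp add: insert_absorb)
  hence "card (set ?l) = k" by (rule edge_card)
  thus False using len k3 card_length[of ?l] by simp
 qed
 have "insert w (set ?l) - {a} = set (tl ?l @ [w])" using wl dl al by auto
 moreover have "insert w (set ?l) - {a} : good" using H_good[OF w(2)] al by simp
 ultimately have "set (last_of k ((x @ y) @ [w])) : good" using last_of_snoc[of k "x @ y" w] assms(1) k3 by simp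
 moreover have "win k H ((x @ y) @ [w])" using assms(1) k3 by (intro win_snoc' y w) auto
 ultimately show ?case using y w by (intro exI[of _ "y @ [w]"]) (auto simp: nth_append less_Suc_eq)
qed

lemma start_state:
  assumes sl: "slots U" and bij: "bij_betw rh {..<k} {..<k}" and b: "length b = k - 1" "!!j. j < k - 1 ==> b ! j : U (rh (Suc j))"
  shows "\<exists>a. a : PiE ({..<k} - {rh 0}) U & rep k rh 0 a b" "distinct b" "set b \<subseteq> (\<Union>i<k. U i)"
proof -
 have rhk: "rh j < k" if "j < k" for j using bij that by (auto simp: bij_betw_def)
 have inj: "rh i = rh j \<longleftrightarrow> i = j" if "i < k" "j < k" for i j using bij that by (auto simp: bij_betw_def inj_on_def)
 define a where "a s = (if s : {..<k} - {rh 0} then b ! (the_inv_into {..<k} rh s - 1) else undefined)" for s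
 have inv: "the_inv_into {..<k} rh (rh j) = j" if "j < k" for j using bij that by (simp add: the_inv_into_f_f bij_betw_def)
 have "a (rh (Suc j)) = b ! j" if "j < k - 1" for j using that rhk[of "Suc j"] inj[of "Suc j" 0] inv[of "Suc j"] by (simp add: a_def)
 hence rep: "rep k rh 0 a b" using b(1) by (simp add: rep_def)
 have "a s : U s" if s: "s : {..<k} - {rh 0}" for s
 proof -
  obtain j where j: "j < k" "s = rh j" using bij s by (auto simp: bij_betw_def)
  then obtain i where i: "j = Suc i" using s by (cases j) auto
  show ?thesis using b(2)[of i] inv[OF j(1)] s j i by (simp add: a_def)
 qed
 hence "a : PiE ({..<k} - {rh 0}) U" by (auto simp: a_def PiE_def extensional_def)
 thus "EX a. a : PiE ({..<k} - {rh 0}) U & rep k rh 0 a b" using rep by blast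
 show "distinct b" unfolding distinct_conv_nth
 proof (intro allI impI)
  fix i j assume ij: "i < length b" "j < length b" "i ~= j"
  show "b ! i ~= b ! j"
  proof
   assume "b ! i = b ! j"
   hence "rh (Suc i) = rh (Suc j)" using slots_disj[OF sl rhk rhk b(2)[of i], of "Suc j"] b(1,2) ij by auto
   thus False using inj[of "Suc i" "Suc j"] ij b(1) by simp
  qed
 qed
 show "set b <= (\<Union>i<k. U i)"
 proof
  fix v assume "v : set b"
  then obtain j where "j < k - 1" "v = b ! j" using b(1) by (auto simp: in_set_conv_nth)
  thus "v : (\<Union>i<k. U i)" using b(2)[of j] rhk[of "Suc j"] by (intro UN_I[of "rh (Suc j)"]) auto
 qed
qed

text \<open>The tight schedule has period k and the zigzag schedule has period 2k-2; the constants c0, eps0 and eta0 serve both.\<close>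
lemma closure_uniform:
  fixes R :: "nat => (nat => 'a) => 'a set => bool"
  assumes sl: "slots U" and q0: "q > 0" "q <= 2 * k" and sg: "!!t. t < q ==> sg t < k"
    and sg_onto: "!!i. i < k ==> \<exists>t<q. sg t = i"
    and R0: "R 0 a0 S0" "finite S0" "card S0 <= k" "a0 : PiE ({..<k} - {sg 0}) U" "a0 ` ({..<k} - {sg 0}) : good"
    and Rstep: "!!t a S y. [|t < q; a : PiE ({..<k} - {sg t}) U; R t a S; y : U (sg t); y \<notin> S; a(sg t := y) : EH U|]
        ==> R (Suc t mod q) ((a(sg t := y))(sg (Suc t mod q) := undefined)) (insert y S)"
    and tau: "4 * tau <= eps0 k"
    and growth: "2 * k * (2 * N) ^ (k - 1) < (1 + eta0 g k) ^ M" and M: "k + M <= eta0 g k * p * N"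
  shows "\<exists>m\<le>M. \<forall>t<q. c0 k * N ^ (k - 1) <= card (reach U sg R m t) &
     card (PiE ({..<k} - {sg t}) U - reach U sg R m t) < c0 k / 8 ^ (k - 1) * N ^ (k - 1)"
proof -
 have k0: "real k >= 3" using k3 by simp
 have c0: "0 < c0 k" "c0 k <= 1 / (64 * real k ^ 3)" "c0 k <= 1"
 proof -
  have b: "0 < 1 / (64 * real k ^ 3)" "1 / (64 * real k ^ 3) <= 1"
  proof -
   have "1 <= real k ^ 3" using k0 by (intro one_le_power) simp
   hence "1 <= 64 * real k ^ 3" by linarith
   thus "1 / (64 * real k ^ 3) <= 1" by (simp only: divide_le_eq_1) auto
   show "0 < 1 / (64 * real k ^ 3)" using k0 by simp
  qed
  thus "0 < c0 k" by (simp add: c0_def)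
  have "(1 / (64 * real k ^ 3)) ^ (k - 1) <= (1 / (64 * real k ^ 3)) ^ 1" using b k3 by (intro power_decreasing) auto
  thus "c0 k <= 1 / (64 * real k ^ 3)" by (simp add: c0_def)
  thus "c0 k <= 1" using b by linarith
 qed
 have e0: "0 < eps0 k" "eps0 k <= c0 k / (k * 32 ^ k)" "eps0 k <= c0 k / k" "eps0 k <= 1"
 proof -
  show "0 < eps0 k" using c0 k0 by (simp add: eps0_def)
  have "c0 k * c0 k <= c0 k * 1" using c0 by (intro mult_left_mono) auto
  thus 1: "eps0 k <= c0 k / (k * 32 ^ k)"
   unfolding eps0_def power2_eq_square using k0 by (intro divide_right_mono) auto
  have "real k * 1 <= real k * 32 ^ k" using k0 by (intro mult_left_mono) auto
  hence "c0 k / (k * 32 ^ k) <= c0 k / k" using c0 k0 by (intro divide_left_mono) auto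
  thus 2: "eps0 k <= c0 k / k" using 1 by linarith
  have "c0 k / k <= 1" using c0 k0 by (simp add: field_simps)
  thus "eps0 k <= 1" using 2 by linarith
 qed
 define et where "et = (eps0 k)^2 * g^2 / (400 * (real q)^2)"
 have qk: "real q <= 2 * k" "real q >= 1" using q0 by linarith+
 have "(real q)^2 <= (2 * real k)^2" using qk by (intro power_mono) auto
 hence et: "eta0 g k <= et" unfolding eta0_def et_def using qk k0 by (intro divide_left_mono) (auto simp: power2_eq_square)
 have eta0: "eta0 g k >= 0" by (simp add: eta0_def)
 have "EX m<=M. ALL t<q. (N / (32 * q * k ^ 2)) ^ (k - 1) <= card (reach U sg R m t) &
   card (reach U sg R m t) * card (PiE ({..<k} - {sg t}) U - reach U sg R m t) <= k * 4 ^ k * eps0 k * N ^ (2 * k - 2)"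
 proof (rule closure_large[OF sl q0(1) sg sg_onto R0 Rstep])
  show "tau <= 1 / real (64 * q * k ^ 3)"
  proof -
   have "real (64 * q * k ^ 3) <= 64 * (2 * k) * real k ^ 3" using qk by (auto intro!: mult_right_mono)
   also have "... <= 4 * (k * (64 * real k ^ 3))" using k0 by simp
   finally have "1 / (4 * (k * (64 * real k ^ 3))) <= 1 / real (64 * q * k ^ 3)" using q0 k0 by (intro divide_left_mono) auto
   moreover have "4 * tau <= (1 / (64 * real k ^ 3)) / k" using tau e0(3) divide_right_mono[OF c0(2), of "real k"] k0 by linarith
   moreover have "(1 / (64 * real k ^ 3)) / k = 4 * (1 / (4 * (k * (64 * real k ^ 3))))" by simp
   ultimately show ?thesis by linarith
  qed
  show "real q * (2 * N) ^ (k - 1) < (1 + et) ^ M"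
  proof -
   have "real q * (2 * N) ^ (k - 1) <= 2 * k * (2 * N) ^ (k - 1)" using qk N0 by (intro mult_right_mono) auto
   also have "... < (1 + eta0 g k) ^ M" using growth by simp
   also have "... <= (1 + et) ^ M" using et eta0 by (intro power_mono) auto
   finally show ?thesis .
  qed
  show "real (k + M) <= et * q * p * N"
  proof -
   have "eta0 g k * 1 * (p * N) <= et * q * (p * N)" using et eta0 qk p0 N0 by (intro mult_right_mono mult_mono) auto
   thus ?thesis using M by (simp add: mult_ac)
  qed
 qed (use e0 tau in \<open>simp_all add: et_def\<close>)
 then obtain m where m: "m <= M" and mt: "!!t. t < q ==> (N / (32 * q * k ^ 2)) ^ (k - 1) <= card (reach U sg R m t) &
   card (reach U sg R m t) * card (PiE ({..<k} - {sg t}) U - reach U sg R m t) <= k * 4 ^ k * eps0 k * N ^ (2 * k - 2)" by blast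
 have NN: "N ^ (2 * k - 2) = N ^ (k - 1) * N ^ (k - 1)"
 proof -
  have "2 * k - 2 = (k - 1) + (k - 1)" using k3 by simp
  thus ?thesis by (simp add: power_add)
 qed
 have Np: "N ^ (k - 1) > 0" using N0 by simp
 show ?thesis
 proof (intro exI[of _ m] conjI m allI impI)
  fix t assume t: "t < q"
  let ?F = "reach U sg R m t" and ?C = "PiE ({..<k} - {sg t}) U - reach U sg R m t"
  have "real (32 * q * k ^ 2) <= 64 * real k ^ 3" using mult_right_mono[OF qk(1), of "32 * real k ^ 2"] by (simp add: power2_eq_square power3_eq_cube mult_ac)
  hence "N / (64 * real k ^ 3) <= N / real (32 * q * k ^ 2)" using N0 q0 k0 by (intro divide_left_mono) auto
  hence "(N / (64 * real k ^ 3)) ^ (k - 1) <= (N / real (32 * q * k ^ 2)) ^ (k - 1)" using N0 by (intro power_mono) auto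
  thus A: "c0 k * N ^ (k - 1) <= card ?F" using mt[OF t] by (simp add: c0_def power_divide)
  have "c0 k * N ^ (k - 1) * card ?C <= real (card ?F) * card ?C" using A by (intro mult_right_mono) auto
  also have "... <= k * 4 ^ k * eps0 k * N ^ (2 * k - 2)" using mt[OF t] by simp
  also have "... = (c0 k * N ^ (k - 1)) * (c0 k / 8 ^ k * N ^ (k - 1))"
  proof -
   have "(32::real) ^ k = 4 ^ k * 8 ^ k" by (simp add: power_mult_distrib[symmetric])
   thus ?thesis unfolding NN eps0_def using k0 by (simp add: power2_eq_square)
  qed
  finally have "card ?C <= c0 k / 8 ^ k * N ^ (k - 1)" by (rule mult_left_le_imp_le) (use c0 Np in simp)
  also have "... < c0 k / 8 ^ (k - 1) * N ^ (k - 1)" using c0 Np k3 by (intro mult_strict_right_mono divide_strict_left_mono power_strict_increasing) auto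
  finally show "card ?C < c0 k / 8 ^ (k - 1) * N ^ (k - 1)" .
 qed
qed

end

text \<open>Two tuples of length k-1 are neighbouring spikes if the walk up the first and down the second is tight.\<close>
definition adj :: "nat => 'a set set => 'a list => 'a list => bool" where
  "adj k E a b \<longleftrightarrow> win k E (a @ rev b)"

lemma adj_sym: "adj k E a b \<longleftrightarrow> adj k E b a"
 unfolding adj_def by (metis rev_append rev_rev_ident win_rev_iff)

lemma last_of_win_append:
  assumes "win k E A" "win k E (last_of k A @ C)" "k >= 1" "k - 1 <= length A"
  shows "win k E (A @ C)"
proof -
 have "win k E (take (length A - (k - 1)) A @ last_of k A @ C)" by (rule win_append) (use assms split_last_of[of A k, symmetric] length_last_of[of k A] in auto)
 thus ?thesis using split_last_of[of A k] by (metis append_assoc)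
qed

context world begin

text \<open>Here a walk is an actual path starting in x, of which the state records the last k-1 vertices.\<close>
lemma tight_half:
  assumes sl: "slots U" and bij: "bij_betw rh {..<k} {..<k}" and x: "length x = k - 1" "set x : good"
    and tau: "4 * tau <= eps0 k"
    and growth: "2 * k * (2 * N) ^ (k - 1) < (1 + eta0 g k) ^ M" and M: "k + M <= eta0 g k * p * N"
  shows "\<exists>F\<subseteq>PiE ({..<k} - {rh 0}) U.
    (\<forall>a\<in>F. a ` ({..<k} - {rh 0}) : good & (\<exists>B. distinct B & set B \<subseteq> (\<Union>i<k. U i) & length B <= k + M &
       win k H (x @ B) & k - 1 <= length B & rep k rh 0 a (last_of k B))) &
    c0 k * N ^ (k - 1) <= card F & card (PiE ({..<k} - {rh 0}) U - F) < c0 k / 8 ^ (k - 1) * N ^ (k - 1)"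
proof -
 have rhk: "rh j < k" if "j < k" for j using bij that by (auto simp: bij_betw_def)
 obtain b where b: "length b = k - 1" "!!j. j < k - 1 ==> b ! j : U (rh (Suc j))" "win k H (x @ b)" "set (last_of k (x @ b)) : good"
  using extend[OF x, of "k - 1" "%j. U (rh (Suc j))"] slots_Ps[OF sl rhk] by auto
 have lb: "last_of k (x @ b) = b" using b(1) by (simp add: last_of_append last_of_self)
 obtain a0 where a0: "a0 : PiE ({..<k} - {rh 0}) U" "rep k rh 0 a0 b" using start_state(1)[OF sl bij b(1,2)] by blast
 note db = start_state(2,3)[OF sl bij b(1,2)]
 define R where "R t a S \<longleftrightarrow> (EX ys. win k H (x @ b @ ys) & distinct (b @ ys) & set (b @ ys) = S & S <= (\<Union>i<k. U i) &
   length ys mod k = t & rep k rh (length ys) a (last_of k (b @ ys)))" for t a S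
 have im0: "a0 ` ({..<k} - {rh 0}) = set b" using rep_image[OF a0(2) bij] k3 by simp
 have "EX m<=M. ALL t<k. c0 k * N ^ (k - 1) <= card (reach U rh R m t) &
   card (PiE ({..<k} - {rh t}) U - reach U rh R m t) < c0 k / 8 ^ (k - 1) * N ^ (k - 1)"
 proof (rule closure_uniform[where ?a0.0 = a0 and ?S0.0 = "set b" and U = U and sg = rh and q = k and R = R and M = M, OF sl _ _ rhk _ _ _ _ a0(1) _ _ tau growth M])
  show "k > 0" "k <= 2 * k" using k3 by auto
  show "EX t<k. rh t = i" if "i < k" for i
  proof -
   have "i : rh ` {..<k}" using bij that by (simp add: bij_betw_def)
   thus ?thesis by auto
  qed
  show "R 0 a0 (set b)" unfolding R_def using b(3) db a0(2) k3 b(1) by (intro exI[of _ "[]"]) (simp add: last_of_self)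
  show "card (set b) <= k" using card_length[of b] b(1) by simp
  show "a0 ` ({..<k} - {rh 0}) : good" using b(4) lb im0 by simp
  fix t a S y assume t: "t < k" and a: "a : PiE ({..<k} - {rh t}) U" and R: "R t a S"
   and y: "y : U (rh t)" "y ~: S" and e: "a(rh t := y) : EH U"
  obtain ys where ys: "win k H (x @ b @ ys)" "distinct (b @ ys)" "set (b @ ys) = S" "S <= (\<Union>i<k. U i)"
   "length ys mod k = t" "rep k rh (length ys) a (last_of k (b @ ys))" using R unfolding R_def by blast
  have len: "k - 1 <= length (b @ ys)" using b(1) by simp
  have "(a(rh t := y)) ` {..<k} = insert y (set (last_of k (b @ ys)))" using upd_image[OF rhk[OF t], of a y] rep_image[OF ys(6) bij] k3 ys(5) by simp
  hence "insert y (set (last_of k (x @ b @ ys))) : H" using e len by (simp add: EH_def last_of_append)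
  hence "win k H ((x @ b @ ys) @ [y])" using len k3 by (intro win_snoc' ys) auto
  moreover have "rep k rh (Suc (length ys)) ((a(rh t := y))(rh (Suc t mod k) := undefined)) (last_of k (b @ ys @ [y]))"
  proof -
   have k2: "k >= 2" using k3 by simp
   have sm: "Suc (length ys) mod k = Suc t mod k" using mod_Suc_eq[of "length ys" k] by (simp only: ys(5))
   have lo: "last_of k (b @ ys @ [y]) = tl (last_of k (b @ ys)) @ [y]" using last_of_snoc[OF k2 len, of y] by simp
   show ?thesis unfolding lo using rep_step[OF ys(6) bij k2, of y] by (simp only: ys(5) sm)
  qed
  moreover have "length (ys @ [y]) mod k = Suc t mod k" using mod_Suc_eq[of "length ys" k] by (simp add: ys(5))
  ultimately show "R (Suc t mod k) ((a(rh t := y))(rh (Suc t mod k) := undefined)) (insert y S)"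
   unfolding R_def using ys y rhk[OF t] by (intro exI[of _ "ys @ [y]"]) auto
 qed simp_all
 then obtain m where m: "m <= M" "c0 k * N ^ (k - 1) <= card (reach U rh R m 0)"
   "card (PiE ({..<k} - {rh 0}) U - reach U rh R m 0) < c0 k / 8 ^ (k - 1) * N ^ (k - 1)" using k3 by auto
 show ?thesis
 proof (intro exI[of _ "reach U rh R m 0"] conjI ballI m)
  show "reach U rh R m 0 <= PiE ({..<k} - {rh 0}) U" by (auto simp: reach_def)
  fix a assume a: "a : reach U rh R m 0"
  thus "a ` ({..<k} - {rh 0}) : good" by (simp add: reach_def)
  obtain S where S: "R 0 a S" "finite S" "card S <= k + m" using a unfolding reach_def by blast
  obtain ys where ys: "win k H (x @ b @ ys)" "distinct (b @ ys)" "set (b @ ys) = S" "S <= (\<Union>i<k. U i)"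
   "length ys mod k = 0" "rep k rh (length ys) a (last_of k (b @ ys))" using S(1) unfolding R_def by (elim exE conjE) (rule that)
  show "EX B. distinct B & set B <= (\<Union>i<k. U i) & length B <= k + M & win k H (x @ B) & k - 1 <= length B & rep k rh 0 a (last_of k B)"
  proof (intro exI[of _ "b @ ys"] conjI)
   show "length (b @ ys) <= k + M" using distinct_card[OF ys(2)] S(3) ys(3) m(1) by simp
   show "rep k rh 0 a (last_of k (b @ ys))" using rep_mod[OF ys(6)] ys(5) by simp
  qed (use ys b in auto)
 qed
qed

lemma rep_join:
  assumes a: "rep k id 0 a l" and h: "!!j. j < k - 1 ==> h j = l' ! j" and l': "length l' = k - 1"
    and e: "!!j. j < k - 1 ==> h ` {..j} \<union> a ` {Suc j..<k} : H"
  shows "win k H (l @ l')"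
 unfolding win_def
proof (intro allI impI)
 fix i assume i: "i + k <= length (l @ l')"
 have l: "length l = k - 1" and al: "!!j. j < k - 1 ==> a (Suc j) = l ! j" using a by (auto simp: rep_def)
 have ik: "i < k - 1" using i l l' k3 by simp
 have "set (take k (drop i (l @ l'))) = set (drop i l) Un set (take (Suc i) l')" using l ik by (simp add: Suc_diff_le numeral_2_eq_2 diff_diff_left[symmetric] del: diff_diff_left)
 also have "set (drop i l) = a ` {Suc i..<k}"
 proof -
  have "drop i l = drop i (map ((!) l) [0..<length l])" by (simp only: map_nth)
  also have "... = map ((!) l) [i..<k - 1]" unfolding l by (simp add: drop_map)
  finally have "drop i l = map ((!) l) [i..<k - 1]" .
  hence "set (drop i l) = (%j. l ! j) ` {i..<k - 1}" by simp
  also have "... = (%j. a (Suc j)) ` {i..<k - 1}" using al by (intro image_cong) auto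
  also have "... = a ` Suc ` {i..<k - 1}" unfolding image_image ..
  also have "Suc ` {i..<k - 1} = {Suc i..<Suc (k - 1)}" by (rule image_Suc_atLeastLessThan)
  also have "Suc (k - 1) = k" using k3 by simp
  finally show ?thesis .
 qed
 also have "set (take (Suc i) l') = h ` {..i}"
 proof -
  have "set (take (Suc i) l') = (%j. l' ! j) ` {..<Suc i}" using l' ik by (simp add: nth_image lessThan_atLeast0)
  also have "... = h ` {..i}" using h ik by (intro image_cong) auto
  finally show ?thesis .
 qed
 finally show "set (take k (drop i (l @ l'))) : H" using e[OF ik] by (simp add: Un_commute)
qed

text \<open>Apply tight_half from x and, with the order of coordinates reversed, from y; join provides k-1 edges across.\<close>
lemma connect_tight:
  assumes slU: "slots U" and slY: "slots Y" and UY: "!!i j. i < k ==> j < k ==> U i ~= Y j"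
    and x: "length x = k - 1" "set x : good" and y: "length y = k - 1" "set y : good"
    and tau: "4 * tau <= eps0 k" "2 * tau <= c0 k / 16 ^ k" and c0: "c0 k > 0"
    and growth: "2 * k * (2 * N) ^ (k - 1) < (1 + eta0 g k) ^ M" and M: "k + M <= eta0 g k * p * N"
  shows "\<exists>q. q ~= [] & distinct q & set q \<subseteq> (\<Union>i<k. U i) \<union> (\<Union>i<k. Y i) & length q <= 2 * (k + M) & win k H (x @ q @ y)"
proof -
 have bij: "bij_betw id {..<k} {..<k}" by simp
 have r0: "reflect k 1 0 = k - 1" by (simp add: reflect_def)
 have ry: "length (rev y) = k - 1" "set (rev y) : good" using y by auto
 obtain F where F: "F <= PiE ({..<k} - {0}) U" "!!a. a : F ==> a ` ({..<k} - {0}) : good"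
   "!!a. a : F ==> EX B. distinct B & set B <= (\<Union>i<k. U i) & length B <= k + M &
    win k H (x @ B) & k - 1 <= length B & rep k id 0 a (last_of k B)"
   "c0 k * N ^ (k - 1) <= card F" using tight_half[OF slU bij x tau(1) growth M] by auto
 obtain Hs where Hs: "!!a. a : Hs ==> EX B. distinct B & set B <= (\<Union>i<k. Y i) & length B <= k + M &
    win k H (rev y @ B) & k - 1 <= length B & rep k (reflect k 1) 0 a (last_of k B)"
   "card (PiE ({..<k} - {k - 1}) Y - Hs) < c0 k / 8 ^ (k - 1) * N ^ (k - 1)" using tight_half[OF slY bij_reflect[of k 1] ry tau(1) growth M] unfolding r0 by blast
 obtain a h where ah: "a : F" "h : Hs" "!!l. l < k - 1 ==> h ` {..l} Un a ` {Suc l..<k} : H" using join[OF slU slY UY F(1,2) c0 tau(2) F(4) Hs(2)] by blast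
 obtain B where B: "distinct B" "set B <= (\<Union>i<k. U i)" "length B <= k + M" "win k H (x @ B)" "k - 1 <= length B" "rep k id 0 a (last_of k B)" using F(3)[OF ah(1)] by blast
 obtain C where C: "distinct C" "set C <= (\<Union>i<k. Y i)" "length C <= k + M" "win k H (rev y @ C)" "k - 1 <= length C" "rep k (reflect k 1) 0 h (last_of k C)" using Hs(1)[OF ah(2)] by blast
 let ?l = "last_of k B" and ?l' = "last_of k C"
 have len: "length ?l = k - 1" "length ?l' = k - 1" by (rule length_last_of[OF B(5)], rule length_last_of[OF C(5)])
 have w: "win k H (?l @ rev ?l')"
 proof (rule rep_join[OF B(6) _ _ ah(3)])
  fix j assume j: "j < k - 1"
  hence "k - 2 - j < k - 1" by simp
  hence "h (reflect k 1 (Suc (k - 2 - j))) = ?l' ! (k - 2 - j)" using C(6) by (simp add: rep_def)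
  moreover have "reflect k 1 (Suc (k - 2 - j)) = j" using j by (auto simp: reflect_def)
  moreover have "rev ?l' ! j = ?l' ! (k - 2 - j)"
  proof -
   have "length ?l' - Suc j = k - 2 - j" using len by simp
   thus ?thesis using rev_nth[of j ?l'] j len by simp
  qed
  ultimately show "h j = rev ?l' ! j" by simp
 qed (use len in auto)
 have lx: "last_of k (x @ B) = ?l" using B(5) by (rule last_of_append)
 have k1: "1 <= k" "k - 1 <= length (x @ B)" using k3 B(5) by auto
 have 1: "win k H ((x @ B) @ rev ?l')" by (rule last_of_win_append[OF B(4) _ k1]) (unfold lx, rule w)
 define C0 where "C0 = take (length (rev y @ C) - (k - 1)) (rev y @ C)"
 have Cs: "rev y @ C = C0 @ ?l'" using split_last_of[of "rev y @ C" k] unfolding C0_def last_of_append[OF C(5), of "rev y"] .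
 have rC: "rev C @ y = rev ?l' @ rev C0" using arg_cong[OF Cs, of rev] by simp
 have 2: "win k H (rev ?l' @ rev C0)" using win_rev[OF C(4)] rC by simp
 have "win k H ((x @ B) @ rev ?l' @ rev C0)" by (rule win_append[OF 1 2]) (use len in simp)
 hence "win k H (x @ (B @ rev C) @ y)" using rC by simp
 moreover have "distinct (B @ rev C)"
 proof -
  have "set B Int set C = {}"
  proof (rule ccontr)
   assume "set B Int set C ~= {}"
   then obtain v i j where v: "i < k" "j < k" "v : U i" "v : Y j" using B(2) C(2) by blast
   thus False using Ps_disj[OF slots_Ps[OF slU v(1)] slots_Ps[OF slY v(2)] UY[OF v(1,2)]] by blast
  qed
  thus ?thesis using B(1) C(1) by simp
 qed
 moreover have "B @ rev C ~= []" using B(5) k3 by auto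
 ultimately show ?thesis using B(2,3) C(2,3) by (intro exI[of _ "B @ rev C"]) auto
qed

end

section \<open>Spike chains\<close>

context world begin

text \<open>The zigzag schedule runs through the coordinates up and down. When it turns, the current tuple is complete and becomes a spike; the parity h of the number of spikes is part of the state, because the direction of reading depends on it.\<close>
lemma spike_half:
  assumes sl: "slots U" and h: "h < 2" and x: "length x = k - 1" "set x : good"
    and tau: "4 * tau <= eps0 k"
    and growth: "2 * k * (2 * N) ^ (k - 1) < (1 + eta0 g k) ^ M" and M: "k + M <= eta0 g k * p * N"
  shows "\<exists>F\<subseteq>PiE ({..<k} - {reflect k h 0}) U.
    (\<forall>a\<in>F. a ` ({..<k} - {reflect k h 0}) : good & (\<exists>gs u. length gs mod 2 = h & successively (adj k H) (x # gs @ [u]) &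
       (\<forall>v\<in>set (gs @ [u]). length v = k - 1) & distinct (concat (gs @ [u])) &
       set (concat (gs @ [u])) \<subseteq> (\<Union>i<k. U i) & length (concat (gs @ [u])) <= k + M & rep k (reflect k h) 0 a u)) &
    c0 k * N ^ (k - 1) <= card F & card (PiE ({..<k} - {reflect k h 0}) U - F) < c0 k / 8 ^ (k - 1) * N ^ (k - 1)"
proof -
 define rh where "rh = reflect k"
 define sg where "sg t = rh (t div (k - 1)) (t mod (k - 1))" for t
 have rhk: "rh i s < k" if "s < k" for i s using that by (simp add: rh_def reflect_def)
 have bij: "bij_betw (rh i) {..<k} {..<k}" for i unfolding rh_def by (rule bij_reflect)
 have k2: "2 <= k" "k - 1 > 0" "1 <= k" using k3 by auto
 have k1k: "k - 1 < k" using k3 by simp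
 have sgk: "sg t < k" for t unfolding sg_def using k2(2) k1k mod_less_divisor[of "k - 1" t] by (intro rhk) linarith
 have sg0: "sg 0 = 0" by (simp add: sg_def rh_def reflect_def)
 have rh00: "rh 0 = id" by (simp add: rh_def reflect_def fun_eq_iff)
 obtain b where b: "length b = k - 1" "!!j. j < k - 1 ==> b ! j : U (k - 1 - j)" "win k H (x @ b)" "set (last_of k (x @ b)) : good"
  using extend[OF x, of "k - 1" "%j. U (k - 1 - j)"] slots_Ps[OF sl] k3 by auto
 have lb: "last_of k (x @ b) = b" using b(1) by (simp add: last_of_append last_of_self)
 define g1 where "g1 = rev b"
 have g1l: "length g1 = k - 1" using b(1) by (simp add: g1_def)
 have g1U: "g1 ! j : U (rh 0 (Suc j))" if "j < k - 1" for j
 proof -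
  have "g1 ! j = b ! (k - 1 - Suc j)" using that b(1) by (simp add: g1_def rev_nth)
  moreover have "b ! (k - 1 - Suc j) : U (k - 1 - (k - 1 - Suc j))" using that by (intro b(2)) auto
  moreover have "k - 1 - (k - 1 - Suc j) = Suc j" using that by simp
  ultimately show ?thesis by (simp add: rh00)
 qed
 obtain a0 where a0: "a0 : PiE ({..<k} - {rh 0 0}) U" "rep k (rh 0) 0 a0 g1" using start_state(1)[OF sl bij g1l g1U] by blast
 note dg1 = start_state(2,3)[OF sl bij g1l g1U]
 have im0: "a0 ` ({..<k} - {rh 0 0}) = set g1" using rep_image[OF a0(2) bij] k3 by simp
 have adj1: "adj k H x g1" using b(3) by (simp add: adj_def g1_def)
 define R where "R t a S \<longleftrightarrow> (EX gs u cur. successively (adj k H) (x # gs @ [u]) & (ALL v:set (gs @ [u]). length v = k - 1) &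
   distinct (concat (gs @ [u]) @ cur) & set (concat (gs @ [u]) @ cur) = S & S <= (\<Union>i<k. U i) &
   length cur = t mod (k - 1) & win k H (u @ cur) & length gs mod 2 = t div (k - 1) &
   rep k (rh (t div (k - 1))) (t mod (k - 1)) a (last_of k (u @ cur)))" for t a S
 define q where "q = 2 * (k - 1)"
 have "EX m<=M. ALL t<q. c0 k * N ^ (k - 1) <= card (reach U sg R m t) &
   card (PiE ({..<k} - {sg t}) U - reach U sg R m t) < c0 k / 8 ^ (k - 1) * N ^ (k - 1)"
 proof (rule closure_uniform[where ?a0.0 = a0 and ?S0.0 = "set g1" and U = U and sg = sg and q = q and R = R and M = M, OF sl _ _ sgk _ _ _ _ _ _ _ tau growth M])
  show "q > 0" "q <= 2 * k" using k3 by (auto simp: q_def)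
  show "EX t<q. sg t = i" if i: "i < k" for i
  proof (cases "i = k - 1")
   case True
   have "sg (k - 1) = i" using k2 True by (simp add: sg_def rh_def reflect_def)
   thus ?thesis using k2 by (intro exI[of _ "k - 1"]) (simp add: q_def)
  next
   case False
   hence "i < k - 1" using i by simp
   hence "sg i = i" by (simp add: sg_def rh_def reflect_def)
   thus ?thesis using \<open>i < k - 1\<close> by (intro exI[of _ i]) (simp add: q_def)
  qed
  show "R 0 a0 (set g1)" unfolding R_def
  proof (rule exI[of _ "[]"], rule exI[of _ g1], rule exI[of _ "[]"], intro conjI)
   show "win k H (g1 @ [])" using g1l k3 by (intro win_short) simp
   show "rep k (rh (0 div (k - 1))) (0 mod (k - 1)) a0 (last_of k (g1 @ []))" using a0(2) g1l by (simp add: last_of_self)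
  qed (use adj1 dg1 g1l in \<open>auto simp: successively_Cons\<close>)
  show "card (set g1) <= k" using card_length[of g1] g1l by simp
  show "a0 : PiE ({..<k} - {sg 0}) U" using a0(1) by (simp only: sg0 rh00 id_apply)
  have "set g1 : good" using b(4) lb by (simp add: g1_def)
  thus "a0 ` ({..<k} - {sg 0}) : good" using im0 by (simp only: sg0 rh00 id_apply)
  fix t a S y assume t: "t < q" and a: "a : PiE ({..<k} - {sg t}) U" and R: "R t a S"
   and y: "y : U (sg t)" "y ~: S" and e: "a(sg t := y) : EH U"
  define r where "r = t mod (k - 1)"
  define i where "i = t div (k - 1)"
  have r: "r < k - 1" using k2 by (simp add: r_def)
  have i2: "i < 2" using t k2 by (simp add: i_def q_def less_mult_imp_div_less)
  have st: "sg t = rh i r" by (simp add: sg_def r_def i_def)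
  have tt: "t = i * (k - 1) + r" by (simp only: r_def i_def div_mult_mod_eq)
  obtain gs u cur where G: "successively (adj k H) (x # gs @ [u])" "ALL v:set (gs @ [u]). length v = k - 1"
   "distinct (concat (gs @ [u]) @ cur)" "set (concat (gs @ [u]) @ cur) = S" "S <= (\<Union>i<k. U i)"
   "length cur = r" "win k H (u @ cur)" "length gs mod 2 = i"
   "rep k (rh i) r a (last_of k (u @ cur))" using R unfolding R_def r_def[symmetric] i_def[symmetric] by (elim exE conjE) (rule that)
  have lu: "length u = k - 1" using G(2) by simp
  have len: "k - 1 <= length (u @ cur)" using lu by simp
  have rk: "r mod k = r" using r by simp
  have "(a(sg t := y)) ` {..<k} = insert y (set (last_of k (u @ cur)))" using upd_image[OF sgk[of t], of a y] rep_image[OF G(9) bij k2(3)] unfolding rk st by simp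
  hence "insert y (set (last_of k (u @ cur))) : H" using e by (simp add: EH_def)
  hence w: "win k H (u @ cur @ [y])" using win_snoc'[OF G(7) _ k2(3) len, of y] by simp
  have lo: "last_of k (u @ cur @ [y]) = tl (last_of k (u @ cur)) @ [y]" using last_of_snoc[OF k2(1) len, of y] by simp
  have rs: "rep k (rh i) (Suc r) ((a(sg t := y))(rh i (Suc r mod k) := undefined)) (last_of k (u @ cur @ [y]))" using rep_step[OF G(9) bij k2(1), of y] unfolding lo rk st .
  have S': "insert y S <= (\<Union>i<k. U i)" using G(5) y(1) sgk by blast
  show "R (Suc t mod q) ((a(sg t := y))(sg (Suc t mod q) := undefined)) (insert y S)"
  proof (cases "Suc r < k - 1")
   case True
   have "Suc t = i * (k - 1) + Suc r" using tt by simp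
   moreover have "i * (k - 1) <= 1 * (k - 1)" using i2 by (intro mult_right_mono) auto
   ultimately have "Suc t < q" using True unfolding q_def by linarith
   hence m: "Suc t mod q = Suc t" by simp
   have d: "Suc t div (k - 1) = i" "Suc t mod (k - 1) = Suc r"
    unfolding \<open>Suc t = i * (k - 1) + Suc r\<close> using True k2(2) by (simp_all only: div_mult_self3 mod_mult_self3 div_less mod_less)
   have s': "sg (Suc t) = rh i (Suc r mod k)" using True d by (simp add: sg_def)
   show ?thesis unfolding R_def m d s' by (rule exI[of _ gs], rule exI[of _ u], rule exI[of _ "cur @ [y]"], intro conjI G(1,2,8) rs w S') (use G(3,4,6) y(2) in auto)
  next
   case False
   hence r': "Suc r = k - 1" using r by simp
   have St: "Suc t = (1 + i) * (k - 1)" using tt r' by simp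
   have d: "Suc t mod q div (k - 1) = 1 - i" "Suc t mod q mod (k - 1) = 0"
   proof -
    have "i = 0 | i = 1" using i2 by auto
    hence "Suc t mod q = (if i = 0 then k - 1 else 0)"
     using k2(2) unfolding St q_def by (elim disjE) (simp_all only: one_add_one mod_self add_0_right mult_1 if_True if_False one_neq_zero simp_thms, simp)
    with \<open>i = 0 | i = 1\<close> show "Suc t mod q div (k - 1) = 1 - i" "Suc t mod q mod (k - 1) = 0"
     using k2(2) by (elim disjE; simp)+
   qed
   have refl: "rh (1 - i) s = rh i (k - 1 - s)" if "s < k" for s using i2 that by (cases "i = 0") (auto simp: rh_def reflect_def)
   have s': "sg (Suc t mod q) = rh i (Suc r mod k)" unfolding sg_def d using refl[of 0] k2 r' by simp
   define l where "l = cur @ [y]"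
   have ll: "length l = k - 1" using G(6) r' by (simp add: l_def)
   have lol: "last_of k (u @ cur @ [y]) = l" using ll last_of_append[of k l u] last_of_self[OF ll] by (simp add: l_def)
   have conc: "concat ((gs @ [u]) @ [rev l]) = concat (gs @ [u]) @ rev l" by simp
   have rsl: "rep k (rh i) (k - 1) ((a(sg t := y))(rh i (Suc r mod k) := undefined)) l" using rs unfolding lol r' .
   show ?thesis unfolding R_def d s'
   proof (rule exI[of _ "gs @ [u]"], rule exI[of _ "rev l"], rule exI[of _ "[]"], intro conjI S')
    have "adj k H u (rev l)" using w by (simp add: adj_def l_def)
    hence "successively (adj k H) ((x # gs @ [u]) @ [rev l])"
     unfolding successively_append_iff[of _ "x # gs @ [u]"] using G(1) by simp
    thus "successively (adj k H) (x # (gs @ [u]) @ [rev l])" by simp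
    show "ALL v:set ((gs @ [u]) @ [rev l]). length v = k - 1" using G(2) ll by auto
    have dl: "distinct l" "set l Int set (concat (gs @ [u])) = {}" "set l Un set (concat (gs @ [u])) = insert y S" using G(3,4) y(2) by (auto simp: l_def)
    show "distinct (concat ((gs @ [u]) @ [rev l]) @ [])" unfolding conc using dl(1,2) G(3) by auto
    show "set (concat ((gs @ [u]) @ [rev l]) @ []) = insert y S" unfolding conc dl(3)[symmetric] by auto
    show "win k H (rev l @ [])" using ll k3 by (intro win_short) simp
    show "length (gs @ [u]) mod 2 = 1 - i" using G(8) i2 by simp presburger
    have "rep k (rh (1 - i)) 0 ((a(sg t := y))(rh i (Suc r mod k) := undefined)) (rev l)"
     unfolding rep_def
    proof (intro conjI allI impI)
     show "length (rev l) = k - 1" using ll by simp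
     fix j assume j: "j < k - 1"
     hence j': "k - 2 - j < k - 1" by simp
     have "((k - 1) + 1 + (k - 2 - j)) mod k = (k - 2 - j) mod k" using k2 by simp
     also have "... = k - 2 - j" using j' by simp
     finally have m: "((k - 1) + 1 + (k - 2 - j)) mod k = k - 2 - j" .
     have "((a(sg t := y))(rh i (Suc r mod k) := undefined)) (rh i (k - 2 - j)) = l ! (k - 2 - j)" using rsl j' m unfolding rep_def by metis
     moreover have "(0 + 1 + j) mod k = Suc j" using j by simp
     moreover have "rh (1 - i) (Suc j) = rh i (k - 2 - j)" using refl[of "Suc j"] j by (simp add: numeral_2_eq_2)
     moreover have "rev l ! j = l ! (k - 2 - j)"
     proof -
      have "length l - Suc j = k - 2 - j" using ll by simp
      thus ?thesis using rev_nth[of j l] j ll by simp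
     qed
     ultimately show "((a(sg t := y))(rh i (Suc r mod k) := undefined)) (rh (1 - i) ((0 + 1 + j) mod k)) = rev l ! j" by simp
    qed
    thus "rep k (rh (1 - i)) 0 ((a(sg t := y))(rh i (Suc r mod k) := undefined)) (last_of k (rev l @ []))" using ll by (simp add: last_of_self)
   qed simp
  qed
 qed simp_all
 then obtain m where m: "m <= M" "!!t. t < q ==> c0 k * N ^ (k - 1) <= card (reach U sg R m t) &
   card (PiE ({..<k} - {sg t}) U - reach U sg R m t) < c0 k / 8 ^ (k - 1) * N ^ (k - 1)" by blast
 define t where "t = h * (k - 1)"
 have tq: "t < q" using h k2 unfolding t_def q_def by (intro mult_strict_right_mono) auto
 have td: "t div (k - 1) = h" "t mod (k - 1) = 0" using k2 by (simp_all add: t_def)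
 have sgt: "sg t = reflect k h 0" by (simp only: sg_def td rh_def)
 show ?thesis
 proof (intro exI[of _ "reach U sg R m t"] conjI ballI)
  show "reach U sg R m t <= PiE ({..<k} - {reflect k h 0}) U" unfolding sgt[symmetric] reach_def by blast
  show "c0 k * N ^ (k - 1) <= card (reach U sg R m t)" using m(2)[OF tq] by blast
  show "card (PiE ({..<k} - {reflect k h 0}) U - reach U sg R m t) < c0 k / 8 ^ (k - 1) * N ^ (k - 1)"
   unfolding sgt[symmetric] using m(2)[OF tq] by blast
  fix a assume a: "a : reach U sg R m t"
  show "a ` ({..<k} - {reflect k h 0}) : good" unfolding sgt[symmetric] using a unfolding reach_def by blast
  obtain S where S: "R t a S" "finite S" "card S <= k + m" using a unfolding reach_def by blast
  obtain gs u cur where G: "successively (adj k H) (x # gs @ [u])" "ALL v:set (gs @ [u]). length v = k - 1"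
   "distinct (concat (gs @ [u]) @ cur)" "set (concat (gs @ [u]) @ cur) = S" "S <= (\<Union>i<k. U i)"
   "length cur = 0" "win k H (u @ cur)" "length gs mod 2 = h"
   "rep k (rh h) 0 a (last_of k (u @ cur))" using S(1) unfolding R_def td by (elim exE conjE) (rule that)
  have cur: "cur = []" using G(6) by simp
  have lu: "last_of k u = u" using G(2) by (intro last_of_self) simp
  have "rep k (reflect k h) 0 a u" using G(9) lu by (simp add: cur rh_def)
  moreover have "distinct (concat (gs @ [u]))" "set (concat (gs @ [u])) = S" using G(3,4) unfolding cur append_Nil2 by simp_all
  moreover have "length (concat (gs @ [u])) <= k + M" using distinct_card[OF calculation(2)] S(3) m(1) unfolding calculation(3) by linarith
  ultimately show "EX gs u. length gs mod 2 = h & successively (adj k H) (x # gs @ [u]) &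
    (ALL v:set (gs @ [u]). length v = k - 1) & distinct (concat (gs @ [u])) &
    set (concat (gs @ [u])) <= (\<Union>i<k. U i) & length (concat (gs @ [u])) <= k + M & rep k (reflect k h) 0 a u" using G(1,2,5,8) by (intro exI[of _ gs] exI[of _ u] conjI) simp_all
 qed
qed

text \<open>The parities of the two halves can be chosen, which makes the total number of spikes odd.\<close>
lemma connect_spikes:
  assumes slU: "slots U" and slY: "slots Y" and UY: "!!i j. i < k ==> j < k ==> U i ~= Y j"
    and x: "length x = k - 1" "set x : good" and y: "length y = k - 1" "set y : good"
    and tau: "4 * tau <= eps0 k" "2 * tau <= c0 k / 16 ^ k" and c0: "c0 k > 0"
    and growth: "2 * k * (2 * N) ^ (k - 1) < (1 + eta0 g k) ^ M" and M: "k + M <= eta0 g k * p * N"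
  shows "\<exists>gs. odd (length gs) & successively (adj k H) (x # gs @ [y]) & (\<forall>v\<in>set gs. length v = k - 1) &
    distinct (concat gs) & set (concat gs) \<subseteq> (\<Union>i<k. U i) \<union> (\<Union>i<k. Y i) & length (concat gs) <= 2 * (k + M)"
proof -
 have r0: "reflect k 0 0 = 0" "reflect k 1 0 = k - 1" and r00: "reflect k 0 = id" by (simp_all add: reflect_def fun_eq_iff)
 have h: "(0::nat) < 2" "(1::nat) < 2" by auto
 obtain F where F: "F <= PiE ({..<k} - {0}) U" "ALL a:F. a ` ({..<k} - {0}) : good &
    (EX gs u. length gs mod 2 = 0 & successively (adj k H) (x # gs @ [u]) &
    (ALL v:set (gs @ [u]). length v = k - 1) & distinct (concat (gs @ [u])) &
    set (concat (gs @ [u])) <= (\<Union>i<k. U i) & length (concat (gs @ [u])) <= k + M & rep k (reflect k 0) 0 a u)"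
   "c0 k * N ^ (k - 1) <= card F" using spike_half[OF slU h(1) x tau(1) growth M] unfolding r0 by (elim exE conjE) (rule that)
 obtain Hs where Hs: "ALL a:Hs. a ` ({..<k} - {k - 1}) : good &
    (EX gs u. length gs mod 2 = 1 & successively (adj k H) (y # gs @ [u]) &
    (ALL v:set (gs @ [u]). length v = k - 1) & distinct (concat (gs @ [u])) &
    set (concat (gs @ [u])) <= (\<Union>i<k. Y i) & length (concat (gs @ [u])) <= k + M & rep k (reflect k 1) 0 a u)"
   "card (PiE ({..<k} - {k - 1}) Y - Hs) < c0 k / 8 ^ (k - 1) * N ^ (k - 1)" using spike_half[OF slY h(2) y tau(1) growth M] unfolding r0 by (elim exE conjE) (rule that)
 have Fg: "a ` ({..<k} - {0}) : good" if "a : F" for a using bspec[OF F(2) that] by (rule conjunct1)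
 obtain a h where ah: "a : F" "h : Hs" "!!l. l < k - 1 ==> h ` {..l} Un a ` {Suc l..<k} : H" using join[OF slU slY UY F(1) Fg c0 tau(2) F(3) Hs(2)] by blast
 obtain gs u where A: "length gs mod 2 = 0" "successively (adj k H) (x # gs @ [u])" "ALL v:set (gs @ [u]). length v = k - 1"
   "distinct (concat (gs @ [u]))" "set (concat (gs @ [u])) <= (\<Union>i<k. U i)" "length (concat (gs @ [u])) <= k + M" "rep k (reflect k 0) 0 a u"
  using bspec[OF F(2) ah(1), THEN conjunct2] by (elim exE conjE) (rule that)
 obtain gs' u' where B: "length gs' mod 2 = 1" "successively (adj k H) (y # gs' @ [u'])" "ALL v:set (gs' @ [u']). length v = k - 1"
   "distinct (concat (gs' @ [u']))" "set (concat (gs' @ [u'])) <= (\<Union>i<k. Y i)" "length (concat (gs' @ [u'])) <= k + M" "rep k (reflect k 1) 0 h u'"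
  using bspec[OF Hs(1) ah(2), THEN conjunct2] by (elim exE conjE) (rule that)
 have len: "length u = k - 1" "length u' = k - 1" using A(3) B(3) by auto
 have "win k H (u @ rev u')"
 proof (rule rep_join[OF A(7)[unfolded r00] _ _ ah(3)])
  fix j assume j: "j < k - 1"
  hence "k - 2 - j < k - 1" by simp
  hence "h (reflect k 1 (Suc (k - 2 - j))) = u' ! (k - 2 - j)" using B(7) by (simp add: rep_def)
  moreover have "reflect k 1 (Suc (k - 2 - j)) = j" using j by (auto simp: reflect_def)
  moreover have "rev u' ! j = u' ! (k - 2 - j)"
  proof -
   have "length u' - Suc j = k - 2 - j" using len by simp
   thus ?thesis using rev_nth[of j u'] j len by simp
  qed
  ultimately show "h j = rev u' ! j" by simp
 qed (use len in auto)
 hence uu: "adj k H u u'" by (simp add: adj_def)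
 define G' where "G' = rev (gs' @ [u'])"
 define G where "G = (gs @ [u]) @ G'"
 have G': "G' = u' # rev gs'" by (simp add: G'_def)
 have "(%x y. adj k H y x) = adj k H" using adj_sym[of k H] by (intro ext) metis
 hence "successively (adj k H) (rev (y # gs' @ [u']))" using B(2) by (simp only: successively_rev)
 hence s2: "successively (adj k H) (G' @ [y])" by (simp add: G'_def)
 have hd_adj: "adj k H (last (x # gs @ [u])) (hd (G' @ [y]))" using uu by (simp add: G')
 have sc: "successively (adj k H) ((x # gs @ [u]) @ (G' @ [y]))" by (rule iffD2[OF successively_append_iff]) (intro conjI disjI2 A(2) s2 hd_adj)
 have oddG: "odd (length G)" using A(1) B(1) by (simp add: G_def G'_def) presburger
 have "mset (concat G') = mset (concat (gs' @ [u']))"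
  unfolding G'_def by (simp add: mset_concat rev_map[symmetric])
 hence cG': "set (concat G') = set (concat (gs' @ [u']))" "distinct (concat G')" "length (concat G') = length (concat (gs' @ [u']))"
  using B(4) mset_eq_imp_distinct_iff mset_eq_setD mset_eq_length by blast+
 have disj: "set (concat (gs @ [u])) Int set (concat G') = {}"
 proof (rule ccontr)
  assume "set (concat (gs @ [u])) Int set (concat G') ~= {}"
  then obtain v i j where v: "i < k" "j < k" "v : U i" "v : Y j" using A(5) B(5) cG'(1) by blast
  thus False using Ps_disj[OF slots_Ps[OF slU v(1)] slots_Ps[OF slY v(2)] UY[OF v(1,2)]] by blast
 qed
 have cG: "concat G = concat (gs @ [u]) @ concat G'" by (simp add: G_def)
 show ?thesis
 proof (intro exI[of _ G] conjI)
  show "ALL v:set G. length v = k - 1" using A(3) B(3) by (auto simp: G_def G'_def)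
  show "set (concat G) <= (\<Union>i<k. U i) Un (\<Union>i<k. Y i)" using A(5) B(5) cG'(1) unfolding cG set_append by blast
  show "length (concat G) <= 2 * (k + M)" using add_mono[OF A(6) B(6)] unfolding cG length_append[of "concat (gs @ [u])"] cG'(3) mult_2 .
  show "distinct (concat G)" unfolding cG distinct_append using A(4) cG'(2) disj by blast
  show "successively (adj k H) (x # G @ [y])" using sc by (simp add: G_def)
 qed (rule oddG)
qed

end

section \<open>Solving many connection problems disjointly\<close>

text \<open>Choose a maximal family of disjointly solved problems. Its vertices form a small set W, so by hypothesis at most half of the problems cannot be solved outside W; all others are in the family already.\<close>
lemma one_round:
  fixes sol :: "'i => 's => bool" and fp :: "'s => 'a set"
  assumes I: "finite I" and finfp: "!!i s. i : I ==> sol i s ==> finite (fp s)"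
    and step: "!!W. W \<subseteq> Z ==> finite W ==> card W <= l * card I ==>
      2 * card {i : I. \<not> (\<exists>s. sol i s & fp s \<subseteq> Z - W & card (fp s) <= l)} <= card I"
  shows "\<exists>J\<subseteq>I. \<exists>f. (\<forall>i\<in>J. sol i (f i) & fp (f i) \<subseteq> Z & card (fp (f i)) <= l) &
      (\<forall>i\<in>J. \<forall>j\<in>J. i ~= j --> fp (f i) \<inter> fp (f j) = {}) & 2 * card (I - J) <= card I"
proof -
 define P where "P J \<longleftrightarrow> J <= I & (EX f. (ALL i:J. sol i (f i) & fp (f i) <= Z & card (fp (f i)) <= l) &
   (ALL i:J. ALL j:J. i ~= j --> fp (f i) Int fp (f j) = {}))" for J
 have "P {}" by (simp add: P_def)
 moreover have "ALL J. P J --> card J < Suc (card I)" using card_mono[OF I] by (auto simp: P_def less_Suc_eq_le)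
 ultimately obtain J where J: "P J" and max: "!!J'. P J' ==> card J' <= card J" using ex_has_greatest_nat[of P "{}" card "Suc (card I)"] by blast
 have JI: "J <= I" using J by (simp add: P_def)
 have finJ: "finite J" using JI I by (rule finite_subset)
 obtain f where f0: "ALL i:J. sol i (f i) & fp (f i) <= Z & card (fp (f i)) <= l"
   and dj0: "ALL i:J. ALL j:J. i ~= j --> fp (f i) Int fp (f j) = {}"
  using J unfolding P_def by (elim conjE exE) (rule that)
 have f: "sol i (f i)" "fp (f i) <= Z" "card (fp (f i)) <= l" if "i : J" for i using f0 that by auto
 have dj: "fp (f i) Int fp (f j) = {}" if "i : J" "j : J" "i ~= j" for i j using dj0 that by simp
 define W where "W = (\<Union>i\<in>J. fp (f i))"
 have W: "W <= Z" "finite W" using f finfp JI finJ by (auto simp: W_def)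
 have "card W <= (\<Sum>i\<in>J. card (fp (f i)))" unfolding W_def by (rule card_UN_le[OF finJ])
 also have "... <= (\<Sum>i\<in>J. l)" by (intro sum_mono f)
 also have "... <= l * card I" using card_mono[OF I JI] by simp
 finally have cW: "card W <= l * card I" .
 have "I - J <= {i : I. ~ (EX s. sol i s & fp s <= Z - W & card (fp s) <= l)}"
 proof
  fix i assume i: "i : I - J"
  have "~ (EX s. sol i s & fp s <= Z - W & card (fp s) <= l)"
  proof
   assume "EX s. sol i s & fp s <= Z - W & card (fp s) <= l"
   then obtain s where s: "sol i s" "fp s <= Z - W" "card (fp s) <= l" by blast
   have "fp s Int fp (f j) = {}" if "j : J" for j using s(2) that by (auto simp: W_def)
   hence dj': "ALL a:insert i J. ALL b:insert i J. a ~= b --> fp ((f(i := s)) a) Int fp ((f(i := s)) b) = {}" using dj i by (auto simp: Int_commute)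
   have sl': "ALL a:insert i J. sol a ((f(i := s)) a) & fp ((f(i := s)) a) <= Z & card (fp ((f(i := s)) a)) <= l" using f s i by auto
   have "insert i J <= I" using i JI by simp
   with dj' sl' have "P (insert i J)" unfolding P_def by (intro conjI exI[of _ "f(i := s)"])
   hence "card (insert i J) <= card J" by (rule max)
   thus False using i finJ by simp
  qed
  thus "i : {i : I. ~ (EX s. sol i s & fp s <= Z - W & card (fp s) <= l)}" using i by simp
 qed
 hence "card (I - J) <= card {i : I. ~ (EX s. sol i s & fp s <= Z - W & card (fp s) <= l)}" using I by (intro card_mono) auto
 hence "2 * card (I - J) <= card I" using step[OF W cW] by linarith
 with JI f0 dj0 show ?thesis by (intro exI[of _ J] conjI exI[of _ f])
qed

text \<open>Each round at least halves the number of unsolved problems and uses its own set Z j.\<close>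
lemma rounds:
  fixes sol :: "'i => 's => bool" and fp :: "'s => 'a set" and Z :: "nat => 'a set"
  assumes I: "finite I" and finfp: "!!i s. i : I ==> sol i s ==> finite (fp s)"
    and disj: "!!i j. i < K ==> j < K ==> i ~= j ==> Z i \<inter> Z j = {}"
    and step: "!!j I' W. j < K ==> I' \<subseteq> I ==> W \<subseteq> Z j ==> finite W ==> card W <= l * card I' ==>
      2 * card {i : I'. \<not> (\<exists>s. sol i s & fp s \<subseteq> Z j - W & card (fp s) <= l)} <= card I'"
    and K: "card I < 2 ^ K"
  shows "\<exists>f. (\<forall>i\<in>I. sol i (f i) & fp (f i) \<subseteq> (\<Union>j<K. Z j) & card (fp (f i)) <= l) &
      (\<forall>i\<in>I. \<forall>j\<in>I. i ~= j --> fp (f i) \<inter> fp (f j) = {})" using assms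
proof (induction K arbitrary: I)
 case 0
 thus ?case by simp
next
 case (Suc K)
 have "\<exists>J\<subseteq>I. EX f. (ALL i:J. sol i (f i) & fp (f i) <= Z K & card (fp (f i)) <= l) &
   (ALL i:J. ALL j:J. i ~= j --> fp (f i) Int fp (f j) = {}) & 2 * card (I - J) <= card I"
 proof (rule one_round[OF Suc.prems(1)])
  show "finite (fp s)" if "i : I" "sol i s" for i s using Suc.prems(2)[OF that] .
  fix W assume "W <= Z K" "finite W" "card W <= l * card I"
  thus "2 * card {i : I. ~ (EX s. sol i s & fp s <= Z K - W & card (fp s) <= l)} <= card I" by (rule Suc.prems(4)[OF lessI order_refl])
 qed
 then obtain J f where J: "J <= I" and f: "ALL i:J. sol i (f i) & fp (f i) <= Z K & card (fp (f i)) <= l"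
   "ALL i:J. ALL j:J. i ~= j --> fp (f i) Int fp (f j) = {}" and half: "2 * card (I - J) <= card I" by (elim conjE exE) (rule that)
 have lt: "card (I - J) < 2 ^ K" using half Suc.prems(5) by simp
 have "EX f. (ALL i:I-J. sol i (f i) & fp (f i) <= (\<Union>j<K. Z j) & card (fp (f i)) <= l) &
   (ALL i:I-J. ALL j:I-J. i ~= j --> fp (f i) Int fp (f j) = {})"
 proof (rule Suc.IH[OF _ _ _ _ lt])
  show "finite (I - J)" using Suc.prems(1) by simp
  show "!!i s. i : I - J ==> sol i s ==> finite (fp s)" using Suc.prems(2) by blast
  show "!!i j. i < K ==> j < K ==> i ~= j ==> Z i Int Z j = {}" using Suc.prems(3) less_SucI by blast
  fix j I' W assume a: "j < K" "I' <= I - J" "W <= Z j" "finite W" "card W <= l * card I'"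
  show "2 * card {i : I'. ~ (EX s. sol i s & fp s <= Z j - W & card (fp s) <= l)} <= card I'" by (rule Suc.prems(4)) (use a in auto)
 qed
 then obtain h where h: "ALL i:I-J. sol i (h i) & fp (h i) <= (\<Union>j<K. Z j) & card (fp (h i)) <= l"
   "ALL i:I-J. ALL j:I-J. i ~= j --> fp (h i) Int fp (h j) = {}" by (elim conjE exE) (rule that)
 define F where "F i = (if i : J then f i else h i)" for i
 have cross: "fp (f i) Int fp (h j) = {}" if "i : J" "j : I - J" for i j
 proof -
  have "fp (f i) <= Z K" "fp (h j) <= (\<Union>j<K. Z j)" using f(1) h(1) that by auto
  moreover have "Z K Int (\<Union>j<K. Z j) = {}"
  proof -
   have "Z K Int Z j = {}" if "j < K" for j using Suc.prems(3)[of K j] that by simp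
   thus ?thesis by auto
  qed
  ultimately show ?thesis by blast
 qed
 show ?case
 proof (intro exI[of _ F] conjI ballI impI)
  fix i assume i: "i : I"
  show "sol i (F i)" using f(1) h(1) i by (auto simp: F_def)
  show "card (fp (F i)) <= l" using f(1) h(1) i by (auto simp: F_def)
  show "fp (F i) <= (\<Union>j<Suc K. Z j)"
  proof (cases "i : J")
   case True hence "fp (F i) <= Z K" using f(1) by (simp add: F_def)
   thus ?thesis by (simp add: lessThan_Suc le_supI1)
  next
   case False hence "fp (F i) <= (\<Union>j<K. Z j)" using h(1) i by (simp add: F_def)
   thus ?thesis by (simp add: lessThan_Suc le_supI2)
  qed
  fix j assume j: "j : I" "i ~= j"
  show "fp (F i) Int fp (F j) = {}" using f(2) h(2) cross i j by (cases "i : J"; cases "j : J") (simp_all add: F_def Int_commute)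
 qed
qed

lemma c0_pos: "k >= 1 ==> c0 k > 0"
 by (simp add: c0_def)

lemma c0_le1: assumes "k >= 1" shows "c0 k <= 1"
proof -
 have "1 <= real k ^ 3" using assms by (intro one_le_power) simp
 hence "1 <= 64 * real k ^ 3" by linarith
 hence "1 / (64 * real k ^ 3) <= 1" by (simp only: divide_le_eq_1) auto
 thus ?thesis unfolding c0_def by (intro power_le_one) auto
qed

lemma eps0_bounds: assumes "k >= 1" shows "eps0 k > 0" "eps0 k <= 1" "eps0 k <= c0 k / 16 ^ k"
proof -
 show "eps0 k > 0" using c0_pos[OF assms] assms by (simp add: eps0_def)
 have c: "0 < c0 k" "c0 k <= 1" using c0_pos c0_le1 assms by auto
 have "(16::real) ^ k <= 32 ^ k" by (intro power_mono) auto
 moreover have "(32::real) ^ k <= k * 32 ^ k" using assms mult_right_mono[of 1 "real k" "32 ^ k"] by simp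
 ultimately have "(16::real) ^ k <= k * 32 ^ k" by linarith
 moreover have "c0 k * c0 k <= c0 k * 1" using c by (intro mult_left_mono) auto
 ultimately show le: "eps0 k <= c0 k / 16 ^ k"
  unfolding eps0_def power2_eq_square using c by (intro frac_le) auto
 have "(1::real) <= 16 ^ k" by (rule one_le_power) simp
 hence "c0 k <= 16 ^ k" using c by linarith
 hence "c0 k / 16 ^ k <= 1" by (simp add: divide_le_eq)
 thus "eps0 k <= 1" using le by linarith
qed

lemma eta0_bounds: assumes "k >= 1" "0 < g" "g <= 1" shows "eta0 g k > 0" "eta0 g k <= eps0 k / 4" "eta0 g k <= 1"
proof -
 note e = eps0_bounds[OF assms(1)]
 show "eta0 g k > 0" using e assms by (simp add: eta0_def)
 have "(eps0 k)^2 * g^2 <= eps0 k * 1" using e assms mult_left_mono[OF e(2), of "eps0 k"] by (intro mult_mono power_le_one) (auto simp: power2_eq_square)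
 moreover have "1 <= (real k)^2" using assms(1) by (intro one_le_power) simp
 hence "4 <= 1600 * (real k)^2" by linarith
 ultimately show le: "eta0 g k <= eps0 k / 4" unfolding eta0_def using e by (intro frac_le) auto
 show "eta0 g k <= 1" using le e by linarith
qed

locale host = pseudorandom V k p L g G
  for V :: "'a set" and k :: nat and p L g :: real and G :: "'a set set" +
  fixes E :: "'a set set"
  assumes EG: "E \<subseteq> G"
begin

text \<open>A part behaves like a random subset of expected size N.\<close>
definition fair :: "real => 'a set => bool" where
  "fair (N::real) X \<longleftrightarrow> X \<subseteq> V & N / 2 <= card X & card X <= (1 + g/8) * N &
     (\<forall>a\<in>nsets V (k - 1). (1/2 + 3 * g / 2) * p * N <= deg E a X & deg G a X <= 3 * p * N)"

text \<open>The conditions on the part size N and the path length M under which connections of length about M exist between parts.\<close>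
definition scale :: "real => nat => bool" where
  "scale (N::real) M \<longleftrightarrow> N > 0 & 256 * real k ^ 3 * L * (k + M) <= g * eta0 g k * p * N &
     L * card V <= eta0 g k * p * N ^ 2 & 2 * real k * (2 * N) ^ (k - 1) < (1 + eta0 g k) ^ M"

lemma scaleD:
  assumes "scale N M"
  shows "N > 0" "k + M <= eta0 g k * p * N" "L <= eps0 k / 4 * p * N" "L * card V <= eps0 k / 4 * p * N^2"
    "real (2 * k) * (2 * N) ^ (k - 1) < (1 + eta0 g k) ^ M" "128 * k * L * (k + M) <= g * p * N / (2 * k)"
    "16 * real k ^ 2 * L <= g * p * N / (2 * k)" "32 * real k ^ 2 * L <= g * (eps0 k / 4) * p * N"
proof -
 have k1: "k >= 1" and kr: "real k >= 3" using k3 by auto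
 note e = eps0_bounds[OF k1] and h = eta0_bounds[OF k1 g0 order_trans[OF g1]]
 have h: "eta0 g k > 0" "eta0 g k <= eps0 k / 4" "eta0 g k <= 1" using eta0_bounds[OF k1 g0] g1 by auto
 show N: "N > 0" and "real (2 * k) * (2 * N) ^ (k - 1) < (1 + eta0 g k) ^ M" using assms by (auto simp: scale_def)
 have pN: "p * N > 0" using p0 N by simp
 have A: "256 * real k ^ 3 * L * (k + M) <= g * eta0 g k * p * N" using assms by (simp add: scale_def)
 have k3p: "real k ^ 3 >= 1" "real k ^ 3 >= real k ^ 2" "real k ^ 2 >= 1" using kr by (auto intro: one_le_power power_increasing)
 have kM: "real (k + M) >= 1" "real (k + M) >= real k" using k1 by auto
 have c1: "256 * (1::real) * 1 * (k + M) <= 256 * real k ^ 3 * L * (k + M)" using k3p L1 by (intro mult_right_mono mult_mono) auto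
 have c2: "256 * 1 * L * (1::real) <= 256 * real k ^ 3 * L * (k + M)" using k3p L1 kM by (intro mult_mono) auto
 have "g * (eta0 g k * (p * N)) <= 1 * (eta0 g k * (p * N))" using g1 h pN by (intro mult_right_mono) auto
 hence g_le: "g * eta0 g k * p * N <= eta0 g k * p * N" by (simp only: mult_1 mult.assoc)
 have "real (k + M) <= 256 * 1 * 1 * real (k + M)" by simp
 also note c1 also note A also note g_le
 finally show "k + M <= eta0 g k * p * N" .
 have ge: "eta0 g k * (p * N) <= eps0 k / 4 * (p * N)" using h pN by (intro mult_right_mono) auto
 hence ge': "eta0 g k * p * N <= eps0 k / 4 * p * N" by (simp only: mult.assoc)
 have "L <= 256 * 1 * L * 1" using L1 by simp
 also note c2 also note A also note g_le also note ge'
 finally show "L <= eps0 k / 4 * p * N" .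
 have "eta0 g k * (p * N^2) <= eps0 k / 4 * (p * N^2)" using h p0 by (intro mult_right_mono) auto
 thus "L * card V <= eps0 k / 4 * p * N^2" using assms by (simp add: scale_def mult_ac)
 have hp: "g * eta0 g k * p * N <= g * 1 * p * N" using h g0 pN by (simp add: mult_left_mono mult_right_mono p0 N less_imp_le)
 have big: "256 * real k ^ 3 * L * (k + M) <= g * p * N" using A hp by simp
 have kk: "0 < 2 * real k" using k1 by simp
 have "128 * k * L * (k + M) * (2 * k) = 256 * real k ^ 2 * L * (k + M)" by (simp add: power2_eq_square)
 also have "... <= 256 * real k ^ 3 * L * (k + M)" using k3p L1 by (intro mult_right_mono) auto
 also have "... <= g * p * N" by (rule big)
 finally show "128 * k * L * (k + M) <= g * p * N / (2 * k)" using kk by (simp add: pos_le_divide_eq)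
 have "16 * real k ^ 2 * L * (2 * k) = 32 * real k ^ 3 * L * 1" by (simp add: power2_eq_square power3_eq_cube)
 also have "... <= 256 * real k ^ 3 * L * (k + M)" using k3p L1 kM by (intro mult_mono) auto
 also have "... <= g * p * N" by (rule big)
 finally show "16 * real k ^ 2 * L <= g * p * N / (2 * k)" using kk by (simp add: pos_le_divide_eq)
 have "32 * real k ^ 2 * L = 32 * real k ^ 2 * L * 1" by simp
 also have "... <= 256 * real k ^ 3 * L * (k + M)" using k3p L1 kM by (intro mult_mono) auto
 also have "... <= g * (eta0 g k * (p * N))" using A by (simp add: mult_ac)
 also have "... <= g * (eps0 k / 4 * (p * N))" using ge g0 by (intro mult_left_mono) auto
 finally show "32 * real k ^ 2 * L <= g * (eps0 k / 4) * p * N" by (simp add: mult_ac)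
qed

text \<open>Remove the sets spoiled by W together with W itself. Every remaining good set loses less than g p N / 2 of its degree into a part, the difference between the lower bounds in fair and in world.\<close>
lemma world_exists:
  assumes sc: "scale N M" and fair: "!!X. X : \<X> ==> fair N X"
    and disj: "!!X Y. X : \<X> ==> Y : \<X> ==> X ~= Y ==> X \<inter> Y = {}"
    and W: "W \<subseteq> V" "card W <= g * N / (8 * real k ^ 2)"
  shows "\<exists>D\<subseteq>nsets V (k - 1). card D * (g * p * N / (2 * k)) <= 16 * k * L * card W &
    world V k p L g G {e : E. \<forall>x\<in>e. e - {x} \<notin> D} (nsets V (k - 1) - D) N (eps0 k / 4) ((%X. X - W) ` \<X>)"
proof -
 note s = scaleD[OF sc]
 define d where "d = g * p * N / (2 * k)"
 have kr: "real k >= 3" using k3 by simp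
 have d0: "d > 0" using g0 p0 s(1) kr by (simp add: d_def)
 have cw: "4 * k * p * card W <= d"
 proof -
  have "4 * k * p * card W <= 4 * k * p * (g * N / (8 * real k ^ 2))" using W(2) p0 by (intro mult_left_mono) auto
  also have "... = d" using kr by (simp add: d_def power2_eq_square)
  finally show ?thesis .
 qed
 have cw2: "64 * k ^ 2 * L * p * card W <= d ^ 2"
 proof -
  have "64 * k ^ 2 * L * p * card W = 16 * k * L * (4 * k * p * card W)" by (simp add: power2_eq_square)
  also have "... <= 16 * k * L * d" using cw L1 by (intro mult_left_mono) auto
  also have "... <= d * d"
  proof (rule mult_right_mono)
   have "16 * real k * L * 1 <= 16 * real k * L * k" using kr L1 by (intro mult_left_mono) auto
   also have "... = 16 * real k ^ 2 * L" by (simp add: power2_eq_square)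
   also have "... <= d" using s(7) by (simp only: d_def)
   finally show "real (16 * k) * L <= d" by simp
  qed (use d0 in simp)
  finally show ?thesis by (simp add: power2_eq_square)
 qed
 obtain D where D: "D <= nsets V (k - 1)" "card D * d <= 16 * k * L * card W"
   "!!a. a : nsets V (k - 1) - D ==> deg G a W < d"
   "!!a x. a : nsets V (k - 1) - D ==> x : a ==> deg G a {y : V. insert y (a - {x}) : D} < d" using infection[OF W(1) s(7)[folded d_def] cw cw2] by blast
 define H where "H = {e : E. ALL x:e. e - {x} ~: D}"
 define good where "good = nsets V (k - 1) - D"
 have EV: "E <= nsets V k" using EG GV by blast
 have cWN: "card W <= N"
 proof -
  have "1 <= (real k)^2" using kr by (intro one_le_power) simp
  hence "1 <= 8 * (real k)^2" by linarith
  moreover have "g * N <= 1 * N" using g1 s(1) by (intro mult_right_mono) auto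
  ultimately have "g * N / (8 * real k ^ 2) <= N / 1" using s(1) by (intro frac_le) auto
  thus ?thesis using W(2) by simp
 qed
 have finW: "finite W" using W(1) by (rule finite_sub)
 have "world V k p L g G H good N (eps0 k / 4) ((%X. X - W) ` \<X>)"
 proof
  show "H <= G" using EG by (auto simp: H_def)
  show "good <= nsets V (k - 1)" by (auto simp: good_def)
  show "e - {x} : good" if "e : H" "x : e" for e x using that EV by (auto simp: H_def good_def nsets_def)
  show "X <= V" if "X : (%X. X - W) ` \<X>" for X using that fair by (auto simp: fair_def)
  show "X Int Y = {}" if "X : (%X. X - W) ` \<X>" "Y : (%X. X - W) ` \<X>" "X ~= Y" for X Y
  proof -
   obtain X' Y' where XY: "X' : \<X>" "Y' : \<X>" "X = X' - W" "Y = Y' - W" using \<open>X : _\<close> \<open>Y : _\<close> by blast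
   hence "X' ~= Y'" using \<open>X ~= Y\<close> by blast
   thus ?thesis using disj XY by blast
  qed
  show "card X <= (1 + g/8) * N" if XW: "X : (%X. X - W) ` \<X>" for X
  proof -
   obtain X' where X': "X' : \<X>" "X = X' - W" using XW by blast
   have "finite X'" using fair[OF X'(1)] finite_sub by (simp add: fair_def)
   hence "card X <= card X'" unfolding X'(2) by (intro card_mono) auto
   thus ?thesis using fair[OF X'(1)] by (simp add: fair_def)
  qed
  show "deg G a X <= 3 * p * N" if a: "a : nsets V (k - 1)" and XW: "X : (%X. X - W) ` \<X>" for a X
  proof -
   obtain X' where X': "X' : \<X>" "X = X' - W" using XW by blast
   have "finite X'" using fair[OF X'(1)] finite_sub by (simp add: fair_def)
   hence "deg G a X <= deg G a X'" unfolding X'(2) by (intro deg_mono) auto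
   also have "deg G a X' <= 3 * p * N" using fair[OF X'(1)] a by (simp add: fair_def)
   finally show ?thesis by simp
  qed
  show "(1/2 + g) * p * N <= deg H a X" if a: "a : good" and X: "X : (%X. X - W) ` \<X>" for a X
  proof -
   obtain X' where X': "X' : \<X>" "X = X' - W" using X by blast
   have X'V: "X' <= V" and finX': "finite X'" using fair[OF X'(1)] finite_sub by (auto simp: fair_def)
   have aN: "a : nsets V (k - 1)" "a ~: D" using a by (auto simp: good_def)
   have fina: "finite a" and carda: "card a = k - 1" using aN(1) by (auto simp: nsets_def)
   define A where "A = {y : X. insert y a : H}"
   define B where "B = {y : W. insert y a : G}"
   define C where "C x = {y : {y : V. insert y (a - {x}) : D}. insert y a : G}" for x
   have "{y : X'. insert y a : E} <= A Un B Un (\<Union>x\<in>a. C x)"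
   proof
    fix y assume y: "y : {y : X'. insert y a : E}"
    have "card (insert y a) = k" using y EV by (auto simp: nsets_def)
    hence ya: "y ~: a" using carda k3 by (auto simp: insert_absorb)
    show "y : A Un B Un (\<Union>x\<in>a. C x)"
    proof (rule ccontr)
     assume no: "y ~: A Un B Un (\<Union>x\<in>a. C x)"
     hence yW: "y ~: W" using y EG by (auto simp: B_def)
     have "insert y a - {x} ~: D" if x: "x : insert y a" for x
     proof (cases "x = y")
      case True thus ?thesis using aN(2) ya by simp
     next
      case False
      hence "x : a" using x by simp
      hence "y ~: C x" using no by blast
      hence "insert y (a - {x}) ~: D" using y X'V EG by (auto simp: C_def)
      thus ?thesis using False by (simp add: insert_Diff_if)
     qed
     hence "insert y a : H" using y by (simp add: H_def)
     thus False using no y yW X'(2) by (auto simp: A_def)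
    qed
   qed
   moreover have finABC: "finite (A Un B Un (\<Union>x\<in>a. C x))" using finX' finW fina finV X'(2) by (auto simp: A_def B_def C_def)
   ultimately have "card {y : X'. insert y a : E} <= card (A Un B Un (\<Union>x\<in>a. C x))" by (intro card_mono)
   also have "... <= card (A Un B) + card (\<Union>x\<in>a. C x)" by (rule card_Un_le)
   also have "... <= card A + card B + (\<Sum>x\<in>a. card (C x))" by (intro add_mono card_Un_le card_UN_le[OF fina])
   finally have "real (deg E a X') <= real (card A + card B + (\<Sum>x\<in>a. card (C x)))"
    unfolding deg_def by (rule of_nat_mono)
   also have "... = deg H a X + deg G a W + (\<Sum>x\<in>a. real (deg G a {y : V. insert y (a - {x}) : D}))" by (simp add: deg_def A_def B_def C_def)
   also have "... <= deg H a X + d + (\<Sum>x\<in>a. d)" using D(3,4)[of a] a unfolding good_def by (intro add_mono sum_mono order_refl less_imp_le) auto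
   also have "... = deg H a X + k * d" using carda k3 by (simp add: algebra_simps of_nat_diff)
   finally have "(1/2 + 3 * g / 2) * p * N <= deg H a X + k * d" using fair[OF X'(1)] aN(1) unfolding fair_def by (meson order_trans)
   moreover have "k * d = g * p * N / 2" using kr by (simp add: d_def)
   ultimately show ?thesis by (simp add: algebra_simps)
  qed
  have "card (nsets V (k - 1) - good) * d <= card D * d"
  proof -
   have "nsets V (k - 1) - good = D" using D(1) by (auto simp: good_def)
   thus ?thesis by simp
  qed
  also have "... <= 16 * k * L * N" using D(2) cWN L1 by (meson mult_left_mono order_trans of_nat_0_le_iff mult_nonneg_nonneg zero_le_numeral zero_le_one)
  also have "... <= (eps0 k / 4 * N) * d"
  proof -
   have "(32 * real k ^ 2 * L) * (N / (2 * k)) <= (g * (eps0 k / 4) * p * N) * (N / (2 * k))" using s(8) s(1) kr by (intro mult_right_mono) auto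
   moreover have "(32 * real k ^ 2 * L) * (N / (2 * k)) = 16 * k * L * N" using kr by (simp add: power2_eq_square)
   ultimately show ?thesis by (simp add: d_def mult_ac)
  qed
  finally show "card (nsets V (k - 1) - good) <= eps0 k / 4 * N" using d0 by (rule mult_right_le_imp_le)
  show "0 < N" by (rule s(1))
  show "0 < eps0 k / 4" using eps0_bounds(1)[of k] k3 by simp
  show "L <= eps0 k / 4 * p * N" by (rule s(3))
  show "L * card V <= eps0 k / 4 * p * N^2" by (rule s(4))
 qed
 thus ?thesis using D(1,2) by (auto simp: H_def good_def d_def)
qed

end

context host begin

lemma fair_nonempty: "fair N X ==> card W < N / 2 ==> finite W ==> X - W ~= {}"
proof
 assume a: "fair N X" "card W < N / 2" "finite W" "X - W = {}"
 hence "card X <= card W" by (intro card_mono) auto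
 thus False using a(1,2) by (simp add: fair_def)
qed

text \<open>In each of K rounds 2k of the parts are used. A request is blocked only if one of its two end tuples is spoiled, and there are few spoiled sets; as the end tuples are distinct, this is at most half of the requests that are left.\<close>
lemma many_connections:
  fixes sol :: "'a list => 'a list => 's => bool" and fp :: "'s => 'a set" and Z :: "nat => 'a set"
    and x y :: "'i => 'a list"
  assumes sc: "scale N M"
    and conn: "!!H good Ps U Y x y. [|world V k p L g G H good N (eps0 k / 4) Ps; H \<subseteq> E;
        !!i. i < k ==> U i : Ps & Y i : Ps; !!i j. i < k ==> j < k ==> i ~= j ==> U i ~= U j & Y i ~= Y j;
        !!i j. i < k ==> j < k ==> U i ~= Y j; length x = k - 1; set x : good; length y = k - 1; set y : good|]
      ==> \<exists>s. sol x y s & fp s \<subseteq> (\<Union>i<k. U i) \<union> (\<Union>i<k. Y i) & card (fp s) <= 2 * (k + M)"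
    and fpfin: "!!x y s. sol x y s ==> finite (fp s)"
    and Z: "!!j. j < 2 * k * K ==> fair N (Z j)" "!!i j. i < 2 * k * K ==> j < 2 * k * K ==> i ~= j ==> Z i \<inter> Z j = {}"
    and I: "finite I" "card I < 2 ^ K" "2 * (k + M) * card I <= g * N / (8 * real k ^ 2)"
    and x: "!!i. i : I ==> length (x i) = k - 1 & set (x i) : nsets V (k - 1)" "inj_on (%i. set (x i)) I"
    and y: "!!i. i : I ==> length (y i) = k - 1 & set (y i) : nsets V (k - 1)" "inj_on (%i. set (y i)) I"
  shows "\<exists>f. (\<forall>i\<in>I. sol (x i) (y i) (f i) & fp (f i) \<subseteq> (\<Union>j<2*k*K. Z j) & card (fp (f i)) <= 2 * (k + M)) &
      (\<forall>i\<in>I. \<forall>j\<in>I. i ~= j --> fp (f i) \<inter> fp (f j) = {})"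
proof -
 note s = scaleD[OF sc]
 have kr: "real k >= 3" using k3 by simp
 define Z' where "Z' j = (\<Union>i<2*k. Z (2 * k * j + i))" for j
 have idx: "2 * k * j + i < 2 * k * K" if "i < 2 * k" "j < K" for i j
 proof -
  have "2 * k * j + i < 2 * k * (j + 1)" using that by simp
  also have "... <= 2 * k * K" using that by (intro mult_left_mono) auto
  finally show ?thesis .
 qed
 have inj: "2 * k * j + i = 2 * k * j' + i' \<longleftrightarrow> j = j' & i = i'" if "i < 2 * k" "i' < 2 * k" for i i' j j'
 proof
  assume eq: "2 * k * j + i = 2 * k * j' + i'"
  have "(2 * k * j + i) div (2 * k) = j" "(2 * k * j' + i') div (2 * k) = j'" using that k3 by (simp_all only: div_mult_self4) simp_all
  thus "j = j' & i = i'" using eq by simp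
 qed simp
 have "EX f. (ALL i:I. sol (x i) (y i) (f i) & fp (f i) <= (\<Union>j<K. Z' j) & card (fp (f i)) <= 2 * (k + M)) &
   (ALL i:I. ALL j:I. i ~= j --> fp (f i) Int fp (f j) = {})"
 proof (rule rounds[OF I(1)])
  show "finite (fp s)" if "sol (x i) (y i) s" for i s using fpfin[OF that] .
  show "Z' i Int Z' j = {}" if ij: "i < K" "j < K" "i ~= j" for i j
  proof -
   have "Z (2 * k * i + a) Int Z (2 * k * j + b) = {}" if "a < 2 * k" "b < 2 * k" for a b by (rule Z(2)) (use idx ij that inj[OF that] in auto)
   thus ?thesis unfolding Z'_def by blast
  qed
  show "card I < 2 ^ K" by (rule I(2))
  fix j I' W assume j: "j < K" and I': "I' <= I" and W: "W <= Z' j" "finite W" "card W <= 2 * (k + M) * card I'"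
  define \<X> where "\<X> = (%i. Z (2 * k * j + i)) ` {..<2 * k}"
  have cI': "card I' <= card I" using I' I(1) by (intro card_mono)
  have WV: "W <= V" using W(1) Z(1) idx j by (auto simp: Z'_def fair_def)
  have "card W <= 2 * (k + M) * card I" using W(3) cI' by (meson le_trans mult_le_mono2)
  hence cW: "card W <= g * N / (8 * real k ^ 2)" using I(3) by (meson of_nat_mono order_trans)
  have cWN: "card W < N / 2"
  proof -
   have "1 <= (real k)^2" using kr by (intro one_le_power) simp
   hence "1 <= 8 * (real k)^2" by linarith
   moreover have "g * N <= 1/10 * N" using g1 s(1) by (intro mult_right_mono) auto
   ultimately have "g * N / (8 * real k ^ 2) <= 1/10 * N / 1" using s(1) by (intro frac_le) auto
   thus ?thesis using cW s(1) by linarith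
  qed
  have Zd: "Z (2 * k * j + a) Int Z (2 * k * j + b) = {}" if "a < 2 * k" "b < 2 * k" "a ~= b" for a b by (rule Z(2)) (use idx j that in auto)
  have Zf: "fair N (Z (2 * k * j + a))" if "a < 2 * k" for a using Z(1) idx j that by simp
  have Xf: "fair N X" if "X : \<X>" for X using that Zf by (auto simp: \<X>_def)
  have Xd: "X Int Y = {}" if XY: "X : \<X>" "Y : \<X>" "X ~= Y" for X Y
  proof -
   obtain a b where ab: "a < 2 * k" "b < 2 * k" "X = Z (2 * k * j + a)" "Y = Z (2 * k * j + b)" using XY(1,2) unfolding \<X>_def by auto
   hence "a ~= b" using XY(3) by blast
   thus ?thesis using Zd ab by simp
  qed
  have "\<exists>D\<subseteq>nsets V (k - 1). card D * (g * p * N / (2 * k)) <= 16 * k * L * card W &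
   world V k p L g G {e : E. ALL x:e. e - {x} ~: D} (nsets V (k - 1) - D) N (eps0 k / 4) ((%X. X - W) ` \<X>)" by (rule world_exists[OF sc _ _ WV cW]) (erule Xf, rule Xd)
  then obtain D where D: "D <= nsets V (k - 1)" "card D * (g * p * N / (2 * k)) <= 16 * k * L * card W"
   "world V k p L g G {e : E. ALL x:e. e - {x} ~: D} (nsets V (k - 1) - D) N (eps0 k / 4) ((%X. X - W) ` \<X>)" by (elim exE conjE) (rule that)
  define U where "U i = Z (2 * k * j + i) - W" for i
  define Y where "Y i = Z (2 * k * j + (k + i)) - W" for i
  have ne: "Z (2 * k * j + a) - W ~= Z (2 * k * j + b) - W" if ab: "a < 2 * k" "b < 2 * k" "a ~= b" for a b using fair_nonempty[OF Zf[OF ab(1)] cWN W(2)] Zd[OF ab] by blast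
  have solve: "EX s. sol (x i) (y i) s & fp s <= Z' j - W & card (fp s) <= 2 * (k + M)"
   if i: "i : I'" "set (x i) ~: D" "set (y i) ~: D" for i
  proof -
   have iI: "i : I" using i I' by blast
   have "EX s. sol (x i) (y i) s & fp s <= (\<Union>i<k. U i) Un (\<Union>i<k. Y i) & card (fp s) <= 2 * (k + M)"
   proof (rule conn[OF D(3)])
    show "{e : E. ALL x:e. e - {x} ~: D} <= E" by blast
    show "U i : (%X. X - W) ` \<X> & Y i : (%X. X - W) ` \<X>" if "i < k" for i using that by (auto simp: U_def Y_def \<X>_def)
    show "U a ~= U b & Y a ~= Y b" if "a < k" "b < k" "a ~= b" for a b
     unfolding U_def Y_def by (intro conjI ne) (use that in auto)
    show "U a ~= Y b" if "a < k" "b < k" for a b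
     unfolding U_def Y_def by (intro ne) (use that in auto)
   qed (use x(1)[OF iI] y(1)[OF iI] i in auto)
   moreover have "(\<Union>i<k. U i) Un (\<Union>i<k. Y i) <= Z' j - W"
   proof -
    have "U i <= Z' j - W" "Y i <= Z' j - W" if "i < k" for i
    proof -
     show "U i <= Z' j - W" unfolding U_def Z'_def using that by (intro Diff_mono UN_upper) auto
     have "k + i : {..<2 * k}" using that by simp
     thus "Y i <= Z' j - W" unfolding Y_def Z'_def by blast
    qed
    thus ?thesis by blast
   qed
   ultimately show ?thesis by (meson order_trans)
  qed
  let ?bad = "{i : I'. ~ (EX s. sol (x i) (y i) s & fp s <= Z' j - W & card (fp s) <= 2 * (k + M))}"
  have finD: "finite D" using D(1) fin_nsets by (rule finite_subset)
  have finI': "finite I'" using I' I(1) by (rule finite_subset)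
  have "?bad <= {i : I'. set (x i) : D} Un {i : I'. set (y i) : D}" using solve by blast
  hence "card ?bad <= card ({i : I'. set (x i) : D} Un {i : I'. set (y i) : D})" using finI' by (intro card_mono) auto
  also have "... <= card {i : I'. set (x i) : D} + card {i : I'. set (y i) : D}" by (rule card_Un_le)
  also have "... <= card D + card D"
  proof (rule add_mono)
   show "card {i : I'. set (x i) : D} <= card D" by (rule card_inj_on_le[where f = "%i. set (x i)"]) (use x(2) I' finD in \<open>auto simp: inj_on_def\<close>)
   show "card {i : I'. set (y i) : D} <= card D" by (rule card_inj_on_le[where f = "%i. set (y i)"]) (use y(2) I' finD in \<open>auto simp: inj_on_def\<close>)
  qed
  finally have bD: "card ?bad <= 2 * card D" by simp
  have "4 * card D <= card I'"
  proof -
   have kL: "real k * L * (k + M) > 0" using kr L1 by simp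
   have "(32 * (real k * L * (k + M))) * real (4 * card D) = card D * (128 * k * L * (k + M))" by simp
   also have "... <= card D * (g * p * N / (2 * k))" using s(6) by (intro mult_left_mono) auto
   also have "... <= 16 * k * L * card W" by (rule D(2))
   also have "... <= 16 * k * L * (2 * (k + M) * card I')" using W(3) L1 by (intro mult_left_mono of_nat_mono) auto
   also have " ... = (32 * (real k * L * (k + M))) * card I'" by simp
   finally have "real (4 * card D) <= card I'" by (rule mult_left_le_imp_le) (use kL in linarith)
   thus ?thesis by linarith
  qed
  thus "2 * card ?bad <= card I'" using bD by linarith
 qed
 moreover have "(\<Union>j<K. Z' j) <= (\<Union>j<2*k*K. Z j)" using idx by (auto simp: Z'_def)
 ultimately show ?thesis by (meson order_trans)
qed

lemma many_tight:
  fixes Z :: "nat => 'a set" and x y :: "'i => 'a list"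
  assumes sc: "scale N M"
    and Z: "!!j. j < 2 * k * K ==> fair N (Z j)" "!!i j. i < 2 * k * K ==> j < 2 * k * K ==> i ~= j ==> Z i \<inter> Z j = {}"
    and I: "finite I" "card I < 2 ^ K" "2 * (k + M) * card I <= g * N / (8 * real k ^ 2)"
    and x: "!!i. i : I ==> length (x i) = k - 1 & set (x i) : nsets V (k - 1)" "inj_on (%i. set (x i)) I"
    and y: "!!i. i : I ==> length (y i) = k - 1 & set (y i) : nsets V (k - 1)" "inj_on (%i. set (y i)) I"
  shows "\<exists>f. (\<forall>i\<in>I. f i ~= [] & distinct (f i) & win k E (x i @ f i @ y i) & set (f i) \<subseteq> (\<Union>j<2*k*K. Z j) & card (set (f i)) <= 2 * (k + M)) &
      (\<forall>i\<in>I. \<forall>j\<in>I. i ~= j --> set (f i) \<inter> set (f j) = {})"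
proof -
 define sol where "sol x y q \<longleftrightarrow> q ~= [] & distinct q & win k E (x @ q @ y)" for x y q
 have k1: "k >= 1" using k3 by simp
 note s = scaleD[OF sc]
 have "EX f. (ALL i:I. sol (x i) (y i) (f i) & set (f i) <= (\<Union>j<2*k*K. Z j) & card (set (f i)) <= 2 * (k + M)) &
   (ALL i:I. ALL j:I. i ~= j --> set (f i) Int set (f j) = {})"
 proof (rule many_connections[where x = x and y = y, OF sc _ _ Z I x y])
  fix H good Ps U Y and x y :: "'a list"
  assume w: "world V k p L g G H good N (eps0 k / 4) Ps" and HE: "H <= E"
   and UY: "!!i. i < k ==> U i : Ps & Y i : Ps" "!!i j. i < k ==> j < k ==> i ~= j ==> U i ~= U j & Y i ~= Y j"
    "!!i j. i < k ==> j < k ==> U i ~= Y j"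
   and xy: "length x = k - 1" "set x : good" "length y = k - 1" "set y : good"
  interpret world V k p L g G H good N "eps0 k / 4" Ps by (rule w)
  have "EX q. q ~= [] & distinct q & set q <= (\<Union>i<k. U i) Un (\<Union>i<k. Y i) & length q <= 2 * (k + M) & win k H (x @ q @ y)"
  proof (rule connect_tight[OF _ _ UY(3) xy _ _ c0_pos[OF k1] s(5,2)])
   show "slots U" "slots Y" using UY by (auto simp: slots_def)
   show "4 * (eps0 k / 4) <= eps0 k" by simp
   show "2 * (eps0 k / 4) <= c0 k / 16 ^ k" using eps0_bounds[OF k1] by linarith
  qed
  then obtain q where q: "q ~= []" "distinct q" "set q <= (\<Union>i<k. U i) Un (\<Union>i<k. Y i)" "length q <= 2 * (k + M)" "win k H (x @ q @ y)" by (elim exE conjE) (rule that)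
  show "EX q. sol x y q & set q <= (\<Union>i<k. U i) Un (\<Union>i<k. Y i) & card (set q) <= 2 * (k + M)"
   unfolding sol_def using q win_mono[OF q(5) HE] card_length[of q] by (intro exI[of _ q] conjI) auto
 qed simp_all
 thus ?thesis unfolding sol_def by simp
qed

lemma many_spikes:
  fixes Z :: "nat => 'a set" and x y :: "'i => 'a list"
  assumes sc: "scale N M"
    and Z: "!!j. j < 2 * k * K ==> fair N (Z j)" "!!i j. i < 2 * k * K ==> j < 2 * k * K ==> i ~= j ==> Z i \<inter> Z j = {}"
    and I: "finite I" "card I < 2 ^ K" "2 * (k + M) * card I <= g * N / (8 * real k ^ 2)"
    and x: "!!i. i : I ==> length (x i) = k - 1 & set (x i) : nsets V (k - 1)" "inj_on (%i. set (x i)) I"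
    and y: "!!i. i : I ==> length (y i) = k - 1 & set (y i) : nsets V (k - 1)" "inj_on (%i. set (y i)) I"
  shows "\<exists>f. (\<forall>i\<in>I. odd (length (f i)) & successively (adj k E) (x i # f i @ [y i]) & (\<forall>v\<in>set (f i). length v = k - 1) &
      distinct (concat (f i)) & set (concat (f i)) \<subseteq> (\<Union>j<2*k*K. Z j) & card (set (concat (f i))) <= 2 * (k + M)) &
      (\<forall>i\<in>I. \<forall>j\<in>I. i ~= j --> set (concat (f i)) \<inter> set (concat (f j)) = {})"
proof -
 define sol where "sol x y gs \<longleftrightarrow> odd (length gs) & successively (adj k E) (x # gs @ [y]) & (ALL v:set gs. length v = k - 1) &
   distinct (concat gs)" for x y gs
 have k1: "k >= 1" using k3 by simp
 note s = scaleD[OF sc]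
 have "EX f. (ALL i:I. sol (x i) (y i) (f i) & set (concat (f i)) <= (\<Union>j<2*k*K. Z j) & card (set (concat (f i))) <= 2 * (k + M)) &
   (ALL i:I. ALL j:I. i ~= j --> set (concat (f i)) Int set (concat (f j)) = {})"
 proof (rule many_connections[where x = x and y = y and fp = "%gs. set (concat gs)", OF sc _ _ Z I x y])
  fix H good Ps U Y and x y :: "'a list"
  assume w: "world V k p L g G H good N (eps0 k / 4) Ps" and HE: "H <= E"
   and UY: "!!i. i < k ==> U i : Ps & Y i : Ps" "!!i j. i < k ==> j < k ==> i ~= j ==> U i ~= U j & Y i ~= Y j"
    "!!i j. i < k ==> j < k ==> U i ~= Y j"
   and xy: "length x = k - 1" "set x : good" "length y = k - 1" "set y : good"
  interpret world V k p L g G H good N "eps0 k / 4" Ps by (rule w)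
  have "EX gs. odd (length gs) & successively (adj k H) (x # gs @ [y]) & (ALL v:set gs. length v = k - 1) &
   distinct (concat gs) & set (concat gs) <= (\<Union>i<k. U i) Un (\<Union>i<k. Y i) & length (concat gs) <= 2 * (k + M)"
  proof (rule connect_spikes[OF _ _ UY(3) xy _ _ c0_pos[OF k1] s(5,2)])
   show "slots U" "slots Y" using UY by (auto simp: slots_def)
   show "4 * (eps0 k / 4) <= eps0 k" by simp
   show "2 * (eps0 k / 4) <= c0 k / 16 ^ k" using eps0_bounds[OF k1] by linarith
  qed
  then obtain gs where gs: "odd (length gs)" "successively (adj k H) (x # gs @ [y])" "ALL v:set gs. length v = k - 1"
   "distinct (concat gs)" "set (concat gs) <= (\<Union>i<k. U i) Un (\<Union>i<k. Y i)" "length (concat gs) <= 2 * (k + M)" by (elim exE conjE) (rule that)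
  have "successively (adj k E) (x # gs @ [y])" by (rule successively_mono[OF gs(2)]) (use win_mono[OF _ HE] in \<open>auto simp: adj_def\<close>)
  moreover have "card (set (concat gs)) <= 2 * (k + M)" using gs(6) card_length[of "concat gs"] by (rule order_trans[rotated])
  ultimately show "EX gs. sol x y gs & set (concat gs) <= (\<Union>i<k. U i) Un (\<Union>i<k. Y i) & card (set (concat gs)) <= 2 * (k + M)"
   unfolding sol_def using gs by (intro exI[of _ gs] conjI)
 qed simp_all
 thus ?thesis unfolding sol_def by (simp only: conj_assoc)
qed

end

section \<open>Absorbers\<close>

text \<open>P continues backwards through the first spike and then along c 0 to the last one, P' backwards through the last spike and then along the reverse of c 0 to the first. Both have used the same vertices, and the shorter chain between the outermost spikes now joins their ends with the roles of P and P' exchanged. An odd number of spikes leaves a single one, through which both continue.\<close>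
lemma absorber_switch:
  assumes k: "k >= 2" and P: "win k E P" "k - 1 <= length P" and P': "win k E P'" "k - 1 <= length P'"
    and gs: "odd (length gs)" "successively (adj k E) (last_of k P # gs @ [last_of k P'])" "\<forall>v\<in>set gs. length v = k - 1"
    and c: "!!j. j < length gs div 2 ==> win k E (rev (gs ! j) @ c j @ gs ! (length gs - 1 - j))"
  shows "\<exists>X X'. win k E (P @ X) & win k E (P' @ X') & mset X = mset (concat gs) + (\<Sum>j<length gs div 2. mset (c j)) &
    mset X' = mset X & last_of k X = last_of k X' & k - 1 <= length X" using P P' gs c
proof (induction "length gs" arbitrary: gs P P' c rule: less_induct)
 case less
 have k1: "1 <= k" using k by simp
 obtain g rest where gr: "gs = g # rest" using less.prems(5) by (cases gs) auto
 show ?case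
 proof (cases rest rule: rev_cases)
  case Nil
  hence gs: "gs = [g]" using gr by simp
  have lg: "length g = k - 1" using less.prems(7) gs by simp
  have a: "adj k E (last_of k P) g" "adj k E (last_of k P') g" using less.prems(6) adj_sym[of k E g] by (auto simp: gs)
  have "win k E (P @ rev g)" "win k E (P' @ rev g)" using a less.prems(1-4) k1 by (auto simp: adj_def intro: last_of_win_append)
  thus ?thesis using lg by (intro exI[of _ "rev g"] exI[of _ "rev g"]) (simp add: gs)
 next
  case (snoc mid h)
  have gs: "gs = g # mid @ [h]" using gr snoc by simp
  have lg: "length g = k - 1" "length h = k - 1" using less.prems(7) gs by auto
  have succ: "adj k E (last_of k P) g" "successively (adj k E) (g # mid @ [h])" "adj k E h (last_of k P')"
  proof -
   have "successively (adj k E) (last_of k P # ((g # mid @ [h]) @ [last_of k P']))" using less.prems(6) gs by simp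
   hence 1: "adj k E (last_of k P) g" "successively (adj k E) ((g # mid @ [h]) @ [last_of k P'])" by (simp_all add: successively_Cons)
   show "adj k E (last_of k P) g" by (rule 1)
   show "successively (adj k E) (g # mid @ [h])" "adj k E h (last_of k P')" using 1(2) unfolding successively_append_iff[of _ "g # mid @ [h]"] by auto
  qed
  define q where "q = c 0"
  have nth0: "gs ! 0 = g" "gs ! (length gs - 1 - 0) = h" by (simp_all add: gs nth_append)
  have half: "length gs div 2 = Suc (length mid div 2)" by (simp add: gs)
  have wq: "win k E (rev g @ q @ h)" using less.prems(8)[of 0] unfolding nth0 half q_def by simp
  have wq': "win k E (rev h @ rev q @ g)" using win_rev[OF wq] by simp
  have w1: "win k E (P @ rev g)" using succ(1) less.prems(1,2) k1 by (auto simp: adj_def intro: last_of_win_append)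
  have w2: "win k E (P' @ rev h)" using adj_sym[THEN iffD1, OF succ(3)] less.prems(3,4) k1 by (auto simp: adj_def intro: last_of_win_append)
  have W1: "win k E (P @ rev g @ q @ h)" by (rule win_append[OF w1 wq]) (use lg k in simp)
  have W2: "win k E (P' @ rev h @ rev q @ g)" by (rule win_append[OF w2 wq']) (use lg k in simp)
  have l1: "last_of k (P @ rev g @ q @ h) = h" "last_of k (P' @ rev h @ rev q @ g) = g" using lg last_of_append[of k h "P @ rev g @ q"] last_of_append[of k g "P' @ rev h @ rev q"]
   by (simp_all add: last_of_self)
  have "EX X X'. win k E ((P' @ rev h @ rev q @ g) @ X) & win k E ((P @ rev g @ q @ h) @ X') &
    mset X = mset (concat mid) + (\<Sum>j<length mid div 2. mset (c (Suc j))) &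
    mset X' = mset X & last_of k X = last_of k X' & k - 1 <= length X"
  proof (rule less.hyps[OF _ W2 _ W1])
   show "length mid < length gs" by (simp add: gs)
   show "odd (length mid)" using less.prems(5) by (simp add: gs)
   show "successively (adj k E) (last_of k (P' @ rev h @ rev q @ g) # mid @ [last_of k (P @ rev g @ q @ h)])"
    unfolding l1 by (rule succ(2))
   show "ALL v:set mid. length v = k - 1" using less.prems(7) by (simp add: gs)
   fix j assume j: "j < length mid div 2"
   have jl: "j < length mid" using j by linarith
   have "gs ! Suc j = mid ! j" using jl by (simp add: gs nth_append)
   moreover have "gs ! (length gs - 1 - Suc j) = mid ! (length mid - 1 - j)"
   proof -
    have "length gs - 1 - Suc j = Suc (length mid - 1 - j)" using jl by (simp add: gs)
    moreover have "length mid - 1 - j < length mid" using jl by linarith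
    hence "(mid @ [h]) ! (length mid - 1 - j) = mid ! (length mid - 1 - j)" by (simp only: nth_append if_True)
    ultimately show ?thesis by (simp only: gs nth_Cons_Suc)
   qed
   ultimately show "win k E (rev (mid ! j) @ c (Suc j) @ mid ! (length mid - 1 - j))" using less.prems(8)[of "Suc j"] j half by simp
  qed (use lg in auto)
  then obtain X X' where X: "win k E ((P' @ rev h @ rev q @ g) @ X)" "win k E ((P @ rev g @ q @ h) @ X')"
    "mset X = mset (concat mid) + (\<Sum>j<length mid div 2. mset (c (Suc j)))"
    "mset X' = mset X" "last_of k X = last_of k X'" "k - 1 <= length X" by (elim exE conjE) (rule that)
  have lX: "k - 1 <= length X'" using X(4,6) by (metis mset_eq_length)
  show ?thesis
  proof (rule exI[of _ "rev g @ q @ h @ X'"], rule exI[of _ "rev h @ rev q @ g @ X"], intro conjI)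
   show "win k E (P @ rev g @ q @ h @ X')" using X(2) by simp
   show "win k E (P' @ rev h @ rev q @ g @ X)" using X(1) by simp
   have "(\<Sum>j<length gs div 2. mset (c j)) = mset q + (\<Sum>j<length mid div 2. mset (c (Suc j)))"
    unfolding half q_def by (simp only: sum.lessThan_Suc_shift)
   thus "mset (rev g @ q @ h @ X') = mset (concat gs) + (\<Sum>j<length gs div 2. mset (c j))" using X(3,4) by (simp add: gs)
   show "mset (rev h @ rev q @ g @ X) = mset (rev g @ q @ h @ X')" using X(4) by simp
   show "last_of k (rev g @ q @ h @ X') = last_of k (rev h @ rev q @ g @ X)" using X(5) last_of_append[OF lX, of "rev g @ q @ h"] last_of_append[OF X(6), of "rev h @ rev q @ g"] by simp
   show "k - 1 <= length (rev g @ q @ h @ X')" using lX by simp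
  qed
 qed
qed

definition absorber :: "nat => 'a set set => 'a => 'a list => 'a list => bool" where
  "absorber k E r A B \<longleftrightarrow> win k E A & win k E B & distinct A & mset A = add_mset r (mset B) &
     k - 1 <= length B & first_of k A = first_of k B & last_of k A = last_of k B"

text \<open>Apply absorber_switch to the paths a @ [r] and a, whose last tuples are the two ends of the spike chain.\<close>
lemma absorber_from_chain:
  assumes k: "k >= 2" and a: "length a = k - 1" "insert r (set a) : E" "distinct (a @ [r])"
    and gs: "odd (length gs)" "successively (adj k E) ((tl a @ [r]) # gs @ [a])" "\<forall>v\<in>set gs. length v = k - 1" "distinct (concat gs)"
    and c: "!!j. j < length gs div 2 ==> win k E (rev (gs ! j) @ c j @ gs ! (length gs - 1 - j))"
    and d: "!!j. j < length gs div 2 ==> distinct (c j)" "!!i j. i < length gs div 2 ==> j < length gs div 2 ==> i ~= j ==> set (c i) \<inter> set (c j) = {}"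
      "!!j. j < length gs div 2 ==> set (c j) \<inter> set (concat gs) = {}" "!!j. j < length gs div 2 ==> set (c j) \<inter> insert r (set a) = {}"
      "set (concat gs) \<inter> insert r (set a) = {}"
  shows "\<exists>A B. absorber k E r A B & set A = insert r (set a) \<union> set (concat gs) \<union> (\<Union>j<length gs div 2. set (c j))"
proof -
 have wa: "win k E a" using a(1) k by (intro win_short) simp
 have war: "win k E (a @ [r])" using a(1,2) k by (auto simp: win_def)
 have la: "last_of k a = a" using a(1) by (simp add: last_of_self)
 have lar: "last_of k (a @ [r]) = tl a @ [r]" using last_of_snoc[OF k, of a r] a(1) la by simp
 have len: "k - 1 <= length (a @ [r])" "k - 1 <= length a" using a(1) by auto
 have "EX X X'. win k E ((a @ [r]) @ X) & win k E (a @ X') & mset X = mset (concat gs) + (\<Sum>j<length gs div 2. mset (c j)) &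
   mset X' = mset X & last_of k X = last_of k X' & k - 1 <= length X" by (rule absorber_switch[OF k war len(1) wa len(2) gs(1) _ gs(3) c]) (simp_all only: la lar gs(2))
 then obtain X X' where X: "win k E ((a @ [r]) @ X)" "win k E (a @ X')" "mset X = mset (concat gs) + (\<Sum>j<length gs div 2. mset (c j))"
   "mset X' = mset X" "last_of k X = last_of k X'" "k - 1 <= length X" by (elim exE conjE) (rule that)
 have lX': "k - 1 <= length X'" using X(4,6) by (metis mset_eq_length)
 have setX: "set X = set (concat gs) Un (\<Union>j<length gs div 2. set (c j))"
 proof -
  have "set_mset (mset X) = set (concat gs) Un (\<Union>j<length gs div 2. set (c j))"
   unfolding X(3) by (simp add: set_mset_sum)
  thus ?thesis by simp
 qed
 have dX: "distinct X"
 proof -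
  have "count (mset X) v <= 1" for v
  proof -
   have cnt: "count (mset (c j)) v = (if v : set (c j) then 1 else 0)" if "j < length gs div 2" for j using d(1)[OF that] by (simp add: distinct_count_atmost_1)
   have cg: "count (mset (concat gs)) v = (if v : set (concat gs) then 1 else 0)" using gs(4) unfolding distinct_count_atmost_1 by blast
   have tot: "count (mset X) v = count (mset (concat gs)) v + (\<Sum>j<length gs div 2. count (mset (c j)) v)"
    unfolding X(3) by (simp add: count_sum)
   show ?thesis
   proof (cases "EX j<length gs div 2. v : set (c j)")
    case True
    then obtain j where j: "j < length gs div 2" "v : set (c j)" by blast
    have "v ~: set (concat gs)" using d(3)[OF j(1)] j(2) by blast
    moreover have "(\<Sum>i<length gs div 2. count (mset (c i)) v) = (\<Sum>i<length gs div 2. if i = j then 1 else 0)"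
    proof (rule sum.cong)
     fix i assume "i : {..<length gs div 2}"
     thus "count (mset (c i)) v = (if i = j then 1 else 0)" using cnt[of i] d(2)[of i j] j by auto
    qed simp
    ultimately show ?thesis using tot cg j(1) by simp
   next
    case False
    have z0: "(\<Sum>j<length gs div 2. count (mset (c j)) v) = 0" by (rule sum.neutral) (use False cnt in simp)
    show ?thesis unfolding tot cg z0 by simp
   qed
  qed
  moreover have "count (mset X) v >= 1" if "v : set X" for v using that by (simp add: Suc_le_eq)
  ultimately show ?thesis unfolding distinct_count_atmost_1 by (auto simp: le_antisym count_eq_zero_iff)
 qed
 have dj: "set X Int insert r (set a) = {}" unfolding setX using d(4,5) by blast
 show ?thesis
 proof (rule exI[of _ "(a @ [r]) @ X"], rule exI[of _ "a @ X'"], intro conjI)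
  show "absorber k E r ((a @ [r]) @ X) (a @ X')" unfolding absorber_def
  proof (intro conjI X(1,2))
   show "distinct ((a @ [r]) @ X)" using dX dj a(3) by auto
   show "mset ((a @ [r]) @ X) = add_mset r (mset (a @ X'))" using X(4) by simp
   show "k - 1 <= length (a @ X')" using a(1) by simp
   show "first_of k ((a @ [r]) @ X) = first_of k (a @ X')" using a(1) by (simp add: first_of_def)
   show "last_of k ((a @ [r]) @ X) = last_of k (a @ X')" using X(5) last_of_append[OF X(6)] last_of_append[OF lX'] by metis
  qed
  show "set ((a @ [r]) @ X) = insert r (set a) Un set (concat gs) Un (\<Union>j<length gs div 2. set (c j))" using setX by auto
 qed
qed

lemma concat_nth_disjoint:
  assumes "distinct (concat xs)" "\<forall>v\<in>set xs. v ~= []" "i < length xs" "j < length xs" "i ~= j"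
  shows "set (xs ! i) \<inter> set (xs ! j) = {}"
proof -
 have "removeAll [] xs = xs" using assms(2) by (induction xs) auto
 hence "distinct xs" using assms(1) by (simp add: distinct_concat_iff)
 hence "xs ! i ~= xs ! j" using assms(3-5) by (simp add: nth_eq_iff_index_eq)
 thus ?thesis using assms(1,3,4) by (simp add: distinct_concat_iff)
qed

lemma length_le_concat: "\<forall>v\<in>set xs. v ~= [] ==> length xs <= length (concat xs)"
proof (induction xs)
 case (Cons x xs)
 hence "length x >= 1" by (cases x) auto
 with Cons show ?case by auto
qed simp

lemma list_nsets: "distinct xs ==> set xs \<subseteq> V ==> length xs = m ==> set xs : nsets V m"
 by (simp add: nsets_def distinct_card)

lemma inj_on_disjoint:
  assumes "!!i j. i : I ==> j : I ==> i ~= j ==> f i \<inter> f j = {}" "!!i. i : I ==> f i ~= {}"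
  shows "inj_on f I"
proof (rule inj_onI, rule ccontr)
 fix i j assume a: "i : I" "j : I" "f i = f j" "i ~= j"
 hence "f i = {}" using assms(1)[of i j] by simp
 thus False using assms(2) a by simp
qed

lemma three_layers_disjoint:
  assumes "P \<inter> P' = {}" "Q \<inter> Q' = {}" "C \<inter> C' = {}" "Q \<subseteq> A" "Q' \<subseteq> A" "C \<subseteq> B" "C' \<subseteq> B"
    "P \<inter> A = {}" "P \<inter> B = {}" "P' \<inter> A = {}" "P' \<inter> B = {}" "A \<inter> B = {}"
  shows "(P \<union> Q \<union> C) \<inter> (P' \<union> Q' \<union> C') = {}"
proof -
 have "P Int Q' = {}" "P Int C' = {}" "Q Int P' = {}" "Q Int C' = {}" "C Int P' = {}" "C Int Q' = {}" using assms by blast+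
 thus ?thesis using assms(1-3) by blast
qed

context host begin

text \<open>For each r there are three requests, in separate groups of parts: a path from r with dummies z to dummies w, whose first vertex gives an edge through r with z; a spike chain between the two (k-1)-tuples in this edge; and the connections between opposite spikes.\<close>
lemma absorbers_exist:
  fixes Z :: "nat => 'a set" and z w :: "'a => 'a list"
  assumes sc: "scale N M" and m: "m = 2 * k * K"
    and Z: "!!j. j < 3 * m ==> fair N (Z j)" "!!i j. i < 3 * m ==> j < 3 * m ==> i ~= j ==> Z i \<inter> Z j = {}"
    and R: "finite R" "R \<subseteq> V"
    and z: "!!r. r : R ==> length (z r) = k - 2 & length (w r) = k - 1 & distinct (z r @ w r) & set (z r @ w r) \<subseteq> V"
    and zdisj: "!!r r'. r : R ==> r' : R ==> r ~= r' ==> set (z r @ w r) \<inter> set (z r' @ w r') = {}"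
    and zR: "!!r. r : R ==> set (z r @ w r) \<inter> R = {}"
    and ZR: "!!j. j < 3 * m ==> Z j \<inter> R = {}" "!!j r. j < 3 * m ==> r : R ==> Z j \<inter> set (z r @ w r) = {}"
    and cnt: "card R * (2 * (k + M)) < 2 ^ K" "2 * (k + M) * (card R * (2 * (k + M))) <= g * N / (8 * real k ^ 2)"
  shows "\<exists>A B. (\<forall>r\<in>R. absorber k E r (A r) (B r) & set (A r) \<subseteq> insert r (set (z r)) \<union> (\<Union>j<3*m. Z j) &
      length (A r) <= k + 2 * (k + M) + (2 * (k + M))^2) &
    (\<forall>r\<in>R. \<forall>r'\<in>R. r ~= r' --> set (A r) \<inter> set (A r') = {})"
proof -
 define B where "B = 2 * (k + M)"
 have k2: "k >= 2" and B1: "B >= 1" using k3 by (auto simp: B_def)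
 define U where "U t = (\<Union>j<m. Z (t * m + j))" for t
 have UU0: "(\<Union>j<2*k*K. Z (t * m + j)) = U t" for t by (simp add: U_def m)
 have idx: "t * m + j < 3 * m" if "t < 3" "j < m" for t j
 proof -
  have "t * m + j < (t + 1) * m" using that by simp
  also have "... <= 3 * m" using that by (intro mult_right_mono) auto
  finally show ?thesis .
 qed
 have idx_inj: "t * m + i ~= t' * m + j" if "i < m" "j < m" "t ~= t' | i ~= j" for t t' i j
 proof
  assume eq: "t * m + i = t' * m + j"
  have "m > 0" using that by simp
  hence "(t * m + i) div m = t" "(t' * m + j) div m = t'" using that by simp_all
  thus False using eq that by simp
 qed
 have Zf: "fair N (Z (t * m + j))" if "t < 3" "j < m" for t j using Z(1) idx that by simp
 have Zd: "Z (t * m + i) Int Z (t * m + j) = {}" if "t < 3" "i < m" "j < m" "i ~= j" for t i j by (rule Z(2)) (use idx idx_inj that in auto)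
 have UU: "U t Int U t' = {}" if t: "t < 3" "t' < 3" "t ~= t'" for t t'
 proof -
  have "Z (t * m + i) Int Z (t' * m + j) = {}" if "i < m" "j < m" for i j by (rule Z(2)) (use idx idx_inj t that in auto)
  thus ?thesis unfolding U_def by blast
 qed
 have UZ: "U t <= (\<Union>j<3*m. Z j)" if "t < 3" for t using idx that unfolding U_def by blast
 have UV: "U t <= V" if "t < 3" for t using Zf[OF that] unfolding U_def fair_def by blast
 have UR: "U t Int R = {}" if "t < 3" for t using ZR(1) idx that unfolding U_def by blast
 have Uz: "U t Int set (z r @ w r) = {}" if "t < 3" "r : R" for t r using ZR(2) idx that unfolding U_def by blast
 have cR: "card R <= card R * B" using B1 by simp
 have cnt': "card R < 2 ^ K" "B * card R <= g * N / (8 * real k ^ 2)"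
 proof -
  show "card R < 2 ^ K" using cR cnt(1) unfolding B_def by linarith
  have "B * card R <= B * (card R * B)" using cR by (rule mult_le_mono2)
  hence "real (B * card R) <= real (B * (card R * B))" by (rule of_nat_mono)
  thus "B * card R <= g * N / (8 * real k ^ 2)" using cnt(2) unfolding B_def by (rule order_trans)
 qed
 \<comment> \<open>A path from r, z r to the dummies w r; only its first vertex hd (q r) is used later.\<close>
 have xr: "length (r # z r) = k - 1 & set (r # z r) : nsets V (k - 1)" if "r : R" for r
 proof -
  have "length (r # z r) = k - 1" using z[OF that] k3 by simp
  moreover have "distinct (r # z r)" "set (r # z r) <= V" using z[OF that] zR[OF that] that R(2) by auto
  ultimately show ?thesis using list_nsets[of "r # z r"] by blast
 qed
 have xr_disj: "set (r # z r) Int set (r' # z r') = {}" if "r : R" "r' : R" "r ~= r'" for r r' using zdisj[OF that] zR[OF that(1)] zR[OF that(2)] that by auto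
 have "EX f. (ALL i:R. f i ~= [] & distinct (f i) & win k E ((i # z i) @ f i @ w i) & set (f i) <= (\<Union>j<2*k*K. Z (0 * m + j)) & card (set (f i)) <= 2 * (k + M)) &
   (ALL i:R. ALL j:R. i ~= j --> set (f i) Int set (f j) = {})"
 proof (rule many_tight[OF sc _ _ R(1) cnt'[unfolded B_def]])
  show "inj_on (%i. set (i # z i)) R" by (rule inj_on_disjoint) (use xr_disj in auto)
  show "inj_on (%i. set (w i)) R"
  proof (rule inj_on_disjoint)
   show "set (w i) Int set (w j) = {}" if "i : R" "j : R" "i ~= j" for i j using zdisj[OF that] by auto
   show "set (w i) ~= {}" if "i : R" for i using z[OF that] k3 by auto
  qed
  show "length (w i) = k - 1 & set (w i) : nsets V (k - 1)" if "i : R" for i using z[OF that] list_nsets[of "w i"] by auto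
 qed (use xr Zf[of 0] Zd[of 0] m in auto)
 then obtain q where q0: "ALL i:R. q i ~= [] & distinct (q i) & win k E ((i # z i) @ q i @ w i) & set (q i) <= U 0 & card (set (q i)) <= 2 * (k + M)"
   "ALL i:R. ALL j:R. i ~= j --> set (q i) Int set (q j) = {}"
  unfolding UU0 by (elim exE conjE) (rule that)
 have q: "!!r. r : R ==> q r ~= []" "!!r. r : R ==> win k E ((r # z r) @ q r @ w r)" "!!r. r : R ==> set (q r) <= U 0"
   "!!r r'. r : R ==> r' : R ==> r ~= r' ==> set (q r) Int set (q r') = {}" using bspec[OF q0(1)] bspec[OF bspec[OF q0(2)]] by simp_all
 define a where "a r = hd (q r) # rev (z r)" for r
 have hdq: "hd (q r) : set (q r)" if "r : R" for r using q(1)[OF that] by simp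
 have hdU: "hd (q r) : U 0" if "r : R" for r using hdq[OF that] q(3)[OF that] by blast
 have al: "length (a r) = k - 1" if "r : R" for r using z[OF that] k3 by (simp add: a_def)
 have aset: "set (a r) = insert (hd (q r)) (set (z r))" for r by (simp add: a_def)
 have ta: "tl (a r) @ [r] = rev (z r) @ [r]" for r by (simp add: a_def)
 have ar: "distinct (a r @ [r])" "set (a r) <= V" if r: "r : R" for r
 proof -
  have "hd (q r) ~: set (z r)" using hdU[OF r] Uz[of 0 r] r by auto
  moreover have "hd (q r) ~= r" using hdU[OF r] UR[of 0] r by auto
  moreover have "r ~: set (z r)" using zR[OF r] r by auto
  ultimately show "distinct (a r @ [r])" using z[OF r] by (simp add: a_def)
  show "set (a r) <= V" using hdU[OF r] UV[of 0] z[OF r] by (auto simp: aset)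
 qed
 have aE: "insert r (set (a r)) : E" if r: "r : R" for r
 proof -
  obtain v q' where v: "q r = v # q'" using q(1)[OF r] by (cases "q r") auto
  have "win k E ((r # z r) @ q r @ w r)" by (rule q(2)[OF r])
  hence "win k E (((r # z r) @ [v]) @ q' @ w r)" by (simp add: v)
  hence "win k E ((r # z r) @ [v])" by (rule win_appendD1)
  moreover have "length ((r # z r) @ [v]) = k" using z[OF r] k3 by simp
  ultimately have "set (take k (drop 0 ((r # z r) @ [v]))) : E" unfolding win_def by (metis add.left_neutral order_refl)
  moreover have "take k (drop 0 ((r # z r) @ [v])) = (r # z r) @ [v]" using z[OF r] k3 by simp
  ultimately show ?thesis using v by (simp add: aset insert_commute)
 qed
 have a_disj: "set (a r) Int set (a r') = {}" if r: "r : R" "r' : R" "r ~= r'" for r r'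
  using zdisj[OF r] q(4)[OF r] hdq[OF r(1)] hdq[OF r(2)] hdU[OF r(1)] hdU[OF r(2)] Uz[of 0, OF _ r(1)] Uz[of 0, OF _ r(2)]
  unfolding aset by auto
 \<comment> \<open>The spike chain from the facet without hd (q r) to the facet without r.\<close>
 have "EX f. (ALL i:R. odd (length (f i)) & successively (adj k E) ((tl (a i) @ [i]) # f i @ [a i]) & (ALL v:set (f i). length v = k - 1) &
   distinct (concat (f i)) & set (concat (f i)) <= (\<Union>j<2*k*K. Z (1 * m + j)) & card (set (concat (f i))) <= 2 * (k + M)) &
   (ALL i:R. ALL j:R. i ~= j --> set (concat (f i)) Int set (concat (f j)) = {})"
 proof (rule many_spikes[OF sc _ _ R(1) cnt'[unfolded B_def]])
  show "fair N (Z (1 * m + j))" if "j < 2 * k * K" for j using Zf[of 1 j] that m by simp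
  show "Z (1 * m + i) Int Z (1 * m + j) = {}" if "i < 2 * k * K" "j < 2 * k * K" "i ~= j" for i j using Zd[of 1 i j] that m by simp
  show "length (tl (a i) @ [i]) = k - 1 & set (tl (a i) @ [i]) : nsets V (k - 1)" if "i : R" for i
   unfolding ta using xr[OF that] by simp
  show "inj_on (%i. set (tl (a i) @ [i])) R"
   unfolding ta by (rule inj_on_disjoint) (use xr_disj in auto)
  show "length (a i) = k - 1 & set (a i) : nsets V (k - 1)" if "i : R" for i using al[OF that] ar[OF that] list_nsets[of "a i"] by auto
  show "inj_on (%i. set (a i)) R" by (rule inj_on_disjoint) (use a_disj in \<open>auto simp: aset\<close>)
 qed
 then obtain gs where gs0: "ALL i:R. odd (length (gs i)) & successively (adj k E) ((tl (a i) @ [i]) # gs i @ [a i]) & (ALL v:set (gs i). length v = k - 1) &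
   distinct (concat (gs i)) & set (concat (gs i)) <= U 1 & card (set (concat (gs i))) <= 2 * (k + M)"
   "ALL i:R. ALL j:R. i ~= j --> set (concat (gs i)) Int set (concat (gs j)) = {}"
  unfolding UU0 by (elim exE conjE) (rule that)
 have gs: "!!r. r : R ==> odd (length (gs r))" "!!r. r : R ==> successively (adj k E) ((tl (a r) @ [r]) # gs r @ [a r])"
   "!!r. r : R ==> ALL v:set (gs r). length v = k - 1" "!!r. r : R ==> distinct (concat (gs r))"
   "!!r. r : R ==> set (concat (gs r)) <= U 1" "!!r. r : R ==> card (set (concat (gs r))) <= B"
   "!!r r'. r : R ==> r' : R ==> r ~= r' ==> set (concat (gs r)) Int set (concat (gs r')) = {}"
  unfolding B_def using bspec[OF gs0(1)] bspec[OF bspec[OF gs0(2)]] by simp_all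
 have gne: "ALL v:set (gs r). v ~= []" if "r : R" for r using gs(3)[OF that] k3 by auto
 have gB: "length (gs r) <= B" if "r : R" for r using length_le_concat[OF gne[OF that]] distinct_card[OF gs(4)[OF that]] gs(6)[OF that] by linarith
 \<comment> \<open>Opposite spikes are connected; the index (r, j) stands for the jth pair of the chain of r.\<close>
 define I where "I = (SIGMA r:R. {..<length (gs r) div 2})"
 define x where "x i = (case i of (r, j) => rev (gs r ! j))" for i
 define y where "y i = (case i of (r, j) => gs r ! (length (gs r) - 1 - j))" for i
 have finI: "finite I" using R(1) by (simp add: I_def)
 have cI: "card I <= card R * B"
 proof -
  have "card I = (\<Sum>r\<in>R. length (gs r) div 2)" using R(1) by (simp add: I_def)
  also have "... <= (\<Sum>r\<in>R. B)" using gB by (intro sum_mono) (meson div_le_dividend le_trans)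
  finally show ?thesis by simp
 qed
 have jl: "j < length (gs r)" "length (gs r) - 1 - j < length (gs r)" if "j < length (gs r) div 2" for j r using that by linarith+
 have gnth: "gs r ! j : set (gs r)" "length (gs r ! j) = k - 1 & set (gs r ! j) : nsets V (k - 1) & set (gs r ! j) <= set (concat (gs r)) & set (gs r ! j) ~= {}"
  if r: "r : R" "j < length (gs r)" for r j
 proof -
  show 1: "gs r ! j : set (gs r)" using r(2) by simp
  have 2: "length (gs r ! j) = k - 1" using gs(3)[OF r(1)] 1 by blast
  have 3: "distinct (gs r ! j)" using gs(4)[OF r(1)] 1 by (simp add: distinct_concat_iff)
  have 4: "set (gs r ! j) <= set (concat (gs r))" using 1 by auto
  have 5: "set (gs r ! j) <= V" using 4 gs(5)[OF r(1)] UV[of 1] by auto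
  have 6: "set (gs r ! j) ~= {}" using 2 k3 by auto
  show "length (gs r ! j) = k - 1 & set (gs r ! j) : nsets V (k - 1) & set (gs r ! j) <= set (concat (gs r)) & set (gs r ! j) ~= {}" using 2 3 4 5 6 list_nsets[OF 3 5 2] by simp
 qed
 have gdisj: "set (gs r ! i) Int set (gs r' ! j) = {}" if r: "r : R" "r' : R" "i < length (gs r)" "j < length (gs r')" "r ~= r' | i ~= j" for r r' i j
 proof (cases "r = r'")
  case True thus ?thesis using concat_nth_disjoint[OF gs(4)[OF r(1)] gne[OF r(1)]] r by simp
 next
  case False
  thus ?thesis using gs(7)[OF r(1,2) False] gnth(2)[OF r(1,3)] gnth(2)[OF r(2,4)] by blast
 qed
 have "EX f. (ALL i:I. f i ~= [] & distinct (f i) & win k E (x i @ f i @ y i) & set (f i) <= (\<Union>j<2*k*K. Z (2 * m + j)) & card (set (f i)) <= 2 * (k + M)) &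
   (ALL i:I. ALL j:I. i ~= j --> set (f i) Int set (f j) = {})"
 proof (rule many_tight[OF sc _ _ finI])
  show "fair N (Z (2 * m + j))" if "j < 2 * k * K" for j using Zf[of 2 j] that m by simp
  show "Z (2 * m + i) Int Z (2 * m + j) = {}" if "i < 2 * k * K" "j < 2 * k * K" "i ~= j" for i j using Zd[of 2 i j] that m by simp
  show "card I < 2 ^ K" using cI cnt(1) unfolding B_def by linarith
  have "2 * (k + M) * card I <= 2 * (k + M) * (card R * (2 * (k + M)))" using cI unfolding B_def by (rule mult_le_mono2)
  thus "2 * (k + M) * card I <= g * N / (8 * real k ^ 2)" using cnt(2) by (meson of_nat_mono order_trans)
  show "length (x i) = k - 1 & set (x i) : nsets V (k - 1)" if "i : I" for i using that gnth(2) jl(1) by (auto simp: I_def x_def)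
  show "length (y i) = k - 1 & set (y i) : nsets V (k - 1)" if "i : I" for i using that gnth(2) jl(2) by (auto simp: I_def y_def)
  show "inj_on (%i. set (x i)) I"
  proof (rule inj_on_disjoint)
   show "set (x i) Int set (x j) = {}" if "i : I" "j : I" "i ~= j" for i j
   proof -
    obtain r s r' s' where [simp]: "i = (r, s)" "j = (r', s')" by (metis surj_pair)
    show ?thesis using that gdisj[of r r' s s'] jl(1)[of s r] jl(1)[of s' r'] by (auto simp: I_def x_def)
   qed
   show "set (x i) ~= {}" if "i : I" for i
   proof -
    obtain r s where [simp]: "i = (r, s)" by (cases i)
    show ?thesis using that gnth(2)[of r "s"] jl(1)[of s r] by (simp add: I_def x_def)
   qed
  qed
  show "inj_on (%i. set (y i)) I"
  proof (rule inj_on_disjoint)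
   show "set (y i) Int set (y j) = {}" if "i : I" "j : I" "i ~= j" for i j
   proof -
    obtain r s r' s' where [simp]: "i = (r, s)" "j = (r', s')" by (metis surj_pair)
    have "r ~= r' | length (gs r) - 1 - s ~= length (gs r') - 1 - s'"
    proof (cases "r = r'")
     case True
     hence "s ~= s'" "s < length (gs r)" "s' < length (gs r)" using that jl(1) by (auto simp: I_def)
     thus ?thesis using True by auto
    qed simp
    thus ?thesis using that gdisj[of r r' "length (gs r) - 1 - s" "length (gs r') - 1 - s'"] jl(2)[of s r] jl(2)[of s' r'] by (auto simp: I_def y_def)
   qed
   show "set (y i) ~= {}" if "i : I" for i
   proof -
    obtain r s where [simp]: "i = (r, s)" by (cases i)
    show ?thesis using that gnth(2)[of r "length (gs r) - 1 - s"] jl(2)[of s r] by (simp add: I_def y_def)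
   qed
  qed
 qed
 then obtain c where c0: "ALL i:I. c i ~= [] & distinct (c i) & win k E (x i @ c i @ y i) & set (c i) <= U 2 & card (set (c i)) <= 2 * (k + M)"
   "ALL i:I. ALL j:I. i ~= j --> set (c i) Int set (c j) = {}"
  unfolding UU0 by (elim exE conjE) (rule that)
 have c: "!!i. i : I ==> distinct (c i)" "!!i. i : I ==> win k E (x i @ c i @ y i)" "!!i. i : I ==> set (c i) <= U 2"
   "!!i. i : I ==> card (set (c i)) <= B" "!!i j. i : I ==> j : I ==> i ~= j ==> set (c i) Int set (c j) = {}"
  unfolding B_def using bspec[OF c0(1)] bspec[OF bspec[OF c0(2)]] by simp_all
 have "EX A B. absorber k E r A B & set A = insert r (set (a r)) Un set (concat (gs r)) Un (\<Union>j<length (gs r) div 2. set (c (r, j)))"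
  if r: "r : R" for r
 proof (rule absorber_from_chain[OF k2 al[OF r] aE[OF r] ar(1)[OF r] gs(1)[OF r] gs(2)[OF r] gs(3)[OF r] gs(4)[OF r]])
  have mem: "(r, j) : I" if "j < length (gs r) div 2" for j using that r by (simp add: I_def)
  have aU: "insert r (set (a r)) Int U t = {}" if "t < 3" "t ~= 0" for t using hdU[OF r] UU[of 0 t] that Uz[OF that(1) r] UR[OF that(1)] r by (auto simp: aset)
  show "win k E (rev (gs r ! j) @ c (r, j) @ gs r ! (length (gs r) - 1 - j))" if "j < length (gs r) div 2" for j using c(2)[OF mem[OF that]] by (simp add: x_def y_def)
  show "distinct (c (r, j))" if "j < length (gs r) div 2" for j using c(1)[OF mem[OF that]] .
  show "set (c (r, i)) Int set (c (r, j)) = {}" if "i < length (gs r) div 2" "j < length (gs r) div 2" "i ~= j" for i j using c(5)[OF mem[OF that(1)] mem[OF that(2)]] that(3) by simp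
  show "set (c (r, j)) Int set (concat (gs r)) = {}" if "j < length (gs r) div 2" for j using c(3)[OF mem[OF that]] gs(5)[OF r] UU[of 1 2] by auto
  show "set (c (r, j)) Int insert r (set (a r)) = {}" if "j < length (gs r) div 2" for j using c(3)[OF mem[OF that]] aU[of 2] by auto
  show "set (concat (gs r)) Int insert r (set (a r)) = {}" using gs(5)[OF r] aU[of 1] by auto
 qed
 hence "ALL r. EX AB. r : R --> absorber k E r (fst AB) (snd AB) & set (fst AB) = insert r (set (a r)) Un set (concat (gs r)) Un (\<Union>j<length (gs r) div 2. set (c (r, j)))"
  by (metis fst_conv snd_conv)
 then obtain AB where AB: "!!r. r : R ==> absorber k E r (fst (AB r)) (snd (AB r))"
  "!!r. r : R ==> set (fst (AB r)) = insert r (set (a r)) Un set (concat (gs r)) Un (\<Union>j<length (gs r) div 2. set (c (r, j)))" by metis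
 have cU: "(\<Union>j<length (gs r) div 2. set (c (r, j))) <= U 2" if "r : R" for r using c(3) that by (auto simp: I_def)
 show ?thesis
 proof (rule exI[of _ "%r. fst (AB r)"], rule exI[of _ "%r. snd (AB r)"], intro conjI ballI impI)
  fix r assume r: "r : R"
  show "absorber k E r (fst (AB r)) (snd (AB r))" by (rule AB(1)[OF r])
  show "set (fst (AB r)) <= insert r (set (z r)) Un (\<Union>j<3*m. Z j)"
   unfolding AB(2)[OF r] aset using hdU[OF r] UZ[of 0] gs(5)[OF r] UZ[of 1] cU[OF r] UZ[of 2] by auto
  have "distinct (fst (AB r))" using AB(1)[OF r] by (simp add: absorber_def)
  hence "length (fst (AB r)) = card (insert r (set (a r)) Un set (concat (gs r)) Un (\<Union>j<length (gs r) div 2. set (c (r, j))))" by (simp add: distinct_card[symmetric] AB(2)[OF r])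
  also have "... <= card (insert r (set (a r))) + card (set (concat (gs r))) + card (\<Union>j<length (gs r) div 2. set (c (r, j)))" by (meson add_le_mono card_Un_le le_trans order_refl)
  also have "... <= k + B + B * B"
  proof (intro add_mono)
   have "card (set (a r)) <= k - 1" using card_length[of "a r"] al[OF r] by simp
   thus "card (insert r (set (a r))) <= k" using card_insert_le_m1[of k "set (a r)" r] k3 by simp
   show "card (set (concat (gs r))) <= B" by (rule gs(6)[OF r])
   have "card (\<Union>j<length (gs r) div 2. set (c (r, j))) <= (\<Sum>j<length (gs r) div 2. card (set (c (r, j))))" by (rule card_UN_le) simp
   also have "... <= (\<Sum>j<length (gs r) div 2. B)" using c(4) r by (intro sum_mono) (auto simp: I_def)
   also have "... <= B * B" using gB[OF r] by (simp add: mult_le_mono1 div_le_dividend le_trans[OF div_le_dividend])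
   finally show "card (\<Union>j<length (gs r) div 2. set (c (r, j))) <= B * B" .
  qed
  finally show "length (fst (AB r)) <= k + 2 * (k + M) + (2 * (k + M))^2" unfolding B_def power2_eq_square .
  fix r' assume r': "r' : R" "r ~= r'"
  have d1: "insert r (set (a r)) Int insert r' (set (a r')) = {}" using a_disj[OF r r'] r r' hdU[OF r] hdU[OF r'(1)] UR[of 0] zR[OF r] zR[OF r'(1)] by (auto simp: aset)
  have d2: "(\<Union>j<length (gs r) div 2. set (c (r, j))) Int (\<Union>j<length (gs r') div 2. set (c (r', j))) = {}"
  proof -
   have "set (c (r, i)) Int set (c (r', j)) = {}" if "i < length (gs r) div 2" "j < length (gs r') div 2" for i j by (rule c(5)) (use that r r' in \<open>auto simp: I_def\<close>)
   thus ?thesis by blast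
  qed
  have aU: "insert v (set (a v)) Int U t = {}" if "t < 3" "t ~= 0" "v : R" for t v using hdU[OF that(3)] UU[of 0 t] that Uz[OF that(1,3)] UR[OF that(1)] by (auto simp: aset)
  have a1: "insert v (set (a v)) Int U 1 = {}" "insert v (set (a v)) Int U 2 = {}" if "v : R" for v using aU[of 1 v] aU[of 2 v] that by auto
  have u12: "U 1 Int U 2 = {}" using UU[of 1 2] by simp
  show "set (fst (AB r)) Int set (fst (AB r')) = {}"
   unfolding AB(2)[OF r] AB(2)[OF r'(1)] by (rule three_layers_disjoint[OF d1 gs(7)[OF r r'] d2 gs(5)[OF r] gs(5)[OF r'(1)] cU[OF r] cU[OF r'(1)] a1[OF r] a1[OF r'(1)] u12])
 qed
qed

end

section \<open>Covering almost all vertices by paths\<close>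

text \<open>Deleting a uniformly random element preserves a nonnegative excess of h over al*s on average, so some single deletion preserves it. Repeat until the total size is small.\<close>
lemma averaging:
  fixes s h :: "'j => real"
  assumes "finite J" "!!j. j : J ==> 0 <= s j & s j <= l" "al * sum s J <= sum h J" "b <= sum s J" "b >= 0" "l >= 0"
  shows "\<exists>J'\<subseteq>J. b <= sum s J' & sum s J' <= b + l & al * sum s J' <= sum h J'"
 using assms(1-4)
proof (induction "card J" arbitrary: J rule: less_induct)
 case less
 show ?case
 proof (cases "sum s J <= b + l")
  case True thus ?thesis using less.prems by blast
 next
  case False
  hence "sum s J > 0" using assms(5,6) by linarith
  hence ne: "J ~= {}" by auto
  hence c: "real (card J) >= 1" using less.prems(1) by (simp add: Suc_leI card_gt_0_iff)
  have "EX j:J. al * (sum s J - s j) <= sum h J - h j"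
  proof (rule ccontr)
   assume "~ ?thesis"
   hence "(\<Sum>j\<in>J. sum h J - h j) < (\<Sum>j\<in>J. al * (sum s J - s j))" using less.prems(1) ne by (intro sum_strict_mono) auto
   hence "(real (card J) - 1) * sum h J < (real (card J) - 1) * (al * sum s J)" by (simp add: sum_subtractf sum_distrib_left[symmetric] algebra_simps)
   thus False using less.prems(3) c by (smt (verit) mult_left_mono)
  qed
  then obtain j where j: "j : J" "al * (sum s J - s j) <= sum h J - h j" by blast
  have eq: "sum s (J - {j}) = sum s J - s j" "sum h (J - {j}) = sum h J - h j" using j(1) less.prems(1) by (simp_all add: sum_diff1)
  have "s j <= l" using less.prems(2)[OF j(1)] by simp
  have "\<exists>J'\<subseteq>J - {j}. b <= sum s J' & sum s J' <= b + l & al * sum s J' <= sum h J'"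
  proof (rule less.hyps)
   show "card (J - {j}) < card J" using j(1) less.prems(1) by (metis card_Diff1_less)
   show "b <= sum s (J - {j})" using eq False \<open>s j <= l\<close> by linarith
   show "al * sum s (J - {j}) <= sum h (J - {j})" using j(2) eq by simp
  qed (use less.prems in auto)
  thus ?thesis by blast
 qed
qed

definition shadow :: "'a set set => 'a set set" where
  "shadow E = {e - {x} | e x. e : E & x : e}"

text \<open>The cleaning of min_degree_subfamily for a family of sets in place of functions.\<close>
lemma min_degree_shadow:
  fixes E :: "'a set set" and th :: real
  assumes "finite E" "\<forall>e\<in>E. finite e" "th >= 0" "th * card (shadow E) < card E"
  shows "\<exists>E'\<subseteq>E. E' ~= {} & (\<forall>e\<in>E'. \<forall>x\<in>e. th <= card {e'\<in>E'. e - {x} \<subseteq> e'})"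
 using assms(1,2,4)
proof (induction "card E" arbitrary: E rule: less_induct)
 case less
 have "0 <= th * card (shadow E)" using assms(3) by simp
 hence ne: "E ~= {}" using less.prems(3) by auto
 show ?case
 proof (cases "ALL e:E. ALL x:e. th <= card {e':E. e - {x} <= e'}")
  case True thus ?thesis using ne by blast
 next
  case False
  then obtain e x where ex: "e : E" "x : e" "card {e':E. e - {x} <= e'} < th" by force
  define R where "R = {e':E. e - {x} <= e'}"
  have RE: "R <= E" and eR: "e : R" using ex(1) by (auto simp: R_def)
  have sh: "shadow E <= (%(e, x). e - {x}) ` (SIGMA e:E. e)" by (auto simp: shadow_def)
  have finS: "finite (shadow E)" by (rule finite_subset[OF sh]) (use less.prems in auto)
  have in_sh: "e - {x} : shadow E" using ex by (auto simp: shadow_def)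
  have sub: "shadow (E - R) <= shadow E - {e - {x}}" by (auto simp: shadow_def R_def)
  have "card (shadow (E - R)) <= card (shadow E - {e - {x}})" using finS sub by (intro card_mono) auto
  also have "... = card (shadow E) - 1" using in_sh by simp
  finally have c1: "card (shadow (E - R)) <= card (shadow E) - 1" .
  have "card (shadow E) >= 1" using in_sh finS by (metis One_nat_def Suc_leI card_gt_0_iff empty_iff)
  with c1 have c2: "real (card (shadow (E - R))) <= real (card (shadow E)) - 1" by linarith
  have cE: "real (card (E - R)) = card E - real (card R)" using RE less.prems(1) by (simp add: card_Diff_subset card_mono finite_subset of_nat_diff)
  have "th * card (shadow (E - R)) <= th * (real (card (shadow E)) - 1)" using c2 assms(3) by (rule mult_left_mono)
  also have "... < card (E - R)" using less.prems(3) ex(3) cE by (simp add: R_def algebra_simps)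
  finally have lt: "th * card (shadow (E - R)) < card (E - R)" .
  have "card (E - R) < card E" using RE eR less.prems(1) by (intro psubset_card_mono) auto
  from less.hyps[OF this _ _ lt] less.prems have "\<exists>E'\<subseteq>E - R. E' ~= {} & (ALL e:E'. ALL x:e. th <= card {e':E'. e - {x} <= e'})" by simp
  thus ?thesis by (meson Diff_subset order_trans)
 qed
qed

text \<open>Walk greedily: at each step at most m - 1 vertices are used and at least m continuations exist.\<close>
lemma long_path:
  fixes E :: "'a set set"
  assumes "E ~= {}" "!!e. e : E ==> finite e & card e = k" "k >= 1"
    and deg: "!!e x. e : E ==> x : e ==> m <= card {e'\<in>E. e - {x} \<subseteq> e'}"
    and n: "k <= n" "n <= m"
  shows "\<exists>xs. distinct xs & length xs = n & win k E xs"
 using n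
proof (induction n rule: dec_induct)
 case base
 obtain e where e: "e : E" using assms(1) by blast
 then obtain xs where xs: "set xs = e" "distinct xs" using finite_distinct_list assms(2) by blast
 hence "length xs = k" using assms(2) e distinct_card by metis
 thus ?case using xs e by (intro exI[of _ xs]) (auto simp: win_def)
next
 case (step n)
 then obtain xs where xs: "distinct xs" "length xs = n" "win k E xs" by auto
 define P f x where "P = take (n - k) xs" "f = drop (n - k + 1) xs" "x = xs ! (n - k)"
 have split: "xs = P @ x # f" unfolding P_f_x_def using id_take_nth_drop[of "n - k" xs] xs(2) step.hyps assms(3) by simp
 have lf: "length f = k - 1" using xs(2) step.hyps by (simp add: P_f_x_def)
 have "win k E (x # f)" using xs(3) split win_appendD2 by metis
 hence e: "insert x (set f) : E" using lf assms(3) by (auto simp: win_def dest!: spec[of _ 0])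
 have s: "insert x (set f) - {x} = set f" using xs(1) split by auto
 have ex: "EX y. y ~: set xs & insert y (set f) : E"
 proof (rule ccontr)
  assume none: "~ ?thesis"
  have "{e':E. set f <= e'} <= (%y. insert y (set f)) ` set xs"
  proof
   fix e' assume e': "e' : {e':E. set f <= e'}"
   have "card (set f) = k - 1" using lf xs(1) split by (simp add: distinct_card)
   hence "card (e' - set f) = 1" using e' assms(2,3) by (simp add: card_Diff_subset)
   then obtain y where "e' - set f = {y}" by (auto simp: card_1_singleton_iff)
   hence "e' = insert y (set f)" using e' by auto
   thus "e' : (%y. insert y (set f)) ` set xs" using none e' by blast
  qed
  hence "card {e':E. set f <= e'} <= card ((%y. insert y (set f)) ` set xs)" by (intro card_mono) auto
  also have "... <= n" using card_image_le[of "set xs"] card_length[of xs] xs(2) le_trans by blast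
  finally show False using deg[OF e, of x] s step.prems by simp
 qed
 then obtain y where y: "y ~: set xs" "insert y (set f) : E" by blast
 have "win k E (xs @ [y])" using win_snoc[of k E "P @ [x]" f y] xs(3) split y(2) lf assms(3) by simp
 thus ?case using xs y by (intro exI[of _ "xs @ [y]"]) auto
qed

text \<open>The k-windows at multiples of k partition the list.\<close>
lemma win_count:
  assumes "win k E xs" "distinct xs" "length xs = k * q" "!!e. e : E ==> card (e \<inter> B) = 1" "k >= 1"
  shows "card (set xs \<inter> B) = q"
 using assms(1-3)
proof (induction q arbitrary: xs)
 case (Suc q)
 have "win k E (drop k xs)" using Suc.prems(1) win_appendD2 by (metis append_take_drop_id)
 hence IH: "card (set (drop k xs) Int B) = q" using Suc.prems Suc.IH[of "drop k xs"] by simp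
 have "set (take k xs) : E" using Suc.prems(1,3) by (auto simp: win_def dest: spec[of _ 0])
 hence c1: "card (set (take k xs) Int B) = 1" by (rule assms(4))
 have "set (take k xs) Int set (drop k xs) = {}" using Suc.prems(2) by (rule set_take_disj_set_drop_if_distinct) simp
 moreover have "set xs Int B = (set (take k xs) Int B) Un (set (drop k xs) Int B)" by (metis Int_Un_distrib2 append_take_drop_id set_append)
 ultimately have "card (set xs Int B) = card (set (take k xs) Int B) + card (set (drop k xs) Int B)" by (simp add: card_Un_disjoint disjoint_iff)
 thus ?case using IH c1 by simp
qed simp

lemma choose_step: "Suc j <= m ==> (m choose j) * (m - j) = Suc j * (m choose Suc j)"
 using binomial_absorption[of j m] binomial_absorb_comp[of m j] by (simp only: mult.commute)

lemma card_nsets_choose: "finite A ==> card (nsets A j) = card A choose j"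
 using n_subsets[of A j] by (simp add: nsets_def cong: conj_cong) (metis (mono_tags, lifting) Collect_cong rev_finite_subset)

context pseudorandom begin

text \<open>Split a (k-1)-set a that meets C into a vertex of C and a (k-2)-set, and sum mixing over the latter.\<close>
lemma typed_count:
  assumes "U \<subseteq> V" "X \<subseteq> V" "U \<inter> X = {}" "C \<subseteq> U"
  shows "card {(a, v, c). a : nsets U (k - 1) & v : X & insert v a : G & c : a \<inter> C} <=
     real (card U choose (k - 2)) * ((1 + g/8) * max (p * card C * card X) (card V * L))" (is "real (card ?A) <= _")
proof -
 let ?S = "%z. {(c, x) : C \<times> X. insert c (insert x z) : G}"
 have fU: "finite U" and fX: "finite X" using assms finV by (auto intro: finite_subset)
 hence fC: "finite C" using assms(4) finite_subset by blast
 have fN: "finite (nsets U (k - 2))" using fU by (rule finite_imp_finite_nsets)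
 have fS: "finite (?S z)" for z by (rule finite_subset[of _ "C \<times> X"]) (use fC fX in auto)
 have "card ?A <= card (SIGMA z:nsets U (k - 2). ?S z)"
 proof (rule card_inj_on_le)
  let ?f = "%(a, v, c). (a - {c}, c, v)"
  show "inj_on ?f ?A"
  proof (rule inj_onI)
   fix s t assume st: "s : ?A" "t : ?A" "?f s = ?f t"
   obtain a v c a' v' c' where e: "s = (a, v, c)" "t = (a', v', c')" by (metis surj_pair)
   hence "c' = c" "v' = v" "a - {c} = a' - {c}" "c : a" "c : a'" using st by auto
   thus "s = t" unfolding e by (metis insert_Diff)
  qed
  show "?f ` ?A <= (SIGMA z:nsets U (k - 2). ?S z)"
  proof
   fix t assume "t : ?f ` ?A"
   then obtain a v c where t: "t = (a - {c}, c, v)" "a : nsets U (k - 1)" "v : X" "insert v a : G" "c : a" "c : C" by auto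
   have "a - {c} : nsets U (k - 2)" using t(2,5) by (auto simp: nsets_def numeral_2_eq_2)
   moreover have "insert c (insert v (a - {c})) = insert v a" using t(5) by auto
   ultimately show "t : (SIGMA z:nsets U (k - 2). ?S z)" using t by simp
  qed
  show "finite (SIGMA z:nsets U (k - 2). ?S z)" using fN fS by blast
 qed
 hence "real (card ?A) <= real (card (SIGMA z:nsets U (k - 2). ?S z))" by (rule of_nat_mono)
 also have "... = (\<Sum>z\<in>nsets U (k - 2). real (card (?S z)))" using fN fS by simp
 also have "... <= (\<Sum>z\<in>nsets U (k - 2). (1 + g/8) * max (p * card C * card X) (card V * L))" by (intro sum_mono mixing) (use assms nsets_mono[OF assms(1), of "k - 2"] in auto)
 also have "... = real (card U choose (k - 2)) * ((1 + g/8) * max (p * card C * card X) (card V * L))" using fU by (simp add: card_nsets_choose)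
 finally show ?thesis .
qed

end

definition packing :: "nat => 'a set set => nat => 'a set => 'a list set => bool" where
  "packing k E l S P \<longleftrightarrow> (\<forall>xs\<in>P. length xs = l & distinct xs & win k E xs & set xs \<subseteq> S) &
     (\<forall>xs\<in>P. \<forall>ys\<in>P. xs ~= ys --> set xs \<inter> set ys = {})"

lemma packing_finite: "finite S ==> packing k E l S P ==> finite P & P \<subseteq> {xs. set xs \<subseteq> S & length xs = l}"
 using finite_subset[OF _ finite_lists_length_eq[of S l], of P] by (auto simp: packing_def)

context host begin

text \<open>Consider the edges with k-1 vertices in U and one in B. By typed_count those that meet the used vertices are less than the hypothesis h guarantees, so cleaning leaves a family of large minimum degree. Exchanging a vertex of such an edge keeps its type, so a tight path in this family has exactly every kth vertex in B.\<close>
lemma one_more_path: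
  fixes m b q :: nat
  assumes U: "U \<subseteq> V" "B \<subseteq> V" "U \<inter> B = {}" "card U = m" and b: "b <= card B" "card B <= 2 * b"
    and h: "9/20 * p * real (m choose (k - 1)) * card B <= card {(a, v). a : nsets U (k - 1) & v : B & insert v a : E}"
    and par: "100 * k * b <= m" "50 * real k * L * card V <= p * m * b" "40 * real k * q <= p * b" "q >= 1"
    and used: "Ur \<subseteq> U" "Br \<subseteq> B" "card Ur <= card B" "3 * card Br <= card B"
  shows "\<exists>xs. length xs = k * q & distinct xs & win k E xs & set xs \<subseteq> (U - Ur) \<union> (B - Br) & card (set xs \<inter> B) = q"
proof -
 define t where "t = real (m choose (k - 1))"
 define c2 where "c2 = real (m choose (k - 2))"
 define n where "n = real (card V)"
 have kr: "real k >= 3" and k1: "k >= 1" using k3 by auto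
 have fin: "finite U" "finite B" using U finV by (auto intro: finite_subset)
 have "40 * real k * q > 0" using kr par(4) by simp
 hence "b > 0" using par(3) p0 by (cases "b = 0") auto
 hence b1: "b >= 1" by simp
 hence m100: "100 * k <= m" using par(1) by (metis le_trans mult.right_neutral mult_le_mono2)
 have mr: "real m >= 100 * real k" using m100 by (metis of_nat_le_iff of_nat_mult of_nat_numeral)
 have Br1: "real (card B) >= 1" using b(1) b1 by linarith
 have "m choose (k - 1) > 0" using m100 k3 by (simp add: zero_less_binomial_iff)
 hence t1: "t >= 1" unfolding t_def by linarith
 define Q where "Q = t * p * card B"
 have Q0: "Q > 0" using t1 p0 Br1 by (simp add: Q_def)
 have c20: "c2 >= 0" by (simp add: c2_def)
 have c2t: "c2 * m <= 51/50 * (real k - 1) * t"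
 proof -
  have "(m choose (k - 2)) * (m - (k - 2)) = Suc (k - 2) * (m choose Suc (k - 2))" using m100 k3 by (intro choose_step) simp
  hence "real (m choose (k - 2)) * real (m - (k - 2)) = real (Suc (k - 2)) * real (m choose Suc (k - 2))" by (metis of_nat_mult)
  moreover have "Suc (k - 2) = k - 1" using k3 by simp
  moreover have "real (m - (k - 2)) = real m - (real k - 2)" "real (k - 1) = real k - 1" using m100 k3 by (simp_all add: of_nat_diff)
  ultimately have e: "c2 * (real m - (real k - 2)) = (real k - 1) * t" by (simp add: c2_def t_def algebra_simps)
  have "50/51 * real m <= real m - (real k - 2)" using mr kr by linarith
  hence "c2 * (50/51 * real m) <= c2 * (real m - (real k - 2))" using c20 by (intro mult_left_mono)
  thus ?thesis using e by (simp add: algebra_simps)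
 qed
 have Bm: "real (card B) * (50 * k) <= m"
 proof -
  have "card B * (50 * k) <= 2 * b * (50 * k)" using b(2) by (rule mult_le_mono1)
  also have "... <= m" using par(1) by (simp add: mult_ac)
  finally have "real (card B * (50 * k)) <= real m" by (rule of_nat_mono)
  thus ?thesis by simp
 qed
 have nL: "50 * real k * (n * L) <= p * m * card B"
 proof -
  have "p * m * b <= p * m * card B" using b(1) p0 by (intro mult_left_mono) auto
  thus ?thesis using par(2) by (simp add: n_def mult_ac)
 qed
 have g8: "1 + g/8 <= 81/80" using g1 by simp
 define T where "T X C = {(a, v, c). a : nsets U (k - 1) & v : X & insert v a : G & c : a Int C}" for X C
 have Tb: "card (T X C) <= c2 * (81/80 * M)" if "X <= B" "C <= U" "p * card C * card X <= M" "n * L <= M" for X C M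
 proof -
  have "card (T X C) <= real (card U choose (k - 2)) * ((1 + g/8) * max (p * card C * card X) (card V * L))"
   unfolding T_def by (rule typed_count) (use U that in auto)
  also have "... <= c2 * (81/80 * M)"
   unfolding c2_def U(4) using that g8 g0 p0 L1 by (intro mult_left_mono mult_mono) (auto simp: n_def intro!: max.coboundedI1)
  finally show ?thesis .
 qed
 have fT: "finite (T X C)" if "X <= B" for X C
 proof (rule finite_subset)
  show "T X C <= nsets U (k - 1) \<times> B \<times> U" using that by (auto simp: T_def nsets_def)
  show "finite (nsets U (k - 1) \<times> B \<times> U)" using fin finite_imp_finite_nsets by blast
 qed
 define PP where "PP = {(a, v). a : nsets U (k - 1) & v : B & insert v a : E}"
 define P1 where "P1 = {(a, v) : PP. v : Br}"
 define P2 where "P2 = {(a, v) : PP. a Int Ur ~= {}}"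
 define P0 where "P0 = {(a, v). a : nsets (U - Ur) (k - 1) & v : B - Br & insert v a : E}"
 have fP: "finite PP"
 proof (rule finite_subset)
  show "PP <= nsets U (k - 1) \<times> B" by (auto simp: PP_def)
  show "finite (nsets U (k - 1) \<times> B)" using fin finite_imp_finite_nsets by blast
 qed
 have P1: "(real k - 1) * card P1 <= c2 * (81/80 * (p * m * card B / 3))"
 proof -
  have "(k - 1) * card P1 = card (SIGMA (a, v):P1. a)"
  proof -
   have "card (SIGMA av:P1. fst av) = (\<Sum>av\<in>P1. card (fst av))"
   proof (rule card_SigmaI)
    show "finite P1" by (rule finite_subset[OF _ fP]) (auto simp: P1_def)
   qed (auto simp: P1_def PP_def nsets_def)
   also have "... = (\<Sum>av\<in>P1. k - 1)" by (intro sum.cong) (auto simp: P1_def PP_def nsets_def)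
   finally show ?thesis by (simp add: case_prod_unfold)
  qed
  also have "... <= card (T Br U)"
  proof (rule card_inj_on_le)
   show "inj_on (%((a, v), c). (a, v, c)) (SIGMA (a, v):P1. a)" by (auto simp: inj_on_def)
   show "(%((a, v), c). (a, v, c)) ` (SIGMA (a, v):P1. a) <= T Br U" using EG by (auto simp: T_def P1_def PP_def nsets_def)
  qed (rule fT[OF used(2)])
  finally have "real ((k - 1) * card P1) <= real (card (T Br U))" by (rule of_nat_mono)
  moreover have "real ((k - 1) * card P1) = (real k - 1) * card P1" using k3 by (simp add: of_nat_diff)
  moreover have "card (T Br U) <= c2 * (81/80 * (p * m * card B / 3))"
  proof (rule Tb[OF used(2)])
   have "real (card Br) <= card B / 3" using used(4) by linarith
   hence "p * m * card Br <= p * m * (card B / 3)" using p0 by (intro mult_left_mono) auto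
   thus "p * card U * card Br <= p * m * card B / 3" using U(4) by simp
   have "3 * (n * L) <= 50 * real k * (n * L)" using kr L1 by (intro mult_right_mono) (auto simp: n_def)
   thus "n * L <= p * m * card B / 3" using nL by linarith
  qed simp
  ultimately show ?thesis by linarith
 qed
 have P2: "card P2 <= c2 * (81/80 * (p * m * card B / (50 * k)))"
 proof -
  have "card P2 <= card (T B Ur)"
  proof (rule card_inj_on_le)
   let ?f = "%(a, v). (a, v, SOME c. c : a Int Ur)"
   show "inj_on ?f P2" by (auto simp: inj_on_def)
   show "?f ` P2 <= T B Ur"
   proof
    fix y assume "y : ?f ` P2"
    then obtain a v where y: "y = (a, v, SOME c. c : a Int Ur)" "(a, v) : P2" by auto
    have "EX c. c : a Int Ur" using y(2) by (auto simp: P2_def)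
    hence "(SOME c. c : a Int Ur) : a Int Ur" by (rule someI_ex)
    thus "y : T B Ur" using y EG by (auto simp: T_def P2_def PP_def)
   qed
  qed (rule fT, simp)
  hence "real (card P2) <= real (card (T B Ur))" by (rule of_nat_mono)
  also have "... <= c2 * (81/80 * (p * m * card B / (50 * k)))"
  proof (rule Tb[OF _ used(1)])
   have "real (card Ur) * (50 * k) <= real (card B) * (50 * k)" using used(3) by (intro mult_right_mono) auto
   hence "real (card Ur) * (50 * k) <= m" using Bm by linarith
   hence "real (card Ur) <= m / (50 * k)" using kr by (simp add: field_simps)
   hence "p * card B * card Ur <= p * card B * (m / (50 * k))" using p0 by (intro mult_left_mono) auto
   thus "p * card Ur * card B <= p * m * card B / (50 * k)" by (simp add: mult_ac)
   show "n * L <= p * m * card B / (50 * k)" using nL kr by (simp add: field_simps)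
  qed simp
  finally show ?thesis .
 qed
 have cP1: "card P1 <= 7/20 * Q"
 proof -
  have "(real k - 1) * card P1 <= (81/80/3 * p * card B) * (c2 * m)" using P1 by (simp add: mult_ac)
  also have "... <= (81/80/3 * p * card B) * (51/50 * (real k - 1) * t)" using c2t p0 by (intro mult_left_mono) auto
  also have "... = (real k - 1) * (81/80/3 * (51/50) * Q)" by (simp add: Q_def mult_ac)
  finally have "card P1 <= 81/80/3 * (51/50) * Q" by (rule mult_left_le_imp_le) (use kr in simp)
  thus ?thesis using Q0 by linarith
 qed
 have cP2: "card P2 <= 1/40 * Q"
 proof -
  have "card P2 <= (81/80/(50*k) * p * card B) * (c2 * m)" using P2 by (simp add: mult_ac)
  also have "... <= (81/80/(50*k) * p * card B) * (51/50 * (real k - 1) * t)" using c2t p0 by (intro mult_left_mono) auto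
  also have "... = (81/80/50 * (51/50) * Q) * ((real k - 1) / k)" by (simp add: Q_def mult_ac)
  also have "... <= (81/80/50 * (51/50) * Q) * 1" using Q0 kr by (intro mult_left_mono) auto
  finally show ?thesis using Q0 by linarith
 qed
 define E0 where "E0 = (%(a, v). insert v a) ` P0"
 have P0sub: "PP - P1 - P2 <= P0" by (auto simp: PP_def P1_def P2_def P0_def nsets_def)
 have fP0: "finite P0" by (rule finite_subset[OF _ fP]) (auto simp: P0_def PP_def nsets_def)
 have aB: "a Int B = {}" "v : B" "v ~: a" "finite a" "card a = k - 1" "insert v a : E" "a <= U - Ur" "v : B - Br" if "(a, v) : P0" for a v using that U(3) by (auto simp: P0_def nsets_def)
 have inj: "inj_on (%(a, v). insert v a) P0"
 proof (rule inj_onI, clarify)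
  fix a v a' v' assume P: "(a, v) : P0" "(a', v') : P0" and eq: "insert v a = insert v' a'"
  have "insert v a Int B = {v}" "insert v' a' Int B = {v'}" using aB(1,2)[OF P(1)] aB(1,2)[OF P(2)] by auto
  hence "v = v'" using eq by simp
  moreover have "a = insert v a - {v}" "a' = insert v' a' - {v'}" using aB(3)[OF P(1)] aB(3)[OF P(2)] by auto
  ultimately show "a = a' & v = v'" using eq by metis
 qed
 have cE0: "real (card E0) >= 3/40 * Q"
 proof -
  have f: "finite P1" "finite P2" by (rule finite_subset[OF _ fP], auto simp: P1_def P2_def)+
  hence "card PP <= card (P0 Un (P1 Un P2))" using fP0 P0sub by (intro card_mono) auto
  also have "... <= card P0 + (card P1 + card P2)" using card_Un_le[of P0 "P1 Un P2"] card_Un_le[of P1 P2] by linarith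
  finally have "real (card PP) <= real (card P0) + (card P1 + card P2)" by linarith
  moreover have "9/20 * Q <= card PP" using h by (simp add: PP_def Q_def t_def mult_ac)
  moreover have "card E0 = card P0" unfolding E0_def by (rule card_image[OF inj])
  ultimately show ?thesis using cP1 cP2 Q0 by linarith
 qed
 have E0: "e <= (U - Ur) Un (B - Br)" "finite e" "card e = k" "e : E" "card (e Int B) = 1" if e: "e : E0" for e
 proof -
  obtain a v where av: "e = insert v a" "(a, v) : P0" using e by (auto simp: E0_def)
  note x = aB[OF av(2)]
  show "e <= (U - Ur) Un (B - Br)" "finite e" "card e = k" "e : E" using x av(1) k1 by auto
  have "e Int B = {v}" using x av(1) by auto
  thus "card (e Int B) = 1" by simp
 qed
 define th where "th = 3/100 * p * card B"
 have th0: "th >= 0" using p0 by (simp add: th_def)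
 have shd: "card (shadow E0) <= 2 * t"
 proof -
  have sub: "shadow E0 <= nsets U (k - 1) Un (%(z, v). insert v z) ` (nsets U (k - 2) \<times> B)"
  proof
   fix s assume "s : shadow E0"
   then obtain a v x where s: "s = insert v a - {x}" "(a, v) : P0" "x : insert v a" by (auto simp: shadow_def E0_def)
   note y = aB[OF s(2)]
   show "s : nsets U (k - 1) Un (%(z, v). insert v z) ` (nsets U (k - 2) \<times> B)"
   proof (cases "x = v")
    case True
    hence "s = a" using s(1) y(3) by auto
    thus ?thesis using y by (auto simp: nsets_def)
   next
    case False
    hence "s = insert v (a - {x})" "x : a" using s by auto
    moreover have "a - {x} : nsets U (k - 2)" using y \<open>x : a\<close> by (auto simp: nsets_def numeral_2_eq_2)
    ultimately show ?thesis using y(2) by auto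
   qed
  qed
  have "card (shadow E0) <= card (nsets U (k - 1) Un (%(z, v). insert v z) ` (nsets U (k - 2) \<times> B))" using sub fin finite_imp_finite_nsets by (intro card_mono) blast+
  also have "... <= card (nsets U (k - 1)) + card (nsets U (k - 2) \<times> B)" using fin finite_imp_finite_nsets by (intro order_trans[OF card_Un_le] add_mono card_image_le) blast+
  also have "... = (m choose (k - 1)) + (m choose (k - 2)) * card B" using fin U(4) by (simp add: card_nsets_choose card_cartesian_product)
  finally have "real (card (shadow E0)) <= real ((m choose (k - 1)) + (m choose (k - 2)) * card B)" by (rule of_nat_mono)
  hence 1: "real (card (shadow E0)) <= t + c2 * card B" by (simp add: t_def c2_def)
  have "(50 * real k) * (c2 * card B) = c2 * (real (card B) * (50 * k))" by simp
  also have "... <= c2 * m" using Bm c20 by (rule mult_left_mono)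
  also have "... <= (51/50 * (real k - 1)) * t" using c2t by simp
  also have "... <= (50 * real k) * t" using kr t1 by (intro mult_right_mono) auto
  finally have "c2 * card B <= t" by (rule mult_left_le_imp_le) (use kr in simp)
  thus ?thesis using 1 by simp
 qed
 have fE0: "finite E0" using fP0 by (simp add: E0_def)
 have "\<exists>E'\<subseteq>E0. E' ~= {} & (ALL e:E'. ALL x:e. th <= card {e':E'. e - {x} <= e'})"
 proof (rule min_degree_shadow[OF fE0 _ th0])
  show "ALL e:E0. finite e" using E0(2) by blast
  have "th * card (shadow E0) <= th * (2 * t)" using shd th0 by (rule mult_left_mono)
  also have "... = 3/50 * Q" by (simp add: th_def Q_def)
  also have "... < card E0" using cE0 Q0 by linarith
  finally show "th * card (shadow E0) < card E0" .
 qed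
 then obtain E' where E': "E' <= E0" "E' ~= {}" "ALL e:E'. ALL x:e. th <= card {e':E'. e - {x} <= e'}" by (elim exE conjE) (rule that)
 have kq: "real (k * q) <= th"
 proof -
  have "p * b <= p * card B" using b(1) p0 by (intro mult_left_mono) auto
  hence "40 * (real k * q) <= p * card B" using par(3) by linarith
  moreover have "p * card B > 0" using p0 Br1 by simp
  ultimately show ?thesis by (simp add: th_def)
 qed
 have "EX xs. distinct xs & length xs = k * q & win k E' xs"
 proof (rule long_path[OF E'(2) _ k1 _ _ order_refl])
  show "finite e & card e = k" if "e : E'" for e using E0(2,3) E'(1) that by blast
  show "k * q <= card {e':E'. e - {x} <= e'}" if "e : E'" "x : e" for e x using E'(3) kq that by (metis of_nat_le_iff order_trans)
  show "k <= k * q" using par(4) by simp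
 qed
 then obtain xs where xs: "distinct xs" "length xs = k * q" "win k E' xs" by blast
 have "card (set xs Int B) = q" by (rule win_count[OF xs(3,1,2) _ k1]) (use E0(5) E'(1) in blast)
 moreover have "win k E xs" using win_mono[OF xs(3)] E'(1) E0(4) by blast
 moreover have "set xs <= (U - Ur) Un (B - Br)"
 proof
  fix x assume "x : set xs"
  then obtain i where i: "i < length xs" "x = xs ! i" by (metis in_set_conv_nth)
  have kl: "k <= length xs" using xs(2) par(4) by simp
  define j where "j = min i (length xs - k)"
  have j: "j + k <= length xs" "j <= i" "i - j < k" using kl i(1) k1 by (auto simp: j_def)
  have "x : set (take k (drop j xs))"
  proof -
   have "take k (drop j xs) ! (i - j) = x" using i j by simp
   moreover have "i - j < length (take k (drop j xs))" using i j by simp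
   ultimately show ?thesis by (metis nth_mem)
  qed
  moreover have "set (take k (drop j xs)) : E0" using xs(3) j(1) E'(1) unfolding win_def by blast
  ultimately show "x : (U - Ur) Un (B - Br)" using E0(1) by blast
 qed
 ultimately show ?thesis using xs by blast
qed

text \<open>The paths found so far take q vertices of B each, that is at most a third of B as k is at least 3.\<close>
lemma more_paths:
  fixes m b q r D :: nat
  assumes U: "U \<subseteq> V" "B \<subseteq> V" "U \<inter> B = {}" "card U = m" and b: "b <= card B" "card B <= 2 * b"
    and h: "9/20 * p * real (m choose (k - 1)) * card B <= card {(a, v). a : nsets U (k - 1) & v : B & insert v a : E}"
    and par: "100 * k * b <= m" "50 * real k * L * card V <= p * m * b" "40 * real k * q <= p * b" "q >= 1"
    and D: "D * (k * q) <= card B" "r <= Suc D"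
  shows "\<exists>Q. packing k E (k * q) (U \<union> B) Q & card Q = r & (\<forall>xs\<in>Q. card (set xs \<inter> B) = q)"
 using D(2)
proof (induction r)
 case 0 thus ?case by (intro exI[of _ "{}"]) (simp add: packing_def)
next
 case (Suc r)
 then obtain Q where Q: "packing k E (k * q) (U Un B) Q" "card Q = r" "ALL xs:Q. card (set xs Int B) = q" by auto
 have finUB: "finite (U Un B)" using U finV by (meson finite_UnI finite_subset)
 have finQ: "finite Q" using packing_finite[OF finUB Q(1)] by simp
 define W where "W = (\<Union>xs\<in>Q. set xs)"
 have W: "W <= U Un B" using Q(1) by (auto simp: W_def packing_def)
 have kq: "k * q >= 1" using k3 par(4) by simp
 have rD: "r * (k * q) <= card B" using D(1) Suc.prems by (meson le_trans mult_le_mono1 Suc_le_mono)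
 have cW: "card W <= r * (k * q)"
 proof -
  have "card W <= (\<Sum>xs\<in>Q. card (set xs))" unfolding W_def using finQ by (rule card_UN_le)
  also have "... <= (\<Sum>xs\<in>Q. k * q)" using Q(1) by (intro sum_mono) (auto simp: packing_def intro: card_length[THEN order_trans])
  finally show ?thesis using Q(2) by simp
 qed
 have cBr: "card (W Int B) <= r * q"
 proof -
  have "W Int B = (\<Union>xs\<in>Q. set xs Int B)" by (auto simp: W_def)
  hence "card (W Int B) <= (\<Sum>xs\<in>Q. card (set xs Int B))" using card_UN_le[OF finQ, of "%xs. set xs Int B"] by simp
  also have "... = r * q" using Q(2,3) by simp
  finally show ?thesis .
 qed
 have finW: "finite W" using W finUB finite_subset by blast
 have "EX xs. length xs = k * q & distinct xs & win k E xs & set xs <= (U - W Int U) Un (B - W Int B) & card (set xs Int B) = q"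
 proof (rule one_more_path[OF U b h par])
  have "card (W Int U) <= card W" using finW by (intro card_mono) auto
  thus "card (W Int U) <= card B" using cW rD by linarith
  have "3 * (r * q) <= k * (r * q)" using k3 by (rule mult_le_mono1)
  also have "... = r * (k * q)" by simp
  finally show "3 * card (W Int B) <= card B" using cBr rD by linarith
 qed auto
 then obtain xs where xs: "length xs = k * q" "distinct xs" "win k E xs" "set xs <= (U - W Int U) Un (B - W Int B)" "card (set xs Int B) = q" by (elim exE conjE) (rule that)
 have dj: "set xs Int W = {}" using xs(4) by blast
 have ne: "set xs ~= {}" using xs(1) kq by auto
 have dj': "set xs Int set ys = {}" if "ys : Q" for ys using dj that unfolding W_def by blast
 have nQ: "xs ~: Q" using dj'[of xs] ne by auto
 have "packing k E (k * q) (U Un B) (insert xs Q)"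
  unfolding packing_def
 proof (intro conjI ballI impI)
  fix ys assume "ys : insert xs Q"
  hence "length ys = k * q & distinct ys & win k E ys & set ys <= U Un B" using xs Q(1) unfolding packing_def by auto
  thus "length ys = k * q" "distinct ys" "win k E ys" "set ys <= U Un B" by simp_all
  fix zs assume "zs : insert xs Q" "ys ~= zs"
  moreover have "set ys Int set zs = {}" if "ys : Q" "zs : Q" using Q(1) that \<open>ys ~= zs\<close> by (simp add: packing_def)
  ultimately show "set ys Int set zs = {}" using dj'[of ys] dj'[of zs] \<open>ys : insert xs Q\<close> by (auto simp: Int_commute)
 qed
 thus ?case using nQ finQ Q(2,3) xs(5) by (intro exI[of _ "insert xs Q"]) auto
qed

lemma double_count:
  assumes "finite A" "finite B"
  shows "(\<Sum>v\<in>B. card {a\<in>A. R a v}) = (\<Sum>a\<in>A. card {v\<in>B. R a v})"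
proof -
 have c: "card {x:X. P x} = (\<Sum>x\<in>X. if P x then 1 else 0)" if "finite X" for X :: "'z set" and P using sum.inter_filter[OF that, of "%_. 1::nat" P] by simp
 show ?thesis unfolding c[OF assms(1)] c[OF assms(2)] by (rule sum.swap)
qed

text \<open>Sum the codegrees of the (k-1)-subsets of U. By spread, all but a few of these sets have few neighbours outside S.\<close>
lemma dense_to_tuples:
  fixes m :: nat
  assumes S: "S \<subseteq> V" and U: "U \<subseteq> V" "card U = m" "real k ^ 2 <= m"
    and deg: "!!a. a : nsets V (k - 1) ==> p * card V / 2 <= deg E a V"
    and F: "128 * real k * card (V - S) <= card V" and L: "256 * real k ^ 2 * L <= p * card V" "64 * L <= p * m"
  shows "9/20 * p * real (m choose (k - 1)) * card S <= (\<Sum>v\<in>S. real (card {a\<in>nsets U (k - 1). insert v a : E}))"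
proof -
 define T where "T = nsets U (k - 1)"
 define n where "n = real (card V)"
 define t where "t = real (m choose (k - 1))"
 have kr: "real k >= 3" using k3 by simp
 have fU: "finite U" and fS: "finite S" using U S finV finite_subset by blast+
 have TV: "T <= nsets V (k - 1)" unfolding T_def using U(1) by (rule nsets_mono)
 have fT: "finite T" unfolding T_def using fU by (rule finite_imp_finite_nsets)
 have cT: "real (card T) = t" using fU U(2) by (simp add: T_def t_def card_nsets_choose)
 have km: "k - 1 <= m"
 proof -
  have "real k * 1 <= real k * real k" using kr by (intro mult_left_mono) auto
  hence "real k <= m" using U(3) by (simp add: power2_eq_square)
  thus ?thesis by linarith
 qed
 have tm: "real m <= t"
 proof -
  define x where "x = real m / (real k - 1)"
  have k10: "real k - 1 > 0" using kr by simp
  have "(real k - 1) * (real k - 1) <= real k * real k" using kr by (intro mult_mono) auto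
  hence sq: "(real k - 1) * (real k - 1) <= m" using U(3) by (simp add: power2_eq_square)
  hence x1: "x >= real k - 1" using k10 by (simp add: x_def field_simps)
  have "real m = x * (real k - 1)" using k10 by (simp add: x_def)
  also have "... <= x * x" using x1 k10 by (intro mult_left_mono) auto
  also have "... = x ^ 2" by (simp add: power2_eq_square)
  also have "... <= x ^ (k - 1)" using x1 kr k3 by (intro power_increasing) auto
  also have "... = (real m / real (k - 1)) ^ (k - 1)" using k3 by (simp add: x_def of_nat_diff)
  also have "... <= t" unfolding t_def by (rule binomial_ge_n_over_k_pow_k[OF km])
  finally show ?thesis .
 qed
 define Bad where "Bad = {a:T. p * n / 32 <= deg G a (V - S)}"
 have bad: "32 * real (card Bad) <= t"
 proof -
  have Fk: "real k * card (V - S) <= n / 128" using F by (simp add: n_def)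
  have "real (card Bad) * (p * n / 32) <= 8 * k * L * card (V - S)"
  proof (rule spread)
   show "Bad <= nsets V (k - 1)" using TV by (auto simp: Bad_def)
   have "4 * p * (real k * card (V - S)) <= 4 * p * (n / 128)" using Fk p0 by (intro mult_left_mono) auto
   thus "4 * k * p * card (V - S) <= p * n / 32" by (simp add: mult_ac)
   show "8 * real k ^ 2 * L <= p * n / 32" using L(1) by (simp add: n_def)
  qed (auto simp: Bad_def)
  also have "... = 8 * L * (real k * card (V - S))" by simp
  also have "... <= 8 * L * (n / 128)" using Fk L1 by (intro mult_left_mono) auto
  finally have "n * (real (card Bad) * p) <= n * (2 * L)" by (simp add: mult_ac)
  moreover have "n > 0"
  proof -
   have "256 * real k ^ 2 * L > 0" using kr L1 by simp
   hence "p * n > 0" using L(1) unfolding n_def by linarith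
   thus ?thesis using p0 by (simp add: zero_less_mult_iff)
  qed
  ultimately have "real (card Bad) * p <= 2 * L" by simp
  hence "p * (32 * real (card Bad)) <= p * m" using L(2) by (simp add: mult_ac)
  hence "32 * real (card Bad) <= m" using p0 by simp
  thus ?thesis using tm by linarith
 qed
 have n0: "n >= 0" by (simp add: n_def)
 have degS: "15/32 * (p * n) <= deg E a S" if a: "a : T" "a ~: Bad" for a
 proof -
  have "p * n / 2 <= deg E a V" using deg TV a(1) by (auto simp: n_def)
  moreover have "deg E a V <= deg E a S + deg G a (V - S)"
  proof -
   have "{y : V. insert y a : E} <= {y : S. insert y a : E} Un {y : V - S. insert y a : G}" using EG by auto
   hence "card {y : V. insert y a : E} <= card ({y : S. insert y a : E} Un {y : V - S. insert y a : G})" using finV fS by (intro card_mono) auto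
   also have "... <= card {y : S. insert y a : E} + card {y : V - S. insert y a : G}" by (rule card_Un_le)
   finally show ?thesis by (simp add: deg_def)
  qed
  moreover have "deg G a (V - S) < p * n / 32" using a by (auto simp: Bad_def)
  ultimately show ?thesis by linarith
 qed
 have pn0: "p * n >= 0" using p0 n0 by simp
 have "9/20 * p * t * card S <= 9/20 * p * t * n" using S finV p0 tm by (intro mult_left_mono) (auto simp: n_def card_mono)
 also have "... = (9/20 * t) * (p * n)" by simp
 also have "... <= ((31/32 * t) * (15/32)) * (p * n)" using pn0 tm by (intro mult_right_mono) auto
 also have "... <= ((t - card Bad) * (15/32)) * (p * n)" using bad pn0 by (intro mult_right_mono) auto
 also have "... = real (card (T - Bad)) * (15/32 * (p * n))"
 proof -
  have "real (card (T - Bad)) = t - card Bad" using fT by (subst card_Diff_subset) (auto simp: Bad_def cT[symmetric] of_nat_diff card_mono)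
  thus ?thesis by simp
 qed
 also have "... = (\<Sum>a\<in>T - Bad. 15/32 * (p * n))" by simp
 also have "... <= (\<Sum>a\<in>T - Bad. real (deg E a S))" by (intro sum_mono degS) auto
 also have "... <= (\<Sum>a\<in>T. real (deg E a S))" using fT by (intro sum_mono2) auto
 also have "... = real (\<Sum>a\<in>T. card {v:S. insert v a : E})" by (simp add: deg_def)
 also have "... = real (\<Sum>v\<in>S. card {a:T. insert v a : E})" by (simp only: double_count[OF fT fS, of "%a v. insert v a : E"])
 finally show ?thesis by (simp add: t_def T_def)
qed

text \<open>Take a packing with the largest number of paths. If at least m vertices are uncovered, pick U among them; the other uncovered vertices and the paths are blocks, and averaging yields a union B of blocks of prescribed size that sees U as densely as S does on average. Paths in U and B that use B only in every kth vertex outnumber the destroyed ones.\<close>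
lemma almost_cover:
  fixes m b q :: nat
  assumes S: "S \<subseteq> V"
    and deg: "!!a. a : nsets V (k - 1) ==> p * card V / 2 <= deg E a V"
    and F: "128 * real k * (card (V - S) + m) <= card V" and L: "256 * real k ^ 2 * L <= p * card V" "64 * L <= p * m"
    and par: "100 * k * b <= m" "50 * real k * L * card V <= p * m * b" "40 * real k * q <= p * b" "q >= 1" "k * q <= b" "real k ^ 2 <= m"
  shows "\<exists>P. packing k E (k * q) S P & card (S - (\<Union>xs\<in>P. set xs)) < m"
proof -
 have finS: "finite S" using S finV finite_subset by blast
 have kq: "k * q >= 1" using k3 par(4) by simp
 have kr: "real k >= 3" using k3 by simp
 let ?X = "{xs. set xs <= S & length xs = k * q}"
 have "EX P. packing k E (k * q) S P & (ALL Q. packing k E (k * q) S Q --> card Q <= card P)"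
 proof (rule ex_has_greatest_nat)
  show "packing k E (k * q) S {}" by (simp add: packing_def)
  show "ALL Q. packing k E (k * q) S Q --> card Q < Suc (card ?X)" using packing_finite[OF finS] card_mono[OF finite_lists_length_eq[OF finS]] by (auto simp: less_Suc_eq_le)
 qed
 then obtain P where P: "packing k E (k * q) S P" "ALL Q. packing k E (k * q) S Q --> card Q <= card P" by blast
 have finP: "finite P" using packing_finite[OF finS P(1)] by simp
 define W where "W = (\<Union>xs\<in>P. set xs)"
 have "card (S - W) < m"
 proof (rule ccontr)
  assume "~ card (S - W) < m"
  then obtain U where U: "U <= S - W" "card U = m" using obtain_subset_with_card_n[of m "S - W"] by auto
  have UV: "U <= V" and US: "U <= S" using U(1) S by auto
  have finU: "finite U" using UV finV finite_subset by blast
  define J where "J = P Un (%v. [v]) ` (S - W - U)"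
  have finJ: "finite J" using finP finS by (simp add: J_def)
  have WS: "W <= S" using P(1) by (auto simp: W_def packing_def)
  have UnJ: "(\<Union>xs\<in>J. set xs) = S - U" using WS U(1) by (auto simp: J_def W_def)
  have sP: "xs = ys | set xs Int set ys = {}" if "xs : P" "ys : P" for xs ys using P(1) that unfolding packing_def by blast
  have sPW: "set xs Int (S - W - U) = {}" if "xs : P" for xs using that by (auto simp: W_def)
  have dj: "set xs Int set ys = {}" if "xs : J" "ys : J" "xs ~= ys" for xs ys
  proof -
   have "xs : P | (EX v:S - W - U. xs = [v])" "ys : P | (EX v:S - W - U. ys = [v])" using that by (auto simp: J_def)
   thus ?thesis using sP[of xs ys] sPW[of xs] sPW[of ys] that(3) by (elim disjE bexE) auto
  qed
  define hv where "hv v = real (card {a:nsets U (k - 1). insert v a : E})" for v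
  define s where "s xs = real (card (set xs))" for xs :: "'a list"
  define h where "h xs = (\<Sum>v\<in>set xs. hv v)" for xs
  have sumJ: "sum s J' = card (\<Union>xs\<in>J'. set xs)" "sum h J' = (\<Sum>v\<in>(\<Union>xs\<in>J'. set xs). hv v)" if "J' <= J" for J'
  proof -
   have f: "finite J'" "ALL xs:J'. finite (set xs)" "ALL xs:J'. ALL ys:J'. xs ~= ys --> set xs Int set ys = {}" using that finJ dj by (auto intro: finite_subset)
   show "sum s J' = card (\<Union>xs\<in>J'. set xs)" using card_UN_disjoint[OF f] by (simp add: s_def)
   show "sum h J' = (\<Sum>v\<in>(\<Union>xs\<in>J'. set xs). hv v)" unfolding h_def using sum.UNION_disjoint[OF f, of hv] by simp
  qed
  define al where "al = 9/20 * p * real (m choose (k - 1))"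
  have mV: "128 * real k * m <= card V"
  proof -
   have "128 * real k * m <= 128 * real k * (card (V - S) + m)" by (intro mult_left_mono) auto
   thus ?thesis using F by linarith
  qed
  have cVS: "card (V - (S - U)) <= card (V - S) + m"
  proof -
   have "V - (S - U) = (V - S) Un U" using UV by auto
   thus ?thesis using card_Un_le[of "V - S" U] U(2) by simp
  qed
  have av: "\<exists>J'\<subseteq>J. real b <= sum s J' & sum s J' <= real b + real (k * q) & al * sum s J' <= sum h J'"
  proof (rule averaging[OF finJ])
   show "0 <= s xs & s xs <= real (k * q)" if "xs : J" for xs
   proof -
    have "length xs <= k * q" using that P(1) kq unfolding J_def packing_def by auto
    thus ?thesis using card_length[of xs] by (simp add: s_def del: of_nat_mult)
   qed
   have "128 * real k * card (V - (S - U)) <= 128 * real k * (card (V - S) + m)" using cVS by (intro mult_left_mono) auto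
   hence F': "128 * real k * card (V - (S - U)) <= card V" using F by linarith
   show "al * sum s J <= sum h J"
    unfolding sumJ[OF order_refl] UnJ al_def hv_def by (rule dense_to_tuples[OF _ UV U(2) par(6) deg F' L]) (use S in auto)
   have "1 * real (card (V - (S - U))) <= 128 * real k * card (V - (S - U))" using kr by (intro mult_right_mono) auto
   have "128 * real (card (V - (S - U))) <= 128 * real k * card (V - (S - U))" using kr by (intro mult_right_mono) auto
   hence c1: "128 * real (card (V - (S - U))) <= card V" using F' by linarith
   have "real (card V) = card (S - U) + real (card (V - (S - U)))"
   proof -
    have "card V = card ((S - U) Un (V - (S - U)))" using S by (intro arg_cong[of _ _ card]) auto
    also have "... = card (S - U) + card (V - (S - U))" using finV finS by (intro card_Un_disjoint) auto
    finally show ?thesis by simp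
   qed
   moreover have "128 * real m <= card V"
   proof -
    have "128 * real m <= 128 * real k * m" using kr by (intro mult_right_mono) auto
    thus ?thesis using mV by linarith
   qed
   moreover have "b <= m"
   proof -
    have "1 * b <= (100 * k) * b" using k3 by (intro mult_le_mono1) auto
    thus ?thesis using par(1) by linarith
   qed
   ultimately show "real b <= sum s J" unfolding sumJ[OF order_refl] UnJ using c1 by linarith
  qed auto
  then obtain J' where J': "J' <= J" "real b <= sum s J'" "sum s J' <= real b + real (k * q)" "al * sum s J' <= sum h J'" by (elim exE conjE) (rule that)
  define B where "B = (\<Union>xs\<in>J'. set xs)"
  have BS: "B <= S - U" using J'(1) UnJ by (auto simp: B_def)
  hence BV: "B <= V" "U Int B = {}" using S by auto
  have finB: "finite B" using BV finV finite_subset by blast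
  note J'' = J'(2-4)[unfolded sumJ[OF J'(1)], folded B_def]
  have b1: "b <= card B" using J''(1) by simp
  have "real (card B) <= real (b + k * q)" using J''(2) by simp
  hence b2: "card B <= 2 * b" using par(5) by linarith
  have "(\<Sum>v\<in>B. hv v) = card {(a, v). a : nsets U (k - 1) & v : B & insert v a : E}"
  proof -
   have fT: "finite {a:nsets U (k - 1). insert v a : E}" for v using finite_imp_finite_nsets[OF finU] by simp
   have "(\<Sum>v\<in>B. card {a:nsets U (k - 1). insert v a : E}) = card (SIGMA v:B. {a:nsets U (k - 1). insert v a : E})" using finB fT by simp
   also have "... = card {(a, v). a : nsets U (k - 1) & v : B & insert v a : E}" by (rule bij_betw_same_card[of prod.swap]) (auto simp: bij_betw_def inj_on_def image_iff)
   finally show ?thesis unfolding hv_def of_nat_sum[symmetric] by (rule arg_cong)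
  qed
  hence h: "9/20 * p * real (m choose (k - 1)) * card B <= card {(a, v). a : nsets U (k - 1) & v : B & insert v a : E}" using J''(3) by (simp add: al_def)
  define D where "D = P Int J'"
  have finD: "finite D" using finP by (simp add: D_def)
  have "card D * (k * q) <= card B"
  proof -
   have "card D * (k * q) = (\<Sum>xs\<in>D. card (set xs))" using P(1) by (simp add: D_def packing_def distinct_card)
   also have "... = card (\<Union>xs\<in>D. set xs)" using finD P(1) by (intro card_UN_disjoint[symmetric]) (auto simp: D_def packing_def)
   also have "... <= card B" using finB by (intro card_mono) (auto simp: D_def B_def)
   finally show ?thesis .
  qed
  from more_paths[OF UV BV U(2) b1 b2 h par(1-4) this order_refl]
  obtain Q where Q: "packing k E (k * q) (U Un B) Q" "card Q = Suc (card D)" by blast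
  have finQ: "finite Q" using packing_finite[OF _ Q(1)] finU finB by simp
  have djPQ: "set xs Int (U Un B) = {}" if "xs : P - D" for xs
  proof -
   have "xs : J" "xs ~: J'" using that by (auto simp: D_def J_def)
   hence "set xs Int B = {}" using dj J'(1) unfolding B_def by blast
   moreover have "set xs <= W" using that by (auto simp: W_def)
   ultimately show ?thesis using U(1) by blast
  qed
  have QUB: "set ys <= U Un B" "set ys ~= {}" if "ys : Q" for ys using Q(1) that kq unfolding packing_def by auto
  have cr: "set xs Int set ys = {}" if "xs : P - D" "ys : Q" for xs ys using djPQ[OF that(1)] QUB[OF that(2)] by blast
  have "packing k E (k * q) S (P - D Un Q)"
   unfolding packing_def
  proof (intro conjI ballI impI)
   fix xs assume xs: "xs : P - D Un Q"
   have "U Un B <= S" using US BS by auto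
   hence QS: "set ys <= S" if "ys : Q" for ys using QUB(1)[OF that] by (rule order_trans[rotated])
   have "length xs = k * q & distinct xs & win k E xs & set xs <= S"
   proof (cases "xs : Q")
    case True thus ?thesis using Q(1) QS[OF True] by (simp add: packing_def)
   next
    case False thus ?thesis using xs P(1) by (simp add: packing_def)
   qed
   thus "length xs = k * q" "distinct xs" "win k E xs" "set xs <= S" by simp_all
   fix ys assume ys: "ys : P - D Un Q" "xs ~= ys"
   have qq: "set xs Int set ys = {}" if "xs : Q" "ys : Q" using Q(1) ys(2) that by (simp add: packing_def)
   show "set xs Int set ys = {}" using xs ys(1) sP[of xs ys] qq cr[of xs ys] cr[of ys xs] ys(2) by (auto simp: Int_commute)
  qed
  hence "card (P - D Un Q) <= card P" using P(2) by blast
  moreover have "card (P - D Un Q) = card (P - D) + card Q"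
  proof (rule card_Un_disjoint)
   have False if "xs : P - D" "xs : Q" for xs using cr[OF that] QUB(2)[OF that(2)] by simp
   thus "(P - D) Int Q = {}" by blast
  qed (use finP finQ in auto)
  moreover have "card (P - D) = card P - card D" "card D <= card P" using finP finD by (auto simp: D_def card_Diff_subset card_mono)
  ultimately show False using Q(2) by linarith
 qed
 thus ?thesis using P(1) by (auto simp: W_def)
qed

end

section \<open>Assembling the Hamilton cycle\<close>

lemma length_first_of: "k - 1 <= length P ==> length (first_of k P) = k - 1"
 by (simp add: first_of_def)

text \<open>The connection l i leads from piece P i to the next piece in cyclic order.\<close>
lemma cycle_of_links:
  fixes P l :: "nat => 'a list"
  assumes "k >= 1" "n >= 1"
    and "!!i. i < n ==> k - 1 <= length (P i) & win k E (P i) & win k E (last_of k (P i) @ l i @ first_of k (P (Suc i mod n)))"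
  defines "vs \<equiv> concat (map (%i. P i @ l i) [0..<n])"
  shows "win k E (vs @ take (k - 1) vs)"
proof -
 define r where "r j = map (%i. (P i, l i)) [j..<n]" for j
 have lk: "linked k E (r j) (first_of k (P 0))" if "j <= n" for j using that
 proof (induction rule: inc_induct)
  case base thus ?case by (simp add: r_def)
 next
  case (step j)
  have rj: "r j = (P j, l j) # r (Suc j)" using step.hyps by (simp add: r_def upt_conv_Cons)
  have "(if r (Suc j) = [] then first_of k (P 0) else first_of k (fst (hd (r (Suc j))))) = first_of k (P (Suc j mod n))"
  proof (cases "Suc j = n")
   case True thus ?thesis by (simp add: r_def)
  next
   case False
   hence "Suc j < n" using step.hyps by simp
   thus ?thesis by (simp add: r_def upt_conv_Cons)
  qed
  thus ?case unfolding rj using step assms(3)[of j] by simp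
 qed
 have P0: "k - 1 <= length (P 0)" using assms(2) assms(3)[of 0] by simp
 have "win k E (concat (map (%(P, Q). P @ Q) (r 0)) @ first_of k (P 0))" by (rule linked_win[OF assms(1) lk]) (use length_first_of[OF P0] in auto)
 moreover have "concat (map (%(P, Q). P @ Q) (r 0)) = vs" by (simp add: r_def vs_def comp_def)
 moreover have "take (k - 1) vs = first_of k (P 0)"
 proof -
  have "[0..<n] = 0 # [1..<n]" using assms(2) by (simp add: upt_conv_Cons)
  thus ?thesis using P0 by (simp add: vs_def first_of_def)
 qed
 ultimately show ?thesis by simp
qed

lemma choose_blocks:
  assumes "finite R" "finite D" "c * card R <= card D"
  shows "\<exists>f. (\<forall>r\<in>R. distinct (f r) & length (f r) = c & set (f r) \<subseteq> D) &
     (\<forall>r\<in>R. \<forall>r'\<in>R. r ~= r' --> set (f r) \<inter> set (f r') = {})" using assms(1,3)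
proof (induction R rule: finite_induct)
 case (insert x R)
 then obtain f where f: "ALL r:R. distinct (f r) & length (f r) = c & set (f r) <= D"
   "ALL r:R. ALL r':R. r ~= r' --> set (f r) Int set (f r') = {}" by auto
 define W where "W = (\<Union>r\<in>R. set (f r))"
 have WD: "W <= D" using f by (auto simp: W_def)
 have "card W <= (\<Sum>r\<in>R. card (set (f r)))" unfolding W_def using insert.hyps(1) by (rule card_UN_le)
 also have "... = card R * c" using f(1) by (simp add: distinct_card)
 finally have "c <= card (D - W)" using insert.prems insert.hyps WD assms(2) by (simp add: card_Diff_subset finite_subset algebra_simps)
 then obtain X where X: "X <= D - W" "card X = c" by (meson obtain_subset_with_card_n)
 hence "finite X" using assms(2) by (meson finite_Diff finite_subset)
 then obtain xs where xs: "set xs = X" "distinct xs" using finite_distinct_list by blast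
 have lx: "length xs = c" using xs X by (metis distinct_card)
 have dj: "set xs Int set (f r) = {}" if "r : R" for r using X(1) xs(1) that by (auto simp: W_def)
 show ?case
 proof (rule exI[of _ "f(x := xs)"], intro conjI ballI impI)
  fix r r' assume r: "r : insert x R" "r' : insert x R" "r ~= r'"
  moreover have "set (f r) Int set (f r') = {}" if "r : R" "r' : R" using f(2) that r(3) by blast
  ultimately show "set ((f(x := xs)) r) Int set ((f(x := xs)) r') = {}" using dj[of r] dj[of r'] insert.hyps(2) by (auto simp: Int_commute)
 qed (use f(1) xs X lx in auto)
qed auto

lemma distinct_concat_map:
  assumes "distinct is" "!!i. i : set is ==> distinct (f i)" "!!i j. i : set is ==> j : set is ==> i ~= j ==> set (f i) \<inter> set (f j) = {}"
  shows "distinct (concat (map f is))"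
 using assms
proof (induction "is")
 case (Cons i xs)
 have "set (f i) Int set (f j) = {}" if "j : set xs" for j using Cons.prems(1,3) that by auto
 thus ?case using Cons by auto
qed simp

lemma disjoint_mono: "A \<subseteq> B ==> B \<inter> C = {} ==> A \<inter> C = {}"
 by blast

lemma absorber_parts:
  assumes "absorber k E r A B"
  shows "win k E A" "win k E B" "distinct A" "distinct B" "r \<notin> set B" "set A = insert r (set B)"
    "k - 1 <= length B" "k - 1 <= length A" "first_of k A = first_of k B" "last_of k A = last_of k B"
proof -
 have a: "win k E A" "win k E B" "distinct A" "mset A = add_mset r (mset B)" "k - 1 <= length B"
  "first_of k A = first_of k B" "last_of k A = last_of k B" using assms by (auto simp: absorber_def)
 thus "win k E A" "win k E B" "distinct A" "k - 1 <= length B" "first_of k A = first_of k B" "last_of k A = last_of k B" by simp_all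
 have m: "mset A = mset (r # B)" using a(4) by simp
 hence "distinct (r # B)" using a(3) mset_eq_imp_distinct_iff by blast
 thus "distinct B" "r ~: set B" by simp_all
 show "set A = insert r (set B)" using mset_eq_setD[OF m] by simp
 have "length A = length (r # B)" using m by (rule mset_eq_length)
 thus "k - 1 <= length A" using a(5) by simp
qed

context host begin

text \<open>Parts 0 to 3m-1 serve the absorbers, parts 3m to 4m-1 link them, and the parts 4m to 5m form the reservoir R: the first m of them for the final links, the last one to complete leftover vertices to tuples. Part 5m+1 supplies the dummy vertices of absorbers_exist. The ends of a piece are taken from B r, which avoids R; they are the ends of A r as well, so the decision between A r and B r is postponed until it is known which vertices of R are used.\<close>
lemma hamilton_cycle:
  fixes W :: "nat => 'a set" and m0 b q K M m :: nat and N N' :: real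
  defines "R \<equiv> \<Union>j\<in>{4*m..5*m}. W j"
  defines "c \<equiv> 2 * (k + M)"
  assumes sc: "scale N M" "scale N' M" and m: "m = 2 * k * K"
    and W: "!!j. j < 4 * m ==> fair N (W j)" "!!j. 4 * m <= j ==> j < 5 * m ==> fair N' (W j)"
    and WV: "!!j. j < 5 * m + 2 ==> W j \<subseteq> V"
    and Wd: "!!i j. i < 5 * m + 2 ==> j < 5 * m + 2 ==> i ~= j ==> W i \<inter> W j = {}"
    and X0: "(k - 2) * m0 <= card (W (5 * m))" and X1: "(2 * k - 3) * card R <= card (W (5 * m + 1))"
    and R: "R ~= {}"
    and cnt: "card R * c < 2 ^ K" "c * (card R * c) <= g * N / (8 * real k ^ 2)"
      "h < 2 ^ K" "c * h <= g * N' / (8 * real k ^ 2)" "card V + m0 * (k * q) + k * q <= h * (k * q)"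
    and deg: "!!a. a : nsets V (k - 1) ==> p * card V / 2 <= deg E a V"
    and F: "128 * real k * (card R * (k + 2 * c + c^2) + m0) <= card V" and L: "256 * real k ^ 2 * L <= p * card V" "64 * L <= p * m0"
    and par: "100 * k * b <= m0" "50 * real k * L * card V <= p * m0 * b" "40 * real k * q <= p * b" "q >= 1" "k * q <= b" "real k ^ 2 <= m0"
  shows "\<exists>vs. distinct vs & set vs = V & (\<forall>i<length vs. set (take k (rotate i vs)) : E)"
proof -
 have k1: "k >= 1" and k2: "k >= 2" using k3 by auto
 have WUV: "(\<Union>j\<in>J. W j) <= V" if "J <= {..<5 * m + 2}" for J
 proof (rule UN_least)
  show "W j <= V" if "j : J" for j using that \<open>J <= {..<5 * m + 2}\<close> by (intro WV) auto
 qed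
 have RV: "R <= V" unfolding R_def by (rule WUV) auto
 have finR: "finite R" using RV finV finite_subset by blast
 \<comment> \<open>Dummies: k-2 vertices for z r and k-1 for w r.\<close>
 have finW: "finite (W j)" if "j < 5 * m + 2" for j using WV[OF that] finV finite_subset by blast
 have fW: "finite (W (5 * m + 1))" "finite (W (5 * m))" by (rule finW, simp)+
 obtain f where f: "ALL r:R. distinct (f r) & length (f r) = 2 * k - 3 & set (f r) <= W (5 * m + 1)"
   "ALL r:R. ALL r':R. r ~= r' --> set (f r) Int set (f r') = {}" using choose_blocks[OF finR fW(1) X1] by (elim exE conjE) (rule that)
 define z w where "z r = take (k - 2) (f r)" and "w r = drop (k - 2) (f r)" for r
 have zw: "z r @ w r = f r" for r by (simp add: z_def w_def)
 have RW: "R Int W j = {}" if "j < 4 * m | j = 5 * m + 1" for j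
 proof -
  have "W i Int W j = {}" if "i : {4*m..5*m}" for i by (rule Wd) (use that \<open>j < 4 * m | j = 5 * m + 1\<close> in auto)
  thus ?thesis unfolding R_def by blast
 qed
 have "EX A B. (ALL r:R. absorber k E r (A r) (B r) & set (A r) <= insert r (set (z r)) Un (\<Union>j<3*m. W j) &
   length (A r) <= k + 2 * (k + M) + (2 * (k + M))^2) &
  (ALL r:R. ALL r':R. r ~= r' --> set (A r) Int set (A r') = {})"
 proof (rule absorbers_exist[OF sc(1) m _ _ finR RV])
  show "fair N (W j)" if "j < 3 * m" for j using W(1) that by simp
  show "W i Int W j = {}" if "i < 3 * m" "j < 3 * m" "i ~= j" for i j using Wd that by simp
  fix r assume r: "r : R"
  have "set (f r) <= V" using f(1) r WV[of "5 * m + 1"] by auto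
  thus "length (z r) = k - 2 & length (w r) = k - 1 & distinct (z r @ w r) & set (z r @ w r) <= V"
   unfolding zw using f(1) r k3 by (auto simp: z_def w_def)
  show "set (z r @ w r) Int R = {}" unfolding zw using f(1) r RW[of "5 * m + 1"] by blast
  show "set (z r @ w r) Int set (z r' @ w r') = {}" if "r' : R" "r ~= r'" for r' unfolding zw using f(2) r that by blast
  show "W j Int set (z r @ w r) = {}" if "j < 3 * m" for j
   unfolding zw using f(1) r Wd[of j "5 * m + 1"] that by auto
 next
  show "W j Int R = {}" if "j < 3 * m" for j using RW[of j] that by auto
  show "card R * (2 * (k + M)) < 2 ^ K" using cnt(1) by (simp add: c_def)
  show "2 * (k + M) * (card R * (2 * (k + M))) <= g * N / (8 * real k ^ 2)" using cnt(2) by (simp add: c_def)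
 qed
 then obtain A B where AB: "ALL r:R. absorber k E r (A r) (B r) & set (A r) <= insert r (set (z r)) Un (\<Union>j<3*m. W j) &
   length (A r) <= k + 2 * (k + M) + (2 * (k + M))^2"
  "ALL r:R. ALL r':R. r ~= r' --> set (A r) Int set (A r') = {}" by (elim exE conjE) (rule that)
 have lenA: "length (A r) <= k + c + c^2" if "r : R" for r using AB(1) that by (simp add: c_def)
 have Asub: "set (A r) <= insert r (set (z r)) Un (\<Union>j<3*m. W j)" if "r : R" for r using AB(1) that by blast
 have Adj: "set (A r) Int set (A r') = {}" if "r : R" "r' : R" "r ~= r'" for r r' using AB(2) that by blast
 have abs: "absorber k E r (A r) (B r)" if "r : R" for r using AB(1) that by blast
 note ab = absorber_parts[OF abs]
 have zD: "set (z r) <= W (5 * m + 1)" if "r : R" for r using f(1) that set_take_subset[of "k - 2" "f r"] unfolding z_def by blast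
 have BR: "set (B r) Int R = {}" if r: "r : R" for r
 proof -
  have "set (B r) <= set (z r) Un (\<Union>j<3*m. W j)" using Asub[OF r] ab(5,6)[OF r] by auto
  moreover have "R Int W j = {}" if "j < 3 * m" for j using RW[of j] that by simp
  ultimately show ?thesis using zD[OF r] RW[of "5 * m + 1"] by blast
 qed
 have AV: "set (A r) <= V" if r: "r : R" for r
 proof -
  have "(\<Union>j<3*m. W j) <= V" by (rule WUV) auto
  moreover have "W (5 * m + 1) <= V" by (rule WV) simp
  ultimately show ?thesis using Asub[OF r] zD[OF r] RV r by blast
 qed
 have BA: "set (B r) <= set (A r)" if "r : R" for r using ab(6)[OF that] by auto
 define G3 where "G3 = (\<Union>j<m. W (3 * m + j))"
 have AG3: "set (A r) Int G3 = {}" if r: "r : R" for r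
 proof -
  have "W i Int W (3 * m + j) = {}" if "i < 3 * m | i = 5 * m + 1" "j < m" for i j by (rule Wd) (use that in auto)
  hence "(\<Union>i<3*m. W i) Int G3 = {}" "W (5 * m + 1) Int G3 = {}" unfolding G3_def by blast+
  moreover have "R Int G3 = {}"
  proof -
   have "R Int W (3 * m + j) = {}" if "j < m" for j by (rule RW) (use that in simp)
   thus ?thesis unfolding G3_def by blast
  qed
  ultimately have "(insert r (set (z r)) Un (\<Union>j<3*m. W j)) Int G3 = {}"
   unfolding Int_Un_distrib2 using disjoint_mono[of "insert r (set (z r))" "R Un W (5 * m + 1)" G3] zD[OF r] r by (simp only: Int_Un_distrib2) blast
  thus ?thesis by (rule disjoint_mono[OF Asub[OF r]])
 qed
 \<comment> \<open>An absorber is linked to the next one before the covering, since R is too small for that many links.\<close>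
 obtain rs where rs: "set rs = R" "distinct rs" using finite_distinct_list[OF finR] by blast
 define s where "s = card R"
 have ls: "length rs = s" using rs by (simp add: s_def distinct_card[symmetric])
 have s1: "s >= 1" using R finR by (simp add: s_def Suc_le_eq card_gt_0_iff)
 have rsR: "rs ! i : R" if "i < s" for i using that rs(1) ls nth_mem by metis
 have rs_ne: "rs ! i ~= rs ! j" if "i < s" "j < s" "i ~= j" for i j using that rs(2) ls by (simp add: nth_eq_iff_index_eq)
 have ends: "length (last_of k xs) = k - 1 & set (last_of k xs) : nsets V (k - 1) & set (last_of k xs) <= set xs & set (last_of k xs) ~= {}"
  "length (first_of k xs) = k - 1 & set (first_of k xs) : nsets V (k - 1) & set (first_of k xs) <= set xs & set (first_of k xs) ~= {}"
  if "k - 1 <= length xs" "distinct xs" "set xs <= V" for xs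
 proof -
  have 1: "length (last_of k xs) = k - 1" "distinct (last_of k xs)" "set (last_of k xs) <= set xs" using that set_drop_subset[of _ xs] by (auto simp: last_of_def)
  have 2: "length (first_of k xs) = k - 1" "distinct (first_of k xs)" "set (first_of k xs) <= set xs" using that set_take_subset[of _ xs] by (auto simp: first_of_def)
  have "last_of k xs ~= []" "first_of k xs ~= []" using 1(1) 2(1) k3 by auto
  thus "length (last_of k xs) = k - 1 & set (last_of k xs) : nsets V (k - 1) & set (last_of k xs) <= set xs & set (last_of k xs) ~= {}"
   "length (first_of k xs) = k - 1 & set (first_of k xs) : nsets V (k - 1) & set (first_of k xs) <= set xs & set (first_of k xs) ~= {}"
   using 1 2 that(3) list_nsets[OF 1(2) _ 1(1)] list_nsets[OF 2(2) _ 2(1)] by auto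
 qed
 have Bok: "k - 1 <= length (B r)" "distinct (B r)" "set (B r) <= V" if "r : R" for r using ab(4,7)[OF that] BA[OF that] AV[OF that] by auto
 have endsB: "length (last_of k (B r)) = k - 1 & set (last_of k (B r)) : nsets V (k - 1) & set (last_of k (B r)) <= set (B r) & set (last_of k (B r)) ~= {}"
  "length (first_of k (B r)) = k - 1 & set (first_of k (B r)) : nsets V (k - 1) & set (first_of k (B r)) <= set (B r) & set (first_of k (B r)) ~= {}"
  if r: "r : R" for r by (rule ends[OF Bok(1)[OF r] Bok(2)[OF r] Bok(3)[OF r]])+
 have Bdj: "set (B r) Int set (B r') = {}" if "r : R" "r' : R" "r ~= r'" for r r' using Adj[OF that] BA[OF that(1)] BA[OF that(2)] by blast
 let ?I = "{..<s - 1}"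
 have "EX l. (ALL i:?I. l i ~= [] & distinct (l i) & win k E (last_of k (B (rs ! i)) @ l i @ first_of k (B (rs ! Suc i))) &
    set (l i) <= (\<Union>j<2*k*K. W (3 * m + j)) & card (set (l i)) <= 2 * (k + M)) &
   (ALL i:?I. ALL j:?I. i ~= j --> set (l i) Int set (l j) = {})"
 proof (rule many_tight[OF sc(1)])
  show "fair N (W (3 * m + j))" if "j < 2 * k * K" for j by (rule W(1)) (use that[folded m] in simp_all)
  show "W (3 * m + i) Int W (3 * m + j) = {}" if "i < 2 * k * K" "j < 2 * k * K" "i ~= j" for i j by (rule Wd) (use that[folded m] in simp_all)
  have c1: "c >= 1" using k3 by (simp add: c_def)
  have "card R * 1 <= card R * c" using c1 by (rule mult_le_mono2)
  hence sc1: "s - 1 <= card R * c" unfolding s_def by linarith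
  thus "card ?I < 2 ^ K" using cnt(1) by simp
  have "c * (s - 1) <= c * (card R * c)" using sc1 by (rule mult_le_mono2)
  hence "real (c * (s - 1)) <= real (c * (card R * c))" by (rule of_nat_mono)
  thus "2 * (k + M) * card ?I <= g * N / (8 * real k ^ 2)" using cnt(2) by (simp add: c_def)
  show "length (last_of k (B (rs ! i))) = k - 1 & set (last_of k (B (rs ! i))) : nsets V (k - 1)" if "i : ?I" for i using endsB(1)[OF rsR[of i]] that by auto
  show "length (first_of k (B (rs ! Suc i))) = k - 1 & set (first_of k (B (rs ! Suc i))) : nsets V (k - 1)" if "i : ?I" for i using endsB(2)[OF rsR[of "Suc i"]] that by auto
  show "inj_on (%i. set (last_of k (B (rs ! i)))) ?I"
  proof (rule inj_on_disjoint)
   fix i j assume ij: "i : ?I" "j : ?I" "i ~= j"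
   hence "i < s" "j < s" by auto
   thus "set (last_of k (B (rs ! i))) Int set (last_of k (B (rs ! j))) = {}" using Bdj[OF rsR rsR rs_ne, of i j] ij(3) endsB(1)[OF rsR, of i] endsB(1)[OF rsR, of j] by blast
  next
   show "set (last_of k (B (rs ! i))) ~= {}" if "i : ?I" for i using endsB(1)[OF rsR, of i] that by simp
  qed
  show "inj_on (%i. set (first_of k (B (rs ! Suc i)))) ?I"
  proof (rule inj_on_disjoint)
   fix i j assume ij: "i : ?I" "j : ?I" "i ~= j"
   hence "Suc i < s" "Suc j < s" by auto
   thus "set (first_of k (B (rs ! Suc i))) Int set (first_of k (B (rs ! Suc j))) = {}"
    using Bdj[OF rsR rsR rs_ne, of "Suc i" "Suc j"] ij(3) endsB(2)[OF rsR, of "Suc i"] endsB(2)[OF rsR, of "Suc j"] by blast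
  next
   show "set (first_of k (B (rs ! Suc i))) ~= {}" if "i : ?I" for i using endsB(2)[OF rsR, of "Suc i"] that by auto
  qed
 qed simp
 then obtain l1 where l1: "ALL i:?I. l1 i ~= [] & distinct (l1 i) & win k E (last_of k (B (rs ! i)) @ l1 i @ first_of k (B (rs ! Suc i))) &
    set (l1 i) <= (\<Union>j<2*k*K. W (3 * m + j)) & card (set (l1 i)) <= 2 * (k + M)"
   "ALL i:?I. ALL j:?I. i ~= j --> set (l1 i) Int set (l1 j) = {}" by (elim exE conjE) (rule that)
 have l1G: "set (l1 i) <= G3" if "i < s - 1" for i
 proof -
  have "set (l1 i) <= (\<Union>j<2*k*K. W (3 * m + j))" using l1(1) that by blast
  thus ?thesis by (simp add: G3_def m)
 qed
 \<comment> \<open>X holds all absorbers and their links, in particular all of R.\<close>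
 define X where "X = (\<Union>r\<in>R. set (A r)) Un (\<Union>i<s - 1. set (l1 i))"
 define S where "S = V - X"
 have G3V: "G3 <= V"
  unfolding G3_def
 proof (rule UN_least)
  show "W (3 * m + j) <= V" if "j : {..<m}" for j using that by (intro WV) simp
 qed
 have XV: "X <= V" using AV l1G G3V unfolding X_def by blast
 have RX: "R <= X" using ab(6) unfolding X_def by blast
 have VS: "V - S = X" using XV by (auto simp: S_def)
 have cX: "card X <= card R * (k + 2 * c + c^2)"
 proof -
  have "card X <= card (\<Union>r\<in>R. set (A r)) + card (\<Union>i<s - 1. set (l1 i))" unfolding X_def by (rule card_Un_le)
  also have "... <= (\<Sum>r\<in>R. card (set (A r))) + (\<Sum>i<s - 1. card (set (l1 i)))" by (intro add_mono card_UN_le finR) simp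
  also have "... <= (\<Sum>r\<in>R. k + c + c^2) + (\<Sum>i<s - 1. c)" using lenA card_length le_trans l1(1) by (intro add_mono sum_mono) (blast, simp add: c_def)
  also have "... = card R * (k + c + c^2) + (s - 1) * c" by simp
  also have "... <= card R * (k + c + c^2) + card R * c" by (simp add: s_def)
  finally show ?thesis by (simp add: algebra_simps)
 qed
 have "EX P. packing k E (k * q) S P & card (S - (\<Union>xs\<in>P. set xs)) < m0"
 proof (rule almost_cover[OF _ deg _ L par])
  show "S <= V" by (auto simp: S_def)
  have "real (card X) <= real (card R * (k + 2 * c + c^2))" using cX by (rule of_nat_mono)
  hence "128 * real k * (card X + m0) <= 128 * real k * (card R * (k + 2 * c + c^2) + m0)" by (intro mult_left_mono) auto
  thus "128 * real k * (card (V - S) + m0) <= card V" unfolding VS using F by linarith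
 qed
 then obtain P where P: "packing k E (k * q) S P" "card (S - (\<Union>xs\<in>P. set xs)) < m0" by blast
 have finS: "finite S" using finV by (simp add: S_def)
 have finP: "finite P" using packing_finite[OF finS P(1)] by simp
 define T where "T = S - (\<Union>xs\<in>P. set xs)"
 have finT: "finite T" using finS by (simp add: T_def)
 have kq: "k * q >= 1" using k3 par(4) by simp
 have Pp: "length xs = k * q" "distinct xs" "win k E xs" "set xs <= S" if "xs : P" for xs using P(1) that by (simp_all add: packing_def)
 have Pdj: "set xs Int set ys = {}" if "xs : P" "ys : P" "xs ~= ys" for xs ys using P(1) that by (simp add: packing_def)
 have cP: "card P * (k * q) <= card V"
 proof -
  have "card P * (k * q) = (\<Sum>xs\<in>P. card (set xs))" using Pp by (simp add: distinct_card)
  also have "... = card (\<Union>xs\<in>P. set xs)" using finP Pdj by (intro card_UN_disjoint[symmetric]) auto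
  also have "... <= card V" using Pp(4) finV by (intro card_mono) (auto simp: S_def)
  finally show ?thesis .
 qed
 have X0': "(k - 2) * card T <= card (W (5 * m))"
 proof -
  have "(k - 2) * card T <= (k - 2) * m0" using P(2) by (intro mult_le_mono2) (simp add: T_def)
  thus ?thesis using X0 by linarith
 qed
 obtain t where t: "ALL v:T. distinct (t v) & length (t v) = k - 2 & set (t v) <= W (5 * m)"
   "ALL v:T. ALL v':T. v ~= v' --> set (t v) Int set (t v') = {}" using choose_blocks[OF finT fW(2) X0'] by (elim exE conjE) (rule that)
 have W5R: "W (5 * m) <= R" unfolding R_def by (rule UN_upper) simp
 have SR: "S Int R = {}" using RX by (auto simp: S_def)
 have TS: "T <= S" by (auto simp: T_def)
 have tR: "set (t v) <= R" if "v : T" for v using t(1) that W5R by blast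
 define Qs where "Qs = P Un (%v. v # t v) ` T"
 have finQ: "finite Qs" using finP finT by (simp add: Qs_def)
 have Qcases: "xs : P | (EX v:T. xs = v # t v)" if "xs : Qs" for xs using that by (auto simp: Qs_def)
 have Qprop: "k - 1 <= length xs & distinct xs & win k E xs & set xs <= S Un W (5 * m)" if "xs : Qs" for xs using Qcases[OF that]
 proof (elim disjE bexE)
  assume x: "xs : P"
  have "k <= k * q" using par(4) by simp
  hence "k - 1 <= k * q" by linarith
  thus ?thesis using Pp[OF x] by auto
 next
  fix v assume v: "v : T" "xs = v # t v"
  have "v ~: set (t v)" using tR[OF v(1)] SR TS v(1) by blast
  moreover have "length xs = k - 1" using t(1) v k3 by simp
  ultimately show ?thesis using t(1) v TS k3 by (auto intro: win_short)
 qed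
 have Qdj: "set xs Int set ys = {}" if "xs : Qs" "ys : Qs" "xs ~= ys" for xs ys
 proof -
  have PT: "set xs Int set (v # t v) = {}" if "xs : P" "v : T" for xs v using Pp(4)[OF that(1)] tR[OF that(2)] SR that by (auto simp: T_def)
  have TT: "set (v # t v) Int set (v' # t v') = {}" if "v : T" "v' : T" "v ~= v'" for v v'
  proof -
   have "set (t v) Int set (t v') = {}" using t(2) that by blast
   thus ?thesis using tR[OF that(1)] tR[OF that(2)] SR TS that by auto
  qed
  show ?thesis using Qcases[OF that(1)] Qcases[OF that(2)] that(3) Pdj[of xs ys] PT[of xs] PT[of ys] TT by (elim disjE bexE) (auto simp: Int_commute)
 qed
 have Qun: "(\<Union>xs\<in>Qs. set xs) = S Un (\<Union>v\<in>T. set (t v))" using Pp(4) by (auto simp: Qs_def T_def)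
 have cQ: "card Qs + 1 <= h"
 proof -
  have "card Qs <= card P + card T" unfolding Qs_def using card_Un_le card_image_le[OF finT] by (meson add_left_mono le_trans)
  hence "card Qs <= card P + m0" using P(2) by (simp add: T_def)
  hence "(card Qs + 1) * (k * q) <= (card P + m0 + 1) * (k * q)" by (intro mult_le_mono1) simp
  also have "... = card P * (k * q) + m0 * (k * q) + k * q" by (simp add: algebra_simps)
  also have "... <= h * (k * q)" using cP cnt(5) by linarith
  finally show ?thesis using kq by (simp only: mult_le_cancel2)
 qed
 \<comment> \<open>Pieces 0 to s-1 are the absorbers; only the links from the last absorber on run through R.\<close>
 obtain qs where qs: "set qs = Qs" "distinct qs" using finite_distinct_list[OF finQ] by blast
 define n where "n = s + length qs"
 define D where "D i = (if i < s then B (rs ! i) else qs ! (i - s))" for i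
 have qsQ: "qs ! (i - s) : Qs" if "s <= i" "i < n" for i using that qs(1) nth_mem[of "i - s" qs] by (simp add: n_def)
 have SV: "S Un W (5 * m) <= V" using W5R RV by (auto simp: S_def)
 have Dok: "k - 1 <= length (D i)" "distinct (D i)" "set (D i) <= V" if "i < n" for i
 proof -
  have "k - 1 <= length (D i) & distinct (D i) & set (D i) <= V"
  proof (cases "i < s")
   case True thus ?thesis using Bok[OF rsR[OF True]] by (simp add: D_def)
  next
   case False
   hence q: "qs ! (i - s) : Qs" using qsQ[of i] that by simp
   have "set (qs ! (i - s)) <= V" using Qprop[OF q] SV by blast
   thus ?thesis using Qprop[OF q] False by (simp add: D_def)
  qed
  thus "k - 1 <= length (D i)" "distinct (D i)" "set (D i) <= V" by simp_all
 qed
 have BS: "set (B r) Int (S Un W (5 * m)) = {}" if "r : R" for r using BA[OF that] that BR[OF that] W5R unfolding S_def X_def by blast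
 have Ddj: "set (D i) Int set (D j) = {}" if ij: "i < n" "j < n" "i ~= j" for i j
 proof -
  have 1: "set (D i) Int set (D j) = {}" if "i < s" "s <= j" "j < n" for i j using BS[OF rsR, of i] Qprop[OF qsQ, of j] that by (auto simp: D_def)
  have 2: "set (D i) Int set (D j) = {}" if "i < s" "j < s" "i ~= j" for i j using Bdj[OF rsR rsR rs_ne, of i j] that by (simp add: D_def)
  have 3: "set (D i) Int set (D j) = {}" if "s <= i" "s <= j" "i < n" "j < n" "i ~= j" for i j
  proof -
   have "qs ! (i - s) ~= qs ! (j - s)" using that qs(2) by (simp add: nth_eq_iff_index_eq n_def)
   thus ?thesis using Qdj[OF qsQ qsQ, of i j] that by (simp add: D_def)
  qed
  show ?thesis using 1[of i j] 1[of j i] 2[of i j] 3[of i j] ij by (cases "i < s"; cases "j < s") (auto simp: Int_commute)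
 qed
 have endsD: "length (last_of k (D i)) = k - 1 & set (last_of k (D i)) : nsets V (k - 1) & set (last_of k (D i)) <= set (D i) & set (last_of k (D i)) ~= {}"
  "length (first_of k (D i)) = k - 1 & set (first_of k (D i)) : nsets V (k - 1) & set (first_of k (D i)) <= set (D i) & set (first_of k (D i)) ~= {}"
  if i: "i < n" for i by (rule ends[OF Dok(1)[OF i] Dok(2)[OF i] Dok(3)[OF i]])+
 let ?J = "{s - 1..<n}"
 have nxt: "Suc i mod n < n" if "i < n" for i using that by simp
 have nxt_inj: "Suc i mod n ~= Suc j mod n" if "i < n" "j < n" "i ~= j" for i j using that by (cases "Suc i = n"; cases "Suc j = n") auto
 have "EX l. (ALL i:?J. l i ~= [] & distinct (l i) & win k E (last_of k (D i) @ l i @ first_of k (D (Suc i mod n))) &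
    set (l i) <= (\<Union>j<2*k*K. W (4 * m + j)) & card (set (l i)) <= 2 * (k + M)) &
   (ALL i:?J. ALL j:?J. i ~= j --> set (l i) Int set (l j) = {})"
 proof (rule many_tight[OF sc(2)])
  show "fair N' (W (4 * m + j))" if "j < 2 * k * K" for j by (rule W(2)) (use that[folded m] in simp_all)
  show "W (4 * m + i) Int W (4 * m + j) = {}" if "i < 2 * k * K" "j < 2 * k * K" "i ~= j" for i j by (rule Wd) (use that[folded m] in simp_all)
  have cJ: "card ?J <= h" using cQ s1 qs by (simp add: n_def distinct_card[symmetric])
  thus "card ?J < 2 ^ K" using cnt(3) by linarith
  have "real (c * card ?J) <= real (c * h)" using cJ by (intro of_nat_mono mult_le_mono2)
  thus "2 * (k + M) * card ?J <= g * N' / (8 * real k ^ 2)" using cnt(4) unfolding c_def of_nat_mult by linarith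
  show "length (last_of k (D i)) = k - 1 & set (last_of k (D i)) : nsets V (k - 1)" if "i : ?J" for i using endsD(1)[of i] that by simp
  show "length (first_of k (D (Suc i mod n))) = k - 1 & set (first_of k (D (Suc i mod n))) : nsets V (k - 1)" if "i : ?J" for i using endsD(2)[OF nxt, of i] that by simp
  show "inj_on (%i. set (last_of k (D i))) ?J"
  proof (rule inj_on_disjoint)
   fix i j assume ij: "i : ?J" "j : ?J" "i ~= j"
   hence "i < n" "j < n" by auto
   thus "set (last_of k (D i)) Int set (last_of k (D j)) = {}" using Ddj[of i j] ij(3) endsD(1)[of i] endsD(1)[of j] by blast
  next
   show "set (last_of k (D i)) ~= {}" if "i : ?J" for i using endsD(1)[of i] that by simp
  qed
  show "inj_on (%i. set (first_of k (D (Suc i mod n)))) ?J"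
  proof (rule inj_on_disjoint)
   fix i j assume ij: "i : ?J" "j : ?J" "i ~= j"
   hence "i < n" "j < n" by auto
   thus "set (first_of k (D (Suc i mod n))) Int set (first_of k (D (Suc j mod n))) = {}" using Ddj[OF nxt nxt nxt_inj, of i j] ij(3) endsD(2)[OF nxt, of i] endsD(2)[OF nxt, of j] by blast
  next
   show "set (first_of k (D (Suc i mod n))) ~= {}" if "i : ?J" for i using endsD(2)[OF nxt, of i] that by simp
  qed
 qed simp
 then obtain l2 where l2: "ALL i:?J. l2 i ~= [] & distinct (l2 i) & win k E (last_of k (D i) @ l2 i @ first_of k (D (Suc i mod n))) &
    set (l2 i) <= (\<Union>j<2*k*K. W (4 * m + j)) & card (set (l2 i)) <= 2 * (k + M)"
   "ALL i:?J. ALL j:?J. i ~= j --> set (l2 i) Int set (l2 j) = {}" by (elim exE conjE) (rule that)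
 define Y where "Y = (\<Union>j<m. W (4 * m + j))"
 have YR: "Y <= R" unfolding Y_def R_def by (rule UN_least, rule UN_upper) simp
 have Y5: "Y Int W (5 * m) = {}"
 proof -
  have "W (4 * m + j) Int W (5 * m) = {}" if "j < m" for j by (rule Wd) (use that in auto)
  thus ?thesis unfolding Y_def by blast
 qed
 have l2Y: "set (l2 i) <= Y" if "s - 1 <= i" "i < n" for i
 proof -
  have "set (l2 i) <= (\<Union>j<2*k*K. W (4 * m + j))" using l2(1) that by simp
  thus ?thesis by (simp add: Y_def m)
 qed
 define l where "l i = (if i < s - 1 then l1 i else l2 i)" for i
 have sn: "s <= n" by (simp add: n_def)
 have ldist: "distinct (l i)" if "i < n" for i using l1(1) l2(1) that by (simp add: l_def)
 have ldj: "set (l i) Int set (l j) = {}" if ij: "i < n" "j < n" "i ~= j" for i j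
 proof -
  have G3R: "G3 Int R = {}"
  proof -
   have "R Int W (3 * m + j) = {}" if "j < m" for j by (rule RW) (use that in simp)
   thus ?thesis unfolding G3_def by blast
  qed
  have 1: "set (l i) Int set (l j) = {}" if "i < s - 1" "s - 1 <= j" "j < n" for i j using l1G[of i] l2Y[of j] that G3R YR by (auto simp: l_def)
  have 2: "set (l i) Int set (l j) = {}" if "i < s - 1" "j < s - 1" "i ~= j" for i j using l1(2) that by (simp add: l_def)
  have 3: "set (l i) Int set (l j) = {}" if "s - 1 <= i" "s - 1 <= j" "i < n" "j < n" "i ~= j" for i j using l2(2) that by (simp add: l_def)
  show ?thesis using 1[of i j] 1[of j i] 2[of i j] 3[of i j] ij by (cases "i < s - 1"; cases "j < s - 1") (auto simp: Int_commute)
 qed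
 have lwin: "win k E (last_of k (D i) @ l i @ first_of k (D (Suc i mod n)))" if "i < n" for i
 proof (cases "i < s - 1")
  case True
  hence "Suc i < s" "Suc i mod n = Suc i" using sn by auto
  thus ?thesis using l1(1) True by (simp add: l_def D_def)
 next
  case False
  thus ?thesis using l2(1) that by (simp add: l_def)
 qed
 define used where "used = (\<Union>i\<in>?J. set (l2 i)) Un (\<Union>v\<in>T. set (t v))"
 have usedR: "used <= R" using l2Y YR tR unfolding used_def by force
 define C where "C i = (if i < s & rs ! i ~: used then A (rs ! i) else D i)" for i
 have setC: "set (C i) = (if i < s then insert (rs ! i) (set (B (rs ! i))) - used else set (D i))" if "i < n" for i
 proof (cases "i < s")
  case True
  have "set (B (rs ! i)) Int used = {}" using BR[OF rsR[OF True]] usedR by blast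
  thus ?thesis using True ab(6)[OF rsR[OF True]] ab(5)[OF rsR[OF True]] by (auto simp: C_def D_def)
 qed (simp add: C_def)
 have Cends: "first_of k (C i) = first_of k (D i)" "last_of k (C i) = last_of k (D i)" if "i < n" for i using ab(9,10)[OF rsR, of i] by (auto simp: C_def D_def)
 have Cok: "k - 1 <= length (C i) & win k E (C i) & distinct (C i)" if "i < n" for i
 proof (cases "i < s")
  case True
  thus ?thesis using ab(1,2,3,4,7,8)[OF rsR[OF True]] by (simp add: C_def D_def)
 next
  case False
  thus ?thesis using Qprop[OF qsQ, of i] that by (simp add: C_def D_def)
 qed
 define vs where "vs = concat (map (%i. C i @ l i) [0..<n])"
 have n1: "n >= 1" using s1 by (simp add: n_def)
 have winvs: "win k E (vs @ take (k - 1) vs)"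
  unfolding vs_def
 proof (rule cycle_of_links[OF k1 n1])
  show "k - 1 <= length (C i) & win k E (C i) & win k E (last_of k (C i) @ l i @ first_of k (C (Suc i mod n)))" if "i < n" for i
   using Cok[OF that] lwin[OF that] Cends(2)[OF that] Cends(1)[OF nxt[OF that]] by simp
 qed
 have usedC: "set (C i) Int (\<Union>i\<in>?J. set (l2 i)) = {}" if "i < n" for i
 proof (cases "i < s")
  case True thus ?thesis using setC[OF that] by (auto simp: used_def)
 next
  case False
  hence "set (C i) <= S Un W (5 * m)" using Qprop[OF qsQ, of i] that by (simp add: C_def D_def)
  moreover have "(\<Union>i\<in>?J. set (l2 i)) <= Y" using l2Y by force
  ultimately show ?thesis using Y5 YR SR by blast
 qed
 have Cl: "set (C i) Int set (l j) = {}" if ij: "i < n" "j < n" for i j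
 proof (cases "j < s - 1")
  case True
  show ?thesis
  proof (cases "i < s")
   case i: True
   have "set (C i) <= set (A (rs ! i))" using setC[OF ij(1)] i ab(6)[OF rsR[OF i]] by auto
   thus ?thesis using AG3[OF rsR[OF i]] l1G[OF True] True by (auto simp: l_def)
  next
   case False
   have "set (C i) <= S Un R" using Qprop[OF qsQ, of i] ij False W5R by (auto simp: C_def D_def)
   moreover have "set (l1 j) Int S = {}" using True by (auto simp: S_def X_def)
   moreover have "G3 Int R = {}"
   proof -
    have "R Int W (3 * m + j) = {}" if "j < m" for j by (rule RW) (use that in simp)
    thus ?thesis unfolding G3_def by blast
   qed
   ultimately show ?thesis using l1G[OF True] True by (auto simp: l_def)
  qed
 next
  case False
  hence "l j = l2 j" "j : ?J" using ij by (auto simp: l_def)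
  hence "set (l j) <= (\<Union>i\<in>?J. set (l2 i))" using UN_upper[of j ?J "%i. set (l2 i)"] by simp
  thus ?thesis using usedC[OF ij(1)] by blast
 qed
 have Cdj: "set (C i) Int set (C j) = {}" if ij: "i < n" "j < n" "i ~= j" for i j
 proof -
  have 1: "set (C i) Int set (C j) = {}" if a: "i < s" "s <= j" "j < n" for i j
  proof -
   have i: "i < n" using a sn by simp
   have "set (C j) <= S Un (\<Union>v\<in>T. set (t v))" using qsQ[OF a(2,3)] a(2) Qun by (auto simp: C_def D_def)
   moreover have "set (C i) Int (\<Union>v\<in>T. set (t v)) = {}" using setC[OF i] a(1) by (auto simp: used_def)
   moreover have "set (C i) Int S = {}"
   proof -
    have "set (C i) <= set (A (rs ! i))" using setC[OF i] a(1) ab(6)[OF rsR[OF a(1)]] by auto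
    thus ?thesis using rsR[OF a(1)] by (auto simp: S_def X_def)
   qed
   ultimately show ?thesis by blast
  qed
  have 2: "set (C i) Int set (C j) = {}" if a: "i < s" "j < s" "i ~= j" for i j
  proof -
   have "set (C i) <= set (A (rs ! i))" "set (C j) <= set (A (rs ! j))" using setC[of i] setC[of j] a sn ab(6)[OF rsR[OF a(1)]] ab(6)[OF rsR[OF a(2)]] by auto
   thus ?thesis using Adj[OF rsR[OF a(1)] rsR[OF a(2)] rs_ne[OF a]] by blast
  qed
  have 3: "set (C i) Int set (C j) = {}" if "s <= i" "s <= j" "i < n" "j < n" "i ~= j" for i j using Ddj[of i j] that by (simp add: C_def)
  show ?thesis using 1[of i j] 1[of j i] 2[of i j] 3[of i j] ij by (cases "i < s"; cases "j < s") (auto simp: Int_commute)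
 qed
 have dvs: "distinct vs"
  unfolding vs_def
 proof (rule distinct_concat_map)
  show "distinct (C i @ l i)" if "i : set [0..<n]" for i using Cok[of i] ldist[of i] Cl[of i i] that by simp
  show "set (C i @ l i) Int set (C j @ l j) = {}" if "i : set [0..<n]" "j : set [0..<n]" "i ~= j" for i j
  proof -
   have "i < n" "j < n" using that by auto
   thus ?thesis using Cdj[of i j] ldj[of i j] Cl[of i j] Cl[of j i] that(3) by auto
  qed
 qed simp
 have setvs: "set vs = (\<Union>i<n. set (C i) Un set (l i))" by (auto simp: vs_def)
 have "V <= set vs"
 proof
  fix x assume x: "x : V"
  have inC: "x : set vs" if "x : set (C i)" "i < n" for i using that setvs by auto
  have inl: "x : set vs" if "x : set (l i)" "i < n" for i using that setvs by auto
  have inQ: "x : set vs" if x: "x : (\<Union>xs\<in>Qs. set xs)"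
  proof -
   obtain xs where "xs : Qs" "x : set xs" using x by blast
   then obtain j where j: "j < length qs" "x : set (qs ! j)" using qs(1) by (metis in_set_conv_nth)
   hence "x : set (C (s + j))" by (simp add: C_def D_def)
   thus ?thesis using inC[of "s + j"] j by (simp add: n_def)
  qed
  show "x : set vs"
  proof (cases "x : used")
   case True
   thus ?thesis
    unfolding used_def
   proof
    assume "x : (\<Union>i\<in>?J. set (l2 i))"
    then obtain i where "i : ?J" "x : set (l2 i)" by blast
    thus ?thesis using inl[of i] by (simp add: l_def)
   next
    assume "x : (\<Union>v\<in>T. set (t v))"
    thus ?thesis using inQ Qun by blast
   qed
  next
   case False
   consider "x : S" | r where "r : R" "x : set (A r)" | i where "i < s - 1" "x : set (l1 i)" using x unfolding S_def X_def by blast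
   thus ?thesis
   proof cases
    case 1 thus ?thesis using inQ Qun by blast
   next
    case 2
    then obtain i where i: "i < s" "rs ! i = r" using rs(1) ls by (metis in_set_conv_nth)
    have "x : set (C i)" using setC[of i] i sn 2 ab(6)[OF 2(1)] False by auto
    thus ?thesis using inC[of i] i sn by simp
   next
    case 3
    thus ?thesis using inl[of i] sn by (simp add: l_def)
   qed
  qed
 qed
 moreover have "set vs <= V"
 proof -
  have "set (C i) <= V" if "i < n" for i using setC[OF that] Dok(3)[OF that] AV[OF rsR, of i] ab(6)[OF rsR, of i] by (auto split: if_splits)
  moreover have "set (l i) <= V" if "i < n" for i
  proof (cases "i < s - 1")
   case True thus ?thesis using l1G[OF True] G3V by (simp add: l_def)
  next
   case False
   hence "set (l2 i) <= Y" using l2Y[of i] that by simp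
   thus ?thesis using False YR RV by (simp add: l_def)
  qed
  ultimately show ?thesis unfolding setvs by blast
 qed
 ultimately have sv: "set vs = V" by blast
 have "k <= length vs"
 proof -
  have "card R * (k + 2 * c + c^2) >= 1 * k" using s1 by (intro mult_le_mono) (auto simp: s_def)
  hence "real k <= real (card R * (k + 2 * c + c^2))" by (simp only: mult_1 of_nat_mono)
  also have "... <= 1 * real (card R * (k + 2 * c + c^2) + m0)" by simp
  also have "... <= 128 * real k * real (card R * (k + 2 * c + c^2) + m0)" using k3 by (intro mult_right_mono) auto
  also have "... <= card V" using F by simp
  finally have "k <= card V" by simp
  thus ?thesis using sv dvs by (simp add: distinct_card[symmetric])
 qed
 thus ?thesis using dvs sv cyclic_win[OF winvs] by blast
qed

end

section \<open>Chernoff bounds and random colourings\<close>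

lemma exp_le_quadratic: assumes "\<bar>x\<bar> <= (1::real)" shows "exp x <= 1 + x + x^2"
proof (cases "x >= 0")
 case True thus ?thesis using exp_bound[of x] assms by simp
next
 case False
 define y where "y = - x"
 have y: "y > 0" "x = - y" using False by (auto simp: y_def)
 have "exp x = 1 / exp y" by (simp add: y(2) exp_minus inverse_eq_divide)
 also have "... <= 1 / (1 + y)" using y(1) exp_ge_add_one_self[of y] by (intro divide_left_mono) auto
 also have "... <= 1 + x + x^2"
 proof -
  have "1 <= (1 - y + y^2) * (1 + y)" using y(1) by (simp add: power2_eq_square algebra_simps)
  thus ?thesis using y by (simp add: divide_le_eq)
 qed
 finally show ?thesis .
qed

text \<open>Markov inequality for exp (l X). Negative l gives lower tails, which is why the event is stated for l X.\<close>
lemma chernoff_mgf: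
  fixes q :: "'x => 'c pmf" and r s l :: real
  assumes V: "finite V" "S \<subseteq> V" and r: "!!x. x : S ==> measure_pmf.prob (q x) A = r"
  shows "measure_pmf.prob (Pi_pmf V d q) {b. s <= l * card {x\<in>S. b x : A}} <= exp (r * card S * (exp l - 1) - s)"
proof -
 let ?P = "Pi_pmf V d q"
 define f where "f x y = (if x : S & y : A then exp l else 1)" for x y
 have finS: "finite S" using V finite_subset by blast
 have int: "integrable (measure_pmf (q x)) (f x)" for x by (rule measure_pmf.integrable_const_bound[where B = "max (exp l) 1"]) (auto simp: f_def)
 have eq: "exp (l * card {x:S. b x : A}) = (\<Prod>x\<in>V. f x (b x))" for b
 proof -
  have "(\<Prod>x\<in>V. f x (b x)) = (\<Prod>x\<in>{x:S. b x : A}. exp l)" using V by (intro prod.mono_neutral_cong_right) (auto simp: f_def)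
  also have "... = exp (l * card {x:S. b x : A})" by (simp add: exp_of_nat2_mult)
  finally show ?thesis by simp
 qed
 have Ef: "measure_pmf.expectation (q x) (f x) = (if x : S then 1 + r * (exp l - 1) else 1)" for x
 proof (cases "x : S")
  case True
  have "f x = (%y. 1 + (exp l - 1) * indicator A y)" using True by (auto simp: f_def indicator_def fun_eq_iff)
  moreover have "integrable (measure_pmf (q x)) (indicat_real A)" by (rule integrable_real_indicator) (simp_all add: measure_pmf.emeasure_eq_measure)
  ultimately show ?thesis using True r[OF True] by (simp add: mult.commute)
 next
  case False
  hence "f x = (%_. 1)" by (auto simp: f_def fun_eq_iff)
  thus ?thesis using False by simp
 qed
 have "measure_pmf.prob ?P {b. s <= l * card {x:S. b x : A}} = measure_pmf.prob ?P {b : space (measure_pmf ?P). exp s <= (\<Prod>x\<in>V. f x (b x))}" by (simp add: eq[symmetric])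
 also have "... <= measure_pmf.expectation ?P (%b. \<Prod>x\<in>V. f x (b x)) / exp s"
 proof (rule integral_Markov_inequality_measure[where A = "{}"])
  show "integrable (measure_pmf ?P) (%b. \<Prod>x\<in>V. f x (b x))" by (rule integrable_prod_Pi_pmf[OF V(1) int])
  show "AE x in measure_pmf ?P. 0 <= (\<Prod>y\<in>V. f y (x y))" by (intro AE_I2 prod_nonneg) (auto simp: f_def)
 qed auto
 also have "measure_pmf.expectation ?P (%b. \<Prod>x\<in>V. f x (b x)) = (\<Prod>x\<in>V. measure_pmf.expectation (q x) (f x))" by (rule expectation_prod_Pi_pmf[OF V(1) int]) (simp add: f_def)
 also have "... = (\<Prod>x\<in>S. 1 + r * (exp l - 1))"
  unfolding Ef using V by (intro prod.mono_neutral_cong_right) auto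
 also have "... <= (\<Prod>x\<in>S. exp (r * (exp l - 1)))"
 proof (rule prod_mono)
  fix x assume x: "x : S"
  have "r <= 1" "r >= 0" using r[OF x] by (metis measure_pmf.prob_le_1, metis measure_nonneg)
  hence "r * (1 - exp l) <= 1"
  proof -
   have "r * (1 - exp l) <= r * 1" using \<open>r >= 0\<close> by (intro mult_left_mono) auto
   thus ?thesis using \<open>r <= 1\<close> by linarith
  qed
  thus "0 <= 1 + r * (exp l - 1) & 1 + r * (exp l - 1) <= exp (r * (exp l - 1))" using exp_ge_add_one_self[of "r * (exp l - 1)"] by (simp add: algebra_simps)
 qed
 also have "... = exp (r * card S * (exp l - 1))" by (simp add: exp_of_nat_mult[symmetric] mult_ac)
 finally show ?thesis by (simp add: exp_diff divide_right_mono)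
qed

lemma chernoff_upper:
  fixes q :: "'x => 'c pmf" and r T eps :: real
  assumes V: "finite V" "S \<subseteq> V" and r: "!!x. x : S ==> measure_pmf.prob (q x) A = r"
    and T: "r * card S <= T" and e: "0 < eps" "eps <= 2"
  shows "measure_pmf.prob (Pi_pmf V d q) {b. (1 + eps) * T <= card {x\<in>S. b x : A}} <= exp (- (eps^2 * T / 4))"
proof (cases "S = {}")
 case True
 show ?thesis
 proof (cases "T > 0")
  case True thus ?thesis using \<open>S = {}\<close> e by (simp add: mult_le_0_iff)
 next
  case False
  hence "T = 0" using T True by simp
  thus ?thesis by simp
 qed
next
 case False
 hence "r >= 0" using r by (metis all_not_in_conv measure_nonneg)
 have "exp (eps/2) - 1 <= eps/2 + (eps/2)^2" using exp_le_quadratic[of "eps/2"] e by simp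
 moreover have e0: "exp (eps/2) - 1 >= 0" using e by simp
 ultimately have *: "r * card S * (exp (eps/2) - 1) <= T * (eps/2 + (eps/2)^2)" using T \<open>r >= 0\<close> by (intro mult_mono) (auto intro: order_trans[OF _ T])
 have "{b. (1 + eps) * T <= card {x:S. b x : A}} = {b. eps/2 * ((1 + eps) * T) <= eps/2 * card {x:S. b x : A}}" using e by simp
 hence "measure_pmf.prob (Pi_pmf V d q) {b. (1 + eps) * T <= card {x:S. b x : A}} <=
   exp (r * card S * (exp (eps/2) - 1) - eps/2 * ((1 + eps) * T))" using chernoff_mgf[OF V r, where s = "eps/2 * ((1 + eps) * T)" and d = d and l = "eps/2"] by simp
 also have "... <= exp (- (eps^2 * T / 4))"
 proof -
  have "T * (eps/2 + (eps/2)^2) - eps/2 * ((1 + eps) * T) = - (eps^2 * T / 4)" by (simp add: power2_eq_square field_simps)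
  thus ?thesis using * by simp
 qed
 finally show ?thesis .
qed

lemma chernoff_lower:
  fixes q :: "'x => 'c pmf" and r eps :: real
  assumes V: "finite V" "S \<subseteq> V" and r: "!!x. x : S ==> measure_pmf.prob (q x) A = r" "r >= 0"
    and e: "0 < eps" "eps <= 2"
  shows "measure_pmf.prob (Pi_pmf V d q) {b. card {x\<in>S. b x : A} <= (1 - eps) * (r * card S)} <= exp (- (eps^2 * (r * card S) / 4))"
proof -
 define T where "T = r * card S"
 have T0: "T >= 0" using r(2) by (simp add: T_def)
 have "exp (-eps/2) - 1 <= -eps/2 + (eps/2)^2" using exp_le_quadratic[of "-eps/2"] e by (simp add: power2_eq_square)
 hence *: "T * (exp (-eps/2) - 1) <= T * (-eps/2 + (eps/2)^2)" using T0 by (rule mult_left_mono)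
 have "{b. card {x:S. b x : A} <= (1 - eps) * T} = {b. (-eps/2) * ((1 - eps) * T) <= (-eps/2) * card {x:S. b x : A}}" using e by (intro Collect_cong) (simp add: mult_le_cancel_left)
 hence "measure_pmf.prob (Pi_pmf V d q) {b. card {x:S. b x : A} <= (1 - eps) * T} <=
   exp (r * card S * (exp (-eps/2) - 1) - (-eps/2) * ((1 - eps) * T))" using chernoff_mgf[OF V r(1), where s = "(-eps/2) * ((1 - eps) * T)" and d = d and l = "-eps/2"] by simp
 also have "... <= exp (- (eps^2 * T / 4))"
 proof -
  have "T * (-eps/2 + (eps/2)^2) - (-eps/2) * ((1 - eps) * T) = - (eps^2 * T / 4)" by (simp add: power2_eq_square field_simps)
  thus ?thesis using * unfolding T_def[symmetric] exp_le_cancel_iff by linarith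
 qed
 finally show ?thesis by (simp add: T_def)
qed

lemma pmf_union_bound_exists:
  fixes P :: "'b pmf" and c :: real
  assumes "finite I" "!!i. i : I ==> measure_pmf.prob P (B i) <= c" "card I * c < 1"
  shows "\<exists>b. \<forall>i\<in>I. b \<notin> B i"
proof (rule ccontr)
 assume "~ ?thesis"
 hence "UNIV = (\<Union>i\<in>I. B i)" by auto
 hence "1 = measure_pmf.prob P (\<Union>i\<in>I. B i)" using measure_pmf.prob_space[of P] by simp
 also have "... <= (\<Sum>i\<in>I. measure_pmf.prob P (B i))" by (rule measure_pmf.finite_measure_subadditive_finite[OF assms(1)]) simp
 also have "... <= (\<Sum>i\<in>I. c)" using assms(2) by (rule sum_mono)
 finally show False using assms(3) by simp
qed

text \<open>Uniformly random colours, Chernoff in both directions, and a union bound over the sets in Y0 and the colours.\<close>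
lemma equipartition:
  fixes V :: "'a set" and Y0 :: "'a set set" and eps y :: real and Q :: nat
  assumes V: "finite V" "Y0 \<subseteq> Pow V" and y: "!!Y. Y : Y0 ==> y <= card Y" and e: "0 < eps" "eps <= 2" and Q: "Q >= 1"
    and c: "2 * real Q * card Y0 * exp (- (eps^2 * (y / Q) / 4)) < 1"
  shows "\<exists>col::'a => nat. \<forall>Y\<in>Y0. \<forall>i<Q. (1 - eps) * (card Y / Q) <= card {x\<in>Y. col x = i} & card {x\<in>Y. col x = i} <= (1 + eps) * (card Y / Q)"
proof -
 define P where "P = Pi_pmf V 0 (%_::'a. pmf_of_set {..<Q})"
 define B where "B = (%(Y, i, s). if s then {b :: 'a => nat. (1 + eps) * (card Y / Q) <= card {x:Y. b x : {i}}}
   else {b. card {x:Y. b x : {i}} <= (1 - eps) * (card Y / Q)})"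
 have finY: "finite Y0" using V by (meson finite_Pow_iff finite_subset)
 have pr: "measure_pmf.prob (pmf_of_set {..<Q}) {i} = 1 / Q" if "i < Q" for i using Q that by (subst measure_pmf_of_set) auto
 have "EX b. ALL t:Y0 \<times> {..<Q} \<times> (UNIV :: bool set). b ~: B t"
 proof (rule pmf_union_bound_exists)
  show "finite (Y0 \<times> {..<Q} \<times> (UNIV :: bool set))" using finY by simp
  show "real (card (Y0 \<times> {..<Q} \<times> (UNIV :: bool set))) * exp (- (eps^2 * (y / Q) / 4)) < 1" using c by (simp add: card_cartesian_product mult_ac)
  fix t assume "t : Y0 \<times> {..<Q} \<times> (UNIV :: bool set)"
  then obtain Y i s where t: "t = (Y, i, s)" "Y : Y0" "i < Q" by auto
  have YV: "Y <= V" using t(2) V(2) by auto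
  have "measure_pmf.prob P (B t) <= exp (- (eps^2 * (1 / Q * card Y) / 4))"
  proof (cases s)
   case True
   thus ?thesis using chernoff_upper[OF V(1) YV pr[OF t(3)] _ e, where T = "1 / Q * card Y" and d = 0] by (simp add: B_def t(1) P_def)
  next
   case False
   thus ?thesis using chernoff_lower[OF V(1) YV pr[OF t(3)] _ e, where d = 0] by (simp add: B_def t(1) P_def)
  qed
  also have "... <= exp (- (eps^2 * (y / Q) / 4))" using y[OF t(2)] e Q by (simp add: divide_right_mono mult_left_mono)
  finally show "measure_pmf.prob P (B t) <= exp (- (eps^2 * (y / Q) / 4))" .
 qed
 then obtain b where b: "ALL t:Y0 \<times> {..<Q} \<times> (UNIV :: bool set). b ~: B t" by blast
 show ?thesis
 proof (rule exI[of _ b], intro ballI allI impI)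
  fix Y i assume Y: "Y : Y0" "i < Q"
  have "b ~: B (Y, i, True)" "b ~: B (Y, i, False)" using b Y by blast+
  thus "(1 - eps) * (card Y / Q) <= card {x:Y. b x = i} & card {x:Y. b x = i} <= (1 + eps) * (card Y / Q)" by (simp add: B_def)
 qed
qed

context host begin

lemma fair_Union:
  fixes N :: real
  assumes "finite J" "J ~= {}" "!!j. j : J ==> fair N (X j)" "!!i j. i : J ==> j : J ==> i ~= j ==> X i \<inter> X j = {}"
  shows "fair (card J * N) (\<Union>j\<in>J. X j)"
proof -
 have f: "X j <= V" "N / 2 <= card (X j)" "card (X j) <= (1 + g/8) * N" if "j : J" for j using assms(3)[OF that] by (auto simp: fair_def)
 have fd: "(1/2 + 3 * g / 2) * p * N <= deg E a (X j)" "deg G a (X j) <= 3 * p * N" if "j : J" "a : nsets V (k - 1)" for j a using assms(3)[OF that(1)] that(2) by (auto simp: fair_def)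
 have fin: "finite (X j)" if "j : J" for j using f(1)[OF that] finV finite_subset by blast
 have c: "card (\<Union>j\<in>J. X j) = (\<Sum>j\<in>J. card (X j))" using assms(1,4) fin by (intro card_UN_disjoint) auto
 have d: "deg H a (\<Union>j\<in>J. X j) = (\<Sum>j\<in>J. deg H a (X j))" for H a
 proof -
  have "{y : (\<Union>j\<in>J. X j). insert y a : H} = (\<Union>j\<in>J. {y : X j. insert y a : H})" by auto
  moreover have "card (\<Union>j\<in>J. {y : X j. insert y a : H}) = (\<Sum>j\<in>J. card {y : X j. insert y a : H})" using assms(1) fin
  proof (intro card_UN_disjoint ballI impI)
   fix i j assume "i : J" "j : J" "i ~= j"
   from assms(4)[OF this] show "{y : X i. insert y a : H} Int {y : X j. insert y a : H} = {}" by blast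
  qed auto
  ultimately show ?thesis by (simp add: deg_def)
 qed
 show ?thesis
  unfolding fair_def
 proof (intro conjI ballI)
  show "(\<Union>j\<in>J. X j) <= V" using f(1) by (rule UN_least)
  have "(\<Sum>j\<in>J. N / 2) <= (\<Sum>j\<in>J. real (card (X j)))" using f(2) by (rule sum_mono)
  thus "card J * N / 2 <= card (\<Union>j\<in>J. X j)" by (simp add: c)
  have "(\<Sum>j\<in>J. real (card (X j))) <= (\<Sum>j\<in>J. (1 + g/8) * N)" using f(3) by (rule sum_mono)
  thus "card (\<Union>j\<in>J. X j) <= (1 + g/8) * (card J * N)" by (simp add: c mult_ac)
  fix a assume a: "a : nsets V (k - 1)"
  have "(\<Sum>j\<in>J. (1/2 + 3 * g / 2) * p * N) <= (\<Sum>j\<in>J. real (deg E a (X j)))" using fd(1)[OF _ a] by (rule sum_mono)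
  thus "(1/2 + 3 * g / 2) * p * (card J * N) <= deg E a (\<Union>j\<in>J. X j)" by (simp add: d mult_ac)
  have "(\<Sum>j\<in>J. real (deg G a (X j))) <= (\<Sum>j\<in>J. 3 * p * N)" using fd(2)[OF _ a] by (rule sum_mono)
  thus "deg G a (\<Union>j\<in>J. X j) <= 3 * p * (card J * N)" by (simp add: d mult_ac)
 qed
qed

text \<open>Equipartition is applied to V and to all neighbourhoods in E and in G.\<close>
lemma fair_partition:
  fixes Q :: nat
  assumes degE: "!!a. a : nsets V (k - 1) ==> (1/2 + 2 * g) * p * card V <= deg E a V"
    and degG: "!!a. a : nsets V (k - 1) ==> deg G a V <= 2 * p * card V"
    and Q: "Q >= 1" and p1: "p <= 1"
    and c: "2 * real Q * (2 * card (nsets V (k - 1)) + 1) * exp (- ((g/8)^2 * (p * card V / 2 / Q) / 4)) < 1"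
  shows "\<exists>X. (\<forall>i<Q. fair (card V / Q) (X i)) & (\<forall>i<Q. \<forall>j<Q. i ~= j --> X i \<inter> X j = {})"
proof -
 let ?N = "nsets V (k - 1)"
 define Y where "Y H a = {y : V. insert y a : H}" for H a
 define Y0 where "Y0 = insert V (Y E ` ?N Un Y G ` ?N)"
 have cY: "card Y0 <= 2 * card ?N + 1"
 proof -
  have fin: "finite (Y E ` ?N)" "finite (Y G ` ?N)" using fin_nsets by auto
  have "card Y0 <= Suc (card (Y E ` ?N Un Y G ` ?N))" unfolding Y0_def using fin by (intro card_insert_le_m1) auto
  also have "card (Y E ` ?N Un Y G ` ?N) <= card (Y E ` ?N) + card (Y G ` ?N)" by (rule card_Un_le)
  also have "... <= card ?N + card ?N" using card_image_le[OF fin_nsets] by (intro add_mono) blast+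
  finally show ?thesis by simp
 qed
 have dY: "deg H a V = card (Y H a)" for H a by (simp add: deg_def Y_def)
 have EG': "card (Y E a) <= card (Y G a)" for a using EG finV by (intro card_mono) (auto simp: Y_def)
 have y: "p * card V / 2 <= card Z" if "Z : Y0" for Z
 proof -
  have big: "p * card V / 2 <= card (Y E a)" if "a : ?N" for a
  proof -
   have "1/2 * (p * card V) <= (1/2 + 2 * g) * (p * card V)" using g0 p0 by (intro mult_right_mono) auto
   moreover have "(1/2 + 2 * g) * (p * card V) <= card (Y E a)" using degE[OF that] by (simp only: dY mult.assoc)
   ultimately show ?thesis by linarith
  qed
  have big': "p * card V / 2 <= card (Y G a)" if "a : ?N" for a using big[OF that] EG'[of a] by linarith
  have "p * card V <= 1 * real (card V)" using p1 by (intro mult_right_mono) auto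
  moreover have "real (card V) >= 0" by simp
  ultimately have V2: "p * card V / 2 <= card V" by linarith
  have "Z = V | (EX a:?N. Z = Y E a) | (EX a:?N. Z = Y G a)" using that by (auto simp: Y0_def)
  thus ?thesis using V2 big big' by (elim disjE bexE) simp_all
 qed
 have "EX col::'a => nat. ALL Y:Y0. ALL i<Q. (1 - g/8) * (card Y / Q) <= card {x:Y. col x = i} & card {x:Y. col x = i} <= (1 + g/8) * (card Y / Q)"
 proof (rule equipartition[OF finV _ y _ _ Q])
  show "Y0 <= Pow V" by (auto simp: Y0_def Y_def)
  have "real (card Y0) <= 2 * card ?N + 1" using cY by linarith
  hence "2 * real Q * card Y0 * exp (- ((g/8)^2 * (p * card V / 2 / Q) / 4)) <= 2 * real Q * (2 * card ?N + 1) * exp (- ((g/8)^2 * (p * card V / 2 / Q) / 4))"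
   by (intro mult_right_mono mult_left_mono) auto
  thus "2 * real Q * card Y0 * exp (- ((g/8)^2 * (p * card V / 2 / Q) / 4)) < 1" using c by linarith
 qed (use g0 g1 in auto)
 then obtain col :: "'a => nat" where col: "ALL Y:Y0. ALL i<Q. (1 - g/8) * (card Y / Q) <= card {x:Y. col x = i} & card {x:Y. col x = i} <= (1 + g/8) * (card Y / Q)" by blast
 define X where "X i = {x:V. col x = i}" for i
 have fairX: "fair (card V / Q) (X i)" if i: "i < Q" for i
 proof -
  define N where "N = card V / Q"
  have N0: "N >= 0" by (simp add: N_def)
  have cc: "(1 - g/8) * (card Z / Q) <= card {x:Z. col x = i}" "card {x:Z. col x = i} <= (1 + g/8) * (card Z / Q)" if "Z : Y0" for Z using col that i by blast+
  have XY: "{x:Y H a. col x = i} = {y : X i. insert y a : H}" for H a by (auto simp: X_def Y_def)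
  have "fair N (X i)"
   unfolding fair_def
  proof (intro conjI ballI)
   show "X i <= V" by (auto simp: X_def)
   have V0: "V : Y0" by (simp add: Y0_def)
   have "1/2 * N <= (1 - g/8) * N" using g1 N0 by (intro mult_right_mono) auto
   thus "N / 2 <= card (X i)" using cc(1)[OF V0] by (simp add: X_def N_def)
   show "card (X i) <= (1 + g/8) * N" using cc(2)[OF V0] by (simp add: X_def N_def)
   fix a assume a: "a : ?N"
   have YE: "Y E a : Y0" "Y G a : Y0" using a by (auto simp: Y0_def)
   have pN: "p * N >= 0" using p0 N0 by simp
   have g2: "g * g <= 1/10 * g" using g1 g0 by (intro mult_right_mono) auto
   have "(1/2 + 3 * g / 2) * (p * N) <= ((1 - g/8) * (1/2 + 2 * g)) * (p * N)" using pN g2 g0 by (intro mult_right_mono) (simp_all add: algebra_simps)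
   also have "... = (1 - g/8) * (((1/2 + 2 * g) * p * card V) / Q)" by (simp add: N_def)
   also have "... <= (1 - g/8) * (card (Y E a) / Q)" using degE[OF a] g1 by (intro mult_left_mono divide_right_mono) (auto simp: dY)
   also have "... <= deg E a (X i)" using cc(1)[OF YE(1)] by (simp add: XY deg_def)
   finally show "(1/2 + 3 * g / 2) * p * N <= deg E a (X i)" by (simp add: mult_ac)
   have "deg G a (X i) <= (1 + g/8) * (card (Y G a) / Q)" using cc(2)[OF YE(2)] by (simp add: XY deg_def)
   also have "... <= (1 + g/8) * ((2 * p * card V) / Q)" using degG[OF a] g0 by (intro mult_left_mono divide_right_mono) (auto simp: dY)
   also have "... = ((1 + g/8) * 2) * (p * N)" by (simp add: N_def)
   also have "... <= 3 * (p * N)" using pN g1 by (intro mult_right_mono) auto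
   finally show "deg G a (X i) <= 3 * p * N" by simp
  qed
  thus ?thesis by (simp add: N_def)
 qed
 have "X i Int X j = {}" if "i ~= j" for i j using that by (auto simp: X_def)
 thus ?thesis using fairX by (intro exI[of _ X]) blast
qed

end

section \<open>The random hypergraph is pseudorandom\<close>

lemma pmf_union_bound:
  assumes "finite I"
  shows "measure_pmf.prob P {b. \<exists>i\<in>I. b : B i} <= (\<Sum>i\<in>I. measure_pmf.prob P (B i))"
proof -
 have "{b. EX i:I. b : B i} = (\<Union>i\<in>I. B i)" by auto
 thus ?thesis using measure_pmf.finite_measure_subadditive_finite[OF assms, of B P] by simp
qed

text \<open>The union bound over all subsets A of S, with weight x to the power |A|, is summed by the binomial formula.\<close>
lemma sum_Pow_card:
  fixes x :: real
  assumes "finite S"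
  shows "(\<Sum>A\<in>Pow S. x ^ card A) = (1 + x) ^ card S"
 using assms
proof (induction S rule: finite_induct)
 case (insert a S)
 have dj: "Pow S Int insert a ` Pow S = {}" using insert.hyps(2) by auto
 have inj: "inj_on (insert a) (Pow S)" using insert.hyps(2) by (auto simp: inj_on_def)
 have "(\<Sum>A\<in>Pow (insert a S). x ^ card A) = (\<Sum>A\<in>Pow S. x ^ card A) + (\<Sum>A\<in>insert a ` Pow S. x ^ card A)"
  unfolding Pow_insert using insert.hyps(1) dj by (intro sum.union_disjoint) auto
 also have "(\<Sum>A\<in>insert a ` Pow S. x ^ card A) = (\<Sum>A\<in>Pow S. x ^ card (insert a A))" by (rule sum.reindex_cong[OF inj]) auto
 also have "... = (\<Sum>A\<in>Pow S. x * x ^ card A)"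
 proof (rule sum.cong)
  fix A assume "A : Pow S"
  hence "finite A" "a ~: A" using insert.hyps finite_subset by auto
  thus "x ^ card (insert a A) = x * x ^ card A" by simp
 qed simp
 finally show ?case using insert by (simp add: sum_distrib_left[symmetric] algebra_simps)
qed simp

lemma card_nsets_le: "finite V ==> real (card (nsets V j)) <= real (card V) ^ j"
proof (cases "j <= card V")
 case True
 assume "finite V"
 hence "card (nsets V j) <= card V ^ j" using True by (simp add: card_nsets_choose binomial_le_pow)
 thus ?thesis by (metis of_nat_le_iff of_nat_power)
next
 case False
 assume "finite V"
 thus ?thesis using False by (simp add: card_nsets_choose binomial_eq_0)
qed

locale random_graph =
  fixes V :: "'a set" and k :: nat and p L g :: real
  assumes finV: "finite V" and k3: "k >= 3" and p: "0 < p" "p <= 1" and L1: "L >= 1" and g: "0 < g" "g <= 1/10"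
begin

definition "T = nsets V k"
definition "R = Pi_pmf T False (%_. bernoulli_pmf p)"
definition "H b = {e\<in>T. b e}"

lemma finT: "finite T" unfolding T_def using finV by (rule finite_imp_finite_nsets)

lemma bern: "measure_pmf.prob (bernoulli_pmf p) {True} = p"
 using p by (simp add: measure_pmf_single)

lemma edge_upper:
  assumes "S \<subseteq> T" "p * card S <= M" "0 < eps" "eps <= 2"
  shows "measure_pmf.prob R {b. (1 + eps) * M <= card {e\<in>S. b e}} <= exp (- (eps^2 * M / 4))"
 using chernoff_upper[OF finT assms(1) bern assms(2,3,4), of False] by (simp add: R_def)

lemma prob_mono: "A \<subseteq> B ==> measure_pmf.prob R A <= measure_pmf.prob R B"
 by (rule measure_pmf.finite_measure_mono) auto

lemma insert_edge: "insert y a : T ==> a : nsets V (k - 1) ==> y \<notin> a"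
 using k3 by (auto simp: T_def nsets_def insert_absorb)

lemma degree_tail:
  assumes a: "a : nsets V (k - 1)"
  shows "measure_pmf.prob R {b. 2 * p * card V < deg (H b) a V} <= exp (- (p * card V / 4))"
proof -
 define S where "S = (%y. insert y a) ` V Int T"
 have "card S <= card ((%y. insert y a) ` V)" using finV by (intro card_mono) (auto simp: S_def)
 also have "... <= card V" using finV by (rule card_image_le)
 finally have "p * card S <= p * card V" using p by (intro mult_left_mono) auto
 have ST: "S <= T" by (auto simp: S_def)
 have "measure_pmf.prob R {b. 2 * (p * card V) <= card {e:S. b e}} <= exp (- (p * card V / 4))" using edge_upper[OF ST \<open>p * card S <= p * card V\<close>, of 1] by simp
 moreover have "{b. 2 * p * card V < deg (H b) a V} <= {b. 2 * (p * card V) <= card {e:S. b e}}"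
 proof
  fix b assume b: "b : {b. 2 * p * card V < deg (H b) a V}"
  have "deg (H b) a V <= card {e:S. b e}"
   unfolding deg_def
  proof (rule card_inj_on_le)
   show "inj_on (%y. insert y a) {y : V. insert y a : H b}" using insert_edge[OF _ a] by (auto simp: inj_on_def H_def)
   show "(%y. insert y a) ` {y : V. insert y a : H b} <= {e:S. b e}" by (auto simp: S_def H_def)
   show "finite {e:S. b e}" using finT by (simp add: S_def)
  qed
  thus "b : {b. 2 * (p * card V) <= card {e:S. b e}}" using b by simp
 qed
 from prob_mono[OF this] calculation show ?thesis by linarith
qed

lemma mixing_tail:
  assumes z: "z : nsets V (k - 2)" and CX: "C \<subseteq> V" "X \<subseteq> V" "C \<inter> X = {}"
  shows "measure_pmf.prob R {b. (1 + g/8) * max (p * card C * card X) (card V * L) < card {(c, x) : C \<times> X. insert c (insert x z) : H b}}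
     <= exp (- ((g/8)^2 * (card V * L) / 4))"
proof -
 define S where "S = (%(c, x). insert c (insert x z)) ` (C \<times> X) Int T"
 define M where "M = max (p * card C * card X) (card V * L)"
 have fin: "finite C" "finite X" using CX finV finite_subset by blast+
 have "card S <= card ((%(c, x). insert c (insert x z)) ` (C \<times> X))" using fin by (intro card_mono) (auto simp: S_def)
 also have "... <= card (C \<times> X)" using fin by (intro card_image_le) simp
 also have "... = card C * card X" by (rule card_cartesian_product)
 finally have "real (card S) <= real (card C * card X)" by (rule of_nat_mono)
 hence "p * card S <= p * real (card C * card X)" using p by (intro mult_left_mono) auto
 hence "p * card S <= M" by (simp add: M_def mult.assoc)
 hence "measure_pmf.prob R {b. (1 + g/8) * M <= card {e:S. b e}} <= exp (- ((g/8)^2 * M / 4))" using g by (intro edge_upper) (auto simp: S_def)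
 also have "... <= exp (- ((g/8)^2 * (card V * L) / 4))" by (simp add: M_def mult_left_mono)
 finally have 1: "measure_pmf.prob R {b. (1 + g/8) * M <= card {e:S. b e}} <= exp (- ((g/8)^2 * (card V * L) / 4))" .
 have "{b. (1 + g/8) * M < card {(c, x) : C \<times> X. insert c (insert x z) : H b}} <= {b. (1 + g/8) * M <= card {e:S. b e}}"
 proof
  fix b assume b: "b : {b. (1 + g/8) * M < card {(c, x) : C \<times> X. insert c (insert x z) : H b}}"
  have nz: "c ~: z & x ~: z" if "insert c (insert x z) : T" for c x
  proof -
   have f: "finite z" "card z = k - 2" "card (insert c (insert x z)) = k" using z that by (auto simp: T_def nsets_def)
   thus ?thesis using k3 by (auto simp: card_insert_if split: if_splits)
  qed
  have "card {(c, x) : C \<times> X. insert c (insert x z) : H b} <= card {e:S. b e}"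
  proof (rule card_inj_on_le)
   show "inj_on (%(c, x). insert c (insert x z)) {(c, x) : C \<times> X. insert c (insert x z) : H b}"
   proof (rule inj_onI, clarify)
    fix c x c' x'
    assume h: "insert c (insert x z) : H b" "insert c' (insert x' z) : H b" and m: "c : C" "x : X" "c' : C" "x' : X"
     and eq: "insert c (insert x z) = insert c' (insert x' z)"
    have "insert c (insert x z) - z = {c, x}" "insert c' (insert x' z) - z = {c', x'}" using nz h by (auto simp: H_def)
    hence e: "{c, x} = {c', x'}" using eq by simp
    have "{c, x} Int C = {c}" "{c', x'} Int C = {c'}" "{c, x} Int X = {x}" "{c', x'} Int X = {x'}" using m CX(3) by auto
    thus "c = c' & x = x'" using e by (metis singleton_inject)
   qed
   show "(%(c, x). insert c (insert x z)) ` {(c, x) : C \<times> X. insert c (insert x z) : H b} <= {e:S. b e}" by (auto simp: S_def H_def)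
   show "finite {e:S. b e}" using finT by (simp add: S_def)
  qed
  thus "b : {b. (1 + g/8) * M <= card {e:S. b e}}" using b by simp
 qed
 from prob_mono[OF this] 1 show ?thesis unfolding M_def by linarith
qed

text \<open>The pairs of a in A and y in F that form an edge give at least |A| d / k different edges, as an edge arises from at most k pairs. This is at least four times the expectation.\<close>
lemma spread_tail:
  fixes d :: nat
  assumes A: "A \<subseteq> nsets V (k - 1)" and F: "F \<subseteq> V" and d: "4 * k * p * card F <= d"
  shows "measure_pmf.prob R {b. \<forall>a\<in>A. d <= deg (H b) a F} <= exp (- (real (card A) * d / (2 * k)))"
proof -
 have kr: "real k > 0" using k3 by simp
 define S where "S = (%(a, y). insert y a) ` (A \<times> F) Int T"
 define s where "s = real (card A) * d / k"
 have s0: "s >= 0" by (simp add: s_def)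
 have fF: "finite F" using F finV finite_subset by blast
 have fA: "finite A" using A finite_imp_finite_nsets[OF finV] finite_subset by blast
 have "card S <= card ((%(a, y). insert y a) ` (A \<times> F))" using fA fF by (intro card_mono) (auto simp: S_def)
 also have "... <= card (A \<times> F)" using fA fF by (intro card_image_le) simp
 also have "... = card A * card F" by (rule card_cartesian_product)
 finally have "real (card S) <= real (card A * card F)" by (rule of_nat_mono)
 hence "p * card S <= p * real (card A * card F)" using p by (intro mult_left_mono) auto
 also have "... = card A * (4 * k * p * card F) / (4 * k)" using kr by simp
 also have "... <= card A * real d / (4 * k)" using d kr by (intro divide_right_mono mult_left_mono) auto
 finally have pS: "p * card S <= s / 4" using kr by (simp add: s_def)
 have "exp 1 - 1 <= (2::real)" using exp_le_quadratic[of 1] by simp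
 hence "p * card S * (exp 1 - 1) <= (s / 4) * 2" using pS p s0 by (intro mult_mono) auto
 hence le: "p * card S * (exp 1 - 1) - s <= - (real (card A) * d / (2 * k))"
 proof -
  have "s = 2 * (real (card A) * d / (2 * k))" by (simp add: s_def)
  thus ?thesis using \<open>p * card S * (exp 1 - 1) <= (s / 4) * 2\<close> by linarith
 qed
 have "measure_pmf.prob R {b. s <= 1 * real (card {e:S. b e : {True}})} <= exp (p * card S * (exp 1 - 1) - s)"
  unfolding R_def by (rule chernoff_mgf[OF finT _ bern]) (auto simp: S_def)
 also have "... <= exp (- (real (card A) * d / (2 * k)))" using le by simp
 finally have 1: "measure_pmf.prob R {b. s <= 1 * real (card {e:S. b e : {True}})} <= exp (- (real (card A) * d / (2 * k)))" .
 have "{b. ALL a:A. d <= deg (H b) a F} <= {b. s <= 1 * real (card {e:S. b e : {True}})}"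
 proof
  fix b assume b: "b : {b. ALL a:A. d <= deg (H b) a F}"
  have fS: "finite {e:S. b e}" using finT by (simp add: S_def)
  have fe: "ALL e:{e:S. b e}. finite e" by (auto simp: S_def T_def nsets_def)
  have "card A * d = (\<Sum>a\<in>A. d)" by simp
  also have "... <= (\<Sum>a\<in>A. deg (H b) a F)" using b by (intro sum_mono) auto
  also have "... = card (SIGMA a:A. {y : F. insert y a : H b})" using fA fF by (simp add: deg_def)
  also have "... <= card (SIGMA e:{e:S. b e}. e)"
  proof (rule card_inj_on_le)
   show "inj_on (%(a, y). (insert y a, y)) (SIGMA a:A. {y : F. insert y a : H b})"
   proof (rule inj_onI)
    let ?f = "%(a, y). (insert y a, y)"
    fix s t assume st: "s : (SIGMA a:A. {y : F. insert y a : H b})" "t : (SIGMA a:A. {y : F. insert y a : H b})" "?f s = ?f t"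
    obtain a y a' y' where e: "s = (a, y)" "t = (a', y')" by (metis surj_pair)
    have h: "a : A" "a' : A" "insert y a : H b" "insert y' a' : H b" "insert y a = insert y' a'" "y = y'" using st e by auto
    hence "y ~: a" "y' ~: a'" using insert_edge A by (auto simp: H_def)
    hence "a = a'" using h(5,6) by (metis insert_ident)
    thus "s = t" using e h(6) by simp
   qed
   show "(%(a, y). (insert y a, y)) ` (SIGMA a:A. {y : F. insert y a : H b}) <= (SIGMA e:{e:S. b e}. e)" by (auto simp: S_def H_def)
   show "finite (SIGMA e:{e:S. b e}. e)" using fS fe by (intro finite_SigmaI) auto
  qed
  also have "... = (\<Sum>e\<in>{e:S. b e}. card e)" by (rule card_SigmaI[OF fS fe])
  also have "... = (\<Sum>e\<in>{e:S. b e}. k)" by (intro sum.cong) (auto simp: S_def T_def nsets_def)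
  finally have "card A * d <= card {e:S. b e} * k" by simp
  hence "real (card A * d) <= real (card {e:S. b e} * k)" by (rule of_nat_mono)
  thus "b : {b. s <= 1 * real (card {e:S. b e : {True}})}" using kr by (simp add: s_def divide_le_eq)
 qed
 from prob_mono[OF this] 1 show ?thesis by linarith
qed

definition typical :: "'a set set => bool" where
  "typical G \<longleftrightarrow> pseudorandom V k p L g G & (\<forall>a\<in>nsets V (k - 1). deg G a V <= 2 * p * card V)"

text \<open>The real bound d in spread may be replaced by the least degree that occurs, a natural number at most |V|, so finitely many events cover all failures.\<close>
lemma typical_if:
  fixes b
  assumes 1: "!!a. a : nsets V (k - 1) ==> \<not> 2 * p * card V < deg (H b) a V"
    and 2: "!!z C X. z : nsets V (k - 2) ==> C : Pow V ==> X : Pow V ==> C \<inter> X = {} ==>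
       \<not> (1 + g/8) * max (p * card C * card X) (card V * L) < card {(c, x) : C \<times> X. insert c (insert x z) : H b}"
    and 3: "!!A F d. A : Pow (nsets V (k - 1)) ==> F : Pow V - {{}} ==> d : {..card V} ==> 4 * k * p * card F <= d ==> 8 * real k ^ 2 * L <= d ==>
       8 * k * L * card F < card A * d ==> \<not> (\<forall>a\<in>A. d <= deg (H b) a F)"
  shows "typical (H b)"
 unfolding typical_def
proof
 show "ALL a:nsets V (k - 1). deg (H b) a V <= 2 * p * card V" using 1 by (simp add: not_less)
 show "pseudorandom V k p L g (H b)"
 proof
  fix A F and d :: real
  assume a: "A <= nsets V (k - 1)" "F <= V" "!!a. a : A ==> d <= deg (H b) a F" "4 * k * p * card F <= d" "8 * real k ^ 2 * L <= d"
  show "card A * d <= 8 * k * L * card F"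
  proof (rule ccontr)
   assume n: "~ ?thesis"
   have fF: "finite F" using a(2) finV finite_subset by blast
   have fA: "finite A" using a(1) finite_imp_finite_nsets[OF finV] finite_subset by blast
   have "8 * k * L * card F >= 0" using L1 by simp
   hence A: "A ~= {}" using n by auto
   have "8 * real k ^ 2 * L > 0" using L1 k3 by simp
   hence d0: "d > 0" using a(5) by linarith
   define m where "m = Min ((%a. deg (H b) a F) ` A)"
   have mA: "m <= deg (H b) a F" if "a : A" for a unfolding m_def using fA that by (intro Min_le) auto
   have "m : (%a. deg (H b) a F) ` A" unfolding m_def using fA A by (intro Min_in) auto
   then obtain a0 where a0: "a0 : A" "m = deg (H b) a0 F" by blast
   have dm: "d <= m" using a(3)[OF a0(1)] a0(2) by simp
   have mF: "m <= card F" unfolding a0(2) deg_def using fF by (intro card_mono) auto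
   have F0: "F ~= {}" using mF dm d0 by auto
   have "card F <= card V" using a(2) finV by (intro card_mono)
   hence "m : {..card V}" using mF by simp
   moreover have "8 * k * L * card F < card A * m"
   proof -
    have "card A * d <= card A * real m" using dm by (intro mult_left_mono) auto
    thus ?thesis using n by simp
   qed
   ultimately show False using 3[of A F m] a F0 dm mA by (auto simp: not_le)
  qed
 next
  fix z C X assume "z : nsets V (k - 2)" "C <= V" "X <= V" "C Int X = {}"
  thus "card {(c, x) : C \<times> X. insert c (insert x z) : H b} <= (1 + g/8) * max (p * card C * card X) (card V * L)" using 2[of z C X] by (simp add: not_less)
 qed (use finV k3 p L1 g in \<open>auto simp: H_def T_def\<close>)
qed

lemma bad_degree:
  assumes "4 * k * ln (card V) <= p * card V" "card V >= 1"
  shows "measure_pmf.prob R {b. \<exists>a\<in>nsets V (k - 1). b : {b. 2 * p * card V < deg (H b) a V}} <= 1 / card V"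
proof -
 define n where "n = real (card V)"
 have n1: "n >= 1" using assms(2) by (simp add: n_def)
 have "measure_pmf.prob R {b. EX a:nsets V (k - 1). b : {b. 2 * p * card V < deg (H b) a V}} <= (\<Sum>a\<in>nsets V (k - 1). measure_pmf.prob R {b. 2 * p * card V < deg (H b) a V})"
  by (rule pmf_union_bound) (rule finite_imp_finite_nsets[OF finV])
 also have "... <= (\<Sum>a\<in>nsets V (k - 1). exp (- (p * n / 4)))" unfolding n_def by (intro sum_mono degree_tail)
 also have "... = card (nsets V (k - 1)) * exp (- (p * n / 4))" by simp
 also have "... <= n ^ (k - 1) * exp (- (k * ln n))"
 proof (rule mult_mono)
  show "real (card (nsets V (k - 1))) <= n ^ (k - 1)" unfolding n_def by (rule card_nsets_le[OF finV])
  show "exp (- (p * n / 4)) <= exp (- (k * ln n))" using assms(1) by (simp add: n_def)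
 qed (use n1 in auto)
 also have "... = 1 / n"
 proof -
  have "exp (- (k * ln n)) = 1 / n ^ k" using n1 by (simp add: exp_minus exp_of_nat_mult inverse_eq_divide)
  moreover have "n ^ k = n ^ (k - 1) * n" using k3 by (metis Suc_diff_1 less_le_trans power_Suc2 zero_less_numeral)
  ultimately show ?thesis using n1 by simp
 qed
 finally show ?thesis by (simp add: n_def)
qed

lemma bad_mixing:
  assumes "2 + 2 * real k <= (g/8)^2 * L / 4" "card V >= 1"
  shows "measure_pmf.prob R {b. \<exists>t\<in>nsets V (k - 2) \<times> {(C, X) : Pow V \<times> Pow V. C \<inter> X = {}}.
      b : (case t of (z, C, X) => {b. (1 + g/8) * max (p * card C * card X) (card V * L) < card {(c, x) : C \<times> X. insert c (insert x z) : H b}})} <= 1 / card V" (is "measure_pmf.prob R {b. \<exists>t\<in>?I. b : ?B t} <= _")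
proof -
 define n where "n = real (card V)"
 have n1: "n >= 1" using assms(2) by (simp add: n_def)
 have finI: "finite ?I" by (rule finite_subset[of _ "nsets V (k - 2) \<times> Pow V \<times> Pow V"]) (use finV finite_imp_finite_nsets[OF finV] in auto)
 have en: "n <= exp n" using exp_ge_add_one_self[of n] by linarith
 have cI: "card ?I <= n ^ (k - 2) * exp (2 * n)"
 proof -
  have "card ?I <= card (nsets V (k - 2) \<times> Pow V \<times> Pow V)" by (intro card_mono) (use finV finite_imp_finite_nsets[OF finV] in auto)
  also have "... = card (nsets V (k - 2)) * (2 ^ card V * 2 ^ card V)" using finV by (simp add: card_cartesian_product card_Pow)
  finally have "real (card ?I) <= real (card (nsets V (k - 2)) * (2 ^ card V * 2 ^ card V))" by (rule of_nat_mono)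
  also have "... = real (card (nsets V (k - 2))) * (2 ^ card V * 2 ^ card V)" by simp
  also have "... <= n ^ (k - 2) * exp (2 * n)"
  proof (rule mult_mono)
   show "real (card (nsets V (k - 2))) <= n ^ (k - 2)" unfolding n_def by (rule card_nsets_le[OF finV])
   have "(2::real) ^ card V <= exp 1 ^ card V" using exp_ge_add_one_self[of 1] by (intro power_mono) auto
   also have "... = exp n" by (simp add: n_def exp_of_nat_mult[symmetric])
   finally have "(2::real) ^ card V * 2 ^ card V <= exp n * exp n" by (intro mult_mono) auto
   thus "(2::real) ^ card V * 2 ^ card V <= exp (2 * n)" by (simp add: exp_add[symmetric])
  qed (use n1 in auto)
  finally show ?thesis .
 qed
 have "measure_pmf.prob R {b. EX t:?I. b : ?B t} <= (\<Sum>t\<in>?I. measure_pmf.prob R (?B t))" by (rule pmf_union_bound[OF finI])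
 also have "... <= (\<Sum>t\<in>?I. exp (- ((g/8)^2 * (n * L) / 4)))" by (rule sum_mono) (use mixing_tail in \<open>auto simp: n_def\<close>)
 also have "... = card ?I * exp (- ((g/8)^2 * (n * L) / 4))" by simp
 also have "... <= (n ^ (k - 2) * exp (2 * n)) * exp (- ((2 + 2 * real k) * n))"
 proof (rule mult_mono[OF cI])
  have "(2 + 2 * real k) * n <= ((g/8)^2 * L / 4) * n" using assms(1) n1 by (intro mult_right_mono) auto
  thus "exp (- ((g/8)^2 * (n * L) / 4)) <= exp (- ((2 + 2 * real k) * n))" by (simp add: mult_ac)
 qed (use n1 in auto)
 also have "... = n ^ (k - 2) * exp (- (2 * k * n))" by (simp add: mult.assoc exp_add[symmetric] algebra_simps)
 also have "... <= exp n ^ k * exp (- (2 * k * n))"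
 proof (rule mult_right_mono)
  have "n ^ (k - 2) <= n ^ k" using n1 by (intro power_increasing) auto
  also have "... <= exp n ^ k" using en n1 by (intro power_mono) auto
  finally show "n ^ (k - 2) <= exp n ^ k" .
 qed simp
 also have "... = exp (- (k * n))" by (simp add: exp_of_nat_mult[symmetric] exp_add[symmetric])
 also have "... <= exp (- n)" using k3 n1 by simp
 also have "... <= 1 / n" using en n1 by (simp add: exp_minus inverse_eq_divide divide_left_mono)
 finally show ?thesis by (simp add: n_def)
qed

text \<open>The bound of spread_tail splits evenly into a factor exponentially small in |A| and one exponentially small in |F|, so the sum over all A and F factorises.\<close>
lemma bad_spread:
  assumes L: "2 * ln (card V) <= L" and n0: "card V >= 1"
  shows "measure_pmf.prob R {b. \<exists>t\<in>{(A, F, d) : Pow (nsets V (k - 1)) \<times> (Pow V - {{}}) \<times> {..card V}. 4 * k * p * card F <= d & 8 * real k ^ 2 * L <= d & 8 * k * L * card F < card A * d}.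
      b : (case t of (A, F, d) => {b. \<forall>a\<in>A. d <= deg (H b) a F})} <= 12 / card V" (is "measure_pmf.prob R {b. \<exists>t\<in>?I. b : ?B t} <= _")
proof -
 define n where "n = real (card V)"
 have n1: "n >= 1" using n0 by (simp add: n_def)
 define x where "x = exp (- (2 * k * L))"
 define y where "y = exp (- (2 * L))"
 let ?N = "nsets V (k - 1)"
 let ?J = "Pow ?N \<times> (Pow V - {{}}) \<times> {..card V}"
 have fN: "finite ?N" by (rule finite_imp_finite_nsets[OF finV])
 have finJ: "finite ?J" using fN finV by simp
 have IJ: "?I <= ?J" by auto
 have finI: "finite ?I" by (rule finite_subset[OF IJ finJ])
 have kr: "real k > 0" using k3 by simp
 have "measure_pmf.prob R {b. EX t:?I. b : ?B t} <= (\<Sum>t\<in>?I. measure_pmf.prob R (?B t))" by (rule pmf_union_bound[OF finI])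
 also have "... <= (\<Sum>t\<in>?I. case t of (A, F, d) => x ^ card A * y ^ card F)"
 proof (rule sum_mono)
  fix t assume "t : ?I"
  then obtain A F d where t: "t = (A, F, d)" "A <= ?N" "F <= V" "4 * k * p * card F <= real d" "8 * real k ^ 2 * L <= real d" "8 * k * L * card F < card A * real d" by auto
  have "measure_pmf.prob R (?B t) <= exp (- (real (card A) * d / (2 * k)))" using spread_tail[OF t(2,3,4)] by (simp add: t(1))
  also have "... <= exp (- (2 * k * L * card A + 2 * L * card F))"
  proof -
   have "(2 * k * L * card A + 2 * L * card F) * (4 * k) = card A * (8 * real k ^ 2 * L) + 8 * k * L * card F" by (simp add: power2_eq_square algebra_simps)
   also have "... <= card A * real d + card A * real d" using t(5,6) by (intro add_mono mult_left_mono) auto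
   also have "... = (card A * real d / (2 * k)) * (4 * k)" using kr by simp
   finally have "2 * k * L * card A + 2 * L * card F <= card A * real d / (2 * k)" by (rule mult_right_le_imp_le) (use kr in simp)
   thus ?thesis by simp
  qed
  also have "... = x ^ card A * y ^ card F" by (simp add: x_def y_def exp_of_nat_mult[symmetric] exp_add[symmetric] algebra_simps)
  finally show "measure_pmf.prob R (?B t) <= (case t of (A, F, d) => x ^ card A * y ^ card F)" by (simp add: t(1))
 qed
 also have "... <= (\<Sum>t\<in>?J. case t of (A, F, d) => x ^ card A * y ^ card F)" using finJ IJ by (intro sum_mono2) (auto simp: x_def y_def)
 also have "... = (\<Sum>A\<in>Pow ?N. x ^ card A) * ((\<Sum>F\<in>Pow V - {{}}. y ^ card F) * (n + 1))"
  unfolding sum_distrib_right[of "%F. y ^ card F"] sum_product by (simp add: sum.cartesian_product[symmetric] n_def mult_ac add.commute)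
 also have "(\<Sum>A\<in>Pow ?N. x ^ card A) = (1 + x) ^ card ?N" by (rule sum_Pow_card[OF fN])
 also have "(\<Sum>F\<in>Pow V - {{}}. y ^ card F) = (1 + y) ^ card V - 1" using finV by (simp add: sum_diff1 sum_Pow_card)
 also have "(1 + x) ^ card ?N * (((1 + y) ^ card V - 1) * (n + 1)) <= 3 * ((2 / n ^ 3) * (n + 1))"
 proof (intro mult_mono)
  have pw: "(1 + u) ^ j <= exp (u * j)" if "u >= 0" for u :: real and j
  proof -
   have "(1 + u) ^ j <= exp u ^ j" using that exp_ge_add_one_self[of u] by (intro power_mono) auto
   thus ?thesis by (simp add: exp_of_nat_mult[symmetric] mult.commute)
  qed
  have y: "y <= 1 / n ^ 4"
  proof -
   have "y <= exp (- (4 * ln n))" using L by (simp add: y_def n_def)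
   also have "... = 1 / n ^ 4" using n1 exp_of_nat_mult[of 4 "ln n"] by (simp add: exp_minus inverse_eq_divide)
   finally show ?thesis .
  qed
  have "x = y ^ k" by (simp add: x_def y_def exp_of_nat_mult[symmetric] mult_ac)
  also have "... <= (1 / n) ^ k"
  proof (rule power_mono)
   have "n ^ 1 <= n ^ 4" using n1 by (intro power_increasing) auto
   hence "1 / n ^ 4 <= 1 / n" using n1 by (intro divide_left_mono) auto
   thus "y <= 1 / n" using y by linarith
  qed (simp add: y_def)
  finally have x: "x <= 1 / n ^ k" by (simp add: power_one_over)
  have x0: "x >= 0" by (simp add: x_def)
  have "x * card ?N <= 1 / n ^ k * n ^ (k - 1)" using x card_nsets_le[OF finV, of "k - 1"] n1 by (intro mult_mono) (auto simp: n_def)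
  also have "... <= 1"
  proof -
   have "n ^ (k - 1) <= n ^ k" using n1 by (intro power_increasing) auto
   thus ?thesis using n1 by (simp add: divide_le_eq)
  qed
  finally have "exp (x * card ?N) <= exp 1" by simp
  moreover have "exp 1 <= (3::real)" using exp_le_quadratic[of 1] by simp
  ultimately show "(1 + x) ^ card ?N <= 3" using pw[of x "card ?N", OF x0] by linarith
  have yn: "y * n <= 1 / n ^ 3"
  proof -
   have "y * n <= 1 / n ^ 4 * n" using y n1 by (intro mult_right_mono) auto
   also have "... = 1 / n ^ 3" using n1 by (simp add: power_eq_if)
   finally show ?thesis .
  qed
  have n31: "1 / n ^ 3 <= 1" using n1 by simp
  have yn0: "y * n >= 0" using n1 by (simp add: y_def)
  have "exp (y * n) <= 1 + y * n + (y * n)^2" using yn yn0 n31 by (intro exp_le_quadratic) simp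
  moreover have "(y * n)^2 <= y * n * 1" unfolding power2_eq_square using yn yn0 n31 by (intro mult_left_mono) auto
  ultimately have "exp (y * n) <= 1 + 2 / n ^ 3" using yn by simp
  moreover have "(1 + y) ^ card V <= exp (y * n)" using pw[of y "card V"] by (simp add: y_def n_def)
  ultimately show "(1 + y) ^ card V - 1 <= 2 / n ^ 3" by linarith
  show "0 <= ((1 + y) ^ card V - 1) * (n + 1)" using n1 by (intro mult_nonneg_nonneg) (simp_all add: y_def one_le_power)
 qed (use n1 in auto)
 also have "... = 6 * (n + 1) / n ^ 3" by simp
 also have "... <= 6 * (n + n) / n ^ 2"
 proof (rule frac_le)
  show "n ^ 2 <= n ^ 3" using n1 by (intro power_increasing) auto
 qed (use n1 in auto)
 also have "... = 12 / n" using n1 by (simp add: power2_eq_square)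
 finally show ?thesis by (simp add: n_def)
qed

lemma random_typical:
  assumes "4 * k * ln (card V) <= p * card V" "2 + 2 * real k <= (g/8)^2 * L / 4" "2 * ln (card V) <= L" "card V >= 1"
  shows "1 - 14 / card V <= measure_pmf.prob R {b. typical (H b)}"
proof -
 let ?D = "{b. EX a:nsets V (k - 1). b : {b. 2 * p * card V < deg (H b) a V}}"
 let ?M = "{b. EX t:nsets V (k - 2) \<times> {(C, X) : Pow V \<times> Pow V. C Int X = {}}.
   b : (case t of (z, C, X) => {b. (1 + g/8) * max (p * card C * card X) (card V * L) < card {(c, x) : C \<times> X. insert c (insert x z) : H b}})}"
 let ?S = "{b. EX t:{(A, F, d) : Pow (nsets V (k - 1)) \<times> (Pow V - {{}}) \<times> {..card V}. 4 * k * p * card F <= d & 8 * real k ^ 2 * L <= d & 8 * k * L * card F < card A * d}.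
   b : (case t of (A, F, d) => {b. ALL a:A. d <= deg (H b) a F})}"
 have "- {b. typical (H b)} <= ?D Un (?M Un ?S)"
 proof
  fix b assume b: "b : - {b. typical (H b)}"
  show "b : ?D Un (?M Un ?S)"
  proof (rule ccontr)
   assume n: "b ~: ?D Un (?M Un ?S)"
   have "typical (H b)"
   proof (rule typical_if)
    show "~ 2 * p * card V < deg (H b) a V" if "a : nsets V (k - 1)" for a using n that by blast
    show "~ (1 + g/8) * max (p * card C * card X) (card V * L) < card {(c, x) : C \<times> X. insert c (insert x z) : H b}"
     if "z : nsets V (k - 2)" "C : Pow V" "X : Pow V" "C Int X = {}" for z C X
    proof
     assume a: "(1 + g/8) * max (p * card C * card X) (card V * L) < card {(c, x) : C \<times> X. insert c (insert x z) : H b}"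
     have "b : ?M" by (rule CollectI, rule bexI[of _ "(z, C, X)"]) (use a that in auto)
     thus False using n by blast
    qed
    show "~ (ALL a:A. d <= deg (H b) a F)" if "A : Pow (nsets V (k - 1))" "F : Pow V - {{}}" "d : {..card V}" "4 * k * p * card F <= d" "8 * real k ^ 2 * L <= d"
      "8 * k * L * card F < card A * d" for A F and d :: nat
    proof
     assume a: "ALL a:A. d <= deg (H b) a F"
     have "b : ?S" by (rule CollectI, rule bexI[of _ "(A, F, d)"]) (use a that in auto)
     thus False using n by blast
    qed
   qed
   thus False using b by simp
  qed
 qed
 from prob_mono[OF this] have "measure_pmf.prob R (- {b. typical (H b)}) <= measure_pmf.prob R (?D Un (?M Un ?S))" .
 also have "... <= measure_pmf.prob R ?D + measure_pmf.prob R (?M Un ?S)" by (rule measure_Un_le) auto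
 also have "measure_pmf.prob R (?M Un ?S) <= measure_pmf.prob R ?M + measure_pmf.prob R ?S" by (rule measure_Un_le) auto
 finally have 1: "measure_pmf.prob R (- {b. typical (H b)}) <= measure_pmf.prob R ?D + (measure_pmf.prob R ?M + measure_pmf.prob R ?S)" by linarith
 have "measure_pmf.prob R (- {b. typical (H b)}) = 1 - measure_pmf.prob R {b. typical (H b)}" using measure_pmf.prob_compl[of "{b. typical (H b)}" R] by (simp add: Compl_eq_Diff_UNIV)
 hence 2: "measure_pmf.prob R {b. typical (H b)} = 1 - measure_pmf.prob R (- {b. typical (H b)})" by linarith
 have "1 / real (card V) + (1 / card V + 12 / card V) = 14 / card V" by (simp add: add_divide_distrib[symmetric])
 thus ?thesis using 1 2 bad_degree[OF assms(1,4)] bad_mixing[OF assms(2,4)] bad_spread[OF assms(3,4)] by linarith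
qed

end

section \<open>The choice of parameters\<close>

context host begin

text \<open>Unions of consecutive runs of colour classes are fair again, with sizes added.\<close>
lemma block_partition:
  fixes s :: "nat => nat" and N :: real
  assumes X: "!!i. i < Q ==> fair N (X i)" "!!i j. i < Q ==> j < Q ==> i ~= j ==> X i \<inter> X j = {}"
    and s: "!!j. j < J ==> s j < s (Suc j)" "s J <= Q"
  defines "W \<equiv> %j. \<Union>i\<in>{s j..<s (Suc j)}. X i"
  shows "!!j. j < J ==> fair (real (s (Suc j) - s j) * N) (W j)"
    and "!!i j. i < J ==> j < J ==> i ~= j ==> W i \<inter> W j = {}"
proof -
 have mono: "s i <= s j" if "i <= j" "j <= J" for i j using that
 proof (induction rule: dec_induct)
  case (step j)
  thus ?case using s(1)[of j] by simp
 qed simp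
 have lt: "i < Q" if "j < J" "i : {s j..<s (Suc j)}" for i j using mono[of "Suc j" J] that s(2) by simp
 show "fair (real (s (Suc j) - s j) * N) (W j)" if j: "j < J" for j
 proof -
  have "fair (card {s j..<s (Suc j)} * N) (\<Union>i\<in>{s j..<s (Suc j)}. X i)"
  proof (rule fair_Union)
   show "{s j..<s (Suc j)} ~= {}" using s(1)[OF j] by simp
   show "fair N (X i)" if "i : {s j..<s (Suc j)}" for i using X(1) lt[OF j that] .
   show "X i Int X i' = {}" if "i : {s j..<s (Suc j)}" "i' : {s j..<s (Suc j)}" "i ~= i'" for i i' using X(2)[OF lt[OF j that(1)] lt[OF j that(2)] that(3)] .
  qed simp
  thus ?thesis by (simp add: W_def)
 qed
 show "W i Int W j = {}" if ij: "i < J" "j < J" "i ~= j" for i j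
 proof -
  have "X a Int X b = {}" if ab: "a : {s i..<s (Suc i)}" "b : {s j..<s (Suc j)}" for a b
  proof (rule X(2)[OF lt[OF ij(1) ab(1)] lt[OF ij(2) ab(2)]])
   show "a ~= b"
   proof (cases "i < j")
    case True thus ?thesis using mono[of "Suc i" j] ij ab by simp
   next
    case False thus ?thesis using mono[of "Suc j" i] ij ab by simp
   qed
  qed
  thus ?thesis unfolding W_def by blast
 qed
qed

text \<open>All sizes are polynomials in l, where l is a small power of n: there are l^6 colours, the large parts consist of l^4 colours each and the small parts of one. The path length, the number of rounds and the error term L are all equal to l, which dominates any multiple of ln n. The covering uses paths of length k l^8 and leaves at most n / l^8 vertices. With t = n / l^9 and p t at least l^11, every condition becomes a comparison of powers of l.\<close>
lemma hamilton_cycle_of_min_degree: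
  fixes l :: nat
  assumes L: "L = real l" and p1: "p <= 1" and big: "20000 * real k ^ 3 <= g * eta0 g k * l"
    and pn: "real l ^ 20 <= p * card V"
    and A1: "4 * real (card V) * l < 2 ^ l" and A2: "2 * real k * (2 * real (card V)) ^ (k - 1) < (1 + eta0 g k) ^ l"
    and A3: "6 * real (card V) ^ k * real l ^ 6 < exp (g^2 / 512 * l)"
    and degE: "!!a. a : nsets V (k - 1) ==> (1/2 + 2 * g) * p * card V <= deg E a V"
    and degG: "!!a. a : nsets V (k - 1) ==> deg G a V <= 2 * p * card V"
  shows "\<exists>vs. distinct vs & set vs = V & (\<forall>i<length vs. set (take k (rotate i vs)) : E)"
proof -
 define n where "n = real (card V)"
 define x where "x = real l"
 define kk where "kk = real k"
 define et where "et = eta0 g k"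
 have kk: "kk >= 3" using k3 by (simp add: kk_def)
 have et: "0 < et" "et <= 1" using eta0_bounds[of k g] k3 g0 g1 by (auto simp: et_def)
 have xge: "20000 * kk ^ 3 <= g * et * x" using big by (simp add: kk_def et_def x_def)
 have k30: "kk ^ 3 > 0" using kk by simp
 have x0: "x > 0"
 proof (rule ccontr)
  assume "~ x > 0"
  hence "x = 0" by (simp add: x_def)
  thus False using xge k30 by simp
 qed
 have xg: "20000 * kk ^ 3 <= g * x"
 proof -
  have "g * x * et <= g * x * 1" using et g0 x0 by (intro mult_left_mono) auto
  thus ?thesis using xge by (simp add: mult_ac)
 qed
 have xb: "20000 * kk ^ 3 <= x"
 proof -
  have "g * x <= 1 * x" using g1 x0 by (intro mult_right_mono) auto
  thus ?thesis using xg by simp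
 qed
 have k23: "kk ^ 2 <= kk ^ 3" "kk <= kk ^ 2" "kk <= kk ^ 3" "1 <= kk ^ 2"
 proof -
  show "kk ^ 2 <= kk ^ 3" using kk by (intro power_increasing) auto
  have "kk ^ 1 <= kk ^ 2" using kk by (intro power_increasing) auto
  thus "kk <= kk ^ 2" by simp
  have "kk ^ 1 <= kk ^ 3" using kk by (intro power_increasing) auto
  thus "kk <= kk ^ 3" by simp
  show "1 <= kk ^ 2" using kk by (intro one_le_power) simp
 qed
 have xb2: "20000 * kk ^ 2 <= x" "20000 * kk <= x" "20000 <= x" "x >= 1" using xb k23 kk by linarith+
 have up: "c * x ^ j <= x ^ Suc j" if "c <= x" for c j using that x0 by (simp add: mult_right_mono)
 have px: "x ^ i <= x ^ j" if "i <= j" for i j using that xb2(4) by (rule power_increasing)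
 define t where "t = n / x ^ 9"
 have nt: "n = t * x ^ 9" using x0 by (simp add: t_def)
 have pn': "x ^ 20 <= p * n" using pn by (simp add: x_def n_def)
 have pt: "x ^ 11 <= p * t"
 proof -
  have "x ^ 11 * x ^ 9 <= (p * t) * x ^ 9" using pn' by (simp add: nt power_add[symmetric] mult_ac)
  thus ?thesis by (rule mult_right_le_imp_le) (use x0 in simp)
 qed
 have t0: "t >= 0" using x0 by (simp add: t_def n_def)
 have tx: "x ^ 11 <= t"
 proof -
  have "p * t <= 1 * t" using p1 t0 by (intro mult_right_mono) auto
  thus ?thesis using pt by simp
 qed
 have x11: "x ^ j <= x ^ 11" if "j <= 11" for j using px that .
 have t1: "t >= 20000" using tx x11[of 1] xb2 by simp
 have l1: "l >= 1" using x0 by (simp add: x_def)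
 define Q where "Q = l ^ 6"
 define m where "m = 2 * k * l"
 define m0 where "m0 = nat \<lfloor>t * x\<rfloor>"
 define b where "b = nat \<lfloor>t\<rfloor>"
 have m0: "real m0 <= t * x" "t * x - 1 <= real m0" "t * x / 2 <= real m0"
 proof -
  have "t * x >= 20000 * 1" using t1 xb2 by (intro mult_mono) auto
  thus "real m0 <= t * x" "t * x - 1 <= real m0" "t * x / 2 <= real m0" unfolding m0_def by linarith+
 qed
 have b: "real b <= t" "t / 2 <= real b" using t1 unfolding b_def by linarith+
 define N1 where "N1 = n / Q"
 have Qx: "real Q = x ^ 6" by (simp add: Q_def x_def)
 have N1: "N1 = t * x ^ 3" using x0 by (simp add: N1_def Qx nt power_eq_if)
 \<comment> \<open>The failure probability is at most 6 n^k l^6 exp (- g^2 l / 512).\<close>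
 have "EX X. (ALL i<Q. fair (card V / Q) (X i)) & (ALL i<Q. ALL j<Q. i ~= j --> X i Int X j = {})"
 proof (rule fair_partition[OF degE degG _ p1])
  show "Q >= 1" using l1 by (simp add: Q_def)
  have n1: "n >= 1"
  proof -
   have "p * n <= 1 * n" using p1 by (intro mult_right_mono) (auto simp: n_def)
   thus ?thesis using pn' px[of 0 20] by simp
  qed
  have "real (card (nsets V (k - 1))) <= n ^ (k - 1)" unfolding n_def by (rule card_nsets_le[OF finV])
  also have "... <= n ^ k" using n1 by (intro power_increasing) auto
  finally have c: "2 * real (card (nsets V (k - 1))) + 1 <= 3 * n ^ k" using one_le_power[OF n1, of k] by linarith
  have "x ^ 14 <= p * n / x ^ 6"
  proof -
   have "x ^ 14 * x ^ 6 <= p * n" using pn' by (simp add: power_add[symmetric])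
   thus ?thesis using x0 by (simp add: le_divide_eq)
  qed
  hence "x <= p * n / x ^ 6" using px[of 1 14] by simp
  hence "g^2 / 512 * x <= g^2 / 512 * (p * n / x ^ 6)" by (intro mult_left_mono) auto
  hence e: "exp (- ((g/8)^2 * (p * n / 2 / Q) / 4)) <= exp (- (g^2 / 512 * x))" by (simp add: Qx power_divide)
  have "2 * real Q * (2 * card (nsets V (k - 1)) + 1) * exp (- ((g/8)^2 * (p * n / 2 / Q) / 4)) <= 2 * real Q * (3 * n ^ k) * exp (- (g^2 / 512 * x))"
   using c e by (intro mult_mono mult_left_mono) auto
  also have "... = (6 * n ^ k * x ^ 6) / exp (g^2 / 512 * x)"
   unfolding Qx exp_minus divide_inverse[of _ "exp _"] by (simp only: mult_ac)
  also have "... < 1" using A3 by (simp add: n_def x_def)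
  finally show "2 * real Q * (2 * card (nsets V (k - 1)) + 1) * exp (- ((g/8)^2 * (p * card V / 2 / Q) / 4)) < 1" by (simp add: n_def)
 qed
 then obtain X where X: "!!i. i < Q ==> fair N1 (X i)" "!!i j. i < Q ==> j < Q ==> i ~= j ==> X i Int X j = {}"
  unfolding N1_def n_def by blast
 define s where "s j = (if j <= 4 * m then j * l ^ 4 else if j <= 5 * m + 1 then 4 * m * l ^ 4 + (j - 4 * m) else 4 * m * l ^ 4 + m + 1 + l ^ 2)" for j
 have l4: "l ^ 4 >= 1" "l ^ 2 >= 1" using l1 by (auto intro: one_le_power)
 have sd: "s (Suc j) = s j + (if j < 4 * m then l ^ 4 else if j <= 5 * m then 1 else l ^ 2)" if j: "j < 5 * m + 2" for j
 proof -
  consider "Suc j <= 4 * m" | "j = 4 * m" | "4 * m < j" "j <= 5 * m" | "j = 5 * m + 1" using j by atomize_elim linarith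
  thus ?thesis
  proof cases
   case 3
   hence "Suc j - 4 * m = Suc (j - 4 * m)" by linarith
   thus ?thesis using 3 by (simp add: s_def)
  qed (auto simp: s_def)
 qed
 have sJ: "s (5 * m + 2) <= Q"
 proof -
  have "real (s (5 * m + 2)) = 8 * kk * x ^ 5 + 2 * kk * x + 1 + x ^ 2" by (simp add: s_def m_def kk_def x_def power_eq_if)
  moreover have "16 * kk * x ^ 5 <= x ^ 6" using up[of "16 * kk" 5] xb2 kk by simp
  moreover have "2 * kk * x ^ 1 <= x ^ 2" using up[of "2 * kk" 1] xb2 kk by (simp add: numeral_2_eq_2)
  moreover have "20000 * x ^ 5 <= x ^ 6" using up[of 20000 5] xb2 by simp
  moreover have "x ^ 2 <= x ^ 5" "1 <= x ^ 5" using px[of 2 5] px[of 0 5] by simp_all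
  ultimately have "real (s (5 * m + 2)) <= real Q" unfolding Qx by simp
  thus ?thesis by simp
 qed
 define W where "W j = (\<Union>i\<in>{s j..<s (Suc j)}. X i)" for j
 have smono: "s j < s (Suc j)" if "j < 5 * m + 2" for j using sd[OF that] l1 by simp
 have fW: "fair (real (s (Suc j) - s j) * N1) (W j)" if "j < 5 * m + 2" for j
  unfolding W_def
 proof (rule block_partition(1)[where Q = Q and J = "5 * m + 2"])
  show "fair N1 (X i)" if "i < Q" for i by (rule X(1)[OF that])
  show "X i Int X j = {}" if "i < Q" "j < Q" "i ~= j" for i j by (rule X(2)[OF that])
  show "s j < s (Suc j)" if "j < 5 * m + 2" for j by (rule smono[OF that])
 qed (rule sJ, rule that)
 have Wd: "W i Int W j = {}" if "i < 5 * m + 2" "j < 5 * m + 2" "i ~= j" for i j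
  unfolding W_def
 proof (rule block_partition(2)[where Q = Q and J = "5 * m + 2"])
  show "fair N1 (X i)" if "i < Q" for i by (rule X(1)[OF that])
  show "X i Int X j = {}" if "i < Q" "j < Q" "i ~= j" for i j by (rule X(2)[OF that])
  show "s j < s (Suc j)" if "j < 5 * m + 2" for j by (rule smono[OF that])
 qed (rule sJ, fact+)
 define N where "N = x ^ 4 * N1"
 have Nt: "N = t * x ^ 7" by (simp add: N_def N1 power_add[symmetric] mult_ac)
 have W1: "fair N (W j)" if "j < 4 * m" for j using fW[of j] sd[of j] that by (simp add: N_def x_def)
 have W2: "fair N1 (W j)" if "4 * m <= j" "j <= 5 * m" for j using fW[of j] sd[of j] that by simp
 have W3: "fair (x ^ 2 * N1) (W (5 * m + 1))" using fW[of "5 * m + 1"] sd[of "5 * m + 1"] by (simp add: x_def)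
 have WV: "W j <= V" if "j < 5 * m + 2" for j using fW[OF that] by (simp add: fair_def)
 \<comment> \<open>The block boundaries s make the parts 0 to 4m-1 large, the next m+1 parts single colours, and the last part l^2 colours.\<close>
 define R where "R = (\<Union>j\<in>{4*m..5*m}. W j)"
 have N10: "N1 > 0" using t1 x0 by (simp add: N1)
 have cR: "real (card R) <= 6 * kk * t * x ^ 4"
 proof -
  have "card R <= (\<Sum>j\<in>{4*m..5*m}. card (W j))" unfolding R_def by (rule card_UN_le) simp
  hence "real (card R) <= (\<Sum>j\<in>{4*m..5*m}. real (card (W j)))" by (metis of_nat_mono of_nat_sum)
  also have "... <= (\<Sum>j\<in>{4*m..5*m}. 2 * N1)"
  proof (rule sum_mono)
   fix j assume "j : {4*m..5*m}"
   hence "card (W j) <= (1 + g/8) * N1" using W2[of j] by (simp add: fair_def)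
   also have "... <= 2 * N1" using g1 N10 by (intro mult_right_mono) auto
   finally show "card (W j) <= 2 * N1" .
  qed
  also have "... = (real m + 1) * (2 * N1)" by simp
  also have "... <= (3 * kk * x) * (2 * N1)"
  proof (rule mult_right_mono)
   have "1 * 1 <= kk * x" using kk xb2 by (intro mult_mono) auto
   thus "real m + 1 <= 3 * kk * x" by (simp add: m_def kk_def x_def)
  qed (use N10 in simp)
  also have "... = 6 * kk * t * x ^ 4" by (simp add: N1 power_eq_if)
  finally show ?thesis .
 qed
 define c where "c = 2 * (k + l)"
 have c: "real c <= 4 * x" "real c >= 0" using xb2 kk by (simp_all add: c_def x_def kk_def)
 have RV: "R <= V" unfolding R_def by (rule UN_least) (use WV in auto)
 have cRn: "real (card R) <= n" using RV finV by (simp add: n_def card_mono)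
 have scale: "scale N' l" if N': "N' = t * x ^ j" "3 <= j" "j <= 9" for N' j
  unfolding scale_def
 proof (intro conjI)
  show N'0: "N' > 0" using t1 x0 N' by simp
  have j3: "x ^ 3 <= x ^ j" using px N' by simp
  have N'n: "N' <= n" unfolding nt N'(1) using t0 px[of j 9] N' by (intro mult_left_mono) auto
  have "2 * N' <= 2 * n" using N'n by simp
  hence "(2 * N') ^ (k - 1) <= (2 * n) ^ (k - 1)" using N'0 by (intro power_mono) auto
  hence "2 * real k * (2 * N') ^ (k - 1) <= 2 * real k * (2 * n) ^ (k - 1)" by (intro mult_left_mono) auto
  thus "2 * real k * (2 * N') ^ (k - 1) < (1 + eta0 g k) ^ l" using A2 by (simp add: n_def)
  have pN: "x ^ 14 <= p * N'"
  proof -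
   have "x ^ 11 * x ^ 3 <= (p * t) * x ^ j" using pt j3 x0 p0 t0 by (intro mult_mono) auto
   thus ?thesis by (simp add: N'(1) power_add[symmetric] mult.assoc)
  qed
  have "256 * real k ^ 3 * L * (k + l) <= 256 * kk ^ 3 * x * (2 * x)" using xb2 kk by (intro mult_mono) (auto simp: kk_def L x_def)
  also have "... = 512 * kk ^ 3 * x ^ 2" by (simp add: power2_eq_square)
  also have "... <= (g * et * x) * x ^ 2"
  proof (rule mult_right_mono)
   show "512 * kk ^ 3 <= g * et * x" using xge k30 by linarith
  qed simp
  also have "... = g * et * x ^ 3" by (simp add: power_eq_if)
  also have "... <= g * et * (p * N')" using pN px[of 3 14] et g0 by (intro mult_left_mono) auto
  finally show "256 * real k ^ 3 * L * real (k + l) <= g * eta0 g k * p * N'" by (simp add: et_def mult_ac)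
  have e1: "1 <= et * x"
  proof -
   have "g * (et * x) <= 1 * (et * x)" using g1 et x0 by (intro mult_right_mono) auto
   thus ?thesis using xge k23 by (simp add: mult_ac)
  qed
  have "L * card V = x * n" by (simp add: L x_def n_def)
  also have "... = t * (1 * x ^ 10)" by (simp add: nt power_eq_if)
  also have "... <= t * ((et * x) * x ^ 10)" using e1 t0 x0 by (intro mult_left_mono mult_right_mono) auto
  also have "... = t * et * x ^ 11" by (simp add: power_eq_if)
  also have "... <= t * et * (p * N' * x ^ 3)"
  proof (rule mult_left_mono)
   have "x ^ 11 * 1 <= (p * N') * x ^ 3" using pN px[of 11 14] px[of 0 3] x0 p0 N'0 by (intro mult_mono) auto
   thus "x ^ 11 <= p * N' * x ^ 3" by simp
  qed (use t0 et in simp)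
  also have "... <= t * et * (p * N' * x ^ j)" using j3 t0 et p0 N'0 by (intro mult_left_mono) auto
  also have "... = eta0 g k * p * N'^2" by (simp add: et_def N'(1) power2_eq_square)
  finally show "L * card V <= eta0 g k * p * N'^2" .
 qed
 have gk: "96 * kk * (8 * kk^2) <= g * x"
 proof -
  have "96 * kk * (8 * kk^2) = 768 * kk ^ 3" by (simp add: power_eq_if)
  thus ?thesis using xg k30 by linarith
 qed
 have k80: "8 * kk^2 > 0" using kk by simp
 define h where "h = 2 * m0 + 2"
 have h: "real h <= 3 * t * x"
 proof -
  have "20000 * 1 <= t * x" using t1 xb2 by (intro mult_mono) auto
  thus ?thesis using m0(1) by (simp add: h_def)
 qed
 define q where "q = l ^ 8"
 have qx: "real q = x ^ 8" by (simp add: q_def x_def)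
 show ?thesis
 proof (rule hamilton_cycle[where W = W and m = m and K = l and M = l and N = N and N' = N1 and h = h and q = q and ?b = b and ?m0.0 = m0])
  show "scale N l" by (rule scale[OF Nt]) auto
  show "scale N1 l" by (rule scale[OF N1]) auto
  show "m = 2 * k * l" by (rule m_def)
  show "fair N (W j)" if "j < 4 * m" for j by (rule W1[OF that])
  show "fair N1 (W j)" if "4 * m <= j" "j < 5 * m" for j by (rule W2) (use that in auto)
  show "W j <= V" if "j < 5 * m + 2" for j by (rule WV[OF that])
  show "W i Int W j = {}" if "i < 5 * m + 2" "j < 5 * m + 2" "i ~= j" for i j by (rule Wd[OF that])
  show "(k - 2) * m0 <= card (W (5 * m))"
  proof -
   have "real ((k - 2) * m0) <= real (k * m0)" by (intro of_nat_mono mult_le_mono1) simp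
   also have "... <= kk * (t * x)" using m0(1) kk by (simp add: kk_def mult_left_mono)
   also have "... = t * (kk * x ^ 1)" by simp
   also have "... <= t * (x ^ 3 / 2)"
   proof (rule mult_left_mono)
    have "(2 * kk) * x ^ 1 <= x ^ 2" using up[of "2 * kk" 1] xb2 kk by (simp add: numeral_2_eq_2)
    thus "kk * x ^ 1 <= x ^ 3 / 2" using px[of 2 3] by simp
   qed (rule t0)
   also have "... = N1 / 2" by (simp add: N1)
   also have "... <= card (W (5 * m))" using W2[of "5 * m"] by (simp add: fair_def)
   finally show ?thesis by (simp only: of_nat_le_iff)
  qed
  show "(2 * k - 3) * card (\<Union>j\<in>{4*m..5*m}. W j) <= card (W (5 * m + 1))"
  proof -
   have "real ((2 * k - 3) * card R) <= real (2 * k * card R)" by (intro of_nat_mono mult_le_mono1) simp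
   also have "... = 2 * kk * card R" by (simp add: kk_def)
   also have "... <= 2 * kk * (6 * kk * t * x ^ 4)" using cR kk by (intro mult_left_mono) auto
   also have "... = t * ((24 * kk^2) * x ^ 4) / 2" by (simp add: power2_eq_square)
   also have "... <= t * x ^ 5 / 2" using up[of "24 * kk^2" 4] xb2 k23 t0 by (intro divide_right_mono mult_left_mono) auto
   also have "... = x ^ 2 * N1 / 2" by (simp add: N1 power_add[symmetric] mult_ac)
   also have "... <= card (W (5 * m + 1))" using W3 by (simp add: fair_def)
   finally show ?thesis unfolding R_def by (simp only: of_nat_le_iff)
  qed
  have "fair N1 (W (4 * m))" by (rule W2) auto
  hence "real (card (W (4 * m))) > 0" using N10 by (simp add: fair_def)
  hence "W (4 * m) ~= {}" by auto
  thus "(\<Union>j\<in>{4*m..5*m}. W j) ~= {}" by force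
  show "card (\<Union>j\<in>{4*m..5*m}. W j) * (2 * (k + l)) < 2 ^ l"
  proof -
   have "real (card R * c) <= n * (4 * x)" using cRn c by (simp add: mult_mono n_def)
   also have "... < 2 ^ l" using A1 by (simp add: n_def x_def mult_ac)
   finally have "real (card R * c) < real (2 ^ l)" by simp
   thus ?thesis unfolding R_def c_def by (simp only: of_nat_less_iff)
  qed
  show "2 * (k + l) * (card (\<Union>j\<in>{4*m..5*m}. W j) * (2 * (k + l))) <= g * N / (8 * real k ^ 2)"
  proof -
   have "real (c * (card R * c)) = real c * (card R * real c)" by simp
   also have "... <= (4 * x) * ((6 * kk * t * x ^ 4) * (4 * x))" using c cR kk t0 by (intro mult_mono mult_nonneg_nonneg) auto
   also have "... = 96 * kk * (t * x ^ 6)" by (simp add: power_eq_if)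
   finally have "real (c * (card R * c)) * (8 * kk^2) <= (96 * kk * (8 * kk^2)) * (t * x ^ 6)" using k80 by (simp add: mult_right_mono mult_ac)
   also have "... <= (g * x) * (t * x ^ 6)" using gk t0 x0 by (intro mult_right_mono) auto
   also have "... = g * N" by (simp add: Nt power_eq_if)
   finally have "real (c * (card R * c)) <= g * N / (8 * kk^2)" using k80 by (simp add: le_divide_eq)
   thus ?thesis unfolding R_def c_def kk_def .
  qed
  show "h < 2 ^ l"
  proof -
   have "real h <= 3 * t * x" by (rule h)
   also have "... <= 4 * n * x"
   proof -
    have "3 * t <= 4 * n" using t0 px[of 0 9] mult_left_mono[of 1 "x ^ 9" t] by (simp add: nt)
    thus ?thesis using x0 by (intro mult_right_mono) auto
   qed
   also have "... < 2 ^ l" using A1 by (simp add: n_def x_def)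
   finally have "real h < real (2 ^ l)" by simp
   thus ?thesis by (simp only: of_nat_less_iff)
  qed
  show "real (2 * (k + l)) * real h <= g * N1 / (8 * real k ^ 2)"
  proof -
   have "real (c * h) = real c * h" by simp
   also have "... <= (4 * x) * (3 * t * x)" using c h x0 by (intro mult_mono) auto
   also have "... = 12 * (t * x ^ 2)" by (simp add: power2_eq_square)
   finally have "real (c * h) * (8 * kk^2) <= (12 * (8 * kk^2)) * (t * x ^ 2)" using k80 by (simp add: mult_right_mono mult_ac)
   also have "... <= (g * x) * (t * x ^ 2)"
   proof (rule mult_right_mono)
    have "12 * (8 * kk^2) <= 96 * kk * (8 * kk^2)" using kk by (intro mult_right_mono) auto
    thus "12 * (8 * kk^2) <= g * x" using gk by linarith
   qed (use t0 in simp)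
   also have "... = g * N1" by (simp add: N1 power_eq_if)
   finally have "real (c * h) <= g * N1 / (8 * kk^2)" using k80 by (simp add: le_divide_eq)
   thus ?thesis unfolding c_def kk_def of_nat_mult[of _ h] .
  qed
  show "card V + m0 * (k * q) + k * q <= h * (k * q)"
  proof -
   have "n = (t * x) * x ^ 8" by (simp add: nt power_eq_if)
   also have "... <= (real m0 + 1) * (kk * x ^ 8)" using m0(2) kk x0 t0 by (intro mult_mono) auto
   finally have "real (card V) <= real ((m0 + 1) * (k * q))" by (simp add: n_def kk_def qx algebra_simps)
   hence "card V <= (m0 + 1) * (k * q)" by (simp only: of_nat_le_iff)
   thus ?thesis by (simp add: h_def algebra_simps)
  qed
  show "p * card V / 2 <= deg E a V" if "a : nsets V (k - 1)" for a
  proof -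
   have "1/2 * (p * card V) <= (1/2 + 2 * g) * (p * card V)" using g0 p0 by (intro mult_right_mono) auto
   thus ?thesis using degE[OF that] by (simp add: mult.assoc)
  qed
  show "128 * real k * real (card (\<Union>j\<in>{4*m..5*m}. W j) * (k + 2 * (2 * (k + l)) + (2 * (k + l))^2) + m0) <= card V"
  proof -
   have "real (k + 2 * c + c^2) <= x ^ 2 + 8 * x ^ 2 + 16 * x ^ 2"
   proof -
    have "kk <= x" using xb2 kk by linarith
    hence "kk <= x ^ 2" using px[of 1 2] by simp
    moreover have "2 * real c <= 8 * x ^ 2" using c px[of 1 2] by simp
    moreover have "real c ^ 2 <= (4 * x) ^ 2" using c by (intro power_mono) auto
    ultimately show ?thesis by (simp add: kk_def power_mult_distrib)
   qed
   hence c25: "real (k + 2 * c + c^2) <= 25 * x ^ 2" by simp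
   have "real (card R * (k + 2 * c + c^2) + m0) = card R * real (k + 2 * c + c^2) + m0" by simp
   also have "... <= (6 * kk * t * x ^ 4) * (25 * x ^ 2) + t * x" using cR c25 m0(1) by (intro add_mono mult_mono) auto
   also have "... = t * (150 * kk * x ^ 6 + x)" by (simp add: power_add[symmetric] algebra_simps)
   also have "... <= t * (151 * kk * x ^ 6)"
   proof (rule mult_left_mono)
    have "x ^ 1 * 1 <= x ^ 6 * kk" using px[of 1 6] kk x0 by (intro mult_mono) auto
    thus "150 * kk * x ^ 6 + x <= 151 * kk * x ^ 6" by (simp add: algebra_simps)
   qed (rule t0)
   finally have "128 * kk * real (card R * (k + 2 * c + c^2) + m0) <= 128 * kk * (t * (151 * kk * x ^ 6))" using kk by (intro mult_left_mono) auto
   also have "... = t * ((19328 * kk^2) * x ^ 6)" by (simp add: power2_eq_square)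
   also have "... <= t * x ^ 7" using up[of "19328 * kk^2" 6] xb2 k23 t0 by (intro mult_left_mono) auto
   also have "... <= n" unfolding nt using px[of 7 9] t0 by (intro mult_left_mono) auto
   finally show ?thesis unfolding R_def c_def kk_def n_def .
  qed
  show "256 * real k ^ 2 * L <= p * card V"
  proof -
   have "256 * real k ^ 2 * L = (256 * kk^2) * x ^ 1" by (simp add: L kk_def x_def)
   also have "... <= x ^ 2" using up[of "256 * kk^2" 1] xb2 k23 by (simp add: numeral_2_eq_2)
   also have "... <= p * n" using px[of 2 20] pn' by simp
   finally show ?thesis by (simp add: n_def)
  qed
  have pm0: "x ^ 12 / 2 <= p * m0"
  proof -
   have "x ^ 12 / 2 = x ^ 11 * x / 2" by (simp add: power_eq_if)
   also have "... <= p * t * x / 2" using pt x0 by (intro divide_right_mono mult_right_mono) auto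
   also have "... = p * (t * x / 2)" by simp
   also have "... <= p * m0" using m0(3) p0 by (intro mult_left_mono) auto
   finally show ?thesis .
  qed
  have pb: "x ^ 11 / 2 <= p * b"
  proof -
   have "x ^ 11 / 2 <= p * (t / 2)" using pt by simp
   also have "... <= p * b" using b(2) p0 by (intro mult_left_mono) auto
   finally show ?thesis .
  qed
  show "64 * L <= p * m0"
  proof -
   have "128 * x ^ 1 <= x ^ 2" using up[of 128 1] xb2 by (simp add: numeral_2_eq_2)
   hence "64 * L <= x ^ 12 / 2" using px[of 2 12] by (simp add: L x_def)
   thus ?thesis using pm0 by linarith
  qed
  show "100 * k * b <= m0"
  proof -
   have "real (100 * k * b) = 100 * kk * b" by (simp add: kk_def)
   also have "... <= 100 * kk * t" using b(1) kk by (intro mult_left_mono) auto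
   also have "... <= (x / 2) * t" using xb2 t0 kk by (intro mult_right_mono) auto
   also have "... <= m0" using m0(3) by (simp add: mult_ac)
   finally show ?thesis by (simp only: of_nat_le_iff)
  qed
  show "50 * real k * L * card V <= p * m0 * b"
  proof -
   have "50 * real k * L * card V = (200 * kk) * x ^ 10 * t / 4" by (simp add: kk_def[symmetric] L x_def[symmetric] n_def[symmetric] nt power_eq_if)
   also have "... <= x ^ 11 * t / 4" using up[of "200 * kk" 10] xb2 kk t0 by (intro divide_right_mono mult_right_mono) auto
   also have "... <= x ^ 12 * t / 4" using px[of 11 12] t0 by (intro divide_right_mono mult_right_mono) auto
   also have "... = x ^ 12 / 2 * (t / 2)" by simp
   also have "... <= p * m0 * b" using pm0 b(2) t0 p0 x0 by (intro mult_mono) auto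
   finally show ?thesis .
  qed
  have k9: "80 * kk * x ^ 8 <= x ^ 9" using up[of "80 * kk" 8] xb2 kk by simp
  show "40 * real k * q <= p * b" using k9 px[of 9 11] pb by (simp add: qx kk_def)
  show "1 <= q" using l1 by (simp add: q_def)
  show "k * q <= b"
  proof -
   have "real (k * q) = kk * x ^ 8" by (simp add: qx kk_def)
   also have "... <= x ^ 11 / 2"
   proof -
    have "2 * (kk * x ^ 8) <= 80 * kk * x ^ 8" using kk x0 by simp
    thus ?thesis using k9 px[of 9 11] by simp
   qed
   also have "... <= b" using tx b(2) by simp
   finally show ?thesis by (simp only: of_nat_le_iff)
  qed
  show "real k ^ 2 <= m0"
  proof -
   have "kk^2 <= x / 2" using xb2 k23 by linarith
   also have "... <= t * x / 2" using t1 x0 by simp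
   finally have "kk^2 <= real m0" using m0(3) by linarith
   thus ?thesis unfolding kk_def .
  qed
 qed
qed

end

section \<open>The random statement\<close>

lemma codegree_le_deg:
  assumes "edges G \<subseteq> nsets (verts G) k" "a : nsets (verts G) (k - 1)" "finite (verts G)" "k >= 1"
  shows "codegree G a <= deg (edges G) a (verts G)"
proof -
 let ?Y = "{y : verts G. insert y a : edges G}"
 have "{e : edges G. a <= e} <= (%y. insert y a) ` ?Y"
 proof
  fix e assume e: "e : {e : edges G. a <= e}"
  have f: "finite a" "card a = k - 1" "finite e" "card e = k" "e <= verts G" using assms(1,2) e by (auto simp: nsets_def)
  hence "card (e - a) = 1" using e assms(4) by (simp add: card_Diff_subset)
  then obtain y where y: "e - a = {y}" by (auto simp: card_1_singleton_iff)
  hence "e = insert y a" "y : verts G" using e f(5) by auto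
  thus "e : (%y. insert y a) ` ?Y" using e by auto
 qed
 hence "card {e : edges G. a <= e} <= card ((%y. insert y a) ` ?Y)" using assms(3) by (intro card_mono) auto
 also have "... <= card ?Y" using assms(3) by (intro card_image_le) simp
 finally show ?thesis by (simp add: codegree_def deg_def)
qed

lemma hamilton_probability:
  fixes n k l :: nat and p g \<gamma> :: real
  assumes k: "k >= 3" and p: "0 < p" "p <= 1" and g: "0 < g" "g <= 1/10" "g <= \<gamma>" and n: "n >= 1" and l: "l >= 1"
    and 1: "4 * k * ln n <= p * n" "2 + 2 * real k <= (g/8)^2 * l / 4" "2 * ln n <= l"
    and big: "20000 * real k ^ 3 <= g * eta0 g k * l" and pn: "real l ^ 20 <= p * n"
    and A: "4 * real n * l < 2 ^ l" "2 * real k * (2 * real n) ^ (k - 1) < (1 + eta0 g k) ^ l" "6 * real n ^ k * real l ^ 6 < exp (g^2 / 512 * l)"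
  shows "1 - 14 / n <= measure_pmf.prob (random_hypergraph k n p)
            {\<Gamma>. \<forall>G. subhypergraph k G \<Gamma> & card (verts G) = n & real (min_codegree k G) >= (1/2 + 2 * \<gamma>) * p * real n
                   --> (\<exists>vs. tight_Hamilton_cycle k G vs)}" (is "_ <= measure_pmf.prob _ ?P")
proof -
 interpret random_graph "{..<n}" k p "real l" g by unfold_locales (use k p g l in auto)
 have "1 - 14 / n <= measure_pmf.prob R {b. typical (H b)}" using random_typical 1 n by simp
 also have "... <= measure_pmf.prob R {b. ({..<n}, H b) : ?P}"
 proof (rule prob_mono, rule Collect_mono, rule impI)
  fix b assume gd: "typical (H b)"
  show "({..<n}, H b) : ?P"
  proof (rule CollectI, intro allI impI, elim conjE)
   fix G assume G: "subhypergraph k G ({..<n}, H b)" "card (verts G) = n" "real (min_codegree k G) >= (1/2 + 2 * \<gamma>) * p * real n"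
   have sub: "edges G <= nsets (verts G) k" "verts G <= {..<n}" "edges G <= H b" using G(1) by (auto simp: subhypergraph_def uniform_hypergraph_def)
   have V: "verts G = {..<n}" using card_subset_eq[of "{..<n}" "verts G"] sub(2) G(2) by simp
   have pr: "pseudorandom {..<n} k p (real l) g (H b)" using gd by (simp add: typical_def)
   interpret host "{..<n}" k p "real l" g "H b" "edges G" by (rule host.intro[OF pr]) (simp add: host_axioms_def sub(3))
   have "EX vs. distinct vs & set vs = {..<n} & (ALL i<length vs. set (take k (rotate i vs)) : edges G)"
   proof (rule hamilton_cycle_of_min_degree[where l = l])
    show "deg (H b) a {..<n} <= 2 * p * card {..<n}" if "a : nsets {..<n} (k - 1)" for a using gd that by (simp add: typical_def)
    show "(1/2 + 2 * g) * p * card {..<n} <= deg (edges G) a {..<n}" if a: "a : nsets {..<n} (k - 1)" for a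
    proof -
     have "min_codegree k G <= codegree G a"
      unfolding min_codegree_def V using a by (intro Min_le finite_imageI finite_imp_finite_nsets) auto
     also have "... <= deg (edges G) a (verts G)" by (rule codegree_le_deg) (use sub a V k in auto)
     finally have "real (min_codegree k G) <= deg (edges G) a {..<n}" by (simp add: V)
     moreover have "(1/2 + 2 * g) * (p * real n) <= (1/2 + 2 * \<gamma>) * (p * real n)" using assms(6) p by (intro mult_right_mono) auto
     hence "(1/2 + 2 * g) * p * card {..<n} <= (1/2 + 2 * \<gamma>) * p * real n" by (simp only: mult.assoc card_lessThan)
     ultimately show ?thesis using G(3) by linarith
    qed
   qed (use p big pn A in simp_all)
   thus "EX vs. tight_Hamilton_cycle k G vs" by (auto simp: tight_Hamilton_cycle_def V)
  qed
 qed
 also have "... = measure_pmf.prob (random_hypergraph k n p) ?P" by (simp add: random_hypergraph_def R_def T_def H_def vimage_def)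
 finally show ?thesis .
qed

text \<open>With y = a ln n this is exp y >= 1 + y + y^2/2 for large y.\<close>
lemma powr_beats_ln:
  fixes a C :: real
  assumes "a > 0" "C >= 0"
  shows "eventually (%n. C * ln (real n) + C <= real (nat \<lfloor>real n powr a\<rfloor>)) sequentially"
proof -
 define D where "D = 2 * (C / a) + 2 * (C + 1) + 1"
 have D1: "D >= 1" using assms by (simp add: D_def)
 have "filterlim (%n. ln (real n)) at_top sequentially" by (rule filterlim_compose[OF ln_at_top filterlim_real_sequentially])
 hence "eventually (%n. D / a <= ln (real n)) sequentially" by (simp add: filterlim_at_top)
 moreover have "eventually (%n::nat. n >= 1) sequentially" by (rule eventually_ge_at_top)
 ultimately show ?thesis
 proof eventually_elim
  case (elim n)
  define y where "y = a * ln n"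
  have y: "y >= D" using elim assms(1) by (simp add: y_def divide_le_eq mult.commute)
  have "1 + y + y^2 / 2 <= exp y" using y D1 by (intro exp_lower_Taylor_quadratic) simp
  also have "exp y = real n powr a" using elim by (simp add: powr_def y_def)
  finally have 1: "1 + y + y^2 / 2 <= real n powr a" .
  have "C / a * y + (C + 1) <= (C / a + (C + 1)) * y"
  proof -
   have "(C + 1) * 1 <= (C + 1) * y" using assms(2) y D1 by (intro mult_left_mono) auto
   thus ?thesis by (simp add: algebra_simps)
  qed
  also have "... <= y / 2 * y"
  proof (rule mult_right_mono)
   have "C >= 0" by (rule assms(2))
   thus "C / a + (C + 1) <= y / 2" using y unfolding D_def by argo
  qed (use y D1 in simp)
  also have "... = y^2 / 2" by (simp add: power2_eq_square)
  finally have "C / a * y + (C + 1) <= real n powr a" using 1 y D1 by linarith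
  moreover have "C / a * y = C * ln n" using assms(1) by (simp add: y_def)
  ultimately have "C * ln n + C + 1 <= real n powr a" by simp
  moreover have "real n powr a - 1 <= real (nat \<lfloor>real n powr a\<rfloor>)" by linarith
  ultimately show ?case by linarith
 qed
qed

lemma exp_beats_power:
  fixes a \<beta> A :: real and j :: nat
  assumes "a > 0" "\<beta> > 0" "A > 0"
  shows "eventually (%n. A * real n ^ j < exp (\<beta> * real (nat \<lfloor>real n powr a\<rfloor>))) sequentially"
proof -
 define C where "C = (\<bar>ln A\<bar> + 1 + j) / \<beta>"
 have C: "C >= 0" "\<beta> * C = \<bar>ln A\<bar> + 1 + j" using assms(2) by (simp_all add: C_def)
 have "eventually (%n::nat. n >= 1) sequentially" by (rule eventually_ge_at_top)
 with powr_beats_ln[OF assms(1) C(1)] show ?thesis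
 proof eventually_elim
  case (elim n)
  define l where "l = real (nat \<lfloor>real n powr a\<rfloor>)"
  have ln0: "ln n >= 0" using elim(2) by simp
  have "\<beta> * (C * ln n + C) <= \<beta> * l" using elim(1) assms(2) by (intro mult_left_mono) (auto simp: l_def)
  hence b: "(\<beta> * C) * ln n + \<beta> * C <= \<beta> * l" by (simp add: algebra_simps)
  have "j * ln n <= (\<beta> * C) * ln n" unfolding C(2) using ln0 by (intro mult_right_mono) auto
  hence "ln A + j * ln n < \<beta> * l" using b C(2) by linarith
  hence "exp (ln A + j * ln n) < exp (\<beta> * l)" by simp
  moreover have "exp (ln A + j * ln n) = A * real n ^ j" using assms(3) elim(2) by (simp add: exp_add exp_of_nat_mult)
  ultimately show ?case by (simp add: l_def)
 qed
qed

theorem theorem1: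
  fixes \<gamma> :: real and k :: nat and p :: "nat \<Rightarrow> real"
  assumes "\<gamma> > 0" and "k \<ge> 3"
    and "\<And>n. 0 \<le> p n \<and> p n \<le> 1"
    and "\<And>n. n \<ge> 1 \<Longrightarrow> p n \<ge> real n powr (- 1 + \<gamma>)"
  shows "(\<lambda>n. measure_pmf.prob (random_hypergraph k n (p n))
            {\<Gamma>. \<forall>G. subhypergraph k G \<Gamma> \<and> card (verts G) = n \<and>
                     real (min_codegree k G) \<ge> (1/2 + 2 * \<gamma>) * p n * real n
                   \<longrightarrow> (\<exists>vs. tight_Hamilton_cycle k G vs)})
         \<longlonglongrightarrow> 1"
proof -
 define g where "g = min \<gamma> (1/10)"
 have g: "0 < g" "g <= 1/10" "g <= \<gamma>" using assms(1) by (auto simp: g_def)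
 define et where "et = eta0 g k"
 have et: "et > 0" using eta0_bounds(1)[of k g] assms(2) g by (simp add: et_def)
 define a where "a = g / 20"
 have a: "a > 0" using g by (simp add: a_def)
 define l where "l n = nat \<lfloor>real n powr a\<rfloor>" for n :: nat
 define C where "C = 1 + 4 * real k + 20000 * real k ^ 3 / (g * et) + (2 + 2 * real k) * 256 / g^2"
 have Cs: "C >= 1 + 4 * real k" "C >= 20000 * real k ^ 3 / (g * et)" "C >= (2 + 2 * real k) * 256 / g^2" "C >= 2"
 proof -
  have "20000 * real k ^ 3 / (g * et) >= 0" "(2 + 2 * real k) * 256 / g^2 >= 0" using g et by simp_all
  thus "C >= 1 + 4 * real k" "C >= 20000 * real k ^ 3 / (g * et)" "C >= (2 + 2 * real k) * 256 / g^2" "C >= 2"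
   unfolding C_def using assms(2) by linarith+
 qed
 have "eventually (%n::nat. n >= 1) sequentially" by (rule eventually_ge_at_top)
 moreover have "eventually (%n. C * ln (real n) + C <= real (l n)) sequentially"
  unfolding l_def using Cs by (intro powr_beats_ln a) simp
 moreover have "eventually (%n. 4 * real n ^ 2 < exp (ln 2 * real (l n))) sequentially"
  unfolding l_def by (intro exp_beats_power a) auto
 moreover have "eventually (%n. (2 * real k * 2 ^ (k - 1)) * real n ^ (k - 1) < exp (ln (1 + et) * real (l n))) sequentially"
  unfolding l_def using et assms(2) by (intro exp_beats_power a) auto
 moreover have "eventually (%n. 6 * real n ^ (k + 6) < exp (g^2 / 512 * real (l n))) sequentially"
  unfolding l_def using g by (intro exp_beats_power a) auto
 ultimately have ev: "eventually (%n. 1 - 14 / real n <= measure_pmf.prob (random_hypergraph k n (p n))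
      {\<Gamma>. ALL G. subhypergraph k G \<Gamma> & card (verts G) = n &
           real (min_codegree k G) >= (1/2 + 2 * \<gamma>) * p n * real n
          --> (EX vs. tight_Hamilton_cycle k G vs)}) sequentially"
 proof eventually_elim
  case (elim n)
  have n1: "real n >= 1" using elim(1) by simp
  have ln0: "ln n >= 0" using n1 by simp
  have lC: "C <= l n" "C * ln n <= l n" using elim(2) ln0 Cs(4) mult_nonneg_nonneg[of C "ln n"] by linarith+
  have l1: "l n >= 1" using lC(1) Cs(4) by linarith
  have la: "real (l n) <= real n powr a" unfolding l_def by (simp add: of_nat_nat)
  have ln: "real (l n) <= n"
  proof -
   have "real n powr a <= real n powr 1" using n1 g by (intro powr_mono) (auto simp: a_def)
   thus ?thesis using la n1 by simp
  qed
  have pn: "real (l n) ^ 20 <= p n * n"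
  proof -
   have "real (l n) ^ 20 <= (real n powr a) ^ 20" using la by (intro power_mono) auto
   also have "... = real n powr g" using n1 by (simp add: a_def powr_power)
   also have "... <= real n powr \<gamma>" using n1 g by (intro powr_mono) auto
   also have "... = real n powr (- 1 + \<gamma>) * real n powr 1" using powr_add[of "real n" "- 1 + \<gamma>" 1] by simp
   also have "... <= p n * n" using assms(4)[OF elim(1)] n1 by (simp add: mult_right_mono)
   finally show ?thesis .
  qed
  have p0: "p n > 0"
  proof -
   have "real n powr (- 1 + \<gamma>) > 0" using n1 by simp
   thus ?thesis using assms(4)[OF elim(1)] by linarith
  qed
  show ?case
  proof (rule hamilton_probability[where l = "l n" and g = g])
   have "4 * real k * ln n <= C * ln n" using Cs(1) ln0 by (intro mult_right_mono) auto
   also have "... <= l n" by (rule lC(2))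
   also have "... <= real (l n) ^ 20" using l1 power_increasing[of 1 20 "real (l n)"] by simp
   finally show "4 * k * ln n <= p n * n" using pn by simp
   have "2 * ln n <= C * ln n" using Cs(4) ln0 by (intro mult_right_mono) auto
   thus "2 * ln n <= l n" using lC(2) by linarith
   have "(2 + 2 * real k) * 256 / g^2 <= l n" using Cs(3) lC(1) by linarith
   hence "(2 + 2 * real k) * 256 <= l n * g^2" using g by (simp add: divide_le_eq)
   thus "2 + 2 * real k <= (g/8)^2 * l n / 4" by (simp add: power_divide mult.commute)
   have "20000 * real k ^ 3 / (g * et) <= l n" using Cs(2) lC(1) by linarith
   thus "20000 * real k ^ 3 <= g * eta0 g k * l n" using g et by (simp add: divide_le_eq et_def mult_ac)
   have "4 * real n * l n <= 4 * real n * n" using ln by (intro mult_left_mono) auto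
   also have "... = 4 * real n ^ 2" by (simp add: power2_eq_square)
   also have "... < exp (ln 2 * l n)" by (rule elim(3))
   also have "... = 2 ^ l n" by (simp add: exp_of_nat2_mult)
   finally show "4 * real n * l n < 2 ^ l n" .
   have "2 * real k * (2 * real n) ^ (k - 1) = (2 * real k * 2 ^ (k - 1)) * real n ^ (k - 1)" by (simp add: power_mult_distrib)
   also have "... < exp (ln (1 + et) * l n)" by (rule elim(4))
   also have "... = (1 + et) ^ l n" using et by (simp add: exp_of_nat2_mult)
   finally show "2 * real k * (2 * real n) ^ (k - 1) < (1 + eta0 g k) ^ l n" by (simp add: et_def)
   have "6 * real n ^ k * real (l n) ^ 6 <= 6 * real n ^ k * real n ^ 6" using ln by (intro mult_left_mono power_mono) auto
   also have "... = 6 * real n ^ (k + 6)" by (simp add: power_add)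
   also have "... < exp (g^2 / 512 * l n)" by (rule elim(5))
   finally show "6 * real n ^ k * real (l n) ^ 6 < exp (g^2 / 512 * l n)" .
  qed (use assms g p0 pn l1 elim(1) in auto)
 qed
 show ?thesis
 proof (rule tendsto_sandwich[OF ev])
  show "(%n. 1 - 14 / real n) \<longlonglongrightarrow> 1" using tendsto_diff[OF tendsto_const lim_const_over_n[of 14], of "1::real"] by simp
 qed (auto simp: measure_pmf.prob_le_1)
qed

end
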